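(* Let $\Lambda$ be a tree-shaped network as in the context, let $p,q\in L^\infty(\Lambda)$, and let $u^0$ satisfy $|u^0(x)|\ge r>0$ for a.e. $x\in\Lambda$, for some constant $r$. Let $u[p]$, $u[q]$ be the solutions of the heat network system $$\partial_tu_j-\partial_x^2u_j+p_j(x)u_j=0 \text{ in } e_j\times(0,T),\ j=0,\dots,N;\quad \partial_xu(Q,t)=0,\ Q\in\Pi_2,\ t\in(0,T);\quad u(\cdot,0)=u^0 \text{ in }\Lambda,$$ with the continuity condition and Kirchhoff law at every interior node (resp. with $q$ in place of $p$), and assume $u[p],u[q]\in H^2(0,T;L^\infty(\Lambda))\cap H^1(0,T;H^2(\Lambda))$. Then there exists $T>0$ such that if $$u[p](Q,t)=u[q](Q,t)\quad\text{for all } t\in(0,T) \text{ and all } Q\in\Pi_2\setminus\{Q_{N_2}\},$$ then $p=q$ in $\Lambda$.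
   Context: $\Lambda$ is a planar tree-shaped network (a connected graph with no closed loop) made of $N+1$ open segments $e_0,\dots,e_N$ of lengths $\ell_j$, joined at interior nodes (set $\Pi_1$, $N_1$ nodes, at each of which at least three segments meet) and having $N_2$ exterior end-points (set $\Pi_2=\{Q_1,\dots,Q_{N_2}\}$, points where only one segment ends), with $N+1=N_1+N_2$. Each segment is oriented, with an initial node $I(e_j)$ and a terminal node $T(e_j)$, and $\partial_x$ on $e_j$ is taken with respect to this orientation. For a function $f$ on $\Lambda$, $f_j=f|_{e_j}$. At an interior node $P$ where the $n_P$ segments $e_1,\dots,e_{n_P}$ meet, the continuity condition is $u_j(P,t)=u_i(P,t)$ for all $i,j\in\{1,\dots,n_P\}$, $0<t<T$, and the Kirchhoff law is $\sum_{j=1}^{n_P}\partial_xu_j(P,t)=0$, $0<t<T$. $L^\gamma(\Lambda)=\{f: f_j\in L^\gamma(e_j)\ \forall j\}$, and $H^k(\Lambda)$ similarly means $f_j\in H^k(e_j)$ for all $j$. *)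

theory Defs
  imports "HOL-Analysis.Analysis"
begin

text \<open>The network has vertex set V, edges indexed by j = 0..N; edge j is the open
segment (0, len j), oriented from its initial node ini j (at x = 0) to its
terminal node ter j (at x = len j).\<close>

definition degree :: "nat \<Rightarrow> (nat \<Rightarrow> 'v) \<Rightarrow> (nat \<Rightarrow> 'v) \<Rightarrow> 'v \<Rightarrow> nat" where
  "degree N ini ter v = card {j. j \<le> N \<and> ini j = v} + card {j. j \<le> N \<and> ter j = v}"

definition adjacent :: "nat \<Rightarrow> (nat \<Rightarrow> 'v) \<Rightarrow> (nat \<Rightarrow> 'v) \<Rightarrow> 'v \<Rightarrow> 'v \<Rightarrow> bool" where
  "adjacent N ini ter v w \<longleftrightarrow>
     (\<exists>j\<le>N. (ini j = v \<and> ter j = w) \<or> (ini j = w \<and> ter j = v))"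

definition connected_net :: "'v set \<Rightarrow> nat \<Rightarrow> (nat \<Rightarrow> 'v) \<Rightarrow> (nat \<Rightarrow> 'v) \<Rightarrow> bool" where
  "connected_net V N ini ter \<longleftrightarrow> (\<forall>v\<in>V. \<forall>w\<in>V. (adjacent N ini ter)\<^sup>*\<^sup>* v w)"

definition has_closed_loop :: "nat \<Rightarrow> (nat \<Rightarrow> 'v) \<Rightarrow> (nat \<Rightarrow> 'v) \<Rightarrow> bool" where
  "has_closed_loop N ini ter \<longleftrightarrow>
     (\<exists>es vs. es \<noteq> [] \<and> distinct es \<and> set es \<subseteq> {..N} \<and>
        length vs = Suc (length es) \<and> hd vs = last vs \<and> distinct (butlast vs) \<and>
        (\<forall>i<length es. (ini (es!i) = vs!i \<and> ter (es!i) = vs!Suc i) \<or>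
                        (ter (es!i) = vs!i \<and> ini (es!i) = vs!Suc i)))"

definition tree_network ::
  "'v set \<Rightarrow> nat \<Rightarrow> (nat \<Rightarrow> 'v) \<Rightarrow> (nat \<Rightarrow> 'v) \<Rightarrow> (nat \<Rightarrow> real) \<Rightarrow> bool" where
  "tree_network V N ini ter len \<longleftrightarrow>
     finite V \<and>
     (\<forall>j\<le>N. ini j \<in> V \<and> ter j \<in> V \<and> len j > 0) \<and>
     connected_net V N ini ter \<and> \<not> has_closed_loop N ini ter \<and>
     (\<forall>v\<in>V. degree N ini ter v = 1 \<or> degree N ini ter v \<ge> 3)"

definition interior_nodes :: "'v set \<Rightarrow> nat \<Rightarrow> (nat \<Rightarrow> 'v) \<Rightarrow> (nat \<Rightarrow> 'v) \<Rightarrow> 'v set" where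
  "interior_nodes V N ini ter = {v\<in>V. degree N ini ter v \<ge> 3}"

definition exterior_nodes :: "'v set \<Rightarrow> nat \<Rightarrow> (nat \<Rightarrow> 'v) \<Rightarrow> (nat \<Rightarrow> 'v) \<Rightarrow> 'v set" where
  "exterior_nodes V N ini ter = {v\<in>V. degree N ini ter v = 1}"

definition Linf_on :: "real \<Rightarrow> (real \<Rightarrow> real) \<Rightarrow> bool" where
  "Linf_on l f \<longleftrightarrow> set_borel_measurable lborel {0<..<l} f \<and>
     (\<exists>C. AE x in lborel. x \<in> {0<..<l} \<longrightarrow> \<bar>f x\<bar> \<le> C)"

definition Linf_net :: "nat \<Rightarrow> (nat \<Rightarrow> real) \<Rightarrow> (nat \<Rightarrow> real \<Rightarrow> real) \<Rightarrow> bool" where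
  "Linf_net N len p \<longleftrightarrow> (\<forall>j\<le>N. Linf_on (len j) (p j))"

definition rect :: "real \<Rightarrow> real \<Rightarrow> (real \<times> real) set" where
  "rect l T = {0<..<l} \<times> {0<..<T}"

definition uncurry2 :: "(real \<Rightarrow> real \<Rightarrow> real) \<Rightarrow> real \<times> real \<Rightarrow> real" where
  "uncurry2 u z = u (fst z) (snd z)"

definition pdiff :: "real \<times> real \<Rightarrow> (real \<times> real \<Rightarrow> real) \<Rightarrow> real \<times> real \<Rightarrow> real" where
  "pdiff a \<phi> = (\<lambda>z. frechet_derivative \<phi> (at z) a)"

fun iter_pdiff :: "(real \<times> real) list \<Rightarrow> (real \<times> real \<Rightarrow> real) \<Rightarrow> real \<times> real \<Rightarrow> real" where
  "iter_pdiff [] \<phi> = \<phi>"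
| "iter_pdiff (a # as) \<phi> = pdiff a (iter_pdiff as \<phi>)"

definition smooth2 :: "(real \<times> real \<Rightarrow> real) \<Rightarrow> bool" where
  "smooth2 \<phi> \<longleftrightarrow> (\<forall>as z. iter_pdiff as \<phi> differentiable (at z))"

definition test_function :: "(real \<times> real) set \<Rightarrow> (real \<times> real \<Rightarrow> real) \<Rightarrow> bool" where
  "test_function S \<phi> \<longleftrightarrow> smooth2 \<phi> \<and>
     compact (closure {z. \<phi> z \<noteq> 0}) \<and> closure {z. \<phi> z \<noteq> 0} \<subseteq> S"

definition locally_integrable_on :: "(real \<times> real) set \<Rightarrow> (real \<times> real \<Rightarrow> real) \<Rightarrow> bool" where
  "locally_integrable_on S f \<longleftrightarrow>
     (\<forall>K. compact K \<and> K \<subseteq> S \<longrightarrow> set_integrable lborel K f)"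

definition weak_deriv ::
  "(real \<times> real) set \<Rightarrow> real \<times> real \<Rightarrow> (real \<times> real \<Rightarrow> real) \<Rightarrow> (real \<times> real \<Rightarrow> real) \<Rightarrow> bool" where
  "weak_deriv S a f g \<longleftrightarrow> locally_integrable_on S f \<and> locally_integrable_on S g \<and>
     (\<forall>\<phi>. test_function S \<phi> \<longrightarrow>
        (\<integral>z. f z * pdiff a \<phi> z \<partial>lborel) = - (\<integral>z. g z * \<phi> z \<partial>lborel))"

definition L2_on :: "(real \<times> real) set \<Rightarrow> (real \<times> real \<Rightarrow> real) \<Rightarrow> bool" where
  "L2_on S f \<longleftrightarrow> set_borel_measurable lborel S f \<and> set_integrable lborel S (\<lambda>z. (f z)\<^sup>2)"

definition H1_H2 :: "real \<Rightarrow> real \<Rightarrow> (real \<Rightarrow> real \<Rightarrow> real) \<Rightarrow> bool" where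
  "H1_H2 l T u \<longleftrightarrow> (let S = rect l T; U = uncurry2 u in
     \<exists>ux uxx ut utx utxx.
       weak_deriv S (1,0) U ux \<and> weak_deriv S (1,0) ux uxx \<and>
       weak_deriv S (0,1) U ut \<and> weak_deriv S (1,0) ut utx \<and> weak_deriv S (1,0) utx utxx \<and>
       L2_on S U \<and> L2_on S ux \<and> L2_on S uxx \<and> L2_on S ut \<and> L2_on S utx \<and> L2_on S utxx)"

definition L2_Linf :: "real \<Rightarrow> real \<Rightarrow> (real \<times> real \<Rightarrow> real) \<Rightarrow> bool" where
  "L2_Linf l T w \<longleftrightarrow> set_borel_measurable lborel (rect l T) w \<and>
     (\<exists>g. set_borel_measurable lborel {0<..<T} g \<and>
          set_integrable lborel {0<..<T} (\<lambda>t. (g t)\<^sup>2) \<and>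
          (AE t in lborel. t \<in> {0<..<T} \<longrightarrow>
             (AE x in lborel. x \<in> {0<..<l} \<longrightarrow> \<bar>w (x, t)\<bar> \<le> g t)))"

definition H2_Linf :: "real \<Rightarrow> real \<Rightarrow> (real \<Rightarrow> real \<Rightarrow> real) \<Rightarrow> bool" where
  "H2_Linf l T u \<longleftrightarrow> (let S = rect l T; U = uncurry2 u in
     \<exists>ut utt. weak_deriv S (0,1) U ut \<and> weak_deriv S (0,1) ut utt \<and>
       L2_Linf l T U \<and> L2_Linf l T ut \<and> L2_Linf l T utt)"

text \<open>u is a solution on (0,T) of
  d_t u_j - d_x^2 u_j + p_j u_j = 0 in e_j x (0,T),
  d_x u(Q,t) = 0 at exterior nodes, continuity and Kirchhoff law at interior nodes,
  u(.,0) = u0.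
u is taken in its continuous representative: u_j and d_x u_j are continuous on
[0,l_j] x [0,T] (as is the case for u in H^1(0,T;H^2)), so node values are
meaningful.  The Kirchhoff law is the flux balance: the sum over the segments
meeting at P of the derivative of u_j along e_j in the direction pointing away
from P.\<close>
definition heat_network_solution ::
  "'v set \<Rightarrow> nat \<Rightarrow> (nat \<Rightarrow> 'v) \<Rightarrow> (nat \<Rightarrow> 'v) \<Rightarrow> (nat \<Rightarrow> real) \<Rightarrow> real \<Rightarrow>
   (nat \<Rightarrow> real \<Rightarrow> real) \<Rightarrow> (nat \<Rightarrow> real \<Rightarrow> real) \<Rightarrow> (nat \<Rightarrow> real \<Rightarrow> real \<Rightarrow> real) \<Rightarrow> bool" where
  "heat_network_solution V N ini ter len T p u0 u \<longleftrightarrow>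
    (\<exists>ux :: nat \<Rightarrow> real \<Rightarrow> real \<Rightarrow> real.
      (\<forall>j\<le>N.
         continuous_on ({0..len j} \<times> {0..T}) (uncurry2 (u j)) \<and>
         continuous_on ({0..len j} \<times> {0..T}) (uncurry2 (ux j)) \<and>
         (\<forall>x\<in>{0..len j}. \<forall>t\<in>{0..T}.
            ((\<lambda>y. u j y t) has_real_derivative ux j x t) (at x within {0..len j})) \<and>
         (\<exists>ut uxx. weak_deriv (rect (len j) T) (0,1) (uncurry2 (u j)) ut \<and>
            weak_deriv (rect (len j) T) (1,0) (uncurry2 (ux j)) uxx \<and>
            (AE z in lborel. z \<in> rect (len j) T \<longrightarrow>
               ut z - uxx z + p j (fst z) * u j (fst z) (snd z) = 0)) \<and>
         (AE x in lborel. x \<in> {0<..<len j} \<longrightarrow> u j x 0 = u0 j x)) \<and>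
      (\<forall>Q\<in>exterior_nodes V N ini ter. \<forall>t\<in>{0<..<T}. \<forall>j\<le>N.
         (ini j = Q \<longrightarrow> ux j 0 t = 0) \<and> (ter j = Q \<longrightarrow> ux j (len j) t = 0)) \<and>
      (\<forall>P\<in>interior_nodes V N ini ter. \<forall>t\<in>{0<..<T}.
         (\<forall>i\<le>N. \<forall>j\<le>N.
            (ini i = P \<and> ini j = P \<longrightarrow> u i 0 t = u j 0 t) \<and>
            (ini i = P \<and> ter j = P \<longrightarrow> u i 0 t = u j (len j) t) \<and>
            (ter i = P \<and> ter j = P \<longrightarrow> u i (len i) t = u j (len j) t)) \<and>
         (\<Sum>j\<in>{j. j \<le> N \<and> ini j = P}. ux j 0 t)
           - (\<Sum>j\<in>{j. j \<le> N \<and> ter j = P}. ux j (len j) t) = 0))"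

end

theory Submission
  imports Defs "HOL-Computational_Algebra.Polynomial"
begin

text \<open>A truncated Laplace transform in time of the heat flow, taken at \<open>k\<^sup>2\<close> and multiplied by
\<open>k\<close>, satisfies, up to an error \<open>exp (- k\<^sup>2 T)\<close>, the same equations on the network as
the Laplace transform at \<open>k\<close> of the solution of the wave equation with the same potential, initial
displacement \<open>u0\<close> and initial velocity \<open>0\<close>. The Gaussian error is negligible against
\<open>exp (- k t)\<close> for every \<open>t\<close>. So equality of two heat flows at an exterior node on the short
interval \<open>(0, T0)\<close> gives equality of the two waves there for all times.
For the waves the problem can be solved sideways: along an edge, the Cauchy data at one end for all
times determine the wave and the potential, because the coefficient of the unknown
difference of potentials on the characteristic is \<open>u0\<close>, which stays away from zero. At a node where all
edges but one are known, continuity and the Kirchhoff law give the data for the remaining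
edge, so the known part grows from the observed end-points until it covers the tree.\<close>

text \<open>The heat equation cannot be continued sideways in a stable way, which is why the data
  are moved to waves. The factor k fits the two flows together: with initial velocity 0, the
  transform of the wave at k solves k^2 v - v'' + p v = k u0, and the transform of the heat flow at
  \<open>k\<^sup>2\<close> solves the same equation with u0 on the right, so k times it differs from
  the former only by truncation in time. In place of an inversion formula, the wave is built
  independently, as a fixed point of d'Alembert's formula on the network, and for large k the
  resolvent equation of the whole network is a contraction, so that two approximate solutions are
  close. The time T enters only through the Gaussian, hence every positive T serves. The second
  obstacle is regularity. Potentials are bounded and measurable, waves merely Lipschitz, and a
  difference of potentials can only be estimated through its primitive. All equations are therefore
  kept in integrated form, and derivatives are replaced by increments over short intervals with a
  quadratic error.\<close>

section \<open>Integration by parts without pointwise derivatives\<close>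

text \<open>On a partition into \<open>Suc n\<close> equal pieces the quadratic errors add up to C
  (b - a)^2 / (n + 1), which vanishes as n grows, while the increments of \<open>W\<close>
  telescope. This does the work of the mean value inequality for functions that need not be
  differentiable.\<close>

lemma telescoping_bound:
  fixes D W :: "real \<Rightarrow> real"
  assumes "a \<le> b"
    and step: "\<And>x y. a \<le> x \<Longrightarrow> x \<le> y \<Longrightarrow> y \<le> b \<Longrightarrow> \<bar>D y - D x\<bar> \<le> (W y - W x) + C * (y - x)\<^sup>2"
  shows "\<bar>D b - D a\<bar> \<le> W b - W a"
proof -
  have main: "\<bar>D b - D a\<bar> \<le> (W b - W a) + (C * (b - a)\<^sup>2) / real (Suc n)" for n
  proof -
    define h where "h = (b - a) / real (Suc n)"
    have h: "h \<ge> 0" "real (Suc n) * h = b - a" using assms(1) by (auto simp: h_def)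
    have "\<bar>D (a + real m * h) - D a\<bar> \<le> (W (a + real m * h) - W a) + real m * (C * h\<^sup>2)"
      if "m \<le> Suc n" for m
      using that
    proof (induction m)
      case 0 then show ?case by simp
    next
      case (Suc m)
      have "real (Suc m) * h \<le> real (Suc n) * h" using h Suc.prems by (intro mult_right_mono) auto
      then have b: "a + real (Suc m) * h \<le> b" using h by simp
      have "\<bar>D (a + real (Suc m) * h) - D (a + real m * h)\<bar>
          \<le> (W (a + real (Suc m) * h) - W (a + real m * h)) + C * h\<^sup>2"
        using step[of "a + real m * h" "a + real (Suc m) * h"] h b by (simp add: algebra_simps)
      then show ?case using Suc by (simp add: algebra_simps)
    qed
    from this[of "Suc n"] have "\<bar>D b - D a\<bar> \<le> (W b - W a) + real (Suc n) * (C * h\<^sup>2)"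
      using h by (simp only: h) (simp add: algebra_simps)
    also have "real (Suc n) * (C * h\<^sup>2) = (C * (b - a)\<^sup>2) / real (Suc n)"
      by (simp add: h_def power2_eq_square field_simps del: of_nat_Suc)
    finally show ?thesis .
  qed
  have "(\<lambda>n. (W b - W a) + (C * (b - a)\<^sup>2) / real (Suc n)) \<longlonglongrightarrow> (W b - W a) + 0"
    by (intro tendsto_add tendsto_const LIMSEQ_Suc lim_const_over_n)
  then have "(\<lambda>n. (W b - W a) + (C * (b - a)\<^sup>2) / real (Suc n)) \<longlonglongrightarrow> (W b - W a)" by simp
  from tendsto_lowerbound[OF this] main show ?thesis by simp
qed

lemma absolutely_integrable_mult_continuous:
  fixes f c :: "real \<Rightarrow> real"
  assumes "f absolutely_integrable_on {a..b}" "continuous_on {a..b} c"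
  shows "(\<lambda>x. f x * c x) absolutely_integrable_on {a..b}"
proof -
  have "(\<lambda>x. c x * f x) absolutely_integrable_on {a..b}"
    using assms
    by (intro absolutely_integrable_bounded_measurable_product_real compact_imp_bounded
        compact_continuous_image continuous_imp_measurable_on_sets_lebesgue) auto
  then show ?thesis by (simp add: mult.commute)
qed

lemma abs_integral_le:
  fixes f g :: "real \<Rightarrow> real"
  assumes "f integrable_on S" "g integrable_on S" "\<And>x. x \<in> S \<Longrightarrow> \<bar>f x\<bar> \<le> g x"
  shows "\<bar>integral S f\<bar> \<le> integral S g"
  using integral_norm_bound_integral[of f S g] assms by auto

lemma abs_integral_le_const:
  fixes f :: "real \<Rightarrow> real"
  assumes "f integrable_on {a..b}" "a \<le> b" "\<And>x. x \<in> {a..b} \<Longrightarrow> \<bar>f x\<bar> \<le> B"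
  shows "\<bar>integral {a..b} f\<bar> \<le> B * (b - a)"
  using abs_integral_le[of f "{a..b}" "\<lambda>_. B"] assms by (auto simp: mult.commute)

lemma integral_diff_interval:
  fixes f :: "real \<Rightarrow> real"
  assumes "f integrable_on {a..b}" "a \<le> x" "x \<le> y" "y \<le> b"
  shows "integral {a..y} f - integral {a..x} f = integral {x..y} f"
  using Henstock_Kurzweil_Integration.integral_combine[of a x y f] assms
    integrable_on_subinterval[of f "{a..b}" a y] by auto

text \<open>Formally \<integral> f Z = F Z - \<integral> F Z', where |Z'| is at most L and F grows
  at most like M exp (g x); integrating the exponential gains the factor 1 / g, which later absorbs
  the other constants. As \<open>Z\<close> is only Lipschitz, \<open>telescoping_bound\<close>
  compares the defect with the primitive \<open>W\<close> of the bound.\<close>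

lemma integral_mult_lipschitz_by_parts:
  fixes f Z F :: "real \<Rightarrow> real"
  assumes f: "f absolutely_integrable_on {a..b}" "\<And>x. x \<in> {a..b} \<Longrightarrow> \<bar>f x\<bar> \<le> B"
    and Z: "\<And>x y. x \<in> {a..b} \<Longrightarrow> y \<in> {a..b} \<Longrightarrow> \<bar>Z x - Z y\<bar> \<le> L * \<bar>x - y\<bar>"
    and F: "\<And>x. x \<in> {a..b} \<Longrightarrow> F x = integral {a..x} f"
    and M: "\<And>x. x \<in> {a..b} \<Longrightarrow> \<bar>F x\<bar> \<le> M * exp (g * x)"
    and "L \<ge> 0" "B \<ge> 0" "M \<ge> 0" "g > 0" "a \<le> b"
  shows "\<bar>integral {a..b} (\<lambda>x. f x * Z x) - F b * Z b\<bar> \<le> L * M / g * exp (g * b)"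
proof -
  have contZ: "continuous_on {a..b} Z"
    by (rule lipschitz_on_continuous_on[of L]) (auto simp: lipschitz_on_def dist_real_def \<open>L \<ge> 0\<close> Z)
  have int: "(\<lambda>x. f x * c x) integrable_on {x..y}"
    if "continuous_on {a..b} c" "a \<le> x" "y \<le> b" for x y c
    using set_lebesgue_integral_eq_integral(1)[OF absolutely_integrable_mult_continuous[OF f(1) that(1)]]
      integrable_on_subinterval[of _ "{a..b}" x y] that by auto
  have int0: "f integrable_on {x..y}" if "a \<le> x" "y \<le> b" for x y
    using int[of "\<lambda>_. 1"] that by auto
  define D where "D x = integral {a..x} (\<lambda>x. f x * Z x) - F x * Z x" for x
  define W where "W x = L * M / g * exp (g * x)" for x
  have "\<bar>D b - D a\<bar> \<le> W b - W a"
  proof (rule telescoping_bound[where D = D and C = "B * L"])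
    fix x y assume xy: "a \<le> x" "x \<le> y" "y \<le> b"
    have F1: "F y - F x = integral {x..y} f"
      using integral_diff_interval[of f a b x y] F xy int0[of a b] by auto
    \<comment> \<open>Freezing \<open>Z\<close> at the right end and \<open>F\<close> at the left
      end leaves one term that is quadratic in y - x and one that the increment of \<open>W\<close>
      dominates.\<close>
    have "D y - D x = integral {x..y} (\<lambda>t. f t * Z t) - (F y - F x) * Z y - F x * (Z y - Z x)"
      using integral_diff_interval[of "\<lambda>t. f t * Z t" a b x y] int[OF contZ] xy
      by (simp add: D_def algebra_simps)
    also have "integral {x..y} (\<lambda>t. f t * Z t) - (F y - F x) * Z y = integral {x..y} (\<lambda>t. f t * (Z t - Z y))"
      unfolding F1 using int[OF contZ, of x y] int0[of x y] xy
      by (simp add: right_diff_distrib Henstock_Kurzweil_Integration.integral_diff integrable_on_mult_left)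
    finally have eq: "D y - D x = integral {x..y} (\<lambda>t. f t * (Z t - Z y)) - F x * (Z y - Z x)" .
    have "\<bar>integral {x..y} (\<lambda>t. f t * (Z t - Z y))\<bar> \<le> (B * L * (y - x)) * (y - x)"
    proof (rule abs_integral_le_const)
      show "(\<lambda>t. f t * (Z t - Z y)) integrable_on {x..y}"
        using xy by (intro int continuous_intros contZ) auto
      fix t assume t: "t \<in> {x..y}"
      have "\<bar>Z t - Z y\<bar> \<le> L * (y - x)"
        using Z[of t y] t xy mult_left_mono[of "y - t" "y - x" L] \<open>L \<ge> 0\<close> by auto
      then have "\<bar>f t\<bar> * \<bar>Z t - Z y\<bar> \<le> B * (L * (y - x))"
        using f(2)[of t] t xy \<open>B \<ge> 0\<close> by (intro mult_mono) auto
      then show "\<bar>f t * (Z t - Z y)\<bar> \<le> B * L * (y - x)" by (simp add: abs_mult mult.assoc)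
    qed (use xy in auto)
    moreover have "\<bar>F x * (Z y - Z x)\<bar> \<le> (M * exp (g * x)) * (L * (y - x))"
      unfolding abs_mult using M[of x] Z[of y x] xy \<open>M \<ge> 0\<close> by (intro mult_mono) auto
    moreover have "(M * exp (g * x)) * (L * (y - x)) \<le> W y - W x"
    proof -
      have "exp (g * x) * (1 + g * (y - x)) \<le> exp (g * x) * exp (g * (y - x))"
        by (intro mult_left_mono) auto
      also have "\<dots> = exp (g * y)" by (simp add: exp_add[symmetric] algebra_simps)
      finally have "exp (g * x) * (y - x) \<le> (exp (g * y) - exp (g * x)) / g"
        using \<open>g > 0\<close> by (simp add: field_simps)
      then have "L * M * (exp (g * x) * (y - x)) \<le> L * M * ((exp (g * y) - exp (g * x)) / g)"
        using \<open>L \<ge> 0\<close> \<open>M \<ge> 0\<close> by (intro mult_left_mono) auto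
      then show ?thesis by (simp add: W_def algebra_simps diff_divide_distrib)
    qed
    ultimately show "\<bar>D y - D x\<bar> \<le> W y - W x + B * L * (y - x)\<^sup>2"
      unfolding eq by (simp add: power2_eq_square algebra_simps)
  qed (use \<open>a \<le> b\<close> in auto)
  moreover have "D a = 0" using F[of a] \<open>a \<le> b\<close> unfolding D_def by auto
  moreover have "W a \<ge> 0" using \<open>L \<ge> 0\<close> \<open>M \<ge> 0\<close> \<open>g > 0\<close> by (simp add: W_def)
  ultimately have "\<bar>D b\<bar> \<le> W b" by linarith
  then show ?thesis by (simp add: D_def W_def)
qed

text \<open>The exact formula, for a continuously differentiable \<open>E\<close> and a primitive
  \<open>F\<close> of a merely bounded \<open>f\<close>. The defect has increments of quadratic
  size, so \<open>telescoping_bound\<close> with \<open>W\<close> = 0 makes it constant.\<close>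

lemma integral_mult_by_parts:
  fixes f E E' F :: "real \<Rightarrow> real"
  assumes f: "f absolutely_integrable_on {a..b}" "\<And>x. x \<in> {a..b} \<Longrightarrow> \<bar>f x\<bar> \<le> B"
    and E: "\<And>x. (E has_real_derivative E' x) (at x)" "continuous_on UNIV E'"
    and F: "\<And>x. x \<in> {a..b} \<Longrightarrow> F x = F a + integral {a..x} f"
    and ab: "a \<le> b"
  shows "integral {a..b} (\<lambda>x. f x * E x) = F b * E b - F a * E a - integral {a..b} (\<lambda>x. F x * E' x)"
proof -
  have "bounded (E' ` {a..b})"
    by (intro compact_imp_bounded compact_continuous_image continuous_on_subset[OF E(2)]) auto
  then obtain K where K: "\<And>x. x \<in> {a..b} \<Longrightarrow> \<bar>E' x\<bar> \<le> K"
    unfolding bounded_iff by fastforce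
  have B0: "B \<ge> 0" "K \<ge> 0" using f(2)[of a] K[of a] ab by auto
  have contE: "continuous_on S E" for S
    using E(1) has_field_derivative_at_within by (intro DERIV_continuous_on) blast
  have int: "(\<lambda>x. f x * c x) integrable_on {x..y}"
    if "continuous_on {a..b} c" "a \<le> x" "y \<le> b" for x y c
    using set_lebesgue_integral_eq_integral(1)[OF absolutely_integrable_mult_continuous[OF f(1) that(1)]]
      integrable_on_subinterval[of _ "{a..b}" x y] that by auto
  have int0: "f integrable_on {x..y}" if "a \<le> x" "y \<le> b" for x y
    using int[of "\<lambda>_. 1"] that by auto
  have Fd: "F y - F x = integral {x..y} f" if "a \<le> x" "x \<le> y" "y \<le> b" for x y
    using integral_diff_interval[of f a b x y] F[of x] F[of y] that int0[of a b] by simp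
  have "continuous_on {a..b} (\<lambda>x. F a + integral {a..x} f)"
    by (intro continuous_intros indefinite_integral_continuous_1 int0) auto
  then have contF: "continuous_on {a..b} F"
    by (rule continuous_on_eq) (rule F[symmetric])
  have Eint: "E y - E x = integral {x..y} E'" if "x \<le> y" for x y
  proof -
    have "(E' has_integral (E y - E x)) {x..y}"
      using that
      by (intro fundamental_theorem_of_calculus)
        (auto simp flip: has_real_derivative_iff_has_vector_derivative intro: has_field_derivative_at_within E(1))
    then show ?thesis by (simp add: integral_unique)
  qed
  have cE': "continuous_on S E'" for S using E(2) continuous_on_subset by blast
  have iF: "(\<lambda>x. F x * E' x) integrable_on {x..y}" if "a \<le> x" "y \<le> b" for x y
    using that by (intro integrable_continuous_interval continuous_intros cE' continuous_on_subset[OF contF]) auto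
  have iE: "E' integrable_on {x..y}" for x y
    by (intro integrable_continuous_interval cE')
  define D where "D x = integral {a..x} (\<lambda>x. f x * E x) - F x * E x + integral {a..x} (\<lambda>x. F x * E' x)" for x
  have "\<bar>D b - D a\<bar> \<le> (\<lambda>_. 0) b - (\<lambda>_. 0::real) a"
  proof (rule telescoping_bound[where D = D and C = "2 * B * K" and W = "\<lambda>_. 0"])
    fix x y assume xy: "a \<le> x" "x \<le> y" "y \<le> b"
    have "D y - D x = (integral {x..y} (\<lambda>t. f t * E t) - (F y - F x) * E y)
        + (integral {x..y} (\<lambda>t. F t * E' t) - F x * (E y - E x))"
      using integral_diff_interval[of "\<lambda>t. f t * E t" a b x y]
        integral_diff_interval[of "\<lambda>t. F t * E' t" a b x y] int[OF contE] iF xy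
      by (simp add: D_def algebra_simps)
    also have "integral {x..y} (\<lambda>t. f t * E t) - (F y - F x) * E y = integral {x..y} (\<lambda>t. f t * (E t - E y))"
      unfolding Fd[OF xy] using int[OF contE, of x y] int0[of x y] xy
      by (simp add: right_diff_distrib Henstock_Kurzweil_Integration.integral_diff integrable_on_mult_left)
    also have "integral {x..y} (\<lambda>t. F t * E' t) - F x * (E y - E x) = integral {x..y} (\<lambda>t. (F t - F x) * E' t)"
      unfolding Eint[OF xy(2)] using iF[of x y] iE[of x y] xy
      by (simp add: left_diff_distrib Henstock_Kurzweil_Integration.integral_diff integrable_on_mult_right)
    finally have eq: "D y - D x = integral {x..y} (\<lambda>t. f t * (E t - E y)) + integral {x..y} (\<lambda>t. (F t - F x) * E' t)" .
    have Ed: "\<bar>E t - E y\<bar> \<le> K * (y - x)" if "t \<in> {x..y}" for t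
    proof -
      have "\<bar>E y - E t\<bar> \<le> K * (y - t)"
        using Eint[of t y] that xy K by (auto intro!: abs_integral_le_const iE)
      also have "\<dots> \<le> K * (y - x)" using that B0 by (intro mult_left_mono) auto
      finally show ?thesis by simp
    qed
    have Fd': "\<bar>F t - F x\<bar> \<le> B * (y - x)" if "t \<in> {x..y}" for t
    proof -
      have "\<bar>F t - F x\<bar> \<le> B * (t - x)"
        using Fd[of x t] that xy f(2) by (auto intro!: abs_integral_le_const int0)
      also have "\<dots> \<le> B * (y - x)" using that B0 by (intro mult_left_mono) auto
      finally show ?thesis .
    qed
    have "\<bar>integral {x..y} (\<lambda>t. f t * (E t - E y))\<bar> \<le> (B * (K * (y - x))) * (y - x)"
    proof (rule abs_integral_le_const)
      show "(\<lambda>t. f t * (E t - E y)) integrable_on {x..y}"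
        using xy by (intro int continuous_intros contE) auto
      show "\<bar>f t * (E t - E y)\<bar> \<le> B * (K * (y - x))" if "t \<in> {x..y}" for t
        unfolding abs_mult using f(2)[of t] Ed[OF that] that xy B0 by (intro mult_mono) auto
    qed (use xy in auto)
    moreover have "\<bar>integral {x..y} (\<lambda>t. (F t - F x) * E' t)\<bar> \<le> ((B * (y - x)) * K) * (y - x)"
    proof (rule abs_integral_le_const)
      show "(\<lambda>t. (F t - F x) * E' t) integrable_on {x..y}"
        using xy by (intro integrable_continuous_interval continuous_intros cE' continuous_on_subset[OF contF]) auto
      show "\<bar>(F t - F x) * E' t\<bar> \<le> (B * (y - x)) * K" if "t \<in> {x..y}" for t
        unfolding abs_mult using K[of t] Fd'[OF that] that xy B0 by (intro mult_mono) auto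
    qed (use xy in auto)
    ultimately show "\<bar>D y - D x\<bar> \<le> 0 - 0 + 2 * B * K * (y - x)\<^sup>2"
      unfolding eq by (simp add: power2_eq_square algebra_simps)
  qed (rule ab)
  then have "D b = D a" by simp
  moreover have "D a = - (F a * E a)" by (simp add: D_def)
  ultimately show ?thesis unfolding D_def by linarith
qed


subsection \<open>Smooth cut-off functions\<close>

fun kdiff :: "nat \<Rightarrow> (real \<Rightarrow> real) \<Rightarrow> bool" where
  "kdiff 0 f \<longleftrightarrow> True"
| "kdiff (Suc n) f \<longleftrightarrow> (\<exists>f'. (\<forall>x. (f has_real_derivative f' x) (at x)) \<and> kdiff n f')"

definition smooth1 :: "(real \<Rightarrow> real) \<Rightarrow> bool" where
  "smooth1 f \<longleftrightarrow> (\<forall>n. kdiff n f)"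

lemma kdiff_Suc_imp: "kdiff (Suc n) f \<Longrightarrow> kdiff n f"
proof (induction n arbitrary: f)
  case (Suc n)
  from Suc.prems obtain f' where "\<forall>x. (f has_real_derivative f' x) (at x)" "kdiff (Suc n) f'"
    by (auto simp only: kdiff.simps)
  then show ?case using Suc.IH by auto
qed simp

text \<open>For each order \<open>kdiff\<close> may choose its own derivative, but by uniqueness all
  choices are the same function, which therefore serves every order.\<close>

lemma smooth1_deriv:
  assumes "smooth1 f"
  obtains f' where "\<And>x. (f has_real_derivative f' x) (at x)" "smooth1 f'"
proof -
  from assms obtain f' where f': "\<And>x. (f has_real_derivative f' x) (at x)"
    unfolding smooth1_def by (metis kdiff.simps(2))
  have "kdiff n f'" for n
  proof -
    from assms obtain g where g: "\<And>x. (f has_real_derivative g x) (at x)" "kdiff n g"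
      unfolding smooth1_def by (metis kdiff.simps(2))
    have "g = f'" using g(1) f' DERIV_unique by blast
    then show ?thesis using g by simp
  qed
  then show ?thesis using that f' by (auto simp: smooth1_def)
qed

lemma kdiff_add: "kdiff n f \<Longrightarrow> kdiff n g \<Longrightarrow> kdiff n (\<lambda>x. f x + g x)"
proof (induction n arbitrary: f g)
  case (Suc n)
  then obtain f' g' where *: "\<forall>x. (f has_real_derivative f' x) (at x)" "kdiff n f'"
    "\<forall>x. (g has_real_derivative g' x) (at x)" "kdiff n g'" by auto
  show ?case unfolding kdiff.simps
    by (rule exI[of _ "\<lambda>x. f' x + g' x"]) (use * Suc.IH in \<open>auto intro!: derivative_eq_intros\<close>)
qed simp

lemma kdiff_mult: "kdiff n f \<Longrightarrow> kdiff n g \<Longrightarrow> kdiff n (\<lambda>x. f x * g x)"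
proof (induction n arbitrary: f g)
  case (Suc n)
  then obtain f' g' where *: "\<forall>x. (f has_real_derivative f' x) (at x)" "kdiff n f'"
    "\<forall>x. (g has_real_derivative g' x) (at x)" "kdiff n g'" by auto
  have "kdiff n f" "kdiff n g" using Suc.prems kdiff_Suc_imp by blast+
  then have "kdiff n (\<lambda>x. f' x * g x + f x * g' x)"
    using * Suc.IH by (intro kdiff_add) auto
  then show ?case unfolding kdiff.simps
    by (intro exI[of _ "\<lambda>x. f' x * g x + f x * g' x"]) (use * in \<open>auto intro!: derivative_eq_intros\<close>)
qed simp

lemma kdiff_const: "kdiff n (\<lambda>x. c)"
proof (induction n arbitrary: c)
  case (Suc n)
  show ?case unfolding kdiff.simps
    by (rule exI[of _ "\<lambda>_. 0"]) (use Suc in auto)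
qed simp

lemma kdiff_affine: "kdiff n f \<Longrightarrow> kdiff n (\<lambda>x. f (a * x + b))"
proof (induction n arbitrary: f)
  case (Suc n)
  then obtain f' where *: "\<forall>x. (f has_real_derivative f' x) (at x)" "kdiff n f'" by auto
  have "((\<lambda>x. f (a * x + b)) has_real_derivative f' (a * x + b) * a) (at x)" for x
    by (rule DERIV_chain2[of f]) (use * in \<open>auto intro!: derivative_eq_intros\<close>)
  moreover have "kdiff n (\<lambda>x. f' (a * x + b) * a)"
    using * Suc.IH by (intro kdiff_mult kdiff_const) auto
  ultimately show ?case unfolding kdiff.simps
    by (intro exI[of _ "\<lambda>x. f' (a * x + b) * a"]) auto
qed simp

lemma smooth1_add: "smooth1 f \<Longrightarrow> smooth1 g \<Longrightarrow> smooth1 (\<lambda>x. f x + g x)"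
  and smooth1_mult: "smooth1 f \<Longrightarrow> smooth1 g \<Longrightarrow> smooth1 (\<lambda>x. f x * g x)"
  and smooth1_affine: "smooth1 f \<Longrightarrow> smooth1 (\<lambda>x. f (a * x + b))"
  and smooth1_const: "smooth1 (\<lambda>x. c)"
  by (auto simp: smooth1_def intro: kdiff_add kdiff_mult kdiff_affine kdiff_const)

definition flat_exp :: "real \<Rightarrow> real" where
  "flat_exp x = (if x > 0 then exp (- 1 / x) else 0)"

text \<open>In the variable y = 1 / x differentiation is - y^2 d/dy, which sends P(y) exp (- y) to
  y^2 (P - P')(y) exp (- y). This family is thus closed under derivatives, and smoothness at 0
  reduces to one difference quotient.\<close>

definition flat_poly :: "real poly \<Rightarrow> real \<Rightarrow> real" where
  "flat_poly P x = (if x > 0 then poly P (1 / x) * exp (- 1 / x) else 0)"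

lemma poly_exp_minus_tendsto_0:
  fixes P :: "real poly"
  shows "((\<lambda>y. poly P y * exp (- y)) \<longlongrightarrow> 0) at_top"
proof -
  have "((\<lambda>y. \<Sum>i\<le>Polynomial.degree P. coeff P i * (y ^ i / exp y)) \<longlongrightarrow> (\<Sum>i\<le>Polynomial.degree P. coeff P i * 0)) at_top"
    by (intro tendsto_sum tendsto_mult tendsto_const tendsto_power_div_exp_0)
  moreover have "(\<Sum>i\<le>Polynomial.degree P. coeff P i * (y ^ i / exp y)) = poly P y * exp (- y)" for y
    unfolding poly_altdef sum_distrib_right by (intro sum.cong) (simp_all add: exp_minus field_simps)
  ultimately show ?thesis by simp
qed

lemma flat_poly_DERIV:
  "(flat_poly P has_real_derivative flat_poly ((P - pderiv P) * [:0, 0, 1:]) x) (at x)"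
proof -
  consider "x > 0" | "x < 0" | "x = 0" by linarith
  then show ?thesis
  proof cases
    case 1
    have "((\<lambda>x. poly P (1 / x) * exp (- 1 / x)) has_real_derivative
        flat_poly ((P - pderiv P) * [:0, 0, 1:]) x) (at x)"
      using 1 by (auto intro!: derivative_eq_intros DERIV_chain2[OF poly_DERIV] simp: flat_poly_def field_simps power2_eq_square)
    then show ?thesis
      by (rule has_field_derivative_transform_within_open[of _ _ _ "{0<..}"]) (use 1 in \<open>auto simp: flat_poly_def\<close>)
  next
    case 2
    have "((\<lambda>x. 0) has_real_derivative flat_poly ((P - pderiv P) * [:0, 0, 1:]) x) (at x)"
      using 2 by (auto simp: flat_poly_def)
    then show ?thesis
      by (rule has_field_derivative_transform_within_open[of _ _ _ "{..<0}"]) (use 2 in \<open>auto simp: flat_poly_def\<close>)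
  next
    case 3
    have "((\<lambda>h. flat_poly P h / h) \<longlongrightarrow> 0) (at_right 0)"
    proof -
      \<comment> \<open>With y = 1 / h the difference quotient at 0 is y P(y) exp (- y).\<close>
      have "((\<lambda>y. poly (P * [:0, 1:]) y * exp (- y)) \<longlongrightarrow> 0) at_top"
        by (rule poly_exp_minus_tendsto_0)
      then have "((\<lambda>h. poly (P * [:0, 1:]) (inverse h) * exp (- inverse h)) \<longlongrightarrow> 0) (at_right (0::real))"
        by (rule filterlim_compose[OF _ filterlim_inverse_at_top_right])
      then show ?thesis
        by (rule Lim_transform_eventually)
          (auto simp: eventually_at_filter flat_poly_def field_simps)
    qed
    moreover have "((\<lambda>h. flat_poly P h / h) \<longlongrightarrow> 0) (at_left 0)"
      by (rule Lim_transform_eventually[OF tendsto_const])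
        (auto simp: eventually_at_filter flat_poly_def)
    ultimately have "((\<lambda>h. flat_poly P h / h) \<longlongrightarrow> 0) (at 0)"
      by (simp add: filterlim_split_at)
    then show ?thesis using 3 by (simp add: DERIV_def flat_poly_def)
  qed
qed

lemma smooth1_flat_exp: "smooth1 flat_exp"
proof -
  have "kdiff n (flat_poly P)" for n P
    by (induction n arbitrary: P) (auto intro!: exI flat_poly_DERIV)
  moreover have "flat_exp = flat_poly 1" by (auto simp: flat_exp_def flat_poly_def)
  ultimately show ?thesis unfolding smooth1_def by metis
qed

lemma smooth1_continuous: "smooth1 f \<Longrightarrow> continuous_on S f"
  by (erule smooth1_deriv) (rule DERIV_continuous_on, rule has_field_derivative_at_within, blast)

lemma smooth1_primitive:
  assumes "\<And>x. (F has_real_derivative f x) (at x)" "smooth1 f"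
  shows "smooth1 F"
  unfolding smooth1_def
proof
  fix n show "kdiff n F" using assms by (cases n) (auto simp: smooth1_def)
qed

text \<open>\<open>s\<close> is the normalised primitive of the bump
  \<open>flat_exp x * flat_exp (1 - x)\<close>, which lives on the unit interval. Rescaled copies of
  \<open>s\<close> will be the ramps of smoothed indicator functions.\<close>

lemma smooth_step:
  obtains s b :: "real \<Rightarrow> real" where "smooth1 s" "smooth1 b"
    "\<And>x. (s has_real_derivative b x) (at x)" "\<And>x. b x \<ge> 0"
    "\<And>x. x \<le> 0 \<or> x \<ge> 1 \<Longrightarrow> b x = 0" "\<And>x. x \<le> 0 \<Longrightarrow> s x = 0" "\<And>x. x \<ge> 1 \<Longrightarrow> s x = 1"
proof -
  define b where "b x = flat_exp x * flat_exp ((-1) * x + 1)" for x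
  have b: "smooth1 b" unfolding b_def by (intro smooth1_mult smooth1_affine smooth1_flat_exp)
  have b0: "b x \<ge> 0" for x by (simp add: b_def flat_exp_def)
  have bz: "b x = 0" if "x \<le> 0 \<or> x \<ge> 1" for x using that by (auto simp: b_def flat_exp_def)
  define I where "I x = integral {-1..x} b" for x
  have intb: "b integrable_on {x..y}" for x y
    by (intro integrable_continuous_interval smooth1_continuous b)
  define s where "s x = integral {0..max 0 x} b" for x
  have I0: "integral {0..1} b > 0"
  proof -
    have "integral {0..1} b \<noteq> 0"
      using has_integral_0_cbox_imp_0[of 0 1 b "1/2"] integrable_integral[OF intb, of 0 1] b0
        smooth1_continuous[OF b, of "{0..1}"]
      by (auto simp: b_def[of "1/2"] flat_exp_def)
    moreover have "integral {0..1} b \<ge> 0" by (intro integral_nonneg intb) (use b0 in auto)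
    ultimately show ?thesis by simp
  qed
  have sd: "(s has_real_derivative b x) (at x)" for x
  proof (cases "x \<le> 0")
    case False
    have "((\<lambda>x. integral {0..x} b) has_real_derivative b x) (at x within {0..x+1})"
      using False by (intro integral_has_real_derivative smooth1_continuous b) auto
    then have "((\<lambda>x. integral {0..x} b) has_real_derivative b x) (at x)"
      using False at_within_interior[of x "{0..x+1}"] by simp
    then show ?thesis
      by (rule has_field_derivative_transform_within_open[of _ _ _ "{0<..}"]) (use False in \<open>auto simp: s_def\<close>)
  next
    case True
    have eq: "s y = integral {x-1..y} b" if "y \<in> {x-1<..<x+1}" for y
    proof (cases "y \<le> 0")
      case True
      have "integral {x-1..y} b = integral {x-1..y} (\<lambda>_. 0)"
        by (intro integral_cong bz) (use True in auto)
      then show ?thesis using True by (simp add: s_def)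
    next
      case False
      have "integral {x-1..y} b = integral {x-1..0} b + integral {0..y} b"
        using \<open>x \<le> 0\<close> False by (intro Henstock_Kurzweil_Integration.integral_combine[symmetric]) (auto intro: intb)
      moreover have "integral {x-1..0} b = integral {x-1..0} (\<lambda>_. 0)"
        by (intro integral_cong bz) auto
      ultimately show ?thesis using False by (simp add: s_def)
    qed
    have "((\<lambda>y. integral {x-1..y} b) has_real_derivative b x) (at x within {x-1..x+1})"
      by (intro integral_has_real_derivative smooth1_continuous b) auto
    then have "((\<lambda>y. integral {x-1..y} b) has_real_derivative b x) (at x)"
      using at_within_interior[of x "{x-1..x+1}"] by simp
    then show ?thesis
      by (rule has_field_derivative_transform_within_open[of _ _ _ "{x-1<..<x+1}"]) (use eq in auto)
  qed
  define c where "c = inverse (integral {0..1} b)"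
  have c: "c > 0" "c * integral {0..1} b = 1" using I0 by (auto simp: c_def)
  show ?thesis
  proof (rule that[of "\<lambda>x. c * s x" "\<lambda>x. c * b x"])
    show sb: "smooth1 (\<lambda>x. c * b x)" by (intro smooth1_mult smooth1_const b)
    show sd': "((\<lambda>x. c * s x) has_real_derivative c * b x) (at x)" for x
      by (rule DERIV_cmult[OF sd])
    show "smooth1 (\<lambda>x. c * s x)" by (rule smooth1_primitive[OF sd' sb])
    show "c * b x \<ge> 0" for x using b0 c by simp
    show "c * b x = 0" if "x \<le> 0 \<or> x \<ge> 1" for x using bz[OF that] by simp
    show "c * s x = 0" if "x \<le> 0" for x using that by (simp add: s_def max_def)
    show "c * s x = 1" if "x \<ge> 1" for x
    proof -
      have "integral {0..x} b = integral {0..1} b + integral {1..x} b"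
        using that by (intro Henstock_Kurzweil_Integration.integral_combine[symmetric]) (auto intro: intb)
      moreover have "integral {1..x} b = integral {1..x} (\<lambda>_. 0)"
        by (intro integral_cong bz) auto
      ultimately show ?thesis using that c by (simp add: s_def)
    qed
  qed
qed


subsection \<open>Bounded measurable weights\<close>

text \<open>Potentials are handled through representatives that are Borel measurable on the whole
  line and bounded at every point. Estimates then have no exceptional sets, and the product with a
  continuous function is integrable on every compact interval.\<close>

definition bdm :: "(real \<Rightarrow> real) \<Rightarrow> real \<Rightarrow> bool" where
  "bdm p C \<longleftrightarrow> p \<in> borel_measurable borel \<and> (\<forall>x. \<bar>p x\<bar> \<le> C)"

lemma bdm_nonneg: "bdm p C \<Longrightarrow> C \<ge> 0"
  by (metis abs_ge_zero bdm_def order_trans)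

lemma bdm_absolutely_integrable:
  assumes "bdm p C" shows "p absolutely_integrable_on {a..b}"
proof (rule measurable_bounded_by_integrable_imp_absolutely_integrable[where g = "\<lambda>_. C"])
  show "p \<in> borel_measurable (lebesgue_on {a..b})"
    using assms by (simp add: bdm_def borel_measurable_if_D measurable_completion measurable_restrict_space1)
qed (use assms in \<open>auto simp: bdm_def\<close>)

lemma bdm_mult_integrable:
  assumes "bdm p C" "continuous_on {a..b} c"
  shows "(\<lambda>x. p x * c x) absolutely_integrable_on {a..b}" "(\<lambda>x. p x * c x) integrable_on {a..b}"
  using absolutely_integrable_mult_continuous[OF bdm_absolutely_integrable[OF assms(1)] assms(2)]
  by (auto simp: set_lebesgue_integral_eq_integral(1))

lemma bdm_const: "bdm (\<lambda>_. c) \<bar>c\<bar>"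
  by (simp add: bdm_def)

lemma bdm_integral_bound:
  assumes "bdm p C" "continuous_on {a..b} c" "a \<le> b" "\<And>x. x \<in> {a..b} \<Longrightarrow> \<bar>c x\<bar> \<le> B"
  shows "\<bar>integral {a..b} (\<lambda>x. p x * c x)\<bar> \<le> C * B * (b - a)"
proof (rule abs_integral_le_const)
  show "\<bar>p x * c x\<bar> \<le> C * B" if "x \<in> {a..b}" for x
    unfolding abs_mult using assms(4)[OF that] assms(1) bdm_nonneg[OF assms(1)]
    by (intro mult_mono) (auto simp: bdm_def)
qed (use assms in \<open>auto intro: bdm_mult_integrable\<close>)

lemma lborel_integral_eq_integral:
  fixes f :: "real \<Rightarrow> real"
  assumes "f \<in> borel_measurable borel" "\<And>x. \<bar>f x\<bar> \<le> C" "\<And>x. x \<notin> {a..b} \<Longrightarrow> f x = 0"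
  shows "(\<integral>x. f x \<partial>lborel) = integral {a..b} f"
proof -
  have eq: "(\<lambda>x. indicator {a..b} x *\<^sub>R f x) = f"
    using assms(3) by (auto simp: fun_eq_iff indicator_def)
  have "integrable lborel f"
  proof (rule Bochner_Integration.integrable_bound[where f = "\<lambda>x. C * indicator {a..b} x"])
    show "integrable lborel (\<lambda>x. C * indicator {a..b} x :: real)"
      by (intro integrable_mult_right integrable_real_indicator) (auto simp: emeasure_lborel_Icc_eq)
  qed (use assms order_trans[OF abs_ge_zero assms(2)] in \<open>auto simp: indicator_def\<close>)
  then have "set_integrable lborel {a..b} f" unfolding set_integrable_def eq .
  from set_borel_integral_eq_integral(2)[OF this] show ?thesis
    unfolding set_lebesgue_integral_def eq .
qed

text \<open>Bridge between the Lebesgue integrals over the plane, in which weak derivatives are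
  stated, and the iterated gauge integrals over intervals that carry the later computations.\<close>

lemma Fubini_box:
  fixes f :: "real \<times> real \<Rightarrow> real"
  assumes "f \<in> borel_measurable borel" "\<And>z. \<bar>f z\<bar> \<le> C" "\<And>z. z \<notin> {a..b} \<times> {c..d} \<Longrightarrow> f z = 0"
  shows "integrable lborel f"
    and "(\<integral>z. f z \<partial>lborel) = integral {a..b} (\<lambda>x. integral {c..d} (\<lambda>t. f (x, t)))"
    and "(\<integral>z. f z \<partial>lborel) = integral {c..d} (\<lambda>t. integral {a..b} (\<lambda>x. f (x, t)))"
proof -
  have C0: "C \<ge> 0" using order_trans[OF abs_ge_zero assms(2)] .
  show int: "integrable lborel f"
  proof (rule Bochner_Integration.integrable_bound[where f = "\<lambda>x. C * indicator (cbox (a,c) (b,d)) x"])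
    show "integrable lborel (\<lambda>x. C * indicator (cbox (a,c) (b,d)) x :: real)"
      by (intro integrable_mult_right integrable_real_indicator emeasure_lborel_cbox_finite) auto
  qed (use assms C0 in \<open>auto simp: indicator_def cbox_Pair_eq\<close>)
  have int': "integrable (lborel \<Otimes>\<^sub>M lborel) (case_prod (\<lambda>x t. f (x, t)))"
    using int by (simp add: lborel_prod)
  note [measurable] = assms(1)
  have fb: "f \<in> borel_measurable (borel \<Otimes>\<^sub>M borel)" using assms(1) by (simp add: borel_prod)
  note [measurable] = fb
  have b1: "(\<integral>t. f (x, t) \<partial>lborel) = integral {c..d} (\<lambda>t. f (x, t))" for x
    by (rule lborel_integral_eq_integral[where C = C]) (use assms in auto)
  have b2: "(\<integral>x. f (x, t) \<partial>lborel) = integral {a..b} (\<lambda>x. f (x, t))" for t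
    by (rule lborel_integral_eq_integral[where C = C]) (use assms in auto)
  have m1: "(\<lambda>x. \<integral>t. f (x, t) \<partial>lborel) \<in> borel_measurable borel"
    using lborel.borel_measurable_lebesgue_integral[of "\<lambda>x t. f (x,t)" borel] by measurable
  have m2: "(\<lambda>t. \<integral>x. f (x, t) \<partial>lborel) \<in> borel_measurable borel"
    using lborel.borel_measurable_lebesgue_integral[of "\<lambda>t x. f (x,t)" borel] by measurable
  have bd: "\<bar>integral {u..v} g\<bar> \<le> C * \<bar>v - u\<bar>"
    if "g \<in> borel_measurable borel" "\<And>x. \<bar>g x\<bar> \<le> C" for g :: "real \<Rightarrow> real" and u v
  proof (cases "u \<le> v")
    case True
    have "bdm g C" using that by (simp add: bdm_def)
    from bdm_mult_integrable(2)[OF this, of u v "\<lambda>_. 1"] show ?thesis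
      using abs_integral_le_const[of g u v C] that True by auto
  qed (use C0 in auto)
  have "(\<integral>z. f z \<partial>lborel) = (\<integral>x. (\<integral>t. f (x, t) \<partial>lborel) \<partial>lborel)"
    using lborel_pair.integral_fst[OF int'] by (simp add: lborel_prod)
  also have "\<dots> = integral {a..b} (\<lambda>x. (\<integral>t. f (x, t) \<partial>lborel))"
  proof (rule lborel_integral_eq_integral[where C = "C * \<bar>d - c\<bar>"])
    show "\<bar>\<integral>t. f (x, t) \<partial>lborel\<bar> \<le> C * \<bar>d - c\<bar>" for x
      unfolding b1 by (rule bd) (use assms in auto)
  qed (use m1 assms in auto)
  finally show "(\<integral>z. f z \<partial>lborel) = integral {a..b} (\<lambda>x. integral {c..d} (\<lambda>t. f (x, t)))"
    by (simp add: b1)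
  have "(\<integral>z. f z \<partial>lborel) = (\<integral>t. (\<integral>x. f (x, t) \<partial>lborel) \<partial>lborel)"
    using lborel_pair.integral_snd[OF int'] by (simp add: lborel_prod)
  also have "\<dots> = integral {c..d} (\<lambda>t. (\<integral>x. f (x, t) \<partial>lborel))"
  proof (rule lborel_integral_eq_integral[where C = "C * \<bar>b - a\<bar>"])
    show "\<bar>\<integral>x. f (x, t) \<partial>lborel\<bar> \<le> C * \<bar>b - a\<bar>" for t
      unfolding b2 by (rule bd) (use assms in auto)
  qed (use m2 assms in auto)
  finally show "(\<integral>z. f z \<partial>lborel) = integral {c..d} (\<lambda>t. integral {a..b} (\<lambda>x. f (x, t)))"
    by (simp add: b2)
qed

text \<open>Composing with the projection onto the rectangle keeps continuity and the bound, and
  makes results about functions on the whole plane applicable.\<close>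

lemma clamped_extension:
  fixes U :: "real \<times> real \<Rightarrow> real"
  assumes "continuous_on ({a..b} \<times> {c..d}) U" "a \<le> b" "c \<le> d"
  obtains V B where "continuous_on UNIV V" "\<And>z. \<bar>V z\<bar> \<le> B" "\<And>z. z \<in> {a..b} \<times> {c..d} \<Longrightarrow> V z = U z"
proof -
  define V where "V z = U (max a (min b (fst z)), max c (min d (snd z)))" for z
  have "bounded (U ` ({a..b} \<times> {c..d}))"
    by (intro compact_imp_bounded compact_continuous_image assms compact_Times) auto
  then obtain B where B: "\<And>z. z \<in> {a..b} \<times> {c..d} \<Longrightarrow> \<bar>U z\<bar> \<le> B"
    unfolding bounded_iff by fastforce
  show ?thesis
  proof (rule that[of V B])
    show "continuous_on UNIV V" unfolding V_def
      by (rule continuous_on_compose2[OF assms(1)]) (use assms in \<open>auto intro!: continuous_intros\<close>)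
    show "\<bar>V z\<bar> \<le> B" for z unfolding V_def by (rule B) (use assms in auto)
    show "V z = U z" if "z \<in> {a..b} \<times> {c..d}" for z using that by (auto simp: V_def)
  qed
qed

text \<open>The weight is only measurable, so the exchange is made for Lebesgue integrals, where
  \<open>Fubini_box\<close> applies, and carried back.\<close>

lemma integral_swap_weight:
  fixes U :: "real \<times> real \<Rightarrow> real"
  assumes p: "bdm p C" and U: "continuous_on ({a..b} \<times> {c..d}) U" and ab: "a \<le> b" "c \<le> d"
  shows "integral {a..b} (\<lambda>x. p x * integral {c..d} (\<lambda>t. U (x, t)))
       = integral {c..d} (\<lambda>t. integral {a..b} (\<lambda>x. p x * U (x, t)))"
proof -
  obtain V B where V: "continuous_on UNIV V" "\<And>z. \<bar>V z\<bar> \<le> B"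
    "\<And>z. z \<in> {a..b} \<times> {c..d} \<Longrightarrow> V z = U z"
    using clamped_extension[OF U ab] by blast
  have [measurable]: "V \<in> borel_measurable borel" using V(1) by (rule borel_measurable_continuous_onI)
  have [measurable]: "p \<in> borel_measurable borel" using p by (simp add: bdm_def)
  define f where "f z = indicator ({a..b} \<times> {c..d}) z * (p (fst z) * V z)" for z
  have m: "(fst :: real \<times> real \<Rightarrow> real) \<in> borel_measurable borel"
    by (simp add: borel_measurable_continuous_onI continuous_on_fst)
  have 1: "f \<in> borel_measurable borel" unfolding f_def
  proof (intro borel_measurable_times borel_measurable_indicator)
    show "{a..b} \<times> {c..d} \<in> sets borel" by (intro borel_closed closed_Times) auto
    show "(\<lambda>z :: real \<times> real. p (fst z)) \<in> borel_measurable borel"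
      using measurable_compose[OF m, of p borel] by simp
  qed auto
  have B0: "B \<ge> 0" "C \<ge> 0" using order_trans[OF abs_ge_zero V(2)] bdm_nonneg[OF p] .
  have 2: "\<bar>f z\<bar> \<le> C * B" for z
    using p V(2)[of z] B0 by (auto simp: f_def indicator_def abs_mult bdm_def intro!: mult_mono)
  have 3: "f z = 0" if "z \<notin> {a..b} \<times> {c..d}" for z using that by (simp add: f_def)
  note F = Fubini_box[OF 1 2 3]
  have "integral {a..b} (\<lambda>x. p x * integral {c..d} (\<lambda>t. U (x, t))) = integral {a..b} (\<lambda>x. integral {c..d} (\<lambda>t. f (x, t)))"
  proof (rule integral_cong)
    fix x assume x: "x \<in> {a..b}"
    have "p x * integral {c..d} (\<lambda>t. U (x, t)) = integral {c..d} (\<lambda>t. p x * U (x, t))" by simp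
    also have "\<dots> = integral {c..d} (\<lambda>t. f (x, t))"
      by (rule integral_cong) (use x V(3) in \<open>auto simp: f_def\<close>)
    finally show "p x * integral {c..d} (\<lambda>t. U (x, t)) = integral {c..d} (\<lambda>t. f (x, t))" .
  qed
  also have "\<dots> = integral {c..d} (\<lambda>t. integral {a..b} (\<lambda>x. f (x, t)))" using F(2,3) by simp
  also have "\<dots> = integral {c..d} (\<lambda>t. integral {a..b} (\<lambda>x. p x * U (x, t)))"
    by (intro integral_cong) (use V(3) in \<open>auto simp: f_def\<close>)
  finally show ?thesis .
qed

text \<open>Continuity in the parameter is uniform over the compact interval, so the continuous
  factor converges uniformly and the bounded weight preserves the limit.\<close>

lemma continuous_on_weighted_integral:
  fixes U :: "'a::topological_space \<times> real \<Rightarrow> real"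
  assumes p: "bdm p C" and U: "continuous_on (S \<times> {a..b}) U"
  shows "continuous_on S (\<lambda>s. integral {a..b} (\<lambda>x. p x * U (s, x)))"
proof (cases "a \<le> b")
  case True
  have cU: "continuous_on {a..b} (\<lambda>x. U (s, x))" if "s \<in> S" for s
    by (rule continuous_on_compose2[OF U]) (use that in \<open>auto intro!: continuous_intros\<close>)
  show ?thesis
    unfolding continuous_on_def
  proof (intro strip tendstoI)
    fix s and e :: real assume s: "s \<in> S" and e: "e > 0"
    define e' where "e' = e / (C * (b - a) + 1)"
    have pos: "C * (b - a) \<ge> 0" using bdm_nonneg[OF p] True by simp
    then have e': "e' > 0" using e by (simp add: e'_def)
    from continuous_on_prod_compactE[OF U compact_Icc s e']
    obtain X0 where X0: "s \<in> X0" "open X0"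
      and fx: "\<forall>x\<in>X0 \<inter> S. \<forall>t\<in>{a..b}. dist (U (x, t)) (U (s, t)) \<le> e'" .
    have "\<forall>\<^sub>F y in at s within S. y \<in> X0 \<inter> S"
      using X0 eventually_at_topological by auto
    then show "\<forall>\<^sub>F y in at s within S. dist (integral {a..b} (\<lambda>x. p x * U (y, x))) (integral {a..b} (\<lambda>x. p x * U (s, x))) < e"
    proof eventually_elim
      case (elim y)
      have "integral {a..b} (\<lambda>x. p x * U (y, x)) - integral {a..b} (\<lambda>x. p x * U (s, x))
          = integral {a..b} (\<lambda>x. p x * (U (y, x) - U (s, x)))"
        using elim s by (simp add: right_diff_distrib Henstock_Kurzweil_Integration.integral_diff bdm_mult_integrable(2)[OF p cU])
      also have "\<bar>\<dots>\<bar> \<le> C * e' * (b - a)"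
        by (rule bdm_integral_bound[OF p _ True]) (use elim fx s in \<open>auto intro!: continuous_intros cU simp: dist_real_def\<close>)
      also have "\<dots> < e"
      proof -
        have "C * e' * (b - a) = e * (C * (b - a)) / (C * (b - a) + 1)" by (simp add: e'_def)
        also have "\<dots> < e" using e pos by (simp add: field_simps)
        finally show ?thesis .
      qed
      finally show ?case by (simp add: dist_real_def)
    qed
  qed
qed auto


subsection \<open>The fundamental lemma of the calculus of variations\<close>

definition bump_pair :: "real \<Rightarrow> (real \<Rightarrow> real) \<Rightarrow> (real \<Rightarrow> real) \<Rightarrow> bool" where
  "bump_pair l g g' \<longleftrightarrow> smooth1 g \<and> smooth1 g' \<and> (\<forall>x. (g has_real_derivative g' x) (at x)) \<and>
     (\<exists>a b. 0 < a \<and> a \<le> b \<and> b < l \<and> (\<forall>x. x \<notin> {a..b} \<longrightarrow> g x = 0 \<and> g' x = 0))"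

text \<open>The argument of du Bois-Reymond: test with a smoothed indicator of the interval from
  \<open>x1\<close> to \<open>x2\<close>. Its derivative is an approximate delta at
  \<open>x1\<close> minus one at \<open>x2\<close>, and the integral of \<open>R\<close> against it
  tends to the integral of \<open>R\<close> over the interval.\<close>

lemma weak_primitive_aux:
  assumes X: "continuous_on {0..l} X"
    and R: "R absolutely_integrable_on {0..l}" "\<And>x. x \<in> {0..l} \<Longrightarrow> \<bar>R x\<bar> \<le> B"
    and weak: "\<And>g g'. bump_pair l g g' \<Longrightarrow>
      integral {0..l} (\<lambda>x. X x * g' x) + integral {0..l} (\<lambda>x. R x * g x) = 0"
    and x12: "0 < x1" "x1 < x2" "x2 < l"
  shows "X x2 - X x1 = integral {x1..x2} R"
proof -
  obtain s b :: "real \<Rightarrow> real" where s: "smooth1 s" "smooth1 b"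
    "\<And>x. (s has_real_derivative b x) (at x)" "\<And>x. b x \<ge> 0"
    "\<And>x. x \<le> 0 \<or> x \<ge> 1 \<Longrightarrow> b x = 0" "\<And>x. x \<le> 0 \<Longrightarrow> s x = 0" "\<And>x. x \<ge> 1 \<Longrightarrow> s x = 1"
    using smooth_step by metis
  have smono: "s x \<le> s y" if "x \<le> y" for x y
    using DERIV_nonneg_imp_nondecreasing[OF that, of s] s(3,4) by blast
  have s01: "0 \<le> s x" "s x \<le> 1" for x
    using smono[of "min x 0" x] s(6)[of "min x 0"] smono[of x "max x 1"] s(7)[of "max x 1"] by auto
  have B0: "B \<ge> 0" using R(2)[of x1] x12 by auto
  have small: "\<bar>X x1 - X x2 + integral {x1..x2} R\<bar> \<le> e" if e: "e > 0" for e
  proof -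
    \<comment> \<open>Four errors of size at most \<open>w\<close> will add up to \<open>e\<close>:
      the two point evaluations of \<open>X\<close>, and the integrals of \<open>R\<close> over the
      two ramps of width \<open>h\<close>.\<close>
    define w where "w = e / 4"
    have w: "w > 0" using e by (simp add: w_def)
    have "isCont X x1" "isCont X x2"
      using X x12 by (auto intro: continuous_on_interior)
    then obtain d1 d2 where d: "d1 > 0" "d2 > 0"
      "\<And>x. \<bar>x - x1\<bar> < d1 \<Longrightarrow> \<bar>X x - X x1\<bar> < w" "\<And>x. \<bar>x - x2\<bar> < d2 \<Longrightarrow> \<bar>X x - X x2\<bar> < w"
      using w unfolding continuous_at_eps_delta dist_real_def by metis
    \<comment> \<open>The entries of the minimum keep \<open>X\<close> within \<open>w\<close> of
      its value at the start of each ramp, keep the ramps from overlapping and inside the interval,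
      and make \<open>h * B\<close> at most \<open>w\<close>.\<close>
    define h where "h = min (min (d1 / 2) (d2 / 2)) (min (min (x2 - x1) ((l - x2) / 2)) (w / (B + 1)))"
    have h: "h > 0" "h < d1" "h < d2" "h \<le> x2 - x1" "x2 + h < l" "h * (B + 1) \<le> w"
    proof -
      show "h > 0" using d w x12 B0 by (auto simp: h_def)
      show "h < d1" "h < d2" "h \<le> x2 - x1" using d by (auto simp: h_def min_less_iff_disj)
      have "h \<le> (l - x2) / 2" unfolding h_def by (meson min.cobounded1 min.cobounded2 order_trans)
      then show "x2 + h < l" using x12 by simp
      have "h \<le> w / (B + 1)" unfolding h_def by (meson min.cobounded1 min.cobounded2 order_trans)
      then show "h * (B + 1) \<le> w" using B0 by (simp add: field_simps)
    qed
    define S where "S c x = s ((x - c) / h)" for c x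
    define S' where "S' c x = b ((x - c) / h) * inverse h" for c x
    have arg: "(x - c) / h = inverse h * x + (- c / h)" for x c
      by (simp add: algebra_simps divide_inverse)
    have dS: "(S c has_real_derivative S' c x) (at x)" for c x
      unfolding S_def S'_def by (rule DERIV_chain2[OF s(3)]) (use h in \<open>auto intro!: derivative_eq_intros simp: divide_inverse\<close>)
    have smS: "smooth1 (S c)" "smooth1 (S' c)" for c
      unfolding S_def S'_def arg
      by (rule smooth1_affine[OF s(1)] smooth1_mult[OF smooth1_affine[OF s(2)] smooth1_const])+
    have S0: "S c x = 0" if "x \<le> c" for c x
      using that h by (auto simp: S_def intro!: s(6) divide_nonpos_pos)
    have S1: "S c x = 1" if "x \<ge> c + h" for c x
      using that h by (auto simp: S_def intro!: s(7))
    have S'0: "S' c x = 0" if "x \<le> c \<or> x \<ge> c + h" for c x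
      using that h s(5)[of "(x - c) / h"] by (auto simp: S'_def field_simps)
    have S'pos: "S' c x \<ge> 0" for c x using s(4) h by (simp add: S'_def)
    have S01: "0 \<le> S c x" "S c x \<le> 1" for c x using s01 by (auto simp: S_def)
    define g where "g x = S x1 x + (-1) * S x2 x" for x
    define g' where "g' x = S' x1 x + (-1) * S' x2 x" for x
    have gz: "g x = 0 \<and> g' x = 0" if "x \<notin> {x1..x2 + h}" for x
    proof (cases "x < x1")
      case True
      then show ?thesis using S0[of x x1] S0[of x x2] S'0[of x x1] S'0[of x x2] x12 by (simp add: g_def g'_def)
    next
      case False
      then show ?thesis using that S1[of x1 x] S1[of x2 x] S'0[of x x1] S'0[of x x2] x12 by (simp add: g_def g'_def)
    qed
    have "\<exists>a b. 0 < a \<and> a \<le> b \<and> b < l \<and> (\<forall>x. x \<notin> {a..b} \<longrightarrow> g x = 0 \<and> g' x = 0)"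
      by (rule exI[of _ x1], rule exI[of _ "x2 + h"]) (use gz x12 h in auto)
    moreover have "smooth1 g" "smooth1 g'"
      unfolding g_def g'_def by (rule smooth1_add[OF smS(1) smooth1_mult[OF smooth1_const smS(1)]]
            smooth1_add[OF smS(2) smooth1_mult[OF smooth1_const smS(2)]])+
    moreover have "(g has_real_derivative g' x) (at x)" for x
      unfolding g_def g'_def by (intro DERIV_add DERIV_cmult dS)
    ultimately have bump: "bump_pair l g g'" unfolding bump_pair_def by blast
    have cS: "continuous_on A (S c)" "continuous_on A (S' c)" for A c
      by (intro smooth1_continuous smS)+
    have iX: "(\<lambda>x. c x * f x) integrable_on {0..l}"
      if "continuous_on {0..l} c" "continuous_on {0..l} f" for c f :: "real \<Rightarrow> real"
      by (intro integrable_continuous_interval continuous_intros that)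
    have one: "\<bar>integral {0..l} (\<lambda>x. X x * S' c x) - X c\<bar> \<le> w"
      if c: "0 < c" "c + h < l" and Xc: "\<And>x. x \<in> {c..c + h} \<Longrightarrow> \<bar>X x - X c\<bar> \<le> w" for c
    proof -
      have "(S' c has_integral (S c l - S c 0)) {0..l}"
        by (rule fundamental_theorem_of_calculus)
          (use c h in \<open>auto simp flip: has_real_derivative_iff_has_vector_derivative intro: has_field_derivative_at_within dS\<close>)
      then have I1: "integral {0..l} (S' c) = 1" using S0[of 0 c] S1[of c l] c by (simp add: integral_unique)
      have "integral {0..l} (\<lambda>x. X x * S' c x) - X c = integral {0..l} (\<lambda>x. (X x - X c) * S' c x)"
        using I1 iX[OF X cS(2)] iX[OF continuous_on_const cS(2)]
        by (simp add: left_diff_distrib Henstock_Kurzweil_Integration.integral_diff)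
      also have "\<bar>\<dots>\<bar> \<le> integral {0..l} (\<lambda>x. w * S' c x)"
      proof (rule abs_integral_le)
        show "\<bar>(X x - X c) * S' c x\<bar> \<le> w * S' c x" for x
        proof (cases "x \<in> {c..c+h}")
          case True
          then show ?thesis using Xc[of x] S'pos[of c x] by (auto simp: abs_mult intro!: mult_right_mono)
        next
          case False
          then show ?thesis using S'0[of x c] by auto
        qed
        show "(\<lambda>x. (X x - X c) * S' c x) integrable_on {0..l}"
          by (rule iX[OF continuous_on_diff[OF X continuous_on_const] cS(2)])
        show "(\<lambda>x. w * S' c x) integrable_on {0..l}"
          by (rule iX[OF continuous_on_const cS(2)])
      qed
      also have "\<dots> = w" using I1 by simp
      finally show ?thesis .
    qed
    have 1: "\<bar>integral {0..l} (\<lambda>x. X x * S' x1 x) - X x1\<bar> \<le> w"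
      by (rule one) (use x12 h d(3) less_imp_le in \<open>auto intro!: less_imp_le\<close>)
    have 2: "\<bar>integral {0..l} (\<lambda>x. X x * S' x2 x) - X x2\<bar> \<le> w"
      by (rule one) (use x12 h d(4) in \<open>auto intro!: less_imp_le\<close>)
    have "integral {0..l} (\<lambda>x. X x * g' x) = integral {0..l} (\<lambda>x. X x * S' x1 x) - integral {0..l} (\<lambda>x. X x * S' x2 x)"
      using iX[OF X cS(2)[of _ x1]] iX[OF X cS(2)[of _ x2]] unfolding g'_def
      by (simp add: right_diff_distrib Henstock_Kurzweil_Integration.integral_diff)
    with 1 2 have A: "\<bar>integral {0..l} (\<lambda>x. X x * g' x) - (X x1 - X x2)\<bar> \<le> 2 * w" by linarith
    have iR: "(\<lambda>x. R x * f x) integrable_on {u..v}" if "continuous_on {0..l} f" "0 \<le> u" "v \<le> l" for f u v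
      using set_lebesgue_integral_eq_integral(1)[OF absolutely_integrable_mult_continuous[OF R(1) that(1)]]
      integrable_on_subinterval[of _ "{0..l}" u v] that by auto
    have iR1: "R integrable_on {u..v}" if "0 \<le> u" "v \<le> l" for u v
      using iR[OF continuous_on_const[of _ 1] that] by simp
    have cg: "continuous_on A g" for A using bump smooth1_continuous by (auto simp: bump_pair_def)
    have split: "integral {0..l} (\<lambda>x. R x * g x) = integral {0..x1} (\<lambda>x. R x * g x) + integral {x1..x1+h} (\<lambda>x. R x * g x)
       + integral {x1+h..x2} (\<lambda>x. R x * g x) + integral {x2..x2+h} (\<lambda>x. R x * g x) + integral {x2+h..l} (\<lambda>x. R x * g x)"
      using Henstock_Kurzweil_Integration.integral_combine[of 0 x1 l "\<lambda>x. R x * g x"]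
        Henstock_Kurzweil_Integration.integral_combine[of x1 "x1+h" l "\<lambda>x. R x * g x"]
        Henstock_Kurzweil_Integration.integral_combine[of "x1+h" x2 l "\<lambda>x. R x * g x"]
        Henstock_Kurzweil_Integration.integral_combine[of x2 "x2+h" l "\<lambda>x. R x * g x"] x12 h
        iR[OF cg] by auto
    have z1: "integral {0..x1} (\<lambda>x. R x * g x) = 0"
      by (rule integral_unique, rule has_integral_is_0) (use S0 x12 in \<open>auto simp: g_def\<close>)
    have z2: "integral {x2+h..l} (\<lambda>x. R x * g x) = 0"
      by (rule integral_unique, rule has_integral_is_0) (use S1 x12 h in \<open>auto simp: g_def\<close>)
    have z3: "integral {x1+h..x2} (\<lambda>x. R x * g x) = integral {x1+h..x2} R"
      by (rule integral_cong) (use S1 S0 in \<open>auto simp: g_def\<close>)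
    have g1: "\<bar>g x\<bar> \<le> 1" for x using S01[of x1 x] S01[of x2 x] by (auto simp: g_def)
    have z4: "\<bar>integral {x2..x2+h} (\<lambda>x. R x * g x)\<bar> \<le> B * (x2 + h - x2)"
    proof (rule abs_integral_le_const)
      show "\<bar>R x * g x\<bar> \<le> B" if "x \<in> {x2..x2 + h}" for x
        using mult_mono[OF R(2)[of x] g1[of x] B0] that x12 h by (auto simp: abs_mult)
    qed (use iR[OF cg] x12 h in auto)
    have z5: "\<bar>integral {x1..x1+h} (\<lambda>x. R x * (g x - 1))\<bar> \<le> B * (x1 + h - x1)"
    proof (rule abs_integral_le_const)
      show "\<bar>R x * (g x - 1)\<bar> \<le> B" if "x \<in> {x1..x1 + h}" for x
      proof -
        have "g x = S x1 x" using that h S0[of x x2] by (simp add: g_def)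
        then have "\<bar>g x - 1\<bar> \<le> 1" using S01[of x1 x] by auto
        from mult_mono[OF R(2)[of x] this B0] show ?thesis using that x12 h by (auto simp: abs_mult)
      qed
    qed (use iR[OF continuous_on_diff[OF cg continuous_on_const]] x12 h in auto)
    have "integral {x1..x1+h} (\<lambda>x. R x * (g x - 1)) = integral {x1..x1+h} (\<lambda>x. R x * g x) - integral {x1..x1+h} R"
      using iR[OF cg, of x1 "x1 + h"] iR1[of x1 "x1+h"] x12 h
      by (simp add: right_diff_distrib Henstock_Kurzweil_Integration.integral_diff)
    moreover have "integral {x1..x2} R = integral {x1..x1+h} R + integral {x1+h..x2} R"
      using Henstock_Kurzweil_Integration.integral_combine[of x1 "x1+h" x2 R] iR1[of x1 x2] x12 h by auto
    ultimately have C: "\<bar>integral {0..l} (\<lambda>x. R x * g x) - integral {x1..x2} R\<bar> \<le> 2 * (B * h)"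
      using split z1 z2 z3 z4 z5 by simp
    have "B * h \<le> w" using h by (simp add: algebra_simps)
    moreover have "w = e / 4" by (simp add: w_def)
    ultimately show ?thesis using A C weak[OF bump] by linarith
  qed
  have "\<bar>X x1 - X x2 + integral {x1..x2} R\<bar> \<le> 0"
    by (rule field_le_epsilon) (use small in auto)
  then show ?thesis by simp
qed

text \<open>\<open>X\<close> minus the primitive of \<open>R\<close> is constant on the open
  interval and continuous on the closed one, so the end-points are included.\<close>

lemma weak_primitive:
  assumes X: "continuous_on {0..l} X"
    and R: "R absolutely_integrable_on {0..l}" "\<And>x. x \<in> {0..l} \<Longrightarrow> \<bar>R x\<bar> \<le> B"
    and weak: "\<And>g g'. bump_pair l g g' \<Longrightarrow>
      integral {0..l} (\<lambda>x. X x * g' x) + integral {0..l} (\<lambda>x. R x * g x) = 0"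
    and x12: "0 \<le> x1" "x1 \<le> x2" "x2 \<le> l" "l > 0"
  shows "X x2 - X x1 = integral {x1..x2} R"
proof -
  have iR: "R integrable_on {0..l}" using R(1) by (simp add: set_lebesgue_integral_eq_integral(1))
  define Y where "Y x = X x - integral {0..x} R" for x
  have Ydiff: "Y x = Y y \<longleftrightarrow> X y - X x = integral {x..y} R" if "0 \<le> x" "x \<le> y" "y \<le> l" for x y
    using integral_diff_interval[OF iR that] by (auto simp: Y_def)
  have "continuous_on (closure {0<..<l}) Y"
    using x12 unfolding Y_def
    by (auto intro!: continuous_intros X indefinite_integral_continuous_1 iR)
  moreover have "Y x = Y (l/2)" if "x \<in> {0<..<l}" for x
    using Ydiff[of x "l/2"] Ydiff[of "l/2" x] weak_primitive_aux[OF X R weak, of x "l/2"]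
      weak_primitive_aux[OF X R weak, of "l/2" x] that
    by (cases x "l/2" rule: linorder_cases) auto
  ultimately have const: "Y x = Y (l/2)" if "x \<in> closure {0<..<l}" for x
    using continuous_constant_on_closure that by blast
  have "Y x1 = Y x2" by (rule trans[OF const const[symmetric]]) (use x12 in auto)
  then show ?thesis using Ydiff x12 by simp
qed

subsection \<open>Tensor products as test functions\<close>

text \<open>A directional derivative of a product in separated variables is a sum of two such
  products. Finite sums are therefore closed under all directional derivatives, and iterated
  derivatives exist by one induction.\<close>

inductive tensor_sum :: "(real \<times> real \<Rightarrow> real) \<Rightarrow> bool" where
  tensor: "smooth1 g \<Longrightarrow> smooth1 h \<Longrightarrow> tensor_sum (\<lambda>z. g (fst z) * h (snd z))"
| add: "tensor_sum f \<Longrightarrow> tensor_sum g \<Longrightarrow> tensor_sum (\<lambda>z. f z + g z)"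

lemma tensor_has_derivative:
  assumes "\<And>x. (g has_real_derivative g' x) (at x)" "\<And>x. (h has_real_derivative h' x) (at x)"
  shows "((\<lambda>z. g (fst z) * h (snd z)) has_derivative
     (\<lambda>v. g' (fst z) * fst v * h (snd z) + g (fst z) * (h' (snd z) * snd v))) (at z)"
proof -
  have "((\<lambda>z. g (fst z)) has_derivative (\<lambda>v. g' (fst z) * fst v)) (at z)"
    by (rule has_derivative_compose[where f = fst and f' = fst and g = g and g' = "\<lambda>v. g' (fst z) * v"])
      (use assms(1) in \<open>auto simp flip: has_field_derivative_def intro!: has_derivative_fst\<close>)
  moreover have "((\<lambda>z. h (snd z)) has_derivative (\<lambda>v. h' (snd z) * snd v)) (at z)"
    by (rule has_derivative_compose[where f = snd and f' = snd and g = h and g' = "\<lambda>v. h' (snd z) * v"])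
      (use assms(2) in \<open>auto simp flip: has_field_derivative_def intro!: has_derivative_snd\<close>)
  ultimately show ?thesis
    by (auto intro!: derivative_eq_intros)
qed

lemma pdiff_tensor:
  assumes "\<And>x. (g has_real_derivative g' x) (at x)" "\<And>x. (h has_real_derivative h' x) (at x)"
  shows "pdiff a (\<lambda>z. g (fst z) * h (snd z)) =
    (\<lambda>z. fst a * g' (fst z) * h (snd z) + g (fst z) * (snd a * h' (snd z)))"
  unfolding pdiff_def
  by (rule ext, subst frechet_derivative_at[OF tensor_has_derivative[OF assms], symmetric]) simp

lemma tensor_sum_pdiff:
  assumes "tensor_sum f"
  shows "(\<forall>z. f differentiable (at z)) \<and> (\<forall>a. tensor_sum (pdiff a f))"
  using assms
proof induction
  case (tensor g h)
  obtain g' where g': "\<And>x. (g has_real_derivative g' x) (at x)" "smooth1 g'"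
    using smooth1_deriv[OF tensor(1)] by blast
  obtain h' where h': "\<And>x. (h has_real_derivative h' x) (at x)" "smooth1 h'"
    using smooth1_deriv[OF tensor(2)] by blast
  have "tensor_sum (\<lambda>z. fst a * g' (fst z) * h (snd z) + g (fst z) * (snd a * h' (snd z)))" for a :: "real \<times> real"
    by (intro tensor_sum.intros smooth1_mult smooth1_const tensor g' h'
        tensor_sum.tensor[of "\<lambda>x. fst a * g' x" h] tensor_sum.tensor[of g "\<lambda>x. snd a * h' x"])
  then show ?case
    using tensor_has_derivative[OF g'(1) h'(1)]
    unfolding pdiff_tensor[OF g'(1) h'(1)] differentiable_def by blast
next
  case (add f g)
  have "pdiff a (\<lambda>z. f z + g z) = (\<lambda>z. pdiff a f z + pdiff a g z)" for a
  proof
    fix z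
    have "((\<lambda>z. f z + g z) has_derivative (\<lambda>v. frechet_derivative f (at z) v + frechet_derivative g (at z) v)) (at z)"
      using add.IH frechet_derivative_works by (intro has_derivative_add) blast+
    from frechet_derivative_at[OF this, symmetric]
    show "pdiff a (\<lambda>z. f z + g z) z = pdiff a f z + pdiff a g z" by (simp add: pdiff_def)
  qed
  then show ?case using add by (auto intro: tensor_sum.add)
qed

lemma tensor_test_function:
  assumes "bump_pair l g g'" "bump_pair T h h'"
  shows "test_function (rect l T) (\<lambda>z. g (fst z) * h (snd z))"
proof -
  let ?f = "\<lambda>z. g (fst z) * h (snd z)"
  have "tensor_sum ?f" using assms by (auto simp: bump_pair_def intro: tensor_sum.tensor)
  then have "tensor_sum (iter_pdiff as ?f)" for as
    by (induction as) (auto simp: tensor_sum_pdiff)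
  then have "smooth2 ?f" by (auto simp: smooth2_def tensor_sum_pdiff)
  moreover obtain a b c d where s: "0 < a" "b < l" "0 < c" "d < T"
    "\<And>x. x \<notin> {a..b} \<Longrightarrow> g x = 0" "\<And>x. x \<notin> {c..d} \<Longrightarrow> h x = 0"
    using assms unfolding bump_pair_def by metis
  have "{z. ?f z \<noteq> 0} \<subseteq> {a..b} \<times> {c..d}" using s(5,6) by force
  then have cl: "closure {z. ?f z \<noteq> 0} \<subseteq> {a..b} \<times> {c..d}"
    by (rule closure_minimal) (auto intro!: closed_Times)
  moreover have "{a..b} \<times> {c..d} \<subseteq> rect l T" using s by (auto simp: rect_def)
  moreover have "compact (closure {z. ?f z \<noteq> 0})"
  proof -
    have "compact (({a..b} \<times> {c..d}) \<inter> closure {z. ?f z \<noteq> 0})"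
      by (intro compact_Int_closed compact_Times) auto
    then show ?thesis using cl by (simp add: inf.absorb2)
  qed
  ultimately show ?thesis by (auto simp: test_function_def)
qed


subsection \<open>The heat equation on one edge\<close>

lemma bump_pair_bounded:
  assumes "bump_pair l g g'"
  obtains B where "\<And>x. \<bar>g x\<bar> \<le> B" "\<And>x. \<bar>g' x\<bar> \<le> B"
proof -
  obtain a b where ab: "\<And>x. x \<notin> {a..b} \<Longrightarrow> g x = 0 \<and> g' x = 0"
    using assms unfolding bump_pair_def by blast
  have "continuous_on {a..b} g" "continuous_on {a..b} g'"
    using assms smooth1_continuous unfolding bump_pair_def by blast+
  then have "bounded (g ` {a..b})" "bounded (g' ` {a..b})"
    by (simp_all add: compact_imp_bounded compact_continuous_image)
  then obtain B1 B2 where B: "\<forall>x\<in>{a..b}. \<bar>g x\<bar> \<le> B1" "\<forall>x\<in>{a..b}. \<bar>g' x\<bar> \<le> B2"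
    unfolding bounded_iff by fastforce
  show ?thesis
  proof (rule that[of "max 0 (max B1 B2)"])
    show "\<bar>g x\<bar> \<le> max 0 (max B1 B2)" for x using B(1) ab[of x] by (cases "x \<in> {a..b}") (auto simp: le_max_iff_disj)
    show "\<bar>g' x\<bar> \<le> max 0 (max B1 B2)" for x using B(2) ab[of x] by (cases "x \<in> {a..b}") (auto simp: le_max_iff_disj)
  qed
qed

text \<open>Applied with weight 1 to the two derivative terms of the equation, and with the
  potential as weight to the remaining one.\<close>

lemma tensor_integral:
  fixes U :: "real \<times> real \<Rightarrow> real"
  assumes q: "bdm q C" and U: "continuous_on ({0..l} \<times> {0..T}) U" and lT: "0 \<le> l" "0 \<le> T"
    and a: "continuous_on UNIV a" "\<And>x. \<bar>a x\<bar> \<le> A" "\<And>x. x \<notin> {0..l} \<Longrightarrow> a x = 0"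
    and b: "continuous_on UNIV b" "\<And>x. \<bar>b x\<bar> \<le> B" "\<And>x. x \<notin> {0..T} \<Longrightarrow> b x = 0"
  shows "integrable lborel (\<lambda>z. q (fst z) * U z * (a (fst z) * b (snd z)))" (is "integrable _ ?f")
    and "(\<integral>z. q (fst z) * U z * (a (fst z) * b (snd z)) \<partial>lborel)
      = integral {0..l} (\<lambda>x. q x * integral {0..T} (\<lambda>t. U (x, t) * b t) * a x)"
proof -
  obtain V D where V: "continuous_on UNIV V" "\<And>z. \<bar>V z\<bar> \<le> D"
    "\<And>z. z \<in> {0..l} \<times> {0..T} \<Longrightarrow> V z = U z"
    using clamped_extension[OF U lT] by blast
  have 0: "?f = (\<lambda>z. q (fst z) * V z * (a (fst z) * b (snd z)))" (is "_ = ?g")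
  proof
    fix z show "?f z = ?g z" using V(3)[of z] a(3)[of "fst z"] b(3)[of "snd z"]
      by (cases "z \<in> {0..l} \<times> {0..T}") (auto simp: mem_Times_iff)
  qed
  have m: "(fst :: real \<times> real \<Rightarrow> real) \<in> borel_measurable borel"
    by (simp add: borel_measurable_continuous_onI continuous_on_fst)
  have "(\<lambda>z::real\<times>real. q (fst z)) \<in> borel_measurable borel"
    using measurable_compose[OF m, of q borel] q by (simp add: bdm_def)
  moreover have "(\<lambda>z::real\<times>real. V z * (a (fst z) * b (snd z))) \<in> borel_measurable borel"
    by (intro borel_measurable_continuous_onI continuous_on_mult V(1)
        continuous_on_compose2[OF a(1)] continuous_on_compose2[OF b(1)])
      (auto intro!: continuous_intros)
  ultimately have 1: "?g \<in> borel_measurable borel"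
    by (simp only: mult.assoc) (rule borel_measurable_times)
  have nn: "C \<ge> 0" "D \<ge> 0" "A \<ge> 0" "B \<ge> 0"
    using bdm_nonneg[OF q] order_trans[OF abs_ge_zero V(2)] order_trans[OF abs_ge_zero a(2)]
      order_trans[OF abs_ge_zero b(2)] .
  have 2: "\<bar>?g z\<bar> \<le> C * D * (A * B)" for z
    unfolding abs_mult using q V(2) a(2) b(2) nn by (intro mult_mono) (auto simp: bdm_def)
  have 3: "?g z = 0" if "z \<notin> {0..l} \<times> {0..T}" for z
    using that a(3)[of "fst z"] b(3)[of "snd z"] by (auto simp: mem_Times_iff)
  note F = Fubini_box[OF 1 2 3]
  show "integrable lborel ?f" unfolding 0 by (rule F(1))
  have "(\<integral>z. ?f z \<partial>lborel) = integral {0..l} (\<lambda>x. integral {0..T} (\<lambda>t. q x * V (x, t) * (a x * b t)))"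
    unfolding 0 using F(2) by simp
  also have "\<dots> = integral {0..l} (\<lambda>x. q x * integral {0..T} (\<lambda>t. U (x, t) * b t) * a x)"
  proof (rule integral_cong)
    fix x assume x: "x \<in> {0..l}"
    have "integral {0..T} (\<lambda>t. q x * V (x, t) * (a x * b t)) = integral {0..T} (\<lambda>t. (q x * a x) * (U (x, t) * b t))"
      by (rule integral_cong) (use x V(3) in auto)
    then show "integral {0..T} (\<lambda>t. q x * V (x, t) * (a x * b t)) = q x * integral {0..T} (\<lambda>t. U (x, t) * b t) * a x"
      by simp
  qed
  finally show "(\<integral>z. ?f z \<partial>lborel) = integral {0..l} (\<lambda>x. q x * integral {0..T} (\<lambda>t. U (x, t) * b t) * a x)" .
qed

locale edge_heat =
  fixes l T C :: real and p :: "real \<Rightarrow> real" and U UX :: "real \<times> real \<Rightarrow> real"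
  assumes l: "l > 0" and T: "T > 0" and p: "bdm p C"
    and U: "continuous_on ({0..l} \<times> {0..T}) U" and UX: "continuous_on ({0..l} \<times> {0..T}) UX"
    and deriv: "\<And>x t. x \<in> {0..l} \<Longrightarrow> t \<in> {0..T} \<Longrightarrow>
        ((\<lambda>y. U (y, t)) has_real_derivative UX (x, t)) (at x within {0..l})"
    and weak: "\<exists>ut uxx. weak_deriv (rect l T) (0,1) U ut \<and> weak_deriv (rect l T) (1,0) UX uxx \<and>
        (AE z in lborel. z \<in> rect l T \<longrightarrow> ut z - uxx z + p (fst z) * U z = 0)"
begin

lemma continuous_time_integral:
  fixes W :: "real \<times> real \<Rightarrow> real"
  assumes "continuous_on ({0..l} \<times> {0..T}) W" "continuous_on UNIV k"
  shows "continuous_on {0..l} (\<lambda>x. integral {0..T} (\<lambda>t. W (x, t) * k t))"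
proof -
  have "continuous_on ({0..l} \<times> {0..T}) (\<lambda>z. W z * k (snd z))"
    by (intro continuous_on_mult assms(1) continuous_on_compose2[OF assms(2)] continuous_on_snd continuous_on_id) auto
  from continuous_on_weighted_integral[OF bdm_const[of 1] this] show ?thesis by simp
qed

text \<open>Testing the equation with a product g(x) h(t) moves the weak derivatives onto g' and h'.
  What remains involves only the continuous functions \<open>U\<close> and
  \<open>UX\<close>.\<close>

lemma weak_tensor:
  assumes g: "bump_pair l g g'" and h: "bump_pair T h h'"
  shows "integral {0..l} (\<lambda>x. integral {0..T} (\<lambda>t. UX (x, t) * h t) * g' x)
    + integral {0..l} (\<lambda>x. (p x * integral {0..T} (\<lambda>t. U (x, t) * h t)
        - integral {0..T} (\<lambda>t. U (x, t) * h' t)) * g x) = 0"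
proof -
  obtain ut uxx where w: "weak_deriv (rect l T) (0,1) U ut" "weak_deriv (rect l T) (1,0) UX uxx"
    "AE z in lborel. z \<in> rect l T \<longrightarrow> ut z - uxx z + p (fst z) * U z = 0"
    using weak by blast
  define \<phi> where "\<phi> z = g (fst z) * h (snd z)" for z
  have test: "test_function (rect l T) \<phi>"
    unfolding \<phi>_def using tensor_test_function[OF g h] by simp
  have dg: "\<And>x. (g has_real_derivative g' x) (at x)" and dh: "\<And>x. (h has_real_derivative h' x) (at x)"
    using g h by (auto simp: bump_pair_def)
  have pd: "pdiff (0,1) \<phi> z = g (fst z) * h' (snd z)" "pdiff (1,0) \<phi> z = g' (fst z) * h (snd z)" for z
    unfolding \<phi>_def pdiff_tensor[OF dg dh] by simp_all
  obtain G where G: "\<And>x. \<bar>g x\<bar> \<le> G" "\<And>x. \<bar>g' x\<bar> \<le> G" using bump_pair_bounded[OF g] by blast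
  obtain H where H: "\<And>x. \<bar>h x\<bar> \<le> H" "\<And>x. \<bar>h' x\<bar> \<le> H" using bump_pair_bounded[OF h] by blast
  have zg: "g x = 0" "g' x = 0" if "x \<notin> {0..l}" for x
    using g that unfolding bump_pair_def by force+
  have zh: "h x = 0" "h' x = 0" if "x \<notin> {0..T}" for x
    using h that unfolding bump_pair_def by force+
  have cg: "continuous_on UNIV g" "continuous_on UNIV g'" and ch: "continuous_on UNIV h" "continuous_on UNIV h'"
    using g h smooth1_continuous unfolding bump_pair_def by blast+
  have c\<phi>: "continuous_on UNIV \<phi>" unfolding \<phi>_def
    by (intro continuous_on_mult continuous_on_compose2[OF cg(1)] continuous_on_compose2[OF ch(1)])
      (auto intro!: continuous_intros)
  note i1 = tensor_integral[OF bdm_const[of 1] U less_imp_le[OF l] less_imp_le[OF T] cg(1) G(1) zg(1) ch(2) H(2) zh(2), simplified]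
  note i2 = tensor_integral[OF bdm_const[of 1] UX less_imp_le[OF l] less_imp_le[OF T] cg(2) G(2) zg(2) ch(1) H(1) zh(1), simplified]
  note i3 = tensor_integral[OF p U less_imp_le[OF l] less_imp_le[OF T] cg(1) G(1) zg(1) ch(1) H(1) zh(1)]
  obtain K where K: "compact K" "K \<subseteq> rect l T" "\<And>z. z \<notin> K \<Longrightarrow> \<phi> z = 0"
    using test closure_subset[of "{z. \<phi> z \<noteq> 0}"] unfolding test_function_def by blast
  \<comment> \<open>Weak derivatives are only locally integrable; the compact support of the test
    function supplies a compact set on which this suffices.\<close>
  have int\<phi>: "integrable lborel (\<lambda>z. f z * \<phi> z)" if "locally_integrable_on (rect l T) f" for f
  proof -
    have f: "integrable lborel (\<lambda>z. indicator K z * f z)"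
      using that K by (auto simp: locally_integrable_on_def set_integrable_def)
    have eq: "(\<lambda>z. f z * \<phi> z) = (\<lambda>z. (indicator K z * f z) * \<phi> z)"
      using K(3) by (auto simp: fun_eq_iff indicator_def)
    show ?thesis
    proof (rule Bochner_Integration.integrable_bound)
      show "integrable lborel (\<lambda>z. (G * H) * (indicator K z * f z))"
        using f by (rule integrable_mult_right)
      show "(\<lambda>z. f z * \<phi> z) \<in> borel_measurable lborel"
        unfolding eq using f borel_measurable_continuous_onI[OF c\<phi>] by auto
      have "\<bar>\<phi> z\<bar> \<le> G * H" for z
        unfolding \<phi>_def abs_mult using G(1)[of "fst z"] H(1)[of "snd z"] by (intro mult_mono) auto
      then have "\<bar>f z * \<phi> z\<bar> \<le> \<bar>(G * H) * (indicator K z * f z)\<bar>" for z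
        using mult_right_mono[of "\<bar>\<phi> z\<bar>" "G * H" "\<bar>f z\<bar>"] K(3)[of z]
          abs_ge_self[of "G * H"] mult_right_mono[of "G * H" "\<bar>G * H\<bar>" "\<bar>f z\<bar>"]
        by (cases "z \<in> K") (auto simp: abs_mult mult.commute)
      then show "AE z in lborel. norm (f z * \<phi> z) \<le> norm ((G * H) * (indicator K z * f z))" by simp
    qed
  qed
  have iut: "integrable lborel (\<lambda>z. ut z * \<phi> z)" and iuxx: "integrable lborel (\<lambda>z. uxx z * \<phi> z)"
    using w(1,2) by (auto simp: weak_deriv_def intro: int\<phi>)
  have e1: "(\<integral>z. U z * (g (fst z) * h' (snd z)) \<partial>lborel) = - (\<integral>z. ut z * \<phi> z \<partial>lborel)"
    using w(1) test unfolding weak_deriv_def pd[symmetric] by blast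
  have e2: "(\<integral>z. UX z * (g' (fst z) * h (snd z)) \<partial>lborel) = - (\<integral>z. uxx z * \<phi> z \<partial>lborel)"
    using w(2) test unfolding weak_deriv_def pd[symmetric] by blast
  have e3: "(\<integral>z. ut z * \<phi> z - uxx z * \<phi> z \<partial>lborel) = (\<integral>z. - (p (fst z) * U z * (g (fst z) * h (snd z))) \<partial>lborel)"
  proof (rule integral_cong_AE)
    show "(\<lambda>z. ut z * \<phi> z - uxx z * \<phi> z) \<in> borel_measurable lborel"
      using iut iuxx by auto
    show "(\<lambda>z. - (p (fst z) * U z * (g (fst z) * h (snd z)))) \<in> borel_measurable lborel"
      using i3(1) by auto
    show "AE z in lborel. ut z * \<phi> z - uxx z * \<phi> z = - (p (fst z) * U z * (g (fst z) * h (snd z)))"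
      using w(3)
    proof eventually_elim
      case (elim z)
      show ?case
      proof (cases "z \<in> rect l T")
        case True
        then have "ut z - uxx z = - (p (fst z) * U z)" using elim by simp
        then have "(ut z - uxx z) * \<phi> z = - (p (fst z) * U z) * \<phi> z" by simp
        then show ?thesis by (simp add: \<phi>_def left_diff_distrib)
      next
        case False
        then have "\<phi> z = 0" using K by blast
        then show ?thesis by (auto simp: \<phi>_def)
      qed
    qed
  qed
  have tot: "- (\<integral>z. U z * (g (fst z) * h' (snd z)) \<partial>lborel) + (\<integral>z. UX z * (g' (fst z) * h (snd z)) \<partial>lborel)
     + (\<integral>z. p (fst z) * U z * (g (fst z) * h (snd z)) \<partial>lborel) = 0"
    using e1 e2 e3 by (simp add: Bochner_Integration.integral_diff[OF iut iuxx])
  have "(\<lambda>x. (p x * integral {0..T} (\<lambda>t. U (x, t) * h t)) * g x) integrable_on {0..l}"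
    using bdm_mult_integrable(2)[OF p continuous_on_mult[OF continuous_time_integral[OF U ch(1)] continuous_on_subset[OF cg(1)]]]
    by (simp add: mult.assoc)
  moreover have "(\<lambda>x. integral {0..T} (\<lambda>t. U (x, t) * h' t) * g x) integrable_on {0..l}"
    by (intro integrable_continuous_interval continuous_intros continuous_time_integral U ch continuous_on_subset[OF cg(1)]) auto
  ultimately show ?thesis
    using tot i1(2) i2(2) i3(2)
    by (simp add: left_diff_distrib Henstock_Kurzweil_Integration.integral_diff)
qed

lemma continuous_space_integral:
  fixes W :: "real \<times> real \<Rightarrow> real"
  assumes "continuous_on ({0..l} \<times> {0..T}) W" "bdm q D" "0 \<le> x1" "x2 \<le> l"
  shows "continuous_on {0..T} (\<lambda>t. integral {x1..x2} (\<lambda>x. q x * W (x, t)))"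
proof -
  have "continuous_on ({0..T} \<times> {x1..x2}) (\<lambda>(t, x). W (x, t))"
    unfolding case_prod_unfold
    by (rule continuous_on_compose2[OF assms(1)]) (use assms in \<open>auto intro!: continuous_intros\<close>)
  from continuous_on_weighted_integral[OF assms(2) this] show ?thesis by simp
qed

lemma swap:
  fixes W :: "real \<times> real \<Rightarrow> real"
  assumes W: "continuous_on ({0..l} \<times> {0..T}) W" and "bdm q D" "0 \<le> x1" "x1 \<le> x2" "x2 \<le> l"
    and k: "continuous_on UNIV k"
  shows "integral {x1..x2} (\<lambda>x. q x * integral {0..T} (\<lambda>t. W (x, t) * k t))
       = integral {0..T} (\<lambda>t. integral {x1..x2} (\<lambda>x. q x * W (x, t)) * k t)"
proof -
  have "continuous_on ({x1..x2} \<times> {0..T}) (\<lambda>z. W z * k (snd z))"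
    by (intro continuous_on_mult continuous_on_subset[OF W] continuous_on_compose2[OF k])
      (use assms in \<open>auto intro!: continuous_intros\<close>)
  from integral_swap_weight[OF assms(2) this] show ?thesis using assms T
    by (simp flip: mult.assoc)
qed

lemma continuous_slice:
  fixes W :: "real \<times> real \<Rightarrow> real"
  assumes "continuous_on ({0..l} \<times> {0..T}) W"
  shows "x \<in> {0..l} \<Longrightarrow> continuous_on {0..T} (\<lambda>t. W (x, t))"
    and "t \<in> {0..T} \<Longrightarrow> continuous_on {0..l} (\<lambda>x. W (x, t))"
  by (rule continuous_on_compose2[OF assms], auto intro!: continuous_intros)+

text \<open>For a fixed \<open>h\<close> in time, \<open>weak_tensor\<close> is a one-dimensional
  weak equation in x, and \<open>weak_primitive\<close> integrates it.\<close>

lemma flux_integral: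
  assumes h: "bump_pair T h h'" and x: "0 \<le> x1" "x1 \<le> x2" "x2 \<le> l"
  shows "integral {0..T} (\<lambda>t. UX (x2, t) * h t) - integral {0..T} (\<lambda>t. UX (x1, t) * h t)
    = integral {x1..x2} (\<lambda>x. p x * integral {0..T} (\<lambda>t. U (x, t) * h t) - integral {0..T} (\<lambda>t. U (x, t) * h' t))"
proof -
  have ch: "continuous_on UNIV h" "continuous_on UNIV h'"
    using h smooth1_continuous unfolding bump_pair_def by blast+
  let ?A = "\<lambda>x. integral {0..T} (\<lambda>t. U (x, t) * h t)" and ?B = "\<lambda>x. integral {0..T} (\<lambda>t. U (x, t) * h' t)"
  have cA: "continuous_on {0..l} ?A" and cB: "continuous_on {0..l} ?B"
    by (intro continuous_time_integral U ch)+
  obtain a where a: "\<And>x. x \<in> {0..l} \<Longrightarrow> \<bar>?A x\<bar> \<le> a"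
    using compact_imp_bounded[OF compact_continuous_image[OF cA compact_Icc]] unfolding bounded_iff by fastforce
  obtain b where b: "\<And>x. x \<in> {0..l} \<Longrightarrow> \<bar>?B x\<bar> \<le> b"
    using compact_imp_bounded[OF compact_continuous_image[OF cB compact_Icc]] unfolding bounded_iff by fastforce
  show ?thesis
  proof (rule weak_primitive[where X = "\<lambda>x. integral {0..T} (\<lambda>t. UX (x, t) * h t)" and B = "C * a + b"])
    show "continuous_on {0..l} (\<lambda>x. integral {0..T} (\<lambda>t. UX (x, t) * h t))"
      by (intro continuous_time_integral UX ch)
    show "(\<lambda>x. p x * ?A x - ?B x) absolutely_integrable_on {0..l}"
      by (intro set_integral_diff bdm_mult_integrable[OF p] cA absolutely_integrable_continuous_real cB)
    show "\<bar>p x * ?A x - ?B x\<bar> \<le> C * a + b" if "x \<in> {0..l}" for x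
    proof -
      have "\<bar>p x * ?A x\<bar> \<le> C * a"
        unfolding abs_mult using p a[OF that] bdm_nonneg[OF p] by (intro mult_mono) (auto simp: bdm_def)
      then show ?thesis using b[OF that] by linarith
    qed
  qed (use weak_tensor h x l in auto)
qed

text \<open>The equation integrated over a rectangle. Once space and time integrals are exchanged in
  \<open>flux_integral\<close>, it becomes a weak equation in t, to which
  \<open>weak_primitive\<close> applies a second time.\<close>

lemma conservation:
  assumes x: "0 \<le> x1" "x1 \<le> x2" "x2 \<le> l" and t: "0 \<le> t1" "t1 \<le> t2" "t2 \<le> T"
  shows "integral {x1..x2} (\<lambda>x. U (x, t2)) - integral {x1..x2} (\<lambda>x. U (x, t1))
    = integral {t1..t2} (\<lambda>t. UX (x2, t) - UX (x1, t) - integral {x1..x2} (\<lambda>x. p x * U (x, t)))"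
proof -
  let ?Y = "\<lambda>t. integral {x1..x2} (\<lambda>x. U (x, t))"
  let ?P = "\<lambda>t. integral {x1..x2} (\<lambda>x. p x * U (x, t))"
  let ?R = "\<lambda>t. UX (x2, t) - UX (x1, t) - ?P t"
  have cY: "continuous_on {0..T} ?Y"
    using continuous_space_integral[OF U bdm_const[of 1] x(1,3)] by simp
  have cP: "continuous_on {0..T} ?P"
    by (rule continuous_space_integral[OF U p x(1,3)])
  have cR: "continuous_on {0..T} ?R"
    using x by (intro continuous_intros cP continuous_slice UX) auto
  obtain b where b: "\<And>t. t \<in> {0..T} \<Longrightarrow> \<bar>?R t\<bar> \<le> b"
    using compact_imp_bounded[OF compact_continuous_image[OF cR compact_Icc]] unfolding bounded_iff by fastforce
  show ?thesis
  proof (rule weak_primitive[OF cY absolutely_integrable_continuous_real[OF cR] b])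
    fix h h' assume h: "bump_pair T h h'"
    have ch: "continuous_on UNIV h" "continuous_on UNIV h'"
      using h smooth1_continuous unfolding bump_pair_def by blast+
    let ?A = "\<lambda>x. integral {0..T} (\<lambda>t. U (x, t) * h t)" and ?B = "\<lambda>x. integral {0..T} (\<lambda>t. U (x, t) * h' t)"
    have cA: "continuous_on {x1..x2} ?A" and cB: "continuous_on {x1..x2} ?B"
      using x by (auto intro!: continuous_on_subset[OF continuous_time_integral[OF U]] ch)
    have ch': "continuous_on {0..T} h" using ch continuous_on_subset by blast
    have i: "(\<lambda>t. UX (x, t) * h t) integrable_on {0..T}" if "x \<in> {0..l}" for x
      by (intro integrable_continuous_interval continuous_intros continuous_slice UX ch' that)
    have iP: "(\<lambda>t. ?P t * h t) integrable_on {0..T}"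
      by (intro integrable_continuous_interval continuous_intros cP ch')
    have "integral {0..T} (\<lambda>t. ?Y t * h' t) = integral {x1..x2} ?B"
      using swap[OF U bdm_const[of 1] x ch(2)] by simp
    moreover have "integral {0..T} (\<lambda>t. ?R t * h t) = integral {0..T} (\<lambda>t. UX (x2, t) * h t)
        - integral {0..T} (\<lambda>t. UX (x1, t) * h t) - integral {0..T} (\<lambda>t. ?P t * h t)"
      using i[of x1] i[of x2] iP x
      by (simp add: left_diff_distrib Henstock_Kurzweil_Integration.integral_diff integrable_diff)
    moreover have "integral {0..T} (\<lambda>t. ?P t * h t) = integral {x1..x2} (\<lambda>x. p x * ?A x)"
      using swap[OF U p x ch(1)] by simp
    moreover have "integral {x1..x2} (\<lambda>x. p x * ?A x - ?B x) = integral {x1..x2} (\<lambda>x. p x * ?A x) - integral {x1..x2} ?B"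
      by (intro Henstock_Kurzweil_Integration.integral_diff bdm_mult_integrable[OF p] cA integrable_continuous_interval cB)
    ultimately show "integral {0..T} (\<lambda>t. ?Y t * h' t) + integral {0..T} (\<lambda>t. ?R t * h t) = 0"
      using flux_integral[OF h x] by simp
  qed (use t T in auto)
qed

definition LU :: "real \<Rightarrow> real \<Rightarrow> real" where
  "LU k x = integral {0..T} (\<lambda>t. U (x, t) * exp (- (k\<^sup>2) * t))"

definition LUX :: "real \<Rightarrow> real \<Rightarrow> real" where
  "LUX k x = integral {0..T} (\<lambda>t. UX (x, t) * exp (- (k\<^sup>2) * t))"

lemma continuous_LU: "continuous_on {0..l} (LU k)" "continuous_on {0..l} (LUX k)"
  unfolding LU_def LUX_def by (intro continuous_time_integral U UX continuous_intros)+

lemma LU_diff: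
  assumes x: "0 \<le> x1" "x1 \<le> x2" "x2 \<le> l"
  shows "LU k x2 - LU k x1 = integral {x1..x2} (LUX k)"
proof -
  let ?e = "\<lambda>t. exp (- (k\<^sup>2) * t)"
  have ce: "continuous_on A ?e" for A by (intro continuous_intros)
  have i: "(\<lambda>t. U (x, t) * ?e t) integrable_on {0..T}" if "x \<in> {0..l}" for x
    by (intro integrable_continuous_interval continuous_on_mult continuous_slice U ce that)
  have "LU k x2 - LU k x1 = integral {0..T} (\<lambda>t. (U (x2, t) - U (x1, t)) * ?e t)"
    using i[of x1] i[of x2] x unfolding LU_def
    by (simp add: left_diff_distrib Henstock_Kurzweil_Integration.integral_diff)
  also have "\<dots> = integral {0..T} (\<lambda>t. integral {x1..x2} (\<lambda>x. UX (x, t)) * ?e t)"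
  proof (rule integral_cong)
    fix t assume t: "t \<in> {0..T}"
    have "((\<lambda>x. UX (x, t)) has_integral U (x2, t) - U (x1, t)) {x1..x2}"
      using x t by (intro fundamental_theorem_of_calculus)
        (auto simp flip: has_real_derivative_iff_has_vector_derivative intro!: DERIV_subset[OF deriv])
    then show "(U (x2, t) - U (x1, t)) * ?e t = integral {x1..x2} (\<lambda>x. UX (x, t)) * ?e t"
      by (simp add: integral_unique)
  qed
  also have "\<dots> = integral {x1..x2} (LUX k)"
    using swap[OF UX bdm_const[of 1] x ce] by (simp add: LUX_def[abs_def])
  finally show ?thesis .
qed

text \<open>Integration by parts in t turns the time derivative into \<open>k\<^sup>2 * LU\<close>
  and two boundary values. The one at T is the only trace of the truncation, and it carries the
  Gaussian factor.\<close>

lemma LUX_diff: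
  assumes x: "0 \<le> x1" "x1 \<le> x2" "x2 \<le> l"
  shows "LUX k x2 - LUX k x1 = integral {x1..x2} (\<lambda>x. p x * LU k x
      + (k\<^sup>2 * LU k x - U (x, 0) + exp (- (k\<^sup>2) * T) * U (x, T)))"
proof -
  let ?e = "\<lambda>t. exp (- (k\<^sup>2) * t)"
  let ?Y = "\<lambda>t. integral {x1..x2} (\<lambda>x. U (x, t))"
  let ?P = "\<lambda>t. integral {x1..x2} (\<lambda>x. p x * U (x, t))"
  let ?R = "\<lambda>t. UX (x2, t) - UX (x1, t) - ?P t"
  have ce: "continuous_on A ?e" for A by (intro continuous_intros)
  have cP: "continuous_on {0..T} ?P"
    by (rule continuous_space_integral[OF U p x(1,3)])
  have cR: "continuous_on {0..T} ?R"
    using x by (intro continuous_intros cP continuous_slice UX) auto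
  obtain b where b: "\<And>t. t \<in> {0..T} \<Longrightarrow> \<bar>?R t\<bar> \<le> b"
    using compact_imp_bounded[OF compact_continuous_image[OF cR compact_Icc]] unfolding bounded_iff by fastforce
  have bp: "integral {0..T} (\<lambda>t. ?R t * ?e t) = ?Y T * ?e T - ?Y 0 * ?e 0 - integral {0..T} (\<lambda>t. ?Y t * (- (k\<^sup>2) * ?e t))"
  proof (rule integral_mult_by_parts[OF absolutely_integrable_continuous_real[OF cR] b])
    show "(?e has_real_derivative - (k\<^sup>2) * ?e t) (at t)" for t by (auto intro!: derivative_eq_intros)
    show "?Y t = ?Y 0 + integral {0..t} ?R" if "t \<in> {0..T}" for t
      using conservation[OF x, of 0 t] that by simp
  qed (use T in \<open>auto intro!: continuous_intros\<close>)
  have i: "(\<lambda>t. UX (x, t) * ?e t) integrable_on {0..T}" if "x \<in> {0..l}" for x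
    by (intro integrable_continuous_interval continuous_on_mult continuous_slice UX ce that)
  have iP: "(\<lambda>t. ?P t * ?e t) integrable_on {0..T}"
    by (intro integrable_continuous_interval continuous_on_mult cP ce)
  have cLU: "continuous_on {x1..x2} (LU k)" using continuous_on_subset[OF continuous_LU(1)] x by auto
  have cU: "continuous_on {x1..x2} (\<lambda>x. U (x, t))" if "t \<in> {0..T}" for t
    using continuous_on_subset[OF continuous_slice(2)[OF U that]] x by auto
  have "integral {0..T} (\<lambda>t. ?R t * ?e t) = LUX k x2 - LUX k x1 - integral {0..T} (\<lambda>t. ?P t * ?e t)"
    using i[of x1] i[of x2] iP x unfolding LUX_def
    by (simp add: left_diff_distrib Henstock_Kurzweil_Integration.integral_diff integrable_diff)
  moreover have "integral {0..T} (\<lambda>t. ?P t * ?e t) = integral {x1..x2} (\<lambda>x. p x * LU k x)"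
    using swap[OF U p x ce] by (simp add: LU_def)
  moreover have "integral {0..T} (\<lambda>t. ?Y t * (- (k\<^sup>2) * ?e t)) = - (k\<^sup>2) * integral {x1..x2} (LU k)"
  proof -
    have "integral {0..T} (\<lambda>t. ?Y t * (- (k\<^sup>2) * ?e t)) = integral {0..T} (\<lambda>t. - (k\<^sup>2) * (?Y t * ?e t))"
      by (rule integral_cong) simp
    also have "\<dots> = - (k\<^sup>2) * integral {0..T} (\<lambda>t. ?Y t * ?e t)" by (rule integral_mult_right)
    also have "integral {0..T} (\<lambda>t. ?Y t * ?e t) = integral {x1..x2} (LU k)"
      using swap[OF U bdm_const[of 1] x ce] by (simp add: LU_def[abs_def])
    finally show ?thesis .
  qed
  ultimately have A: "LUX k x2 - LUX k x1 = integral {x1..x2} (\<lambda>x. p x * LU k x)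
      + (k\<^sup>2 * integral {x1..x2} (LU k) - ?Y 0 + ?e T * ?Y T)"
    using bp by (simp add: mult.commute)
  have ints: "(\<lambda>x. p x * LU k x) integrable_on {x1..x2}" "LU k integrable_on {x1..x2}"
    "(\<lambda>x. U (x, 0)) integrable_on {x1..x2}" "(\<lambda>x. U (x, T)) integrable_on {x1..x2}"
    using T bdm_mult_integrable(2)[OF p cLU] integrable_continuous_interval[OF cLU]
        integrable_continuous_interval[OF cU[of 0]] integrable_continuous_interval[OF cU[of T]] by simp_all
  have I1: "((\<lambda>x. k\<^sup>2 * LU k x - U (x, 0) + ?e T * U (x, T)) has_integral
      (k\<^sup>2 * integral {x1..x2} (LU k) - ?Y 0 + ?e T * ?Y T)) {x1..x2}"
    by (intro has_integral_add has_integral_diff has_integral_mult_right integrable_integral ints)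
  have "((\<lambda>x. p x * LU k x + (k\<^sup>2 * LU k x - U (x, 0) + ?e T * U (x, T))) has_integral
      (integral {x1..x2} (\<lambda>x. p x * LU k x) + (k\<^sup>2 * integral {x1..x2} (LU k) - ?Y 0 + ?e T * ?Y T))) {x1..x2}"
    by (intro has_integral_add I1 integrable_integral ints)
  then show ?thesis using A by (simp add: integral_unique)
qed

text \<open>Variation of constants for the resolvent equation with the free kernel exp (- k |x - y|)
  / (2 k). Up to the factor 2, the coefficients of the first two exponentials are the amplitudes of
  the waves that enter the edge at its two ends.\<close>

lemma Green_representation:
  assumes x: "x \<in> {0..l}"
  shows "2 * k * LU k x = (k * LU k 0 - LUX k 0) * exp (- k * x) + (k * LU k l + LUX k l) * exp (- k * (l - x))
    - integral {0..l} (\<lambda>y. (p y * LU k y - (U (y, 0) - exp (- (k\<^sup>2) * T) * U (y, T))) * exp (- k * \<bar>x - y\<bar>))"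
proof -
  define G where "G y = p y * LU k y + (k\<^sup>2 * LU k y - U (y, 0) + exp (- (k\<^sup>2) * T) * U (y, T))" for y
  define q where "q y = p y * LU k y - (U (y, 0) - exp (- (k\<^sup>2) * T) * U (y, T))" for y
  have cU: "continuous_on {0..l} (\<lambda>x. U (x, t))" if "t \<in> {0..T}" for t
    by (rule continuous_slice(2)[OF U that])
  have c1: "continuous_on {0..l} (\<lambda>y. c * LU k y - U (y, 0) + exp (- (k\<^sup>2) * T) * U (y, T))" for c
    using T by (intro continuous_intros continuous_LU cU) auto
  have absq: "(\<lambda>y. p y * LU k y + (c * LU k y - U (y, 0) + exp (- (k\<^sup>2) * T) * U (y, T))) absolutely_integrable_on {0..l}" for c
    by (intro set_integral_add bdm_mult_integrable[OF p] continuous_LU absolutely_integrable_continuous_real c1)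
  have absG: "G absolutely_integrable_on {0..l}" unfolding G_def[abs_def] by (rule absq)
  have absq': "q absolutely_integrable_on {0..l}"
    unfolding q_def[abs_def] using absq[of 0] by (simp add: algebra_simps)
  obtain a where a: "\<And>y. y \<in> {0..l} \<Longrightarrow> \<bar>LU k y\<bar> \<le> a"
    using compact_imp_bounded[OF compact_continuous_image[OF continuous_LU(1) compact_Icc]] unfolding bounded_iff by fastforce
  obtain a' where a': "\<And>y. y \<in> {0..l} \<Longrightarrow> \<bar>LUX k y\<bar> \<le> a'"
    using compact_imp_bounded[OF compact_continuous_image[OF continuous_LU(2) compact_Icc]] unfolding bounded_iff by fastforce
  obtain b where b: "\<And>y. y \<in> {0..l} \<Longrightarrow> \<bar>k\<^sup>2 * LU k y - U (y, 0) + exp (- (k\<^sup>2) * T) * U (y, T)\<bar> \<le> b"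
    using compact_imp_bounded[OF compact_continuous_image[OF c1 compact_Icc]] unfolding bounded_iff by fastforce
  have bG: "\<bar>G y\<bar> \<le> C * a + b" if "y \<in> {0..l}" for y
  proof -
    have "\<bar>p y * LU k y\<bar> \<le> C * a"
      unfolding abs_mult using p a[OF that] bdm_nonneg[OF p] by (intro mult_mono) (auto simp: bdm_def)
    then show ?thesis using b[OF that] unfolding G_def by linarith
  qed
  have iG: "G integrable_on {u..v}" "LUX k integrable_on {u..v}" "LU k integrable_on {u..v}" if "0 \<le> u" "v \<le> l" for u v
    using absG continuous_on_subset[OF continuous_LU(1), of "{u..v}" k] continuous_on_subset[OF continuous_LU(2), of "{u..v}" k]
      integrable_on_subinterval[of G "{0..l}" u v] that
    by (auto simp: set_lebesgue_integral_eq_integral(1) intro!: integrable_continuous_interval)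
  \<comment> \<open>For \<open>s\<^sup>2 = k\<^sup>2\<close> the integrand is the derivative of (LUX
    + s LU) exp (- s (y - x)). With s = - k to the left of x and s = k to the right, the values of
    LUX at x cancel and those of LU add up.\<close>
  have part: "integral {u..v} (\<lambda>y. q y * exp (- s * (y - x)))
      = (LUX k v + s * LU k v) * exp (- s * (v - x)) - (LUX k u + s * LU k u) * exp (- s * (u - x))"
    if uv: "0 \<le> u" "u \<le> v" "v \<le> l" and s: "s\<^sup>2 = k\<^sup>2" for u v s
  proof -
    let ?E = "\<lambda>y. exp (- s * (y - x))"
    have cLU: "continuous_on {u..v} (LU k)" "continuous_on {u..v} (LUX k)"
      using continuous_on_subset[OF continuous_LU(1), of "{u..v}"] continuous_on_subset[OF continuous_LU(2), of "{u..v}"] uv by auto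
    have abs1: "G absolutely_integrable_on {u..v}"
      using absolutely_integrable_on_subinterval[OF absG, of u v] uv by auto
    have bp: "integral {u..v} (\<lambda>y. (G y + s * LUX k y) * ?E y)
        = (LUX k v + s * LU k v) * ?E v - (LUX k u + s * LU k u) * ?E u - integral {u..v} (\<lambda>y. (LUX k y + s * LU k y) * (- s * ?E y))"
    proof (rule integral_mult_by_parts[where B = "(C * a + b) + \<bar>s\<bar> * a'"])
      show "(\<lambda>y. G y + s * LUX k y) absolutely_integrable_on {u..v}"
        by (intro set_integral_add abs1 absolutely_integrable_continuous_real continuous_intros cLU)
      show "\<bar>G y + s * LUX k y\<bar> \<le> C * a + b + \<bar>s\<bar> * a'" if "y \<in> {u..v}" for y
      proof -
        have "\<bar>s * LUX k y\<bar> \<le> \<bar>s\<bar> * a'" unfolding abs_mult using a'[of y] that uv by (intro mult_left_mono) auto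
        then show ?thesis using bG[of y] that uv by auto
      qed
      show "(?E has_real_derivative - s * ?E y) (at y)" for y by (auto intro!: derivative_eq_intros)
      show "LUX k y + s * LU k y = LUX k u + s * LU k u + integral {u..y} (\<lambda>y. G y + s * LUX k y)"
        if "y \<in> {u..v}" for y
      proof -
        have "integral {u..y} (\<lambda>y. G y + s * LUX k y) = integral {u..y} G + s * integral {u..y} (LUX k)"
          using iG[of u y] that uv by (simp add: Henstock_Kurzweil_Integration.integral_add integrable_on_mult_right)
        moreover have "integral {u..y} G = LUX k y - LUX k u"
          unfolding G_def using LUX_diff[of u y k] that uv by simp
        moreover have "integral {u..y} (LUX k) = LU k y - LU k u" using LU_diff[of u y k] that uv by simp
        ultimately show ?thesis by (simp add: algebra_simps)
      qed
    qed (use uv in \<open>auto intro!: continuous_intros\<close>)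
    have i1: "(\<lambda>y. (G y + s * LUX k y) * ?E y) integrable_on {u..v}"
      by (intro set_lebesgue_integral_eq_integral(1) absolutely_integrable_mult_continuous set_integral_add abs1
          absolutely_integrable_continuous_real continuous_intros cLU)
    have i2: "(\<lambda>y. (LUX k y + s * LU k y) * (- s * ?E y)) integrable_on {u..v}"
      by (intro integrable_continuous_interval continuous_intros cLU)
    have "q y * ?E y = (G y + s * LUX k y) * ?E y + (LUX k y + s * LU k y) * (- s * ?E y)" for y
    proof -
      have "q y = G y - s\<^sup>2 * LU k y" unfolding q_def G_def s by (simp add: algebra_simps)
      then show ?thesis by (simp only:) (simp add: algebra_simps power2_eq_square)
    qed
    then have "integral {u..v} (\<lambda>y. q y * ?E y) = integral {u..v} (\<lambda>y. (G y + s * LUX k y) * ?E y)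
        + integral {u..v} (\<lambda>y. (LUX k y + s * LU k y) * (- s * ?E y))"
      using i1 i2 by (simp only: Henstock_Kurzweil_Integration.integral_add)
    then show ?thesis using bp by simp
  qed
  have "integral {0..l} (\<lambda>y. q y * exp (- k * \<bar>x - y\<bar>))
      = integral {0..x} (\<lambda>y. q y * exp (- k * \<bar>x - y\<bar>)) + integral {x..l} (\<lambda>y. q y * exp (- k * \<bar>x - y\<bar>))"
    using x by (intro Henstock_Kurzweil_Integration.integral_combine[symmetric] set_lebesgue_integral_eq_integral(1)
        absolutely_integrable_mult_continuous absq' continuous_intros) auto
  also have "integral {0..x} (\<lambda>y. q y * exp (- k * \<bar>x - y\<bar>)) = integral {0..x} (\<lambda>y. q y * exp (- (- k) * (y - x)))"
    by (rule integral_cong) (auto simp: algebra_simps)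
  also have "\<dots> = (LUX k x - k * LU k x) - (LUX k 0 - k * LU k 0) * exp (- k * x)"
    using part[of 0 x "- k"] x by simp
  also have "integral {x..l} (\<lambda>y. q y * exp (- k * \<bar>x - y\<bar>)) = integral {x..l} (\<lambda>y. q y * exp (- k * (y - x)))"
    by (rule integral_cong) (auto simp: algebra_simps)
  also have "\<dots> = (LUX k l + k * LU k l) * exp (- k * (l - x)) - (LUX k x + k * LU k x)"
    using part[of x l k] x by simp
  finally show ?thesis unfolding q_def by (simp add: algebra_simps)
qed

end


subsection \<open>Weighted contractions\<close>

text \<open>Banach iteration in the norm sup |f i| / w i, without a metric space: \<open>A\<close>
  only has to be closed under geometrically fast limits that are uniform relative to
  \<open>w\<close>. Since the index type is arbitrary, functions of different kinds can be solved
  for together.\<close>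

lemma weighted_fixpoint:
  fixes \<Phi> :: "('i \<Rightarrow> real) \<Rightarrow> 'i \<Rightarrow> real" and w :: "'i \<Rightarrow> real"
  assumes maps: "\<And>f. f \<in> A \<Longrightarrow> \<Phi> f \<in> A"
    and contr: "\<And>f g c. f \<in> A \<Longrightarrow> g \<in> A \<Longrightarrow> c \<ge> 0 \<Longrightarrow> (\<And>i. i \<in> I \<Longrightarrow> \<bar>f i - g i\<bar> \<le> c * w i)
      \<Longrightarrow> (\<And>i. i \<in> I \<Longrightarrow> \<bar>\<Phi> f i - \<Phi> g i\<bar> \<le> c / 2 * w i)"
    and closed: "\<And>F f K. (\<And>n. F n \<in> A) \<Longrightarrow> (\<And>n i. i \<in> I \<Longrightarrow> \<bar>F n i - f i\<bar> \<le> K * (1/2)^n * w i) \<Longrightarrow> f \<in> A"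
    and f0: "f0 \<in> A" "\<And>i. i \<in> I \<Longrightarrow> \<bar>\<Phi> f0 i - f0 i\<bar> \<le> c0 * w i" "c0 \<ge> 0"
    and w: "\<And>i. i \<in> I \<Longrightarrow> w i > 0"
  obtains f where "f \<in> A" "\<And>i. i \<in> I \<Longrightarrow> \<Phi> f i = f i" "\<And>i. i \<in> I \<Longrightarrow> \<bar>f i - f0 i\<bar> \<le> 2 * c0 * w i"
proof -
  define F where "F n = (\<Phi> ^^ n) f0" for n
  have F0: "F 0 = f0" and FS: "F (Suc n) = \<Phi> (F n)" for n by (auto simp: F_def)
  have FA: "F n \<in> A" for n by (induction n) (auto simp: F0 FS f0 maps)
  have step: "i \<in> I \<Longrightarrow> \<bar>F (Suc n) i - F n i\<bar> \<le> c0 * (1/2)^n * w i" for n i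
  proof (induction n arbitrary: i)
    case 0 then show ?case using f0 by (simp add: F0 FS)
  next
    case (Suc n)
    have "\<bar>\<Phi> (F (Suc n)) i - \<Phi> (F n) i\<bar> \<le> (c0 * (1/2)^n) / 2 * w i"
      by (rule contr) (use Suc FA f0 in auto)
    then show ?case by (simp add: FS)
  qed
  have dist: "i \<in> I \<Longrightarrow> \<bar>F (n + m) i - F n i\<bar> \<le> 2 * c0 * (1/2)^n * (1 - (1/2)^m) * w i" for n m i
  proof (induction m)
    case (Suc m)
    have "\<bar>F (n + Suc m) i - F n i\<bar> \<le> c0 * (1/2)^(n + m) * w i + 2 * c0 * (1/2)^n * (1 - (1/2)^m) * w i"
      using step[of i "n + m"] Suc by simp
    also have "\<dots> = 2 * c0 * (1/2)^n * (1 - (1/2)^Suc m) * w i" by (simp add: power_add algebra_simps)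
    finally show ?case .
  qed simp
  have dist': "\<bar>F m i - F n i\<bar> \<le> 2 * c0 * (1/2)^n * w i" if "i \<in> I" "n \<le> m" for n m i
  proof -
    have "2 * c0 * (1/2)^n * (1 - (1/2)^(m - n)) * w i \<le> 2 * c0 * (1/2)^n * 1 * w i"
      using w[OF that(1)] f0(3) by (intro mult_right_mono mult_left_mono) auto
    then show ?thesis using dist[OF that(1), of n "m - n"] that by simp
  qed
  have conv: "\<exists>y. (\<lambda>n. F n i) \<longlonglongrightarrow> y" if i: "i \<in> I" for i
  proof -
    have "Cauchy (\<lambda>n. F n i)"
    proof (rule metric_CauchyI)
      fix e :: real assume e: "e > 0"
      have "(\<lambda>n. 2 * (2 * c0 * w i) * (1/2::real)^n) \<longlonglongrightarrow> 2 * (2 * c0 * w i) * 0"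
        by (intro tendsto_mult tendsto_const LIMSEQ_power_zero) auto
      then have "eventually (\<lambda>n. 2 * (2 * c0 * w i) * (1/2::real)^n < e) sequentially"
        using e by (intro order_tendstoD(2)) auto
      then obtain N where N: "2 * (2 * c0 * w i) * (1/2::real)^N < e"
        by (auto simp: eventually_sequentially)
      show "\<exists>M. \<forall>m\<ge>M. \<forall>n\<ge>M. dist (F m i) (F n i) < e"
      proof (intro exI[of _ N] allI impI)
        fix m n assume "m \<ge> N" "n \<ge> N"
        then have "\<bar>F m i - F N i\<bar> \<le> 2 * c0 * (1/2)^N * w i" "\<bar>F n i - F N i\<bar> \<le> 2 * c0 * (1/2)^N * w i"
          using dist'[OF i] by auto
        then show "dist (F m i) (F n i) < e" using N by (simp add: dist_real_def algebra_simps)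
      qed
    qed
    then show ?thesis using Cauchy_convergent convergent_def by blast
  qed
  define f where "f i = lim (\<lambda>n. F n i)" for i
  have lim: "(\<lambda>n. F n i) \<longlonglongrightarrow> f i" if "i \<in> I" for i
    using conv[OF that] limI f_def by metis
  have near: "\<bar>F n i - f i\<bar> \<le> 2 * c0 * (1/2)^n * w i" if "i \<in> I" for n i
  proof -
    have "(\<lambda>m. \<bar>F n i - F m i\<bar>) \<longlonglongrightarrow> \<bar>F n i - f i\<bar>"
      by (intro tendsto_intros lim that)
    moreover have "eventually (\<lambda>m. \<bar>F n i - F m i\<bar> \<le> 2 * c0 * (1/2)^n * w i) sequentially"
      using eventually_ge_at_top[of n] by eventually_elim (use dist'[OF that] abs_minus_commute in metis)
    ultimately show ?thesis by (rule tendsto_upperbound) simp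
  qed
  have fA: "f \<in> A" by (rule closed[of F "f" "2 * c0"]) (use FA near in auto)
  have fixed: "\<Phi> f i = f i" if i: "i \<in> I" for i
  proof -
    have "\<bar>\<Phi> f i - f i\<bar> \<le> 2 * c0 * w i * (1/2)^n" for n
    proof -
      have "\<bar>\<Phi> (F n) i - \<Phi> f i\<bar> \<le> (2 * c0 * (1/2)^n) / 2 * w i"
        by (rule contr) (use FA fA near f0 i in auto)
      moreover have "\<bar>\<Phi> (F n) i - f i\<bar> \<le> c0 * (1/2)^n * w i" using near[OF i, of "Suc n"] by (simp add: FS)
      ultimately show ?thesis by (simp add: algebra_simps)
    qed
    moreover have "(\<lambda>n. 2 * c0 * w i * (1/2::real)^n) \<longlonglongrightarrow> 2 * c0 * w i * 0"
      by (intro tendsto_mult tendsto_const LIMSEQ_power_zero) auto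
    ultimately have "\<bar>\<Phi> f i - f i\<bar> \<le> 0"
      by (intro tendsto_lowerbound[where F = sequentially and f = "\<lambda>n. 2 * c0 * w i * (1/2::real)^n"]) auto
    then show ?thesis by simp
  qed
  show ?thesis using that[of f] fA fixed near[of _ 0] by (auto simp: F0 abs_minus_commute)
qed

subsection \<open>The retarded potential of an edge\<close>

text \<open>The Duhamel term of d'Alembert's formula for the source - P z, over the part of the
  backward light cone of (x, t) that lies over the edge. The maximum with 0 empties the time
  interval at points y outside the base of the cone.\<close>

definition Nop :: "(real \<Rightarrow> real) \<Rightarrow> real \<Rightarrow> (real \<Rightarrow> real \<Rightarrow> real) \<Rightarrow> real \<Rightarrow> real \<Rightarrow> real" where
  "Nop P l z x t = - (1/2) * integral {0..l} (\<lambda>y. P y * integral {0..max 0 (t - \<bar>x - y\<bar>)} (z y))"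

lemma continuous_on_compose_pair:
  assumes "continuous_on UNIV (\<lambda>(x, t). z x t)" "continuous_on A f" "continuous_on A g"
  shows "continuous_on A (\<lambda>a. z (f a) (g a))"
  using continuous_on_compose2[OF assms(1) continuous_on_Pair[OF assms(2,3)]] by simp

lemma continuous_section:
  assumes "continuous_on UNIV (\<lambda>(x, t). z x t)"
  shows "continuous_on A (z x)" "continuous_on A (\<lambda>x. z x t)"
  using continuous_on_compose_pair[OF assms continuous_on_const continuous_on_id, of A x]
    continuous_on_compose_pair[OF assms continuous_on_id continuous_on_const, of A t] by auto

text \<open>Rescaling time to the unit interval moves the parameter from the upper limit into the
  integrand.\<close>

lemma continuous_time_primitive:
  fixes z :: "real \<Rightarrow> real \<Rightarrow> real"
  assumes z: "continuous_on UNIV (\<lambda>(x, t). z x t)"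
  shows "continuous_on UNIV (\<lambda>(y, s). integral {0..max 0 s} (z y))"
proof -
  have "continuous_on (UNIV \<times> {0..1}) (\<lambda>((y, s), r). z y (max 0 s * r))"
    unfolding case_prod_unfold by (intro continuous_on_compose_pair[OF z] continuous_intros)
  then have "continuous_on UNIV (\<lambda>(y, s). integral {0..1} (\<lambda>r. z y (max 0 s * r)))"
    using integral_continuous_on_param[of UNIV 0 1 "\<lambda>ys r. z (fst ys) (max 0 (snd ys) * r)"]
    by (simp add: case_prod_unfold)
  then have "continuous_on UNIV (\<lambda>(y, s). max 0 s * integral {0..1} (\<lambda>r. z y (max 0 s * r)))"
    by (auto simp: case_prod_unfold intro!: continuous_intros)
  moreover have "max 0 s * integral {0..1} (\<lambda>r. z y (max 0 s * r)) = integral {0..max 0 s} (z y)" for y s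
  proof (cases "s > 0")
    case True
    have "(z y has_integral integral {0..s} (z y)) {0..s}"
      by (intro integrable_integral integrable_continuous_interval continuous_section(1)[OF z])
    then have "(z y has_integral integral {0..s} (z y)) (cbox 0 s)" by simp
    from has_integral_affinity'[OF this True, of 0]
    have "((\<lambda>r. z y (s * r)) has_integral integral {0..s} (z y) / s) {0..1}"
      using True by (simp add: divide_inverse mult.commute)
    then have "integral {0..1} (\<lambda>r. z y (s * r)) = integral {0..s} (z y) / s"
      by (rule integral_unique)
    then show ?thesis using True by (simp add: max_def)
  qed auto
  ultimately show ?thesis by simp
qed

lemma continuous_Nop:
  assumes P: "bdm P C" and z: "continuous_on UNIV (\<lambda>(x, t). z x t)"
  shows "continuous_on UNIV (\<lambda>(x, t). Nop P l z x t)"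
proof -
  have "continuous_on (UNIV \<times> {0..l}) (\<lambda>((x, t), y). integral {0..max 0 (t - \<bar>x - y\<bar>)} (z y))"
    unfolding case_prod_unfold
    by (intro continuous_on_compose_pair[OF continuous_time_primitive[OF z]] continuous_intros)
  from continuous_on_weighted_integral[OF P this]
  show ?thesis unfolding Nop_def by (auto simp: case_prod_unfold intro!: continuous_intros)
qed

lemma continuous_cone_primitive:
  assumes z: "continuous_on UNIV (\<lambda>(x, t). z x t)" and c: "continuous_on A c"
  shows "continuous_on A (\<lambda>y::real. integral {0..max 0 (c y)} (z y :: real \<Rightarrow> real))"
  by (intro continuous_on_compose_pair[OF continuous_time_primitive[OF z]] continuous_on_id c)

lemma Nop_0: "Nop P l z 0 0 = 0" "x \<in> {0..l} \<Longrightarrow> Nop P l z x 0 = 0"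
proof -
  have "integral {0..max 0 (0 - \<bar>x - y\<bar>)} (z y) = 0" for x y by simp
  then show "Nop P l z 0 0 = 0" "x \<in> {0..l} \<Longrightarrow> Nop P l z x 0 = 0" by (simp_all add: Nop_def)
qed

lemma has_integral_reflect_interval:
  fixes f :: "real \<Rightarrow> real"
  assumes "f integrable_on {0..l}" "0 \<le> l"
  shows "integral {0..l} (\<lambda>y. f (l - y)) = integral {0..l} f"
proof -
  have "(f has_integral integral {0..l} f) (cbox 0 l)" using assms by (simp add: integrable_integral)
  from has_integral_affinity[OF this, of "-1" l] 
  have "((\<lambda>x. f (- x + l)) has_integral integral {0..l} f) ((\<lambda>x. - x + l) ` {0..l})"
    by simp
  moreover have "(\<lambda>x. - x + l) ` {0..l} = {0..l}"
    by (auto simp: image_iff intro!: bexI[of _ "l - _"])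
  ultimately show ?thesis by (simp add: integral_unique)
qed

lemma Nop_reflect:
  assumes P: "bdm P C" and z: "continuous_on UNIV (\<lambda>(x, t). z x t)" and l: "l \<ge> 0"
    and P': "\<And>y. P' y = P (l - y)" and z': "\<And>y t. z' y t = z (l - y) t"
  shows "Nop P' l z' x t = Nop P l z (l - x) t"
proof -
  have "(\<lambda>y. P y * integral {0..max 0 (t - \<bar>l - x - y\<bar>)} (z y)) integrable_on {0..l}"
    by (intro bdm_mult_integrable(2)[OF P] continuous_cone_primitive[OF z] continuous_intros)
  from has_integral_reflect_interval[OF this l]
  have "integral {0..l} (\<lambda>y. P (l - y) * integral {0..max 0 (t - \<bar>x - y\<bar>)} (z (l - y)))
      = integral {0..l} (\<lambda>y. P y * integral {0..max 0 (t - \<bar>l - x - y\<bar>)} (z y))"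
    by (simp add: algebra_simps abs_minus_commute)
  moreover have "z' y = z (l - y)" for y by (rule ext) (rule z')
  ultimately show ?thesis by (simp add: Nop_def P')
qed

lemma integral_exp_le:
  fixes f :: "real \<Rightarrow> real" and c g s :: real
  assumes "f integrable_on {0..s}" "\<And>t. t \<in> {0..s} \<Longrightarrow> \<bar>f t\<bar> \<le> c * exp (g * t)" "g > 0" "s \<ge> 0" "c \<ge> 0"
  shows "\<bar>integral {0..s} f\<bar> \<le> c * exp (g * s) / g"
proof -
  have "((\<lambda>t. c * exp (g * t)) has_integral (c * exp (g * s) / g - c * exp (g * 0) / g)) {0..s}"
    by (rule fundamental_theorem_of_calculus[where f = "\<lambda>t. c * exp (g * t) / g"]) (use assms in \<open>auto simp flip: has_real_derivative_iff_has_vector_derivative intro!: derivative_eq_intros\<close>)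
  then have "\<bar>integral {0..s} f\<bar> \<le> c * exp (g * s) / g - c * exp (g * 0) / g"
    using abs_integral_le[OF assms(1) _ assms(2)] by (metis has_integral_integrable integral_unique)
  also have "\<dots> \<le> c * exp (g * s) / g" using assms by simp
  finally show ?thesis .
qed

text \<open>Integrating exp (g s) in time gains 1 / g, so in an exponentially weighted norm the
  Duhamel term contracts as soon as g is large against C l.\<close>

lemma Nop_diff_bound:
  assumes P: "bdm P C" and z: "continuous_on UNIV (\<lambda>(x, t). z x t)" "continuous_on UNIV (\<lambda>(x, t). z' x t)"
    and "l \<ge> 0" "g > 0" "c \<ge> 0" "t \<ge> 0"
    and d: "\<And>y s. y \<in> {0..l} \<Longrightarrow> s \<ge> 0 \<Longrightarrow> \<bar>z y s - z' y s\<bar> \<le> c * exp (g * s)"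
  shows "\<bar>Nop P l z x t - Nop P l z' x t\<bar> \<le> c * (C * l / (2 * g)) * exp (g * t)"
proof -
  let ?m = "\<lambda>z y. integral {0..max 0 (t - \<bar>x - y\<bar>)} (z y)"
  have cm: "continuous_on {0..l} (?m z)" "continuous_on {0..l} (?m z')"
    by (intro continuous_cone_primitive z continuous_intros)+
  have "Nop P l z x t - Nop P l z' x t = - (1/2) * integral {0..l} (\<lambda>y. P y * (?m z y - ?m z' y))"
    using bdm_mult_integrable(2)[OF P cm(1)] bdm_mult_integrable(2)[OF P cm(2)]
    by (simp add: Nop_def right_diff_distrib Henstock_Kurzweil_Integration.integral_diff)
  moreover have "\<bar>integral {0..l} (\<lambda>y. P y * (?m z y - ?m z' y))\<bar> \<le> C * (c * exp (g * t) / g) * (l - 0)"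
  proof (rule bdm_integral_bound[OF P])
    show "continuous_on {0..l} (\<lambda>y. ?m z y - ?m z' y)" by (intro continuous_on_diff cm)
    fix y assume y: "y \<in> {0..l}"
    let ?s = "max 0 (t - \<bar>x - y\<bar>)"
    have i: "z y integrable_on {0..?s}" "z' y integrable_on {0..?s}"
      by (intro integrable_continuous_interval continuous_section(1)[OF z(1)] continuous_section(1)[OF z(2)])+
    have "?m z y - ?m z' y = integral {0..?s} (\<lambda>s. z y s - z' y s)"
      using i by (simp add: Henstock_Kurzweil_Integration.integral_diff)
    also have "\<bar>\<dots>\<bar> \<le> c * exp (g * ?s) / g"
      by (rule integral_exp_le) (use assms y i in \<open>auto intro: integrable_diff\<close>)
    also have "\<dots> \<le> c * exp (g * t) / g"
      using assms by (intro divide_right_mono mult_left_mono) auto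
    finally show "\<bar>?m z y - ?m z' y\<bar> \<le> c * exp (g * t) / g" .
  qed (use assms in auto)
  ultimately have "\<bar>Nop P l z x t - Nop P l z' x t\<bar> \<le> 1/2 * (C * (c * exp (g * t) / g) * (l - 0))"
    by (simp only: abs_mult)
  then show ?thesis by (simp add: field_simps)
qed


subsection \<open>The wave equation on a network\<close>

text \<open>Half-edges: each edge occurs once for each of its ends, with the space variable measured
  from that end, and \<open>opp\<close> exchanges the two. Orientation disappears, and every
  outgoing derivative is taken at 0. \<open>u0\<close> is given on the whole line because the
  outgoing waves read it at all negative times.\<close>

locale network =
  fixes H :: "'h set" and opp :: "'h \<Rightarrow> 'h" and nd :: "'h \<Rightarrow> 'v" and l :: "'h \<Rightarrow> real"
    and u0 :: "'h \<Rightarrow> real \<Rightarrow> real" and lmin lmax K0 :: real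
  assumes fin: "finite H"
    and opp: "\<And>d. d \<in> H \<Longrightarrow> opp d \<in> H" "\<And>d. d \<in> H \<Longrightarrow> opp (opp d) = d" "\<And>d. d \<in> H \<Longrightarrow> l (opp d) = l d"
    and lmin: "lmin > 0" and len: "\<And>d. d \<in> H \<Longrightarrow> lmin \<le> l d" "\<And>d. d \<in> H \<Longrightarrow> l d \<le> lmax"
    and u0_cont: "\<And>d. d \<in> H \<Longrightarrow> continuous_on UNIV (u0 d)"
    and u0_bound: "\<And>d x. d \<in> H \<Longrightarrow> \<bar>u0 d x\<bar> \<le> K0"
    and u0_opp: "\<And>d x. d \<in> H \<Longrightarrow> u0 (opp d) x = u0 d (l d - x)"
    and u0_node: "\<And>d e. d \<in> H \<Longrightarrow> e \<in> H \<Longrightarrow> nd d = nd e \<Longrightarrow> u0 d 0 = u0 e 0"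
begin

definition at_node :: "'v \<Rightarrow> 'h set" where
  "at_node v = {e \<in> H. nd e = v}"

lemma at_node: "finite (at_node v)" "d \<in> H \<Longrightarrow> d \<in> at_node (nd d)" "e \<in> at_node v \<Longrightarrow> e \<in> H" "e \<in> at_node v \<Longrightarrow> nd e = v"
  using fin by (auto simp: at_node_def)

text \<open>The node conditions (continuity, and vanishing sum of the outgoing derivatives) turn
the incoming waves \<open>f e\<close> at a node into outgoing ones.\<close>

definition scatter :: "('h \<Rightarrow> real) \<Rightarrow> 'h \<Rightarrow> real" where
  "scatter f d = 2 / real (card (at_node (nd d))) * (\<Sum>e\<in>at_node (nd d). f e) - f d"

lemma card_at_node: "d \<in> H \<Longrightarrow> real (card (at_node (nd d))) > 0"
  using at_node(2)[of d] at_node(1) by (metis card_gt_0_iff empty_iff of_nat_0_less_iff)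

lemma scatter_diff: "scatter f d - scatter g d = scatter (\<lambda>e. f e - g e) d"
  by (simp add: scatter_def sum_subtractf algebra_simps)

text \<open>Twice an average minus one value: the norm is at most 2 + 1. As this exceeds 1,
  smallness has to come from the travel time along the edges.\<close>

lemma scatter_bound:
  assumes d: "d \<in> H" and f: "\<And>e. e \<in> H \<Longrightarrow> \<bar>f e\<bar> \<le> c"
  shows "\<bar>scatter f d\<bar> \<le> 3 * c"
proof -
  let ?n = "real (card (at_node (nd d)))"
  have n: "?n > 0" by (rule card_at_node[OF d])
  have "\<bar>\<Sum>e\<in>at_node (nd d). f e\<bar> \<le> (\<Sum>e\<in>at_node (nd d). \<bar>f e\<bar>)" by (rule sum_abs)
  also have "\<dots> \<le> ?n * c" using sum_bounded_above[of "at_node (nd d)" "\<lambda>e. \<bar>f e\<bar>" c] f at_node(3) by simp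
  finally have "\<bar>2 / ?n * (\<Sum>e\<in>at_node (nd d). f e)\<bar> \<le> 2 / ?n * (?n * c)"
    unfolding abs_mult using n by (intro mult_mono) auto
  also have "\<dots> = 2 * c" using n by simp
  finally show ?thesis using f[OF d] unfolding scatter_def by linarith
qed

lemma scatter_const:
  assumes d: "d \<in> H" and f: "\<And>e. e \<in> H \<Longrightarrow> nd e = nd d \<Longrightarrow> f e = c"
  shows "scatter f d = c"
proof -
  have "(\<Sum>e\<in>at_node (nd d). f e) = real (card (at_node (nd d))) * c"
    using sum.cong[of "at_node (nd d)" "at_node (nd d)" f "\<lambda>_. c"] f at_node(3,4) by simp
  then show ?thesis using card_at_node[OF d] f[OF d] by (simp add: scatter_def)
qed

definition pot :: "('h \<Rightarrow> real \<Rightarrow> real) \<Rightarrow> real \<Rightarrow> bool" where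
  "pot P C \<longleftrightarrow> (\<forall>d\<in>H. bdm (P d) C \<and> (\<forall>x. P (opp d) x = P d (l d - x)))"

text \<open>The wave that reaches the node of \<open>d\<close> from within the edge: what left the
  far end \<open>l d\<close> time units earlier, plus the Duhamel term at x = 0. The value of the
  wave at the node is \<open>W d\<close> plus this.\<close>

definition inc :: "('h \<Rightarrow> real \<Rightarrow> real) \<Rightarrow> ('h \<Rightarrow> real \<Rightarrow> real \<Rightarrow> real) \<Rightarrow> ('h \<Rightarrow> real \<Rightarrow> real) \<Rightarrow> 'h \<Rightarrow> real \<Rightarrow> real" where
  "inc P z W d s = W (opp d) (s - l d) + Nop (P d) (l d) (z d) 0 s"

text \<open>\<open>z d\<close> is the wave on the edge of the half-edge \<open>d\<close>, with the space variable measured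
from the node of \<open>d\<close>, initial displacement \<open>u0\<close> and initial velocity \<open>0\<close>; \<open>W d\<close> is the wave
that leaves the node of \<open>d\<close> into this edge.\<close>

definition wave :: "('h \<Rightarrow> real \<Rightarrow> real) \<Rightarrow> ('h \<Rightarrow> real \<Rightarrow> real \<Rightarrow> real) \<Rightarrow> ('h \<Rightarrow> real \<Rightarrow> real) \<Rightarrow> real \<Rightarrow> real \<Rightarrow> bool" where
  "wave P z W g K \<longleftrightarrow> (\<forall>d\<in>H.
     continuous_on UNIV (\<lambda>(x, t). z d x t) \<and> continuous_on UNIV (W d) \<and>
     (\<forall>s\<le>0. W d s = u0 d (- s) / 2) \<and> (\<forall>x t. z (opp d) x t = z d (l d - x) t) \<and>
     (\<forall>x\<in>{0..l d}. \<forall>t\<ge>0. z d x t = W d (t - x) + W (opp d) (t - l d + x) + Nop (P d) (l d) (z d) x t) \<and>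
     (\<forall>s\<ge>0. W d s = scatter (\<lambda>e. inc P z W e s) d) \<and>
     (\<forall>x. \<forall>t\<ge>0. \<bar>z d x t\<bar> \<le> K * exp (g * t)) \<and> (\<forall>s. \<bar>W d s\<bar> \<le> K * exp (g * max 0 s)))"

text \<open>Projection onto an edge, by which the fixed point map below yields functions that are
  continuous for all real x.\<close>

definition clp :: "real \<Rightarrow> real \<Rightarrow> real" where "clp a x = max 0 (min a x)"

lemma clp: "a \<ge> 0 \<Longrightarrow> clp a x \<in> {0..a}" "x \<in> {0..a} \<Longrightarrow> clp a x = x" "a \<ge> 0 \<Longrightarrow> clp a (a - x) = a - clp a x"
  "continuous_on S f \<Longrightarrow> continuous_on S (\<lambda>x. clp a (f x))"
  by (auto simp: clp_def intro!: continuous_intros)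

text \<open>d'Alembert's formula on the edges and the scattering at the nodes form one fixed point
  problem for all \<open>z d\<close> and \<open>W d\<close>. Scattering is not small, but it acts on
  waves delayed by at least \<open>lmin\<close>, and an exponential weight in time turns the delay
  into a small factor.\<close>

lemma wave_exists:
  assumes P: "pot P C"
  obtains z W g K where "g \<ge> 1" "K \<ge> 0" "wave P z W g K"
proof -
  have bP: "bdm (P d) C" if "d \<in> H" for d using P that by (auto simp: pot_def)
  \<comment> \<open>The first summand makes the Duhamel factor C l / (2 g) at most 1/200, the second
    makes the delay factor exp (- g l) at most 1/12.\<close>
  define g where "g = 100 * (\<bar>C\<bar> * \<bar>lmax\<bar> + 1) + 12 / lmin"
  have g0: "g > 0" using lmin by (simp add: g_def add_nonneg_pos add_pos_pos)
  have g1: "\<bar>C * l d / (2 * g)\<bar> \<le> 1 / 200" "exp (- g * l d) \<le> 1 / 12" if d: "d \<in> H" for d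
  proof -
    have "\<bar>C * l d\<bar> \<le> \<bar>C\<bar> * \<bar>lmax\<bar>" unfolding abs_mult using len[OF d] lmin by (intro mult_left_mono) auto
    also have "\<dots> \<le> g / 100" using lmin by (simp add: g_def)
    finally show "\<bar>C * l d / (2 * g)\<bar> \<le> 1 / 200" using g0 by (simp add: abs_divide abs_mult field_simps)
    have "12 / lmin * lmin \<le> g * l d"
      using len(1)[OF d] lmin g0 by (intro mult_mono) (auto simp: g_def)
    then have "12 \<le> g * l d" using lmin by simp
    then have "12 \<le> exp (g * l d)" using exp_ge_add_one_self[of "g * l d"] by linarith
    then show "exp (- g * l d) \<le> 1 / 12" by (simp add: exp_minus field_simps)
  qed
  define I :: "(('h \<times> real \<times> real) + ('h \<times> real)) set" where
    "I = Inl ` (H \<times> UNIV) \<union> Inr ` (H \<times> UNIV)"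
  \<comment> \<open>The weight 1/8 on the outgoing waves balances the two families: \<open>z\<close>
    contains two of them, and 1/8 + 1/8 + 1/200 < 1/2, while scattering gives 3 (1/96 + 1/200) <
    1/16.\<close>
  define w :: "(('h \<times> real \<times> real) + ('h \<times> real)) \<Rightarrow> real" where
    "w i = (case i of Inl (d, x, t) \<Rightarrow> exp (g * max 0 t) | Inr (d, s) \<Rightarrow> exp (g * s) / 8)" for i
  define zX where "zX X d x t = (X (Inl (d, x, t)) :: real)"
    for X :: "(('h \<times> real \<times> real) + ('h \<times> real)) \<Rightarrow> real" and d x t
  define WX where "WX X d s = (X (Inr (d, s)) :: real)"
    for X :: "(('h \<times> real \<times> real) + ('h \<times> real)) \<Rightarrow> real" and d s
  define A where "A = {X. \<forall>d\<in>H. continuous_on UNIV (\<lambda>(x, t). zX X d x t) \<and> continuous_on UNIV (WX X d) \<and>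
     (\<forall>s\<le>0. WX X d s = u0 d (- s) / 2) \<and> (\<forall>x t. zX X (opp d) x t = zX X d (l d - x) t)}"
  define \<Phi> where "\<Phi> X i = (case i of
      Inl (d, x, t) \<Rightarrow> WX X d (max 0 t - clp (l d) x) + WX X (opp d) (max 0 t - l d + clp (l d) x)
          + Nop (P d) (l d) (zX X d) (clp (l d) x) (max 0 t)
    | Inr (d, s) \<Rightarrow> if s \<le> 0 then u0 d (- s) / 2 else scatter (\<lambda>e. inc P (zX X) (WX X) e s) d)" for X i
  have z\<Phi>: "zX (\<Phi> X) d x t = WX X d (max 0 t - clp (l d) x) + WX X (opp d) (max 0 t - l d + clp (l d) x)
          + Nop (P d) (l d) (zX X d) (clp (l d) x) (max 0 t)" for X d x t
    by (simp add: zX_def[of "\<Phi> X"] \<Phi>_def)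
  have W\<Phi>: "WX (\<Phi> X) d s = (if s \<le> 0 then u0 d (- s) / 2 else scatter (\<lambda>e. inc P (zX X) (WX X) e s) d)" for X d s
    by (simp add: WX_def[of "\<Phi> X"] \<Phi>_def)
  have AD: "continuous_on UNIV (\<lambda>(x, t). zX X d x t)" "continuous_on UNIV (WX X d)"
     "\<And>s. s \<le> 0 \<Longrightarrow> WX X d s = u0 d (- s) / 2" "\<And>x t. zX X (opp d) x t = zX X d (l d - x) t"
    if "X \<in> A" "d \<in> H" for X d using that by (auto simp: A_def)
  have ld: "l d \<ge> 0" if "d \<in> H" for d using len(1)[OF that] lmin by simp
  have inc0: "inc P (zX X) (WX X) e 0 = u0 e 0 / 2" if "X \<in> A" "e \<in> H" for X e
    using AD(3)[OF that(1) opp(1)[OF that(2)], of "- l e"] ld[OF that(2)] u0_opp[OF that(2)]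
    by (simp add: inc_def Nop_0)
  have cinc: "continuous_on UNIV (inc P (zX X) (WX X) e)" if "X \<in> A" "e \<in> H" for X e
    unfolding inc_def[abs_def] using that
    by (intro continuous_intros continuous_on_compose2[OF AD(2)[OF that(1) opp(1)[OF that(2)]]]
        continuous_on_compose_pair[OF continuous_Nop[OF bP AD(1)]]) auto
  have maps: "\<Phi> X \<in> A" if X: "X \<in> A" for X
    unfolding A_def
  proof (intro CollectI ballI conjI allI impI)
    fix d assume d: "d \<in> H"
    show "continuous_on UNIV (\<lambda>(x, t). zX (\<Phi> X) d x t)"
      unfolding z\<Phi> case_prod_unfold
      by (intro continuous_intros clp(4) continuous_on_compose2[OF AD(2)[OF X d]] continuous_on_compose2[OF AD(2)[OF X opp(1)[OF d]]]
          continuous_on_compose_pair[OF continuous_Nop[OF bP[OF d] AD(1)[OF X d]]]) auto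
    define S where "S s = scatter (\<lambda>e. inc P (zX X) (WX X) e s) d" for s
    \<comment> \<open>Continuity of \<open>u0\<close> across the node makes the outgoing wave
      continuous at time 0, because equal incoming values are scattered to themselves.\<close>
    have S0: "S 0 = u0 d 0 / 2"
      unfolding S_def by (rule scatter_const[OF d]) (use inc0[OF X] u0_node d in metis)
    have cS: "continuous_on UNIV S"
      unfolding S_def scatter_def
      by (intro continuous_intros cinc[OF X] d) (simp add: at_node(3))
    have c0: "continuous_on UNIV (\<lambda>s. u0 d (- s) / 2)"
      by (intro continuous_intros continuous_on_compose2[OF u0_cont[OF d]]) auto
    have "continuous_on UNIV (\<lambda>s. if s \<le> 0 then u0 d (- s) / 2 else S s)"
      by (rule continuous_on_cases_le[where h = "\<lambda>s. s"])
        (use S0 in \<open>auto intro: continuous_on_subset[OF cS] continuous_on_subset[OF c0] continuous_on_id\<close>)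
    then show "continuous_on UNIV (WX (\<Phi> X) d)"
      unfolding W\<Phi>[abs_def] S_def .
    show "WX (\<Phi> X) d s = u0 d (- s) / 2" if "s \<le> 0" for s using that by (simp add: W\<Phi>)
    show "zX (\<Phi> X) (opp d) x t = zX (\<Phi> X) d (l d - x) t" for x t
    proof -
      have "Nop (P (opp d)) (l d) (zX X (opp d)) (clp (l d) x) (max 0 t)
         = Nop (P d) (l d) (zX X d) (l d - clp (l d) x) (max 0 t)"
        by (rule Nop_reflect[OF bP[OF d] AD(1)[OF X d] ld[OF d]])
          (use P d AD(4)[OF X d] in \<open>auto simp: pot_def\<close>)
      then show ?thesis using opp[OF d] by (simp add: z\<Phi> clp(3)[OF ld[OF d]] algebra_simps)
    qed
  qed
  have contr: "\<bar>\<Phi> X i - \<Phi> Y i\<bar> \<le> c / 2 * w i"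
    if X: "X \<in> A" and Y: "Y \<in> A" and c: "c \<ge> 0" and XY: "\<And>i. i \<in> I \<Longrightarrow> \<bar>X i - Y i\<bar> \<le> c * w i" and i: "i \<in> I" for X Y c i
  proof -
    have dz: "\<bar>zX X d x t - zX Y d x t\<bar> \<le> c * exp (g * max 0 t)" if "d \<in> H" for d x t
      using XY[of "Inl (d, x, t)"] that by (simp add: I_def w_def zX_def)
    have dW: "\<bar>WX X d s - WX Y d s\<bar> \<le> c / 8 * exp (g * s)" if "d \<in> H" for d s
      using XY[of "Inr (d, s)"] that by (simp add: I_def w_def WX_def)
    have dN: "\<bar>Nop (P d) (l d) (zX X d) x t - Nop (P d) (l d) (zX Y d) x t\<bar> \<le> c / 200 * exp (g * t)"
      if d: "d \<in> H" and t: "t \<ge> 0" for d x t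
    proof -
      have "\<bar>Nop (P d) (l d) (zX X d) x t - Nop (P d) (l d) (zX Y d) x t\<bar> \<le> c * (C * l d / (2 * g)) * exp (g * t)"
        by (rule Nop_diff_bound[OF bP[OF d] AD(1)[OF X d] AD(1)[OF Y d] ld[OF d] g0 c t])
          (use dz[OF d] in \<open>metis max.absorb2\<close>)
      also have "\<dots> \<le> c * (1 / 200) * exp (g * t)"
        by (intro mult_right_mono mult_left_mono abs_le_D1[OF g1(1)[OF d]] c) simp
      finally show ?thesis by simp
    qed
    consider d x t where "i = Inl (d, x, t)" "d \<in> H" | d s where "i = Inr (d, s)" "d \<in> H"
      using i by (auto simp: I_def)
    then show ?thesis
    proof cases
      case 1
      define x' where "x' = clp (l d) x"
      define t' where "t' = max 0 t"
      have x': "x' \<in> {0..l d}" and t': "t' \<ge> 0" using clp(1)[OF ld[OF 1(2)]] by (auto simp: x'_def t'_def)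
      define E where "E = c * exp (g * t')"
      have E: "E \<ge> 0" "c * exp (g * s) \<le> E" if "s \<le> t'" for s
        using c g0 that by (auto simp: E_def intro!: mult_left_mono)
      have "\<bar>WX X d (t' - x') - WX Y d (t' - x')\<bar> \<le> E / 8"
        using dW[OF 1(2), of "t' - x'"] E(2)[of "t' - x'"] x' by simp
      moreover have "\<bar>WX X (opp d) (t' - l d + x') - WX Y (opp d) (t' - l d + x')\<bar> \<le> E / 8"
        using dW[OF opp(1)[OF 1(2)], of "t' - l d + x'"] E(2)[of "t' - l d + x'"] x' by simp
      moreover have "\<Phi> X i - \<Phi> Y i = (WX X d (t' - x') - WX Y d (t' - x')) + (WX X (opp d) (t' - l d + x') - WX Y (opp d) (t' - l d + x'))
        + (Nop (P d) (l d) (zX X d) x' t' - Nop (P d) (l d) (zX Y d) x' t')"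
        by (simp add: 1 \<Phi>_def x'_def t'_def)
      moreover have "\<bar>Nop (P d) (l d) (zX X d) x' t' - Nop (P d) (l d) (zX Y d) x' t'\<bar> \<le> E / 200"
        using dN[OF 1(2) t', of x'] by (simp add: E_def)
      moreover have "c / 2 * w i = E / 2" by (simp add: 1 w_def t'_def E_def)
      ultimately show ?thesis using E(1)[of t'] by linarith
    next
      case 2
      show ?thesis
      proof (cases "s \<le> 0")
        case True then show ?thesis using c by (simp add: 2 \<Phi>_def w_def)
      next
        case False
        define E where "E = c * exp (g * s)"
        have E: "E \<ge> 0" using c by (simp add: E_def)
        have "\<bar>scatter (\<lambda>e. inc P (zX X) (WX X) e s - inc P (zX Y) (WX Y) e s) d\<bar> \<le> 3 * (E / 64)"
        proof (rule scatter_bound[OF 2(2)])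
          fix e assume e: "e \<in> H"
          have "\<bar>WX X (opp e) (s - l e) - WX Y (opp e) (s - l e)\<bar> \<le> c / 8 * exp (g * (s - l e))"
            by (rule dW[OF opp(1)[OF e]])
          also have "exp (g * (s - l e)) = exp (g * s) * exp (- g * l e)"
            by (simp add: exp_add[symmetric] algebra_simps)
          also have "c / 8 * (exp (g * s) * exp (- g * l e)) \<le> c / 8 * (exp (g * s) * (1 / 12))"
            using g1(2)[OF e] c by (intro mult_left_mono) auto
          finally have 1: "\<bar>WX X (opp e) (s - l e) - WX Y (opp e) (s - l e)\<bar> \<le> E / 96" by (simp add: E_def)
          have 2: "\<bar>Nop (P e) (l e) (zX X e) 0 s - Nop (P e) (l e) (zX Y e) 0 s\<bar> \<le> E / 200"
            using dN[OF e, of s 0] False by (simp add: E_def)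
          have "inc P (zX X) (WX X) e s - inc P (zX Y) (WX Y) e s = (WX X (opp e) (s - l e) - WX Y (opp e) (s - l e))
             + (Nop (P e) (l e) (zX X e) 0 s - Nop (P e) (l e) (zX Y e) 0 s)" by (simp add: inc_def)
          then show "\<bar>inc P (zX X) (WX X) e s - inc P (zX Y) (WX Y) e s\<bar> \<le> E / 64"
            using 1 2 E by linarith
        qed
        moreover have "\<Phi> X i - \<Phi> Y i = scatter (\<lambda>e. inc P (zX X) (WX X) e s - inc P (zX Y) (WX Y) e s) d"
          using False by (simp add: 2 \<Phi>_def scatter_diff)
        moreover have "c / 2 * w i = E / 16" by (simp add: 2 w_def E_def)
        ultimately show ?thesis using E by linarith
      qed
    qed
  qed
  have wpos: "w i > 0" for i by (auto simp: w_def split: sum.splits)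
  have closed: "f \<in> A"
    if F: "\<And>n. F n \<in> A" and Ff: "\<And>n i. i \<in> I \<Longrightarrow> \<bar>F n i - f i\<bar> \<le> K * (1/2)^n * w i" for F f K
  proof -
    have small: "(\<lambda>n. K * (1/2)^n) \<longlonglongrightarrow> 0"
      using tendsto_mult[OF tendsto_const LIMSEQ_power_zero, of "1/2::real" K] by simp
    have lim: "(\<lambda>n. F n i) \<longlonglongrightarrow> f i" if i: "i \<in> I" for i
    proof (rule Lim_transform_bound[THEN LIM_zero_cancel])
      show "(\<lambda>n. K * (1/2)^n * w i) \<longlonglongrightarrow> 0" using tendsto_mult[OF small tendsto_const] by simp
      show "\<forall>\<^sub>F n in sequentially. norm (F n i - f i) \<le> norm (K * (1/2)^n * w i)"
        using Ff[OF i] order_trans[OF _ abs_ge_self] by (auto intro!: always_eventually)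
    qed
    have unif: "continuous_on UNIV (\<lambda>a. f (j a))"
      if j: "\<And>a. j a \<in> I" and cw: "continuous_on UNIV (\<lambda>a. w (j a))" and cF: "\<And>n. continuous_on UNIV (\<lambda>a. F n (j a))"
      for j :: "'b::topological_space \<Rightarrow> _"
    proof -
      \<comment> \<open>The weight grows with time, so the convergence is uniform only after
        division by it; multiplying back preserves continuity.\<close>
      have "uniform_limit UNIV (\<lambda>n a. F n (j a) / w (j a)) (\<lambda>a. f (j a) / w (j a)) sequentially"
      proof (rule uniform_limitI)
        fix e :: real assume e: "e > 0"
        have "\<forall>\<^sub>F n in sequentially. K * (1/2)^n < e" using order_tendstoD(2)[OF small e] .
        then show "\<forall>\<^sub>F n in sequentially. \<forall>a\<in>UNIV. dist (F n (j a) / w (j a)) (f (j a) / w (j a)) < e"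
        proof eventually_elim
          case (elim n)
          show ?case
          proof
            fix a
            have "dist (F n (j a) / w (j a)) (f (j a) / w (j a)) = \<bar>F n (j a) - f (j a)\<bar> / w (j a)"
              using wpos[of "j a"] by (simp add: dist_real_def diff_divide_distrib[symmetric])
            also have "\<dots> \<le> K * (1/2)^n" using Ff[OF j, of n a] wpos[of "j a"] by (simp add: pos_divide_le_eq)
            finally show "dist (F n (j a) / w (j a)) (f (j a) / w (j a)) < e" using elim by simp
          qed
        qed
      qed
      then have "continuous_on UNIV (\<lambda>a. f (j a) / w (j a))"
        by (rule uniform_limit_theorem[rotated])
          (auto intro!: always_eventually continuous_intros cF cw simp: wpos less_imp_neq[OF wpos, symmetric])
      then have "continuous_on UNIV (\<lambda>a. f (j a) / w (j a) * w (j a))" by (intro continuous_on_mult cw)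
      moreover have "f (j a) / w (j a) * w (j a) = f (j a)" for a using wpos[of "j a"] by simp
      ultimately show ?thesis by simp
    qed
    show ?thesis
      unfolding A_def
    proof (intro CollectI ballI conjI allI impI)
      fix d assume d: "d \<in> H"
      have "continuous_on UNIV (\<lambda>a. f (Inl (d, a)))"
      proof (rule unif)
        show "Inl (d, a) \<in> I" for a using d by (simp add: I_def)
        show "continuous_on UNIV (\<lambda>a. w (Inl (d, a)))"
          unfolding w_def case_prod_unfold by (auto intro!: continuous_intros)
        show "continuous_on UNIV (\<lambda>a. F n (Inl (d, a)))" for n
          using AD(1)[OF F d] by (simp add: zX_def case_prod_unfold)
      qed
      then show "continuous_on UNIV (\<lambda>(x, t). zX f d x t)" by (simp add: zX_def case_prod_unfold)
      have "continuous_on UNIV (\<lambda>s. f (Inr (d, s)))"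
      proof (rule unif)
        show "Inr (d, a) \<in> I" for a using d by (simp add: I_def)
        show "continuous_on UNIV (\<lambda>a. w (Inr (d, a)))"
          unfolding w_def by (auto intro!: continuous_intros)
        show "continuous_on UNIV (\<lambda>a. F n (Inr (d, a)))" for n
          using AD(2)[OF F d] by (simp add: WX_def[abs_def])
      qed
      then show "continuous_on UNIV (WX f d)" by (simp add: WX_def[abs_def])
      show "WX f d s = u0 d (- s) / 2" if "s \<le> 0" for s
      proof -
        have eq: "F n (Inr (d, s)) = u0 d (- s) / 2" for n using AD(3)[OF F d that] by (simp add: WX_def)
        have "(\<lambda>n. F n (Inr (d, s))) \<longlonglongrightarrow> f (Inr (d, s))"
          using lim[of "Inr (d, s)"] d by (simp add: I_def)
        then have "u0 d (- s) / 2 = f (Inr (d, s))" unfolding eq by (simp only: LIMSEQ_const_iff)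
        then show ?thesis by (simp add: WX_def)
      qed
      show "zX f (opp d) x t = zX f d (l d - x) t" for x t
      proof -
        have "F n (Inl (opp d, x, t)) = F n (Inl (d, l d - x, t))" for n using AD(4)[OF F d] by (simp add: zX_def)
        then have "(\<lambda>n. F n (Inl (d, l d - x, t))) \<longlonglongrightarrow> f (Inl (opp d, x, t))"
          using lim[of "Inl (opp d, x, t)"] opp(1)[OF d] by (simp add: I_def)
        moreover have "(\<lambda>n. F n (Inl (d, l d - x, t))) \<longlonglongrightarrow> f (Inl (d, l d - x, t))"
          using lim[of "Inl (d, l d - x, t)"] d by (simp add: I_def)
        ultimately show ?thesis unfolding zX_def by (rule LIMSEQ_unique)
      qed
    qed
  qed
  \<comment> \<open>The starting point must have the prescribed past; afterwards each outgoing wave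
    is frozen at its value at time 0.\<close>
  define X0 :: "(('h \<times> real \<times> real) + ('h \<times> real)) \<Rightarrow> real" where
    "X0 i = (case i of Inl _ \<Rightarrow> 0 | Inr (d, s) \<Rightarrow> u0 d (max 0 (- s)) / 2)" for i
  have zX0: "zX X0 d x t = 0" and WX0: "WX X0 d s = u0 d (max 0 (- s)) / 2" for d x t s
    by (simp_all add: zX_def WX_def X0_def)
  have X0A: "X0 \<in> A"
    unfolding A_def
  proof (intro CollectI ballI conjI allI impI)
    fix d assume d: "d \<in> H"
    show "continuous_on UNIV (\<lambda>(x, t). zX X0 d x t)" unfolding zX0 case_prod_unfold by (rule continuous_on_const)
    show "continuous_on UNIV (WX X0 d)" unfolding WX0[abs_def]
      by (intro continuous_intros continuous_on_compose2[OF u0_cont[OF d]]) auto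
    show "WX X0 d s = u0 d (- s) / 2" if "s \<le> 0" for s using that by (simp add: WX0)
    show "zX X0 (opp d) x t = zX X0 d (l d - x) t" for x t by (simp add: zX0)
  qed
  have bd0: "\<bar>\<Phi> X0 i - X0 i\<bar> \<le> (16 * \<bar>K0\<bar>) * w i" if i: "i \<in> I" for i
  proof -
    have "zX X0 d = (\<lambda>_ _. 0)" for d by (intro ext) (simp add: zX0)
    then have N0: "Nop (P d) (l d) (zX X0 d) x t = 0" for d x t by (simp add: Nop_def)
    have bW: "\<bar>WX X0 d s\<bar> \<le> \<bar>K0\<bar> / 2" if "d \<in> H" for d s
      using u0_bound[OF that, of "max 0 (- s)"] by (simp add: WX0)
    consider d x t where "i = Inl (d, x, t)" "d \<in> H" | d s where "i = Inr (d, s)" "d \<in> H"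
      using i by (auto simp: I_def)
    then show ?thesis
    proof cases
      case 1
      have "1 \<le> w i" using g0 by (simp add: 1 w_def)
      then have "16 * \<bar>K0\<bar> * 1 \<le> 16 * \<bar>K0\<bar> * w i" by (intro mult_left_mono) auto
      moreover have "\<Phi> X0 i - X0 i = WX X0 d (max 0 t - clp (l d) x) + WX X0 (opp d) (max 0 t - l d + clp (l d) x)"
        by (simp add: 1 \<Phi>_def N0 X0_def[of "Inl _"])
      ultimately show ?thesis
        using bW[OF 1(2), of "max 0 t - clp (l d) x"] bW[OF opp(1)[OF 1(2)], of "max 0 t - l d + clp (l d) x"] by linarith
    next
      case 2
      show ?thesis
      proof (cases "s \<le> 0")
        case True then show ?thesis by (simp add: 2 \<Phi>_def X0_def w_def)
      next
        case False
        have "1 \<le> 8 * w i" using g0 False by (simp add: 2 w_def)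
        then have "2 * \<bar>K0\<bar> * 1 \<le> 2 * \<bar>K0\<bar> * (8 * w i)" by (intro mult_left_mono) auto
        moreover have "\<bar>scatter (\<lambda>e. inc P (zX X0) (WX X0) e s) d\<bar> \<le> 3 * (\<bar>K0\<bar> / 2)"
          by (rule scatter_bound[OF 2(2)]) (use bW opp(1) in \<open>auto simp: inc_def N0\<close>)
        moreover have "\<Phi> X0 i - X0 i = scatter (\<lambda>e. inc P (zX X0) (WX X0) e s) d - WX X0 d s"
          using False by (simp add: 2 \<Phi>_def WX_def[of X0 d s])
        ultimately show ?thesis using bW[OF 2(2), of s] by linarith
      qed
    qed
  qed
  have "\<exists>X. X \<in> A \<and> (\<forall>i\<in>I. \<Phi> X i = X i) \<and> (\<forall>i\<in>I. \<bar>X i - X0 i\<bar> \<le> 2 * (16 * \<bar>K0\<bar>) * w i)"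
  proof (rule weighted_fixpoint[of A \<Phi> I w X0 "16 * \<bar>K0\<bar>"])
    show "\<Phi> f \<in> A" if "f \<in> A" for f using that by (rule maps)
    show "\<bar>\<Phi> f i - \<Phi> h i\<bar> \<le> c / 2 * w i"
      if "f \<in> A" "h \<in> A" "c \<ge> 0" "\<And>i. i \<in> I \<Longrightarrow> \<bar>f i - h i\<bar> \<le> c * w i" "i \<in> I" for f h c i
      using that by (rule contr)
    show "f \<in> A" if "\<And>n. F n \<in> A" "\<And>n i. i \<in> I \<Longrightarrow> \<bar>F n i - f i\<bar> \<le> K * (1/2)^n * w i" for F f K
      using that by (rule closed)
    show "X0 \<in> A" by (rule X0A)
    show "\<bar>\<Phi> X0 i - X0 i\<bar> \<le> 16 * \<bar>K0\<bar> * w i" if "i \<in> I" for i using that by (rule bd0)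
    show "0 \<le> 16 * \<bar>K0\<bar>" by simp
    show "0 < w i" for i by (rule wpos)
  qed blast
  then obtain X where X: "X \<in> A" "\<And>i. i \<in> I \<Longrightarrow> \<Phi> X i = X i" "\<And>i. i \<in> I \<Longrightarrow> \<bar>X i - X0 i\<bar> \<le> 2 * (16 * \<bar>K0\<bar>) * w i"
    by blast
  \<comment> \<open>The distance to the start is at most 32 |K0| times the weight. This bounds
    \<open>z\<close>; for \<open>W\<close>, whose weight contains 1/8, the size of the start is
    added. The constant 40 |K0| covers both.\<close>
  have "wave P (zX X) (WX X) g (40 * \<bar>K0\<bar>)"
    unfolding wave_def
  proof (intro ballI conjI allI impI)
    fix d assume d: "d \<in> H"
    show "continuous_on UNIV (\<lambda>(x, t). zX X d x t)" "continuous_on UNIV (WX X d)" by (rule AD[OF X(1) d])+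
    show "WX X d s = u0 d (- s) / 2" if "s \<le> 0" for s by (rule AD(3)[OF X(1) d that])
    show "zX X (opp d) x t = zX X d (l d - x) t" for x t by (rule AD(4)[OF X(1) d])
    show "zX X d x t = WX X d (t - x) + WX X (opp d) (t - l d + x) + Nop (P d) (l d) (zX X d) x t"
      if "x \<in> {0..l d}" "t \<ge> 0" for x t
    proof -
      have "zX X d x t = zX (\<Phi> X) d x t" using X(2)[of "Inl (d, x, t)"] d by (simp add: zX_def I_def)
      then show ?thesis using that clp(2)[OF that(1)] by (simp add: z\<Phi>)
    qed
    show "WX X d s = scatter (\<lambda>e. inc P (zX X) (WX X) e s) d" if "s \<ge> 0" for s
    proof (cases "s = 0")
      case True
      have "scatter (\<lambda>e. inc P (zX X) (WX X) e 0) d = u0 d 0 / 2"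
        by (rule scatter_const[OF d]) (use inc0[OF X(1)] u0_node d in metis)
      then show ?thesis using AD(3)[OF X(1) d, of 0] True by simp
    next
      case False
      have "WX X d s = WX (\<Phi> X) d s" using X(2)[of "Inr (d, s)"] d by (simp add: WX_def I_def)
      then show ?thesis using that False by (simp add: W\<Phi>)
    qed
    show "\<bar>zX X d x t\<bar> \<le> 40 * \<bar>K0\<bar> * exp (g * t)" if "t \<ge> 0" for x t
    proof -
      have "\<bar>zX X d x t\<bar> \<le> 32 * \<bar>K0\<bar> * exp (g * t)"
        using X(3)[of "Inl (d, x, t)"] d that by (simp add: zX_def X0_def I_def w_def)
      also have "\<dots> \<le> 40 * \<bar>K0\<bar> * exp (g * t)" by (intro mult_right_mono) auto
      finally show ?thesis .
    qed
    show "\<bar>WX X d s\<bar> \<le> 40 * \<bar>K0\<bar> * exp (g * max 0 s)" for s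
    proof -
      have "\<bar>WX X d s - WX X0 d s\<bar> \<le> 4 * \<bar>K0\<bar> * exp (g * s)"
        using X(3)[of "Inr (d, s)"] d by (simp add: WX_def I_def w_def)
      also have "\<dots> \<le> 4 * \<bar>K0\<bar> * exp (g * max 0 s)"
        using g0 by (intro mult_left_mono) auto
      finally have 1: "\<bar>WX X d s - WX X0 d s\<bar> \<le> 4 * \<bar>K0\<bar> * exp (g * max 0 s)" .
      have "\<bar>WX X0 d s\<bar> \<le> \<bar>K0\<bar> * 1" using u0_bound[OF d, of "max 0 (- s)"] by (simp add: WX0)
      also have "\<dots> \<le> \<bar>K0\<bar> * exp (g * max 0 s)" using g0 by (intro mult_left_mono) auto
      finally have "\<bar>WX X0 d s\<bar> \<le> \<bar>K0\<bar> * exp (g * max 0 s)" .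
      with 1 show ?thesis using mult_nonneg_nonneg[of "\<bar>K0\<bar>" "exp (g * max 0 s)"] by simp
    qed
  qed
  moreover have "g \<ge> 1" using lmin by (simp add: g_def add_increasing2)
  ultimately show ?thesis using that[of g "40 * \<bar>K0\<bar>"] by auto
qed

end


subsection \<open>Lipschitz bounds\<close>

lemma time_primitive_lipschitz:
  fixes z :: "real \<Rightarrow> real \<Rightarrow> real"
  assumes z: "continuous_on UNIV (\<lambda>(x, t). z x t)"
    and B: "\<And>t. t \<in> {0..\<Theta>} \<Longrightarrow> \<bar>z y t\<bar> \<le> B"
    and D: "\<And>t. t \<in> {0..\<Theta>} \<Longrightarrow> \<bar>z y t - z y' t\<bar> \<le> D"
    and s: "s \<in> {0..\<Theta>}" "s' \<in> {0..\<Theta>}"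
  shows "\<bar>integral {0..s} (z y) - integral {0..s'} (z y')\<bar> \<le> D * \<Theta> + B * \<bar>s - s'\<bar>"
proof -
  have i: "z y integrable_on {a..b}" for y a b
    by (intro integrable_continuous_interval continuous_section(1)[OF z])
  have D0: "D \<ge> 0" using D[of s] s by auto
  have 1: "\<bar>integral {0..s} (z y) - integral {0..s'} (z y)\<bar> \<le> B * \<bar>s - s'\<bar>"
  proof (cases "s \<le> s'")
    case True
    have "\<bar>integral {s..s'} (z y)\<bar> \<le> B * (s' - s)"
      by (rule abs_integral_le_const) (use True s B i in auto)
    then show ?thesis using integral_diff_interval[OF i, of 0 s s' s' y] True s by auto
  next
    case False
    have "\<bar>integral {s'..s} (z y)\<bar> \<le> B * (s - s')"
      by (rule abs_integral_le_const) (use False s B i in auto)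
    then show ?thesis using integral_diff_interval[OF i, of 0 s' s s y] False s by auto
  qed
  have "integral {0..s'} (z y) - integral {0..s'} (z y') = integral {0..s'} (\<lambda>t. z y t - z y' t)"
    using i by (simp add: Henstock_Kurzweil_Integration.integral_diff)
  also have "\<bar>\<dots>\<bar> \<le> D * (s' - 0)"
    by (rule abs_integral_le_const) (use s D i in \<open>auto intro: integrable_diff\<close>)
  also have "\<dots> \<le> D * \<Theta>" using D0 s by (intro mult_left_mono) auto
  finally show ?thesis using 1 by linarith
qed

text \<open>Only the lengths of the time intervals depend on (x, t), so a bound for \<open>z\<close>
  alone gives the Lipschitz constant.\<close>

lemma Nop_lipschitz:
  assumes P: "bdm P C" and z: "continuous_on UNIV (\<lambda>(x, t). z x t)" and l: "l \<ge> 0"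
    and B: "\<And>y s. y \<in> {0..l} \<Longrightarrow> s \<in> {0..\<Theta>} \<Longrightarrow> \<bar>z y s\<bar> \<le> B"
    and t: "t \<le> \<Theta>" "t' \<le> \<Theta>" and \<Theta>: "\<Theta> \<ge> 0"
  shows "\<bar>Nop P l z x t - Nop P l z x' t'\<bar> \<le> C * B * l * (\<bar>x - x'\<bar> + \<bar>t - t'\<bar>)"
proof -
  let ?m = "\<lambda>x t y. integral {0..max 0 (t - \<bar>x - y\<bar>)} (z y)"
  have cm: "continuous_on {0..l} (?m x t)" for x t
    by (intro continuous_cone_primitive z continuous_intros)
  have B0: "B \<ge> 0" using B[of 0 0] l \<Theta> by auto
  let ?d = "\<bar>x - x'\<bar> + \<bar>t - t'\<bar>"
  have "Nop P l z x t - Nop P l z x' t' = - (1/2) * integral {0..l} (\<lambda>y. P y * (?m x t y - ?m x' t' y))"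
    using bdm_mult_integrable(2)[OF P cm] by (simp add: Nop_def right_diff_distrib Henstock_Kurzweil_Integration.integral_diff)
  moreover have "\<bar>integral {0..l} (\<lambda>y. P y * (?m x t y - ?m x' t' y))\<bar> \<le> C * (B * ?d) * (l - 0)"
  proof (rule bdm_integral_bound[OF P])
    show "continuous_on {0..l} (\<lambda>y. ?m x t y - ?m x' t' y)" by (intro continuous_on_diff cm)
    fix y assume y: "y \<in> {0..l}"
    have "\<bar>?m x t y - ?m x' t' y\<bar> \<le> 0 * \<Theta> + B * \<bar>max 0 (t - \<bar>x - y\<bar>) - max 0 (t' - \<bar>x' - y\<bar>)\<bar>"
      by (rule time_primitive_lipschitz[OF z]) (use B y t \<Theta> in auto)
    also have "\<dots> \<le> B * ?d"
    proof -
      have "\<bar>max 0 a - max 0 b\<bar> \<le> \<bar>a - b\<bar>" for a b :: real by (auto simp: max_def)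
      also have "\<bar>(t - \<bar>x - y\<bar>) - (t' - \<bar>x' - y\<bar>)\<bar> \<le> ?d" by linarith
      finally show ?thesis using B0 by (simp add: mult_left_mono)
    qed
    finally show "\<bar>?m x t y - ?m x' t' y\<bar> \<le> B * ?d" .
  qed (use l in auto)
  ultimately have "\<bar>Nop P l z x t - Nop P l z x' t'\<bar> \<le> 1/2 * (C * (B * ?d) * (l - 0))"
    by (simp only: abs_mult)
  moreover have "C * B * l * ?d \<ge> 0" using bdm_nonneg[OF P] B0 l by simp
  ultimately show ?thesis by (simp add: algebra_simps)
qed

subsection \<open>Sideways uniqueness\<close>

text \<open>On one edge the wave equation is solved in the direction of space, from vanishing
Cauchy data of the difference \<open>\<zeta>\<close> at \<open>x = 0\<close>. As only the primitive \<open>F\<close> of \<open>f\<close> can be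
controlled, \<open>f\<close> is integrated by parts against the Lipschitz function \<open>z\<close>; the weight
\<open>exp (g * x)\<close> with large \<open>g\<close> then forces \<open>F = 0\<close> and \<open>\<zeta> = 0\<close>.\<close>

lemma sideways_uniqueness:
  fixes z \<zeta> :: "real \<Rightarrow> real \<Rightarrow> real"
  assumes l: "l > 0" and \<Theta>: "\<Theta> \<ge> l" and p: "bdm p C" and f: "bdm f Cf"
    and cz: "continuous_on UNIV (\<lambda>(x, t). z x t)" and c\<zeta>: "continuous_on UNIV (\<lambda>(x, t). \<zeta> x t)"
    and Lz: "\<And>x y s t. x \<in> {0..l} \<Longrightarrow> y \<in> {0..l} \<Longrightarrow> s \<in> {0..\<Theta>} \<Longrightarrow> t \<in> {0..\<Theta>} \<Longrightarrow>
       \<bar>z x s - z y t\<bar> \<le> L * (\<bar>x - y\<bar> + \<bar>s - t\<bar>)"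
    and L\<zeta>: "\<And>x s t. x \<in> {0..l} \<Longrightarrow> s \<in> {0..\<Theta>} \<Longrightarrow> t \<in> {0..\<Theta>} \<Longrightarrow> \<bar>\<zeta> x s - \<zeta> x t\<bar> \<le> L * \<bar>s - t\<bar>"
    and L0: "L \<ge> 0"
    and rep: "\<And>x t. x \<in> {0..l} \<Longrightarrow> t \<ge> 0 \<Longrightarrow> \<zeta> x t = 1/2 *
       (integral {0..x} (\<lambda>y. p y * (integral {0..max 0 (t + x - y)} (\<zeta> y) - integral {0..max 0 (t - x + y)} (\<zeta> y)))
      + integral {0..x} (\<lambda>y. f y * (integral {0..max 0 (t + x - y)} (z y) - integral {0..max 0 (t - x + y)} (z y))))"
    and \<zeta>0: "\<And>x. x \<in> {0..l} \<Longrightarrow> \<zeta> x 0 = 0"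
    and r: "r > 0" "\<And>x. x \<in> {0..l} \<Longrightarrow> \<bar>z x 0\<bar> \<ge> r"
  shows "\<And>x. x \<in> {0..l} \<Longrightarrow> integral {0..x} f = 0"
    and "\<And>x t. x \<in> {0..l} \<Longrightarrow> t \<ge> 0 \<Longrightarrow> x + t \<le> \<Theta> \<Longrightarrow> \<zeta> x t = 0"
proof -
  have C0: "C \<ge> 0" "Cf \<ge> 0" using bdm_nonneg p f by auto
  have bounded_rect: "\<exists>B\<ge>0. \<forall>x\<in>{0..l}. \<forall>t\<in>{0..\<Theta>}. \<bar>h x t\<bar> \<le> B"
    if "continuous_on UNIV (\<lambda>(x, t). h x t)" for h :: "real \<Rightarrow> real \<Rightarrow> real"
  proof -
    have "compact ((\<lambda>(x, t). h x t) ` ({0..l} \<times> {0..\<Theta>}))"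
      by (intro compact_continuous_image continuous_on_subset[OF that] compact_Times) auto
    then obtain B where B: "\<forall>v\<in>(\<lambda>(x, t). h x t) ` ({0..l} \<times> {0..\<Theta>}). \<bar>v\<bar> \<le> B"
      using compact_imp_bounded[of "(\<lambda>(x, t). h x t) ` ({0..l} \<times> {0..\<Theta>})"] unfolding bounded_iff by auto
    then show ?thesis by (intro exI[of _ "max 0 B"]) (force simp: le_max_iff_disj)
  qed
  obtain B where B: "B \<ge> 0" "\<And>x t. x \<in> {0..l} \<Longrightarrow> t \<in> {0..\<Theta>} \<Longrightarrow> \<bar>z x t\<bar> \<le> B"
    using bounded_rect[OF cz] by blast
  obtain B' where B': "B' \<ge> 0" "\<And>x t. x \<in> {0..l} \<Longrightarrow> t \<in> {0..\<Theta>} \<Longrightarrow> \<bar>\<zeta> x t\<bar> \<le> B'"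
    using bounded_rect[OF c\<zeta>] by blast
  define F where "F x = integral {0..x} f" for x
  define m where "m y s = integral {0..max 0 s} (z y)" for y s
  define \<mu> where "\<mu> y s = integral {0..max 0 s} (\<zeta> y)" for y s
  have iz: "z y integrable_on {a..b}" "\<zeta> y integrable_on {a..b}" for y a b
    by (intro integrable_continuous_interval continuous_section(1)[OF cz] continuous_section(1)[OF c\<zeta>])+
  have cm: "continuous_on A (\<lambda>y. m y (c y))" "continuous_on A (\<lambda>y. \<mu> y (c y))" if "continuous_on A c" for A c
    unfolding m_def \<mu>_def using that
    by (auto intro: continuous_cone_primitive[OF cz] continuous_cone_primitive[OF c\<zeta>])
  have mlip: "\<bar>m y s - m y' s'\<bar> \<le> L * \<Theta> * \<bar>y - y'\<bar> + B * \<bar>s - s'\<bar>"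
    if "y \<in> {0..l}" "y' \<in> {0..l}" "s \<le> \<Theta>" "s' \<le> \<Theta>" for y y' s s'
  proof -
    have "\<bar>m y s - m y' s'\<bar> \<le> (L * (\<bar>y - y'\<bar> + 0)) * \<Theta> + B * \<bar>max 0 s - max 0 s'\<bar>"
      unfolding m_def by (rule time_primitive_lipschitz[OF cz]) (use that B Lz[OF that(1,2)] l \<Theta> in \<open>auto, fastforce\<close>)
    also have "B * \<bar>max 0 s - max 0 s'\<bar> \<le> B * \<bar>s - s'\<bar>" using B by (intro mult_left_mono) auto
    finally show ?thesis by (simp add: algebra_simps)
  qed
  have mu_diff: "\<mu> y b - \<mu> y a = integral {max 0 a..max 0 b} (\<zeta> y)"
    and m_diff: "m y b - m y a = integral {max 0 a..max 0 b} (z y)" if "a \<le> b" for a b y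
    unfolding \<mu>_def m_def using that
    by (auto intro!: integral_diff_interval[of _ 0 "max 0 b"] iz)
  \<comment> \<open>Lipschitz constant in y of the difference of the two time integrals of
    \<open>z\<close> in the representation: each contributes L \<Theta> through its integrand and B
    through its moving limit.\<close>
  define L1 where "L1 = 2 * (L * \<Theta> + B)"
  have L10: "L1 \<ge> 0" using L0 l \<Theta> B by (simp add: L1_def)
  define Y where "Y = (2 * L + 2 * C * L1) / r"
  \<comment> \<open>Large enough that the multiple of \<open>S\<close> in the bound for
    \<open>S\<close> can be absorbed, and that g r exceeds 2 L + 2 C L1, which makes the final
    inequality for \<open>M\<close> strict.\<close>
  define g where "g = 1 + 2 * C * l + 2 * Y"
  have "Y \<ge> 0" "2 * C * l \<ge> 0" using r L0 L10 C0 l by (auto simp: Y_def)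
  then have "g \<ge> 1" "g \<ge> 2 * C * l" "g > Y" by (auto simp: g_def)
  then have g: "g \<ge> 1" "g \<ge> 2 * C * l" "g > (2 * L + 2 * C * L1) / r" by (auto simp: Y_def)
  have cF: "continuous_on {0..l} F"
    unfolding F_def by (intro indefinite_integral_continuous_1 set_lebesgue_integral_eq_integral(1) bdm_absolutely_integrable[OF f])
  have "continuous_on {0..l} (\<lambda>x. \<bar>F x\<bar> * exp (- g * x))" by (intro continuous_intros cF)
  from continuous_attains_sup[OF compact_Icc _ this]
  obtain x0 where x0: "x0 \<in> {0..l}" "\<And>x. x \<in> {0..l} \<Longrightarrow> \<bar>F x\<bar> * exp (- g * x) \<le> \<bar>F x0\<bar> * exp (- g * x0)"
    using l by fastforce
  define M where "M = \<bar>F x0\<bar> * exp (- g * x0)"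
  have M0: "M \<ge> 0" by (simp add: M_def)
  have M: "\<bar>F x\<bar> \<le> M * exp (g * x)" if "x \<in> {0..l}" for x
    using x0(2)[OF that] by (simp add: M_def exp_minus field_simps)
  \<comment> \<open>The formula for \<open>\<zeta>\<close> at (x, t) reads \<open>\<zeta>\<close>
    only at points (y, s) with y \<le> x and y + s \<le> x + t, so this triangle is closed under the
    recursion.\<close>
  define \<Delta> where "\<Delta> = {(x, t). 0 \<le> x \<and> x \<le> l \<and> 0 \<le> t \<and> x + t \<le> \<Theta>}"
  have comp\<Delta>: "compact \<Delta>"
  proof -
    have "\<Delta> = ({0..l} \<times> {0..\<Theta>}) \<inter> {v. fst v + snd v \<le> \<Theta>}" by (auto simp: \<Delta>_def)
    moreover have "closed {v::real\<times>real. fst v + snd v \<le> \<Theta>}" by (intro closed_Collect_le continuous_intros)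
    ultimately show ?thesis by (auto intro: compact_Int_closed compact_Times)
  qed
  have "continuous_on \<Delta> (\<lambda>v. \<bar>\<zeta> (fst v) (snd v)\<bar> * exp (- g * fst v))"
    by (intro continuous_intros continuous_on_compose_pair[OF c\<zeta>])
  moreover have "(0, 0) \<in> \<Delta>" using l \<Theta> by (auto simp: \<Delta>_def)
  then have "\<Delta> \<noteq> {}" by blast
  ultimately obtain v0 where v0: "v0 \<in> \<Delta>" "\<And>v. v \<in> \<Delta> \<Longrightarrow> \<bar>\<zeta> (fst v) (snd v)\<bar> * exp (- g * fst v) \<le> \<bar>\<zeta> (fst v0) (snd v0)\<bar> * exp (- g * fst v0)"
    using continuous_attains_sup[OF comp\<Delta>] by blast
  define x1 t1 where "x1 = fst v0" and "t1 = snd v0"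
  have x1: "x1 \<in> {0..l}" "t1 \<ge> 0" "x1 + t1 \<le> \<Theta>" using v0(1) by (auto simp: \<Delta>_def x1_def t1_def)
  define S where "S = \<bar>\<zeta> x1 t1\<bar> * exp (- g * x1)"
  have S0: "S \<ge> 0" by (simp add: S_def)
  have S: "\<bar>\<zeta> x t\<bar> \<le> S * exp (g * x)" if "x \<in> {0..l}" "t \<ge> 0" "x + t \<le> \<Theta>" for x t
    using v0(2)[of "(x, t)"] that by (simp add: S_def x1_def t1_def \<Delta>_def exp_minus field_simps)
  have absf: "f absolutely_integrable_on {a..b}" for a b by (rule bdm_absolutely_integrable[OF f])
  have parts: "\<bar>integral {0..x} (\<lambda>y. f y * Z y) - F x * Z x\<bar> \<le> L' * M / g * exp (g * x)"
    if x: "x \<in> {0..l}" and Z: "\<And>y y'. y \<in> {0..x} \<Longrightarrow> y' \<in> {0..x} \<Longrightarrow> \<bar>Z y - Z y'\<bar> \<le> L' * \<bar>y - y'\<bar>" and L': "L' \<ge> 0" for x Z L'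
    by (rule integral_mult_lipschitz_by_parts[where B = Cf, OF absf _ Z])
      (use x M g M0 C0 L' f in \<open>auto simp: bdm_def F_def\<close>)
  have S_est: "S \<le> (C * l * S + L1 * M) / g"
  proof -
    let ?x = x1 and ?t = t1
    have 1: "\<bar>integral {0..?x} (\<lambda>y. p y * (\<mu> y (?t + ?x - y) - \<mu> y (?t - ?x + y)))\<bar> \<le> (2 * l * C * S) * exp (g * ?x) / g"
    proof (rule integral_exp_le)
      show "(\<lambda>y. p y * (\<mu> y (?t + ?x - y) - \<mu> y (?t - ?x + y))) integrable_on {0..?x}"
        by (intro bdm_mult_integrable(2)[OF p] continuous_on_diff cm continuous_intros)
      fix y assume y: "y \<in> {0..?x}"
      have "\<bar>\<mu> y (?t + ?x - y) - \<mu> y (?t - ?x + y)\<bar> \<le> (S * exp (g * y)) * (max 0 (?t + ?x - y) - max 0 (?t - ?x + y))"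
        using y x1 iz by (subst mu_diff) (auto intro!: abs_integral_le_const S)
      also have "\<dots> \<le> (S * exp (g * y)) * (2 * l)"
        using y x1 S0 by (intro mult_left_mono) auto
      finally have "\<bar>p y\<bar> * \<bar>\<mu> y (?t + ?x - y) - \<mu> y (?t - ?x + y)\<bar> \<le> C * ((S * exp (g * y)) * (2 * l))"
        using p C0 by (intro mult_mono) (auto simp: bdm_def)
      then show "\<bar>p y * (\<mu> y (?t + ?x - y) - \<mu> y (?t - ?x + y))\<bar> \<le> (2 * l * C * S) * exp (g * y)"
        by (simp add: abs_mult mult_ac)
    qed (use g x1 l C0 S0 in auto)
    \<comment> \<open>At y = x both time limits equal t, so the factor of f vanishes there and
      integration by parts leaves no boundary term.\<close>
    have 2: "\<bar>integral {0..?x} (\<lambda>y. f y * (m y (?t + ?x - y) - m y (?t - ?x + y))) - F ?x * (m ?x (?t + ?x - ?x) - m ?x (?t - ?x + ?x))\<bar>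
       \<le> (2 * L1) * M / g * exp (g * ?x)"
    proof (rule parts[OF x1(1)])
      fix y y' assume y: "y \<in> {0..?x}" "y' \<in> {0..?x}"
      define K where "K = L * \<Theta> * \<bar>y - y'\<bar> + B * \<bar>y - y'\<bar>"
      have "\<bar>m y (?t + ?x - y) - m y' (?t + ?x - y')\<bar> \<le> K"
        using mlip[of y y' "?t + ?x - y" "?t + ?x - y'"] y x1 by (simp add: K_def abs_minus_commute)
      moreover have "\<bar>m y (?t - ?x + y) - m y' (?t - ?x + y')\<bar> \<le> K"
        using mlip[of y y' "?t - ?x + y" "?t - ?x + y'"] y x1 by (simp add: K_def)
      moreover have "2 * L1 * \<bar>y - y'\<bar> = 4 * K" by (simp add: L1_def K_def algebra_simps)
      moreover have "K \<ge> 0" using L0 l \<Theta> B by (simp add: K_def)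
      ultimately show "\<bar>m y (?t + ?x - y) - m y (?t - ?x + y) - (m y' (?t + ?x - y') - m y' (?t - ?x + y'))\<bar> \<le> 2 * L1 * \<bar>y - y'\<bar>"
        by linarith
    qed (use L10 in auto)
    have eq: "\<zeta> ?x ?t = 1/2 * (integral {0..?x} (\<lambda>y. p y * (\<mu> y (?t + ?x - y) - \<mu> y (?t - ?x + y)))
        + integral {0..?x} (\<lambda>y. f y * (m y (?t + ?x - y) - m y (?t - ?x + y))))"
      unfolding \<mu>_def m_def by (rule rep[OF x1(1,2)])
    have aux: "\<bar>1/2 * (a + b)\<bar> \<le> 1/2 * (A' + B')" if "\<bar>a\<bar> \<le> A'" "\<bar>b - c\<bar> \<le> B'" "c = 0" for a b c A' B' :: real
      using that by (auto simp: abs_le_iff)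
    have "\<bar>\<zeta> ?x ?t\<bar> \<le> 1/2 * ((2 * l * C * S) * exp (g * ?x) / g + (2 * L1) * M / g * exp (g * ?x))"
      unfolding eq by (rule aux[OF 1 2]) simp
    also have "\<dots> = (C * l * S + L1 * M) / g * exp (g * ?x)"
      by (simp add: algebra_simps add_divide_distrib)
    finally show ?thesis by (simp add: S_def exp_minus field_simps)
  qed
  \<comment> \<open>The representation at t = 0, where \<open>\<zeta>\<close> vanishes, is
    differentiated in x; this yields integrals along the characteristic through (x, 0). As the
    weights are only measurable, forward difference quotients with a quadratic error are used, hence
    x < l.\<close>
  have J: "integral {0..x} (\<lambda>y. p y * \<zeta> y (x - y)) + integral {0..x} (\<lambda>y. f y * z y (x - y)) = 0" (is "?Jp + ?Jf = 0")
    if x: "0 \<le> x" "x < l" for x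
  proof -
    define D where "D = C * L * l + Cf * L * l + C * B' + Cf * B"
    have K: "integral {0..x} (\<lambda>y. p y * \<mu> y (x - y)) + integral {0..x} (\<lambda>y. f y * m y (x - y)) = 0" if "x \<in> {0..l}" for x
    proof -
      have 1: "integral {0..x} (\<lambda>y. p y * (\<mu> y (0 + x - y) - \<mu> y (0 - x + y))) = integral {0..x} (\<lambda>y. p y * \<mu> y (x - y))"
        by (rule integral_cong) (auto simp: \<mu>_def)
      have 2: "integral {0..x} (\<lambda>y. f y * (m y (0 + x - y) - m y (0 - x + y))) = integral {0..x} (\<lambda>y. f y * m y (x - y))"
        by (rule integral_cong) (auto simp: m_def)
      have "0 = 1/2 * (integral {0..x} (\<lambda>y. p y * (\<mu> y (0 + x - y) - \<mu> y (0 - x + y)))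
        + integral {0..x} (\<lambda>y. f y * (m y (0 + x - y) - m y (0 - x + y))))"
        using rep[OF that, of 0] \<zeta>0[OF that] unfolding \<mu>_def m_def by simp
      then show ?thesis unfolding 1 2 by simp
    qed
    \<comment> \<open>Increasing x by h lengthens every time interval by h, which gives the first
      order term, and adds the strip from x to x + h, whose time intervals are at most h long. Both
      errors are quadratic in h.\<close>
    have quad: "\<bar>integral {0..x+h} (\<lambda>y. q y * n y (x + h - y)) - integral {0..x} (\<lambda>y. q y * n y (x - y))
        - h * integral {0..x} (\<lambda>y. q y * w y (x - y))\<bar> \<le> (Cq * L * l + Cq * Bw) * h\<^sup>2"
      if h: "0 < h" "x + h \<le> l" and q: "bdm q Cq" and cw: "continuous_on UNIV (\<lambda>(x, t). w x t)"
        and n: "\<And>y s. n y s = integral {0..max 0 s} (w y)"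
        and Lw: "\<And>x s t. x \<in> {0..l} \<Longrightarrow> s \<in> {0..\<Theta>} \<Longrightarrow> t \<in> {0..\<Theta>} \<Longrightarrow> \<bar>w x s - w x t\<bar> \<le> L * \<bar>s - t\<bar>"
        and Bw: "Bw \<ge> 0" "\<And>x t. x \<in> {0..l} \<Longrightarrow> t \<in> {0..\<Theta>} \<Longrightarrow> \<bar>w x t\<bar> \<le> Bw" for h q Cq w n Bw
    proof -
      have Cq: "Cq \<ge> 0" by (rule bdm_nonneg[OF q])
      have cn: "continuous_on A (\<lambda>y. n y (c y))" if "continuous_on A c" for A c
        unfolding n by (rule continuous_cone_primitive[OF cw that])
      have iw: "w y integrable_on {a..b}" for y a b
        by (intro integrable_continuous_interval continuous_section(1)[OF cw])
      have cwd: "continuous_on A (\<lambda>y. w y (x - y))" for A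
        by (intro continuous_on_compose_pair[OF cw] continuous_intros)
      have i1: "(\<lambda>y. q y * n y (b - y)) integrable_on {u..v}" for u v b
        by (intro bdm_mult_integrable(2)[OF q] cn continuous_intros)
      have nd: "n y b - n y a = integral {a..b} (w y)" if "0 \<le> a" "a \<le> b" for a b y
        unfolding n using that by (simp add: integral_diff_interval[of _ 0 b] iw)
      have "integral {0..x+h} (\<lambda>y. q y * n y (x + h - y)) = integral {0..x} (\<lambda>y. q y * n y (x + h - y)) + integral {x..x+h} (\<lambda>y. q y * n y (x + h - y))"
        using x h by (intro Henstock_Kurzweil_Integration.integral_combine[symmetric] i1) auto
      moreover have "integral {0..x} (\<lambda>y. q y * n y (x + h - y)) - integral {0..x} (\<lambda>y. q y * n y (x - y))
          - h * integral {0..x} (\<lambda>y. q y * w y (x - y)) = integral {0..x} (\<lambda>y. q y * (n y (x + h - y) - n y (x - y) - h * w y (x - y)))"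
      proof -
        have "((\<lambda>y. q y * n y (x + h - y) - q y * n y (x - y) - h * (q y * w y (x - y))) has_integral
          integral {0..x} (\<lambda>y. q y * n y (x + h - y)) - integral {0..x} (\<lambda>y. q y * n y (x - y))
          - h * integral {0..x} (\<lambda>y. q y * w y (x - y))) {0..x}"
          by (intro has_integral_diff has_integral_mult_right integrable_integral i1 bdm_mult_integrable(2)[OF q cwd])
        then show ?thesis by (subst integral_unique[symmetric], assumption) (simp add: algebra_simps)
      qed
      moreover have "\<bar>integral {0..x} (\<lambda>y. q y * (n y (x + h - y) - n y (x - y) - h * w y (x - y)))\<bar> \<le> Cq * (L * h\<^sup>2) * (x - 0)"
      proof (rule bdm_integral_bound[OF q])
        show "continuous_on {0..x} (\<lambda>y. n y (x + h - y) - n y (x - y) - h * w y (x - y))"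
          by (intro continuous_intros cn cwd)
        fix y assume y: "y \<in> {0..x}"
        have "n y (x + h - y) - n y (x - y) - h * w y (x - y) = integral {x-y..x+h-y} (\<lambda>s. w y s - w y (x - y))"
        proof -
          have "integral {x-y..x+h-y} (\<lambda>s. w y s - w y (x - y))
              = integral {x-y..x+h-y} (w y) - integral {x-y..x+h-y} (\<lambda>_. w y (x - y))"
            by (intro Henstock_Kurzweil_Integration.integral_diff iw integrable_const_ivl)
          moreover have "integral {x-y..x+h-y} (\<lambda>_. w y (x - y)) = h * w y (x - y)" using h by simp
          ultimately show ?thesis using nd[of "x - y" "x + h - y" y] y h by simp
        qed
        also have "\<bar>\<dots>\<bar> \<le> (L * h) * (x + h - y - (x - y))"
        proof (rule abs_integral_le_const)
          fix s assume s: "s \<in> {x-y..x+h-y}"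
          have "\<bar>w y s - w y (x - y)\<bar> \<le> L * \<bar>s - (x - y)\<bar>" by (rule Lw) (use s y x h \<Theta> in auto)
          also have "\<dots> \<le> L * h" using s L0 by (intro mult_left_mono) auto
          finally show "\<bar>w y s - w y (x - y)\<bar> \<le> L * h" .
        qed (use h iw in \<open>auto intro: integrable_diff\<close>)
        finally show "\<bar>n y (x + h - y) - n y (x - y) - h * w y (x - y)\<bar> \<le> L * h\<^sup>2"
          by (simp add: power2_eq_square mult.assoc)
      qed (use x in auto)
      moreover have "Cq * (L * h\<^sup>2) * (x - 0) \<le> Cq * (L * h\<^sup>2) * l"
        using x Cq L0 by (intro mult_left_mono) auto
      moreover have "\<bar>integral {x..x+h} (\<lambda>y. q y * n y (x + h - y))\<bar> \<le> Cq * (Bw * h) * (x + h - x)"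
      proof (rule bdm_integral_bound[OF q])
        show "continuous_on {x..x + h} (\<lambda>y. n y (x + h - y))" by (intro cn continuous_intros)
        fix y assume y: "y \<in> {x..x+h}"
        have "\<bar>integral {0..max 0 (x + h - y)} (w y)\<bar> \<le> Bw * (max 0 (x + h - y) - 0)"
          by (rule abs_integral_le_const) (use y x h \<Theta> iw Bw in auto)
        also have "\<dots> \<le> Bw * h" using y h Bw by (intro mult_left_mono) auto
        finally show "\<bar>n y (x + h - y)\<bar> \<le> Bw * h" by (simp add: n)
      qed (use h in auto)
      ultimately show ?thesis by (simp add: power2_eq_square algebra_simps)
    qed
    have bound: "\<bar>?Jp + ?Jf\<bar> \<le> D * h" if h: "0 < h" "x + h \<le> l" for h
    proof -
      have "\<bar>integral {0..x+h} (\<lambda>y. p y * \<mu> y (x + h - y)) - integral {0..x} (\<lambda>y. p y * \<mu> y (x - y)) - h * ?Jp\<bar> \<le> (C * L * l + C * B') * h\<^sup>2"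
        by (rule quad[OF h p c\<zeta>]) (use L\<zeta> B' in \<open>auto simp: \<mu>_def\<close>)
      moreover have "\<bar>integral {0..x+h} (\<lambda>y. f y * m y (x + h - y)) - integral {0..x} (\<lambda>y. f y * m y (x - y)) - h * ?Jf\<bar> \<le> (Cf * L * l + Cf * B) * h\<^sup>2"
        by (rule quad[OF h f cz]) (use Lz[of x x for x] B in \<open>auto simp: m_def\<close>)
      moreover note K[of x] K[of "x + h"]
      ultimately have "\<bar>h * ?Jp + h * ?Jf\<bar> \<le> (C * L * l + C * B') * h\<^sup>2 + (Cf * L * l + Cf * B) * h\<^sup>2"
        using x h by auto
      moreover have "h * \<bar>?Jp + ?Jf\<bar> = \<bar>h * ?Jp + h * ?Jf\<bar>"
        using h by (simp only: distrib_left[symmetric] abs_mult)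
      moreover have "(C * L * l + C * B') * h\<^sup>2 + (Cf * L * l + Cf * B) * h\<^sup>2 = h * (D * h)"
        by (simp add: D_def power2_eq_square algebra_simps)
      ultimately have "h * \<bar>?Jp + ?Jf\<bar> \<le> h * (D * h)" by linarith
      then show ?thesis using h by simp
    qed
    have "\<bar>?Jp + ?Jf\<bar> \<le> 0"
    proof (rule tendsto_lowerbound)
      show "((\<lambda>h. D * h) \<longlongrightarrow> 0) (at_right 0)" by (auto intro!: tendsto_eq_intros)
      show "\<forall>\<^sub>F h in at_right 0. \<bar>?Jp + ?Jf\<bar> \<le> D * h"
        unfolding eventually_at_right_field
        by (rule exI[of _ "l - x"]) (use x bound in auto)
    qed simp
    then show ?thesis by simp
  qed
  \<comment> \<open>On the characteristic f is multiplied by z(y, x - y), whose value at y = x is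
    the initial displacement, of size at least r. The boundary term of the integration by parts
    therefore recovers F.\<close>
  have F_est: "r * \<bar>F x\<bar> \<le> (2 * L * M + C * S) / g * exp (g * x)" if x: "0 \<le> x" "x < l" for x
  proof -
    have 1: "\<bar>integral {0..x} (\<lambda>y. p y * \<zeta> y (x - y))\<bar> \<le> (C * S) * exp (g * x) / g"
    proof (rule integral_exp_le)
      show "(\<lambda>y. p y * \<zeta> y (x - y)) integrable_on {0..x}"
        by (intro bdm_mult_integrable(2)[OF p] continuous_on_compose_pair[OF c\<zeta>] continuous_intros)
      fix y assume y: "y \<in> {0..x}"
      have "\<bar>p y\<bar> * \<bar>\<zeta> y (x - y)\<bar> \<le> C * (S * exp (g * y))"
        using p S[of y "x - y"] y x C0 \<Theta> by (intro mult_mono) (auto simp: bdm_def)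
      then show "\<bar>p y * \<zeta> y (x - y)\<bar> \<le> (C * S) * exp (g * y)" by (simp add: abs_mult)
    qed (use g x C0 S0 in auto)
    have 2: "\<bar>integral {0..x} (\<lambda>y. f y * z y (x - y)) - F x * z x (x - x)\<bar> \<le> (2 * L) * M / g * exp (g * x)"
    proof (rule parts)
      fix y y' assume "y \<in> {0..x}" "y' \<in> {0..x}"
      then show "\<bar>z y (x - y) - z y' (x - y')\<bar> \<le> 2 * L * \<bar>y - y'\<bar>"
        using Lz[of y y' "x - y" "x - y'"] x \<Theta> by (simp add: abs_minus_commute)
    qed (use x L0 in auto)
    have "r * \<bar>F x\<bar> \<le> \<bar>F x * z x 0\<bar>" using mult_right_mono[OF r(2)[of x] abs_ge_zero[of "F x"]] x
      by (simp add: abs_mult mult.commute)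
    also have "\<dots> \<le> (C * S) * exp (g * x) / g + (2 * L) * M / g * exp (g * x)"
      using 1 2 J[OF x] by simp
    also have "\<dots> = (2 * L * M + C * S) / g * exp (g * x)" by (simp add: algebra_simps add_divide_distrib)
    finally show ?thesis .
  qed
  have F_est': "r * \<bar>F x\<bar> \<le> (2 * L * M + C * S) / g * exp (g * x)" if x: "x \<in> {0..l}" for x
  proof -
    have "r * \<bar>F x\<bar> - (2 * L * M + C * S) / g * exp (g * x) \<le> 0"
    proof (rule continuous_le_on_closure[of "{0..<l}" "\<lambda>x. r * \<bar>F x\<bar> - (2 * L * M + C * S) / g * exp (g * x)"])
      show "continuous_on (closure {0..<l}) (\<lambda>x. r * \<bar>F x\<bar> - (2 * L * M + C * S) / g * exp (g * x))"
        using l cF g by (auto intro!: continuous_intros)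
    qed (use x l F_est in auto)
    then show ?thesis by simp
  qed
  \<comment> \<open>One estimate bounds \<open>S\<close> by \<open>M\<close>, the other bounds
    \<open>M\<close> by \<open>M\<close> and \<open>S\<close> with a factor 1 / g. Substituting the
    first into the second at \<open>x0\<close>, where the weighted maximum \<open>M\<close> is
    attained, forces \<open>M = 0\<close>.\<close>
  have "S \<le> 2 * L1 * M"
  proof -
    have "g * S \<le> C * l * S + L1 * M" using S_est g by (simp add: field_simps)
    moreover have "C * l * S \<le> g / 2 * S" using g(2) S0 by (intro mult_right_mono) auto
    ultimately have "g * S \<le> 2 * L1 * M" by simp
    moreover have "1 * S \<le> g * S" using g(1) S0 by (intro mult_right_mono) auto
    ultimately show ?thesis by simp
  qed
  then have "2 * L * M + C * S \<le> (2 * L + 2 * C * L1) * M"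
    using mult_left_mono[of S "2 * L1 * M" C] C0 by (simp add: algebra_simps)
  then have "(2 * L * M + C * S) / g * exp (g * x0) \<le> (2 * L + 2 * C * L1) * M / g * exp (g * x0)"
    using g by (intro mult_right_mono divide_right_mono) auto
  with F_est'[OF x0(1)] have "r * \<bar>F x0\<bar> \<le> (2 * L + 2 * C * L1) * M / g * exp (g * x0)" by linarith
  moreover have "\<bar>F x0\<bar> = M * exp (g * x0)" by (simp add: M_def exp_minus)
  ultimately have "(r * M) * exp (g * x0) \<le> ((2 * L + 2 * C * L1) * M / g) * exp (g * x0)"
    by (simp only: mult.assoc)
  then have "r * M \<le> (2 * L + 2 * C * L1) * M / g" by (rule mult_right_le_imp_le) simp
  then have "M * (g * r) \<le> M * (2 * L + 2 * C * L1)" using g by (simp add: field_simps)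
  moreover have "2 * L + 2 * C * L1 < g * r" using g(3) r by (simp add: field_simps)
  ultimately have Mz: "M = 0" using M0 mult_strict_left_mono[of "2 * L + 2 * C * L1" "g * r" M] by (cases "M > 0") auto
  then have Sz: "S = 0" using \<open>S \<le> 2 * L1 * M\<close> S0 by simp
  show "integral {0..x} f = 0" if "x \<in> {0..l}" for x using M[OF that] Mz by (simp add: F_def)
  show "\<zeta> x t = 0" if "x \<in> {0..l}" "t \<ge> 0" "x + t \<le> \<Theta>" for x t using S[OF that] Sz by simp
qed


section \<open>From vanishing primitives to equality almost everywhere\<close>

lemma bdm_diff:
  assumes "bdm p C" "bdm q C"
  shows "bdm (\<lambda>y. p y - q y) (2 * C)"
  unfolding bdm_def
proof (intro conjI allI)
  show "(\<lambda>y. p y - q y) \<in> borel_measurable borel"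
    by (intro borel_measurable_diff) (use assms in \<open>auto simp: bdm_def\<close>)
  show "\<bar>p y - q y\<bar> \<le> 2 * C" for y
  proof -
    have "\<bar>p y\<bar> \<le> C" "\<bar>q y\<bar> \<le> C" using assms by (auto simp: bdm_def)
    then show ?thesis by linarith
  qed
qed

text \<open>Adding \<open>C\<close> makes f a nonnegative density. The measures with densities f + C
  and C on the interval agree on all half-lines, hence everywhere, and so the densities agree almost
  everywhere.\<close>

lemma AE_eq_0_if_integrals_eq_0:
  assumes f: "bdm f C" and z: "\<And>x. x \<in> {0..l} \<Longrightarrow> integral {0..x} f = 0"
  shows "AE x in lborel. x \<in> {0..l} \<longrightarrow> f x = 0"
proof -
  have C: "C \<ge> 0" by (rule bdm_nonneg[OF f])
  define h where "h f y = ennreal (indicator {0..l} y * (f y + C))" for f :: "real \<Rightarrow> real" and y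
  have hm: "h k \<in> borel_measurable lborel" if "bdm k C" for k
  proof -
    have [measurable]: "k \<in> borel_measurable borel" using that by (simp add: bdm_def)
    show ?thesis unfolding h_def by measurable
  qed
  have em: "emeasure (density lborel (h k)) {a<..} = ennreal (C * max 0 (l - max 0 a))"
    if k: "bdm k C" and kz: "\<And>x. x \<in> {0..l} \<Longrightarrow> integral {0..x} k = 0" for k a
  proof -
    let ?g = "\<lambda>y. indicator {a<..} y * (indicator {0..l} y * (k y + C))"
    have [measurable]: "k \<in> borel_measurable borel" using k by (simp add: bdm_def)
    have kC: "0 \<le> k y + C" "k y + C \<le> 2 * C" for y
    proof -
      have "\<bar>k y\<bar> \<le> C" using k by (simp add: bdm_def)
      then show "0 \<le> k y + C" "k y + C \<le> 2 * C" by linarith+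
    qed
    have gm: "?g \<in> borel_measurable borel" by measurable
    have gb: "\<bar>?g y\<bar> \<le> 2 * C" for y using kC[of y] C by (auto simp: indicator_def)
    have "integrable lborel ?g"
    proof (rule Bochner_Integration.integrable_bound[where f = "\<lambda>x. (2 * C) * indicator {0..l} x"])
      show "integrable lborel (\<lambda>x. (2 * C) * indicator {0..l} x :: real)"
        by (intro integrable_mult_right integrable_real_indicator) (auto simp: emeasure_lborel_Icc_eq)
    qed (use gm kC C in \<open>auto simp: indicator_def\<close>)
    moreover have "(\<integral>y. ?g y \<partial>lborel) = C * max 0 (l - max 0 a)"
    proof -
      have "(\<integral>y. ?g y \<partial>lborel) = integral {max 0 a..l} ?g"
        by (rule lborel_integral_eq_integral[OF gm gb]) (auto simp: indicator_def)
      also have "\<dots> = integral {max 0 a..l} (\<lambda>y. k y + C)"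
        by (rule integral_spike[of "{a}"]) (auto simp: indicator_def)
      also have "\<dots> = C * max 0 (l - max 0 a)"
      proof (cases "max 0 a \<le> l")
        case True
        have ik: "k integrable_on {u..v}" for u v
          using bdm_mult_integrable(2)[OF k continuous_on_const[of _ 1], of u v] by simp
        have "integral {max 0 a..l} (\<lambda>y. k y + C) = integral {max 0 a..l} k + integral {max 0 a..l} (\<lambda>_. C)"
          by (intro Henstock_Kurzweil_Integration.integral_add ik integrable_const_ivl)
        moreover have "integral {max 0 a..l} k = 0"
          using integral_diff_interval[OF ik, of 0 "max 0 a" l l] kz[of l] kz[of "max 0 a"] True by auto
        ultimately show ?thesis using True by simp
      qed auto
      finally show ?thesis .
    qed
    moreover have "emeasure (density lborel (h k)) {a<..} = (\<integral>\<^sup>+y. ennreal (?g y) \<partial>lborel)"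
      using hm[OF k] by (subst emeasure_density) (auto simp: h_def indicator_def intro!: nn_integral_cong)
    ultimately show ?thesis
      using nn_integral_eq_integral[of lborel ?g] kC by (simp add: indicator_def)
  qed
  have b0: "bdm (\<lambda>_. 0) C" using C by (simp add: bdm_def)
  have "density lborel (h f) = density lborel (h (\<lambda>_. 0))"
    by (rule measure_eqI_lessThan) (use em[OF f z] em[OF b0] in auto)
  then have "AE y in lborel. h f y = h (\<lambda>_. 0) y"
    using sigma_finite_measure.density_unique_iff[OF sigma_finite_lborel hm[OF f] hm[OF b0]] by simp
  then show ?thesis
  proof eventually_elim
    case (elim y)
    have "\<bar>f y\<bar> \<le> C" using f by (simp add: bdm_def)
    then have "f y + C \<ge> 0" by linarith
    then show ?case using elim C by (auto simp: h_def)
  qed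
qed

lemma integral_cong_AE_lborel:
  fixes f g :: "real \<Rightarrow> real"
  assumes "AE x in lborel. x \<in> {a..b} \<longrightarrow> f x = g x"
  shows "integral {a..b} f = integral {a..b} g"
proof -
  have "AE x in lebesgue. x \<in> {a..b} \<longrightarrow> f x = g x" using assms by (rule AE_completion)
  then obtain N where N: "N \<in> null_sets lebesgue" "{x. \<not> (x \<in> {a..b} \<longrightarrow> f x = g x)} \<subseteq> N"
    by (auto elim: AE_E3 simp: eventually_ae_filter)
  show ?thesis
    by (rule integral_spike[of N]) (use N in \<open>auto simp: negligible_iff_null_sets\<close>)
qed

section \<open>Uniqueness of wave and potential along one edge\<close>

context network
begin

lemma waveD:
  assumes "wave P z W g K" "d \<in> H"
  shows "continuous_on UNIV (\<lambda>(x, t). z d x t)" "continuous_on UNIV (W d)"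
    "\<And>s. s \<le> 0 \<Longrightarrow> W d s = u0 d (- s) / 2" "\<And>x t. z (opp d) x t = z d (l d - x) t"
    "\<And>x t. x \<in> {0..l d} \<Longrightarrow> t \<ge> 0 \<Longrightarrow> z d x t = W d (t - x) + W (opp d) (t - l d + x) + Nop (P d) (l d) (z d) x t"
    "\<And>s. s \<ge> 0 \<Longrightarrow> W d s = scatter (\<lambda>e. inc P z W e s) d"
    "\<And>x t. t \<ge> 0 \<Longrightarrow> \<bar>z d x t\<bar> \<le> K * exp (g * t)" "\<And>s. \<bar>W d s\<bar> \<le> K * exp (g * max 0 s)"
  using assms unfolding wave_def by blast+

lemma potD: assumes "pot P C" "d \<in> H" shows "bdm (P d) C" "P (opp d) x = P d (l d - x)"
  using assms by (auto simp: pot_def)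

lemma l_pos: "d \<in> H \<Longrightarrow> l d > 0"
  using len(1)[of d] lmin by simp

lemma wave_initial: "wave P z W g K \<Longrightarrow> d \<in> H \<Longrightarrow> x \<in> {0..l d} \<Longrightarrow> z d x 0 = u0 d x"
  using waveD(5)[of P z W g K d x 0] waveD(3)[of P z W g K d "- x"] waveD(3)[of P z W g K "opp d" "- l d + x"]
    opp(1) u0_opp[of d "l d - x"] Nop_0(2)[of x "l d" "P d" "z d"] by simp

text \<open>Induction over time steps of length \<open>lmin\<close>: scattering at time s reads
  outgoing waves only up to time s - \<open>lmin\<close>. The constant grows with each step, but
  finitely many steps reach \<open>\<Theta>\<close>.\<close>

lemma wave_lipschitz:
  assumes P: "pot P C" and w: "wave P z W g K" and g: "g > 0" "K \<ge> 0"
    and u0L: "\<And>d x y. d \<in> H \<Longrightarrow> \<bar>u0 d x - u0 d y\<bar> \<le> L0 * \<bar>x - y\<bar>" and L0: "L0 \<ge> 0" and \<Theta>: "\<Theta> \<ge> 0"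
  obtains L where "L \<ge> 0" "\<And>d x y s t. d \<in> H \<Longrightarrow> x \<in> {0..l d} \<Longrightarrow> y \<in> {0..l d} \<Longrightarrow> s \<in> {0..\<Theta>} \<Longrightarrow> t \<in> {0..\<Theta>} \<Longrightarrow>
     \<bar>z d x s - z d y t\<bar> \<le> L * (\<bar>x - y\<bar> + \<bar>s - t\<bar>)"
proof -
  define B where "B = K * exp (g * \<Theta>)"
  have B0: "B \<ge> 0" using g by (simp add: B_def)
  have B: "\<bar>z d x t\<bar> \<le> B" if "d \<in> H" "t \<in> {0..\<Theta>}" for d x t
  proof -
    have "\<bar>z d x t\<bar> \<le> K * exp (g * t)" using waveD(7)[OF w] that by auto
    also have "\<dots> \<le> B" unfolding B_def using g that by (intro mult_left_mono) auto
    finally show ?thesis .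
  qed
  define N where "N = \<bar>C\<bar> * B * \<bar>lmax\<bar>"
  have N0: "N \<ge> 0" using B0 by (simp add: N_def)
  have NL: "\<bar>Nop (P d) (l d) (z d) x t - Nop (P d) (l d) (z d) x' t'\<bar> \<le> N * (\<bar>x - x'\<bar> + \<bar>t - t'\<bar>)"
    if d: "d \<in> H" and t: "t \<le> \<Theta>" "t' \<le> \<Theta>" for d x x' t t'
  proof -
    have "\<bar>Nop (P d) (l d) (z d) x t - Nop (P d) (l d) (z d) x' t'\<bar> \<le> C * B * l d * (\<bar>x - x'\<bar> + \<bar>t - t'\<bar>)"
      by (rule Nop_lipschitz[OF potD(1)[OF P d] waveD(1)[OF w d]])
        (use B[OF d] t \<Theta> less_imp_le[OF l_pos[OF d]] in auto)
    also have "\<dots> \<le> N * (\<bar>x - x'\<bar> + \<bar>t - t'\<bar>)"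
      unfolding N_def using B0 len(2)[OF d] l_pos[OF d] by (intro mult_right_mono mult_mono) auto
    finally show ?thesis .
  qed
  have WL: "\<exists>L\<ge>0. \<forall>d\<in>H. \<forall>s s'. s \<le> real n * lmin \<longrightarrow> s' \<le> real n * lmin \<longrightarrow> s \<le> \<Theta> \<longrightarrow> s' \<le> \<Theta> \<longrightarrow> \<bar>W d s - W d s'\<bar> \<le> L * \<bar>s - s'\<bar>" for n
  proof (induction n)
    case 0
    have "\<bar>W d s - W d s'\<bar> \<le> L0 * \<bar>s - s'\<bar>" if "d \<in> H" "s \<le> 0" "s' \<le> 0" for d s s'
    proof -
      have "\<bar>u0 d (- s) - u0 d (- s')\<bar> \<le> L0 * \<bar>s - s'\<bar>"
        using u0L[OF that(1), of "- s" "- s'"] by (simp add: abs_minus_commute)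
      moreover have "W d s - W d s' = (u0 d (- s) - u0 d (- s')) / 2" using that by (simp add: waveD(3)[OF w] diff_divide_distrib)
      ultimately show ?thesis by simp
    qed
    then show ?case using L0 by auto
  next
    case (Suc n)
    then obtain L where L: "L \<ge> 0" "\<And>d s s'. d \<in> H \<Longrightarrow> s \<le> real n * lmin \<Longrightarrow> s' \<le> real n * lmin \<Longrightarrow> s \<le> \<Theta> \<Longrightarrow> s' \<le> \<Theta> \<Longrightarrow> \<bar>W d s - W d s'\<bar> \<le> L * \<bar>s - s'\<bar>"
      by blast
    define L' where "L' = 3 * (L + N) + L0"
    have pos: "\<bar>W d s - W d s'\<bar> \<le> L' * \<bar>s - s'\<bar>"
      if d: "d \<in> H" and s: "0 \<le> s" "0 \<le> s'" "s \<le> real (Suc n) * lmin" "s' \<le> real (Suc n) * lmin" "s \<le> \<Theta>" "s' \<le> \<Theta>" for d s s'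
    proof -
      have "\<bar>scatter (\<lambda>e. inc P z W e s - inc P z W e s') d\<bar> \<le> 3 * ((L + N) * \<bar>s - s'\<bar>)"
      proof (rule scatter_bound[OF d])
        fix e assume e: "e \<in> H"
        have "\<bar>W (opp e) (s - l e) - W (opp e) (s' - l e)\<bar> \<le> L * \<bar>(s - l e) - (s' - l e)\<bar>"
          by (rule L(2)[OF opp(1)[OF e]]) (use len(1)[OF e] s lmin in \<open>auto simp: algebra_simps\<close>)
        moreover have "\<bar>Nop (P e) (l e) (z e) 0 s - Nop (P e) (l e) (z e) 0 s'\<bar> \<le> N * (\<bar>0 - 0\<bar> + \<bar>s - s'\<bar>)"
          by (rule NL[OF e]) (use s in auto)
        ultimately show "\<bar>inc P z W e s - inc P z W e s'\<bar> \<le> (L + N) * \<bar>s - s'\<bar>"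
          by (simp add: inc_def distrib_right)
      qed
      then show ?thesis using waveD(6)[OF w d] s mult_nonneg_nonneg[OF L0 abs_ge_zero[of "s - s'"]]
        by (simp add: scatter_diff L'_def algebra_simps)
    qed
    have neg: "\<bar>W d s - W d s'\<bar> \<le> L' * \<bar>s - s'\<bar>" if d: "d \<in> H" and s: "s \<le> 0" "s' \<le> 0" for d s s'
    proof -
      have "\<bar>u0 d (- s) - u0 d (- s')\<bar> \<le> L0 * \<bar>s - s'\<bar>"
        using u0L[OF d, of "- s" "- s'"] by (simp add: abs_minus_commute)
      also have "\<dots> \<le> L' * \<bar>s - s'\<bar>" using L(1) N0 by (intro mult_right_mono) (auto simp: L'_def)
      finally have "\<bar>u0 d (- s) - u0 d (- s')\<bar> \<le> L' * \<bar>s - s'\<bar>" .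
      moreover have "W d s - W d s' = (u0 d (- s) - u0 d (- s')) / 2" using d s by (simp add: waveD(3)[OF w] diff_divide_distrib)
      ultimately show ?thesis by simp
    qed
    have mix: "\<bar>W d s - W d s'\<bar> \<le> L' * \<bar>s - s'\<bar>"
      if d: "d \<in> H" and s: "s \<le> 0" "0 \<le> s'" "s' \<le> real (Suc n) * lmin" "s' \<le> \<Theta>" for d s s'
    proof -
      have "\<bar>W d s - W d 0\<bar> \<le> L' * \<bar>s - 0\<bar>" by (rule neg[OF d]) (use s in auto)
      moreover have "\<bar>W d 0 - W d s'\<bar> \<le> L' * \<bar>0 - s'\<bar>" by (rule pos[OF d]) (use s \<Theta> lmin in auto)
      moreover have "L' * \<bar>s - s'\<bar> = L' * \<bar>s - 0\<bar> + L' * \<bar>0 - s'\<bar>"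
        using s by (simp add: algebra_simps)
      ultimately show ?thesis by linarith
    qed
    have "\<bar>W d s - W d s'\<bar> \<le> L' * \<bar>s - s'\<bar>"
      if d: "d \<in> H" and s: "s \<le> real (Suc n) * lmin" "s' \<le> real (Suc n) * lmin" "s \<le> \<Theta>" "s' \<le> \<Theta>" for d s s'
      using pos[OF d, of s s'] neg[OF d, of s s'] mix[OF d, of s s'] mix[OF d, of s' s] s
      by (cases "s \<le> 0"; cases "s' \<le> 0") (auto simp: abs_minus_commute)
    moreover have "L' \<ge> 0" using L N0 L0 by (simp add: L'_def)
    ultimately show ?case by blast
  qed
  obtain n where n: "\<Theta> \<le> real n * lmin" using lmin ex_less_of_nat_mult[of lmin \<Theta>] by (auto intro: less_imp_le)
  obtain L where L: "L \<ge> 0" "\<And>d s s'. d \<in> H \<Longrightarrow> s \<le> \<Theta> \<Longrightarrow> s' \<le> \<Theta> \<Longrightarrow> \<bar>W d s - W d s'\<bar> \<le> L * \<bar>s - s'\<bar>"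
    using WL[of n] n by (meson order_trans)
  show ?thesis
  proof (rule that[of "2 * L + N"])
    show "2 * L + N \<ge> 0" using L N0 by simp
    fix d x y s t assume d: "d \<in> H" and x: "x \<in> {0..l d}" "y \<in> {0..l d}" and s: "s \<in> {0..\<Theta>}" "t \<in> {0..\<Theta>}"
    let ?e = "\<bar>x - y\<bar> + \<bar>s - t\<bar>"
    have "\<bar>W d (s - x) - W d (t - y)\<bar> \<le> L * \<bar>(s - x) - (t - y)\<bar>" by (rule L(2)[OF d]) (use x s in auto)
    also have "\<dots> \<le> L * ?e" by (rule mult_left_mono[OF _ L(1)]) linarith
    finally have 1: "\<bar>W d (s - x) - W d (t - y)\<bar> \<le> L * ?e" .
    have "\<bar>W (opp d) (s - l d + x) - W (opp d) (t - l d + y)\<bar> \<le> L * \<bar>(s - l d + x) - (t - l d + y)\<bar>"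
      by (rule L(2)[OF opp(1)[OF d]]) (use x s in auto)
    also have "\<dots> \<le> L * ?e" by (rule mult_left_mono[OF _ L(1)]) linarith
    finally have 2: "\<bar>W (opp d) (s - l d + x) - W (opp d) (t - l d + y)\<bar> \<le> L * ?e" .
    have 3: "\<bar>Nop (P d) (l d) (z d) x s - Nop (P d) (l d) (z d) y t\<bar> \<le> N * ?e" by (rule NL[OF d]) (use s in auto)
    have "z d x s - z d y t = (W d (s - x) - W d (t - y)) + (W (opp d) (s - l d + x) - W (opp d) (t - l d + y))
       + (Nop (P d) (l d) (z d) x s - Nop (P d) (l d) (z d) y t)"
      using waveD(5)[OF w d] x s by simp
    moreover have "(2 * L + N) * ?e = L * ?e + L * ?e + N * ?e" by (simp add: algebra_simps)
    ultimately show "\<bar>z d x s - z d y t\<bar> \<le> (2 * L + N) * ?e" using 1 2 3 by linarith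
  qed
qed

text \<open>Subtract the two d'Alembert formulas. Equality of the incoming waves at the node
  expresses the wave from the far end by a cone integral with apex (0, t + x). Beyond x it cancels
  against the cone of (x, t), so only the part of the edge from 0 to x remains and the far end drops
  out.\<close>

lemma edge_representation:
  assumes P: "pot P C" and Q: "pot Q C" and w: "wave P z W g K" and w': "wave Q z' W' g' K'" and d: "d \<in> H"
    and eqW: "\<And>s. s \<ge> 0 \<Longrightarrow> W d s = W' d s" and eqI: "\<And>s. s \<ge> 0 \<Longrightarrow> inc P z W d s = inc Q z' W' d s"
    and x: "x \<in> {0..l d}" and t: "t \<ge> 0"
  defines "\<zeta> \<equiv> \<lambda>x t. z d x t - z' d x t"
  shows "\<zeta> x t = 1/2 *
       (integral {0..x} (\<lambda>y. P d y * (integral {0..max 0 (t + x - y)} (\<zeta> y) - integral {0..max 0 (t - x + y)} (\<zeta> y)))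
      + integral {0..x} (\<lambda>y. (P d y - Q d y) * (integral {0..max 0 (t + x - y)} (z' d y) - integral {0..max 0 (t - x + y)} (z' d y))))"
proof -
  have cz: "continuous_on UNIV (\<lambda>(x, t). z d x t)" "continuous_on UNIV (\<lambda>(x, t). z' d x t)"
    using waveD(1)[OF w d] waveD(1)[OF w' d] .
  have c\<zeta>: "continuous_on UNIV (\<lambda>(x, t). \<zeta> x t)"
    using continuous_on_diff[OF cz] by (simp add: \<zeta>_def case_prod_unfold)
  have bp: "bdm (P d) C" "bdm (Q d) C" using potD(1)[OF P d] potD(1)[OF Q d] .
  have bf: "bdm (\<lambda>y. P d y - Q d y) (2 * C)"
    by (rule bdm_diff[OF bp])
  have iz: "z d y integrable_on {a..b}" "z' d y integrable_on {a..b}" for y a b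
    by (intro integrable_continuous_interval continuous_section(1)[OF cz(1)] continuous_section(1)[OF cz(2)])+
  define G where "G c = integral {0..l d} (\<lambda>y. P d y * integral {0..max 0 (c y)} (\<zeta> y))
      + integral {0..l d} (\<lambda>y. (P d y - Q d y) * integral {0..max 0 (c y)} (z' d y))" for c :: "real \<Rightarrow> real"
  \<comment> \<open>The sources are split as P z - Q z' = P (z - z') + (P - Q) z'.\<close>
  have Nd: "Nop (P d) (l d) (z d) x t - Nop (Q d) (l d) (z' d) x t = - (1/2) * G (\<lambda>y. t - \<bar>x - y\<bar>)" for x t
  proof -
    let ?c = "\<lambda>y. max 0 (t - \<bar>x - y\<bar>)"
    have cc: "continuous_on {0..l d} (\<lambda>y. t - \<bar>x - y\<bar>)" by (intro continuous_intros)
    note cm = continuous_cone_primitive[OF cz(1) cc] continuous_cone_primitive[OF cz(2) cc] continuous_cone_primitive[OF c\<zeta> cc]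
    have I: "integral {0..?c y} (\<zeta> y) = integral {0..?c y} (z d y) - integral {0..?c y} (z' d y)" for y
      unfolding \<zeta>_def by (intro Henstock_Kurzweil_Integration.integral_diff iz)
    have eq: "(\<lambda>y. P d y * integral {0..?c y} (z d y) - Q d y * integral {0..?c y} (z' d y))
       = (\<lambda>y. P d y * integral {0..?c y} (\<zeta> y) + (P d y - Q d y) * integral {0..?c y} (z' d y))"
      unfolding I by (rule ext) (simp add: algebra_simps)
    have "integral {0..l d} (\<lambda>y. P d y * integral {0..?c y} (z d y)) - integral {0..l d} (\<lambda>y. Q d y * integral {0..?c y} (z' d y))
      = integral {0..l d} (\<lambda>y. P d y * integral {0..?c y} (z d y) - Q d y * integral {0..?c y} (z' d y))"
      by (rule Henstock_Kurzweil_Integration.integral_diff[symmetric, OF bdm_mult_integrable(2)[OF bp(1) cm(1)] bdm_mult_integrable(2)[OF bp(2) cm(2)]])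
    also have "\<dots> = G (\<lambda>y. t - \<bar>x - y\<bar>)"
      unfolding eq G_def
      by (rule Henstock_Kurzweil_Integration.integral_add[OF bdm_mult_integrable(2)[OF bp(1) cm(3)] bdm_mult_integrable(2)[OF bf cm(2)]])
    finally have "integral {0..l d} (\<lambda>y. P d y * integral {0..?c y} (z d y)) - integral {0..l d} (\<lambda>y. Q d y * integral {0..?c y} (z' d y))
      = G (\<lambda>y. t - \<bar>x - y\<bar>)" .
    then show ?thesis by (simp add: Nop_def)
  qed
  have split: "integral {0..l d} (\<lambda>y. q y * integral {0..max 0 (t + x - y)} (v y)) - integral {0..l d} (\<lambda>y. q y * integral {0..max 0 (t - \<bar>x - y\<bar>)} (v y))
     = integral {0..x} (\<lambda>y. q y * (integral {0..max 0 (t + x - y)} (v y) - integral {0..max 0 (t - x + y)} (v y)))"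
    if q: "bdm q D" and v: "continuous_on UNIV (\<lambda>(x, t). v x t)" for q D v
  proof -
    have i: "(\<lambda>y. q y * integral {0..max 0 (c y)} (v y)) integrable_on {a..b}" if "continuous_on {a..b} c" for c a b
      by (intro bdm_mult_integrable(2)[OF q] continuous_cone_primitive[OF v] that)
    have s1: "integral {0..l d} (\<lambda>y. q y * integral {0..max 0 (c y)} (v y)) = integral {0..x} (\<lambda>y. q y * integral {0..max 0 (c y)} (v y))
       + integral {x..l d} (\<lambda>y. q y * integral {0..max 0 (c y)} (v y))" if "continuous_on {0..l d} c" for c
      using x by (intro Henstock_Kurzweil_Integration.integral_combine[symmetric] i that) auto
    have "integral {x..l d} (\<lambda>y. q y * integral {0..max 0 (t + x - y)} (v y)) = integral {x..l d} (\<lambda>y. q y * integral {0..max 0 (t - \<bar>x - y\<bar>)} (v y))"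
      by (rule integral_cong) (auto simp: algebra_simps)
    moreover have "integral {0..x} (\<lambda>y. q y * integral {0..max 0 (t - \<bar>x - y\<bar>)} (v y)) = integral {0..x} (\<lambda>y. q y * integral {0..max 0 (t - x + y)} (v y))"
      by (rule integral_cong) (auto simp: algebra_simps)
    moreover have "integral {0..x} (\<lambda>y. q y * (integral {0..max 0 (t + x - y)} (v y) - integral {0..max 0 (t - x + y)} (v y)))
      = integral {0..x} (\<lambda>y. q y * integral {0..max 0 (t + x - y)} (v y)) - integral {0..x} (\<lambda>y. q y * integral {0..max 0 (t - x + y)} (v y))"
      unfolding right_diff_distrib by (intro Henstock_Kurzweil_Integration.integral_diff i continuous_intros)
    moreover have "continuous_on {0..l d} (\<lambda>y. t + x - y)" "continuous_on {0..l d} (\<lambda>y. t - \<bar>x - y\<bar>)"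
      by (intro continuous_intros)+
    ultimately show ?thesis using s1[of "\<lambda>y. t + x - y"] s1[of "\<lambda>y. t - \<bar>x - y\<bar>"] by linarith
  qed
  have W0: "W d s = W' d s" for s
    using eqW[of s] waveD(3)[OF w d, of s] waveD(3)[OF w' d, of s] by (cases "s \<ge> 0") auto
  have eI: "W (opp d) (t + x - l d) - W' (opp d) (t + x - l d) = - (Nop (P d) (l d) (z d) 0 (t + x) - Nop (Q d) (l d) (z' d) 0 (t + x))"
    using eqI[of "t + x"] x t by (simp add: inc_def)
  have "\<zeta> x t = (W (opp d) (t - l d + x) - W' (opp d) (t - l d + x)) + (Nop (P d) (l d) (z d) x t - Nop (Q d) (l d) (z' d) x t)"
    using waveD(5)[OF w d x t] waveD(5)[OF w' d x t] W0 by (simp add: \<zeta>_def)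
  also have "W (opp d) (t - l d + x) - W' (opp d) (t - l d + x) = 1/2 * G (\<lambda>y. t + x - \<bar>0 - y\<bar>)"
    using eI unfolding Nd by (simp add: algebra_simps)
  also have "G (\<lambda>y. t + x - \<bar>0 - y\<bar>) = G (\<lambda>y. t + x - y)"
    unfolding G_def by (intro arg_cong2[of _ _ _ _ "(+)"] integral_cong) auto
  finally have "\<zeta> x t = 1/2 * (G (\<lambda>y. t + x - y) - G (\<lambda>y. t - \<bar>x - y\<bar>))" unfolding Nd by simp
  also have "G (\<lambda>y. t + x - y) - G (\<lambda>y. t - \<bar>x - y\<bar>) =
     (integral {0..x} (\<lambda>y. P d y * (integral {0..max 0 (t + x - y)} (\<zeta> y) - integral {0..max 0 (t - x + y)} (\<zeta> y)))
      + integral {0..x} (\<lambda>y. (P d y - Q d y) * (integral {0..max 0 (t + x - y)} (z' d y) - integral {0..max 0 (t - x + y)} (z' d y))))"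
    unfolding split[OF bp(1) c\<zeta>, symmetric] split[OF bf cz(2), symmetric] G_def by simp
  finally show ?thesis .
qed

text \<open>\<open>sideways_uniqueness\<close> holds for every large \<open>\<Theta>\<close>, so the
  two waves agree on the edge at all times. The Duhamel terms then agree as well, and this passes
  the equality of outgoing and incoming waves on to the far end.\<close>

lemma edge_uniqueness:
  assumes P: "pot P C" and Q: "pot Q C" and w: "wave P z W g K" and w': "wave Q z' W' g' K'" and d: "d \<in> H"
    and g: "g > 0" "K \<ge> 0" "g' > 0" "K' \<ge> 0"
    and eqW: "\<And>s. s \<ge> 0 \<Longrightarrow> W d s = W' d s" and eqI: "\<And>s. s \<ge> 0 \<Longrightarrow> inc P z W d s = inc Q z' W' d s"
    and u0L: "\<And>d x y. d \<in> H \<Longrightarrow> \<bar>u0 d x - u0 d y\<bar> \<le> L0 * \<bar>x - y\<bar>" and L0: "L0 \<ge> 0"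
    and r: "r > 0" "\<And>d x. d \<in> H \<Longrightarrow> x \<in> {0..l d} \<Longrightarrow> \<bar>u0 d x\<bar> \<ge> r"
  shows "AE x in lborel. x \<in> {0..l d} \<longrightarrow> P d x = Q d x"
    and "\<And>s. s \<ge> 0 \<Longrightarrow> W (opp d) s = W' (opp d) s"
    and "\<And>s. s \<ge> 0 \<Longrightarrow> inc P z W (opp d) s = inc Q z' W' (opp d) s"
proof -
  have cz: "continuous_on UNIV (\<lambda>(x, t). z d x t)" "continuous_on UNIV (\<lambda>(x, t). z' d x t)"
    using waveD(1)[OF w d] waveD(1)[OF w' d] .
  define \<zeta> where "\<zeta> = (\<lambda>x t. z d x t - z' d x t)"
  have c\<zeta>: "continuous_on UNIV (\<lambda>(x, t). \<zeta> x t)"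
    using continuous_on_diff[OF cz] by (simp add: \<zeta>_def case_prod_unfold)
  have bp: "bdm (P d) C" "bdm (Q d) C" using potD(1)[OF P d] potD(1)[OF Q d] .
  have bf: "bdm (\<lambda>y. P d y - Q d y) (2 * C)"
    by (rule bdm_diff[OF bp])
  have both: "(\<forall>x\<in>{0..l d}. integral {0..x} (\<lambda>y. P d y - Q d y) = 0) \<and> (\<forall>x\<in>{0..l d}. \<forall>t\<ge>0. x + t \<le> \<Theta> \<longrightarrow> \<zeta> x t = 0)"
    if \<Theta>: "\<Theta> \<ge> l d" for \<Theta>
  proof -
    have \<Theta>0: "\<Theta> \<ge> 0" using \<Theta> l_pos[OF d] by simp
    obtain L where L: "L \<ge> 0" "\<And>x y s t. x \<in> {0..l d} \<Longrightarrow> y \<in> {0..l d} \<Longrightarrow> s \<in> {0..\<Theta>} \<Longrightarrow> t \<in> {0..\<Theta>} \<Longrightarrow>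
       \<bar>z d x s - z d y t\<bar> \<le> L * (\<bar>x - y\<bar> + \<bar>s - t\<bar>)"
      by (rule wave_lipschitz[OF P w g(1,2) u0L L0 \<Theta>0]) (use d in blast)+
    obtain L' where L': "L' \<ge> 0" "\<And>x y s t. x \<in> {0..l d} \<Longrightarrow> y \<in> {0..l d} \<Longrightarrow> s \<in> {0..\<Theta>} \<Longrightarrow> t \<in> {0..\<Theta>} \<Longrightarrow>
       \<bar>z' d x s - z' d y t\<bar> \<le> L' * (\<bar>x - y\<bar> + \<bar>s - t\<bar>)"
      by (rule wave_lipschitz[OF Q w' g(3,4) u0L L0 \<Theta>0]) (use d in blast)+
    have A: "\<bar>z' d x s - z' d y t\<bar> \<le> (L + L') * (\<bar>x - y\<bar> + \<bar>s - t\<bar>)"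
      if "x \<in> {0..l d}" "y \<in> {0..l d}" "s \<in> {0..\<Theta>}" "t \<in> {0..\<Theta>}" for x y s t
      using L'(2)[OF that] mult_nonneg_nonneg[OF L(1), of "\<bar>x - y\<bar> + \<bar>s - t\<bar>"] by (simp add: distrib_right)
    have B: "\<bar>\<zeta> x s - \<zeta> x t\<bar> \<le> (L + L') * \<bar>s - t\<bar>"
      if "x \<in> {0..l d}" "s \<in> {0..\<Theta>}" "t \<in> {0..\<Theta>}" for x s t
      using L(2)[OF that(1,1,2,3)] L'(2)[OF that(1,1,2,3)] by (simp add: \<zeta>_def distrib_right)
    have C: "\<zeta> x 0 = 0" if "x \<in> {0..l d}" for x
      using wave_initial[OF w d that] wave_initial[OF w' d that] by (simp add: \<zeta>_def)
    have D: "r \<le> \<bar>z' d x 0\<bar>" if "x \<in> {0..l d}" for x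
      using wave_initial[OF w' d that] r(2)[OF d that] by simp
    have rep: "\<zeta> x t = 1/2 *
       (integral {0..x} (\<lambda>y. P d y * (integral {0..max 0 (t + x - y)} (\<zeta> y) - integral {0..max 0 (t - x + y)} (\<zeta> y)))
      + integral {0..x} (\<lambda>y. (P d y - Q d y) * (integral {0..max 0 (t + x - y)} (z' d y) - integral {0..max 0 (t - x + y)} (z' d y))))"
      if "x \<in> {0..l d}" "t \<ge> 0" for x t
      unfolding \<zeta>_def by (rule edge_representation[OF P Q w w' d eqW eqI that])
    note sw = sideways_uniqueness[OF l_pos[OF d] \<Theta> bp(1) bf cz(2) c\<zeta> A B _ rep C r(1) D]
    show ?thesis using sw L(1) L'(1) by auto
  qed
  have Fz: "integral {0..x} (\<lambda>y. P d y - Q d y) = 0" if "x \<in> {0..l d}" for x using both[of "l d"] that by auto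
  have z0: "z d x t = z' d x t" if "x \<in> {0..l d}" "t \<ge> 0" for x t
    using both[of "l d + t"] that by (auto simp: \<zeta>_def)
  show AE: "AE x in lborel. x \<in> {0..l d} \<longrightarrow> P d x = Q d x"
    using AE_eq_0_if_integrals_eq_0[OF bf Fz] by simp
  have N: "Nop (P d) (l d) (z d) x t = Nop (Q d) (l d) (z' d) x t" for x t
  proof -
    have "integral {0..l d} (\<lambda>y. P d y * integral {0..max 0 (t - \<bar>x - y\<bar>)} (z d y))
        = integral {0..l d} (\<lambda>y. Q d y * integral {0..max 0 (t - \<bar>x - y\<bar>)} (z' d y))"
    proof (rule integral_cong_AE_lborel)
      have e: "integral {0..c} (z d y) = integral {0..c} (z' d y)" if "y \<in> {0..l d}" for c y
        by (rule integral_cong) (use z0[OF that] in auto)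
      show "AE y in lborel. y \<in> {0..l d} \<longrightarrow> P d y * integral {0..max 0 (t - \<bar>x - y\<bar>)} (z d y)
           = Q d y * integral {0..max 0 (t - \<bar>x - y\<bar>)} (z' d y)"
        using AE by eventually_elim (simp add: e)
    qed
    then show ?thesis by (simp add: Nop_def)
  qed
  have W0: "W d s = W' d s" for s
    using eqW[of s] waveD(3)[OF w d, of s] waveD(3)[OF w' d, of s] by (cases "s \<ge> 0") auto
  show "W (opp d) s = W' (opp d) s" if "s \<ge> 0" for s
    using eqI[of "s + l d"] that l_pos[OF d] N by (simp add: inc_def)
  show "inc P z W (opp d) s = inc Q z' W' (opp d) s" for s
  proof -
    have "Nop (P (opp d)) (l d) (z (opp d)) 0 s = Nop (P d) (l d) (z d) (l d - 0) s"
      by (rule Nop_reflect[OF bp(1) cz(1)]) (use potD(2)[OF P d] waveD(4)[OF w d] l_pos[OF d] in auto)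
    moreover have "Nop (Q (opp d)) (l d) (z' (opp d)) 0 s = Nop (Q d) (l d) (z' d) (l d - 0) s"
      by (rule Nop_reflect[OF bp(2) cz(2)]) (use potD(2)[OF Q d] waveD(4)[OF w' d] l_pos[OF d] in auto)
    ultimately show ?thesis using opp[OF d] W0 N by (simp add: inc_def)
  qed
qed

end


subsection \<open>Truncated Laplace transforms\<close>

lemma exp_partial_sum_bound:
  fixes v :: real
  assumes "v \<ge> 0"
  shows "(\<Sum>n<m. v ^ Suc n / fact (Suc n)) \<le> exp v - 1"
proof -
  have "(\<Sum>n<m. v ^ Suc n / fact (Suc n)) = (\<Sum>n<Suc m. v ^ n / fact n) - 1"
    by (simp add: sum.lessThan_Suc_shift del: sum.lessThan_Suc)
  also have "(\<Sum>n<Suc m. v ^ n / fact n) \<le> exp v"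
  proof -
    have "(\<Sum>n<Suc m. v ^ n / fact n) \<le> (\<Sum>n. v ^ n / fact n)"
      using assms summable_exp[of v] by (intro sum_le_suminf) (auto simp: divide_inverse mult.commute)
    then show ?thesis by (simp add: exp_def divide_inverse mult.commute)
  qed
  finally show ?thesis by simp
qed

text \<open>The kernel \<open>1 - exp (- exp (k * (t - s)))\<close> tends to the indicator of \<open>s < t\<close>, and its
expansion in powers of \<open>exp (k * (t - s))\<close> only involves the Laplace transform at the points
\<open>k, 2 * k, 3 * k, \<dots>\<close>.\<close>

lemma laplace_small_imp_zero:
  fixes h :: "real \<Rightarrow> real"
  assumes h: "continuous_on UNIV h" and a: "0 < a" "a \<le> N"
    and small: "\<And>k. k \<ge> k0 \<Longrightarrow> \<bar>integral {0..N} (\<lambda>s. exp (- k * s) * h s)\<bar> \<le> C * exp (- k * a)"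
    and t: "t \<in> {0..<a}"
  shows "h t = 0"
proof -
  have C0: "C \<ge> 0"
  proof -
    have "0 \<le> C * exp (- k0 * a)" using small[of k0] abs_ge_zero order_trans by blast
    then show ?thesis by (simp add: zero_le_mult_iff)
  qed
  have ch: "continuous_on A h" for A using h continuous_on_subset by blast
  define E where "E k t s = 1 - exp (- exp (k * (t - s)))" for k t s :: real
  have cE: "continuous_on A (E k t)" for A k t unfolding E_def by (intro continuous_intros)
  \<comment> \<open>The n-th term of the expansion is integrated by the assumption at the point (n +
    1) k. The factors exp ((n + 1) k t) and exp (- (n + 1) k a) combine, and the series sums to a
    bound that tends to 0 for t < a as k grows.\<close>
  have est: "\<bar>integral {0..N} (\<lambda>s. E k t s * h s)\<bar> \<le> C * (exp (exp (- k * (a - t))) - 1)"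
    if k: "k \<ge> k0" "k \<ge> 0" and t: "t \<ge> 0" for k t
  proof -
    define S where "S m s = (\<Sum>n<m. (-1) ^ n / fact (Suc n) * exp (k * (t - s)) ^ Suc n)" for m s
    have S_lim: "(\<lambda>m. S m s * h s) \<longlonglongrightarrow> E k t s * h s" for s
    proof -
      let ?v = "exp (k * (t - s))"
      have "(\<lambda>n. inverse (fact n) * (- ?v) ^ n) sums exp (- ?v)"
        using exp_converges[of "- ?v"] by simp
      then have "(\<lambda>n. inverse (fact (Suc n)) * (- ?v) ^ Suc n) sums (exp (- ?v) - 1)"
        by (subst sums_Suc_iff) simp
      then have "(\<lambda>n. - (inverse (fact (Suc n)) * (- ?v) ^ Suc n)) sums - (exp (- ?v) - 1)" by (rule sums_minus)
      moreover have "- (inverse (fact (Suc n)) * (- ?v) ^ Suc n) = (-1) ^ n / fact (Suc n) * ?v ^ Suc n" for n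
        by (simp add: power_minus[of ?v] divide_inverse)
      ultimately have "(\<lambda>m. S m s) \<longlonglongrightarrow> E k t s" by (simp add: sums_def S_def E_def)
      then show ?thesis by (intro tendsto_mult tendsto_const)
    qed
    have S_bound: "\<bar>S m s\<bar> \<le> exp (exp (k * t))" if "s \<in> {0..N}" for m s
    proof -
      have "\<bar>S m s\<bar> \<le> (\<Sum>n<m. \<bar>(-1) ^ n / fact (Suc n) * exp (k * (t - s)) ^ Suc n\<bar>)"
        unfolding S_def by (rule sum_abs)
      also have "\<dots> = (\<Sum>n<m. exp (k * (t - s)) ^ Suc n / fact (Suc n))"
        by (intro sum.cong) (auto simp: abs_mult power_abs)
      also have "\<dots> \<le> exp (exp (k * (t - s))) - 1" by (rule exp_partial_sum_bound) simp
      also have "\<dots> \<le> exp (exp (k * t))"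
      proof -
        have "k * (t - s) \<le> k * t" using k that by (intro mult_left_mono) auto
        then have "exp (exp (k * (t - s))) \<le> exp (exp (k * t))" by simp
        then show ?thesis by linarith
      qed
      finally show ?thesis .
    qed
    have cS: "continuous_on A (S m)" for A m unfolding S_def by (intro continuous_intros)
    obtain B where B: "\<And>s. s \<in> {0..N} \<Longrightarrow> \<bar>h s\<bar> \<le> B"
      using compact_imp_bounded[OF compact_continuous_image[OF ch compact_Icc, of 0 N]] unfolding bounded_iff by fastforce
    have lim: "(\<lambda>m. integral {0..N} (\<lambda>s. S m s * h s)) \<longlonglongrightarrow> integral {0..N} (\<lambda>s. E k t s * h s)"
    proof (rule dominated_convergence(2)[where h = "\<lambda>_. exp (exp (k * t)) * B"])
      show "(\<lambda>s. S m s * h s) integrable_on {0..N}" for m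
        by (intro integrable_continuous_interval continuous_on_mult cS ch)
      show "norm (S m s * h s) \<le> exp (exp (k * t)) * B" if "s \<in> {0..N}" for m s
        using mult_mono[OF S_bound[OF that] B[OF that]] by (simp add: abs_mult)
    qed (use S_lim in auto)
    have bound: "\<bar>integral {0..N} (\<lambda>s. S m s * h s)\<bar> \<le> C * (exp (exp (- k * (a - t))) - 1)" for m
    proof -
      let ?I = "\<lambda>n. integral {0..N} (\<lambda>s. exp (- (real (Suc n) * k) * s) * h s)"
      have "(\<lambda>s. S m s * h s) = (\<lambda>s. \<Sum>n<m. ((-1) ^ n / fact (Suc n) * exp (real (Suc n) * k * t)) * (exp (- (real (Suc n) * k) * s) * h s))"
      proof
        fix s
        have "exp (k * (t - s)) ^ Suc n = exp (real (Suc n) * k * t) * exp (- (real (Suc n) * k) * s)" for n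
          by (simp only: exp_of_nat_mult[symmetric] exp_add[symmetric]) (simp add: algebra_simps)
        then show "S m s * h s = (\<Sum>n<m. ((-1) ^ n / fact (Suc n) * exp (real (Suc n) * k * t)) * (exp (- (real (Suc n) * k) * s) * h s))"
          unfolding S_def sum_distrib_right by (intro sum.cong) (simp_all only: mult_ac)
      qed
      then have "integral {0..N} (\<lambda>s. S m s * h s)
          = (\<Sum>n<m. integral {0..N} (\<lambda>s. ((-1) ^ n / fact (Suc n) * exp (real (Suc n) * k * t)) * (exp (- (real (Suc n) * k) * s) * h s)))"
        by (simp only:) (intro integral_sum finite_lessThan integrable_continuous_interval continuous_intros ch)
      also have "\<dots> = (\<Sum>n<m. ((-1) ^ n / fact (Suc n) * exp (real (Suc n) * k * t)) * ?I n)"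
        by (intro sum.cong refl integral_mult_right)
      also have "\<bar>\<dots>\<bar> \<le> (\<Sum>n<m. C * (exp (- k * (a - t)) ^ Suc n / fact (Suc n)))"
      proof (rule order_trans[OF sum_abs sum_mono])
        fix n
        have "real (Suc n) * k \<ge> 1 * k" using k by (intro mult_right_mono) auto
        then have "\<bar>?I n\<bar> \<le> C * exp (- (real (Suc n) * k) * a)"
          using small[of "real (Suc n) * k"] k by simp
        then have "(exp (real (Suc n) * k * t) / fact (Suc n)) * \<bar>?I n\<bar> \<le> (exp (real (Suc n) * k * t) / fact (Suc n)) * (C * exp (- (real (Suc n) * k) * a))"
          by (intro mult_left_mono) auto
        also have "\<dots> = C * (exp (real (Suc n) * k * t) * exp (- (real (Suc n) * k) * a) / fact (Suc n))"
          by simp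
        also have "exp (real (Suc n) * k * t) * exp (- (real (Suc n) * k) * a) = exp (- k * (a - t)) ^ Suc n"
          by (simp only: exp_of_nat_mult[symmetric] exp_add[symmetric]) (simp add: algebra_simps)
        finally show "\<bar>(-1) ^ n / fact (Suc n) * exp (real (Suc n) * k * t) * ?I n\<bar> \<le> C * (exp (- k * (a - t)) ^ Suc n / fact (Suc n))"
          by (simp only: abs_mult abs_divide power_abs) simp
      qed
      also have "\<dots> \<le> C * (exp (exp (- k * (a - t))) - 1)"
        unfolding sum_distrib_left[symmetric] using C0 by (intro mult_left_mono exp_partial_sum_bound) auto
      finally show ?thesis .
    qed
    have "(\<lambda>m. \<bar>integral {0..N} (\<lambda>s. S m s * h s)\<bar>) \<longlonglongrightarrow> \<bar>integral {0..N} (\<lambda>s. E k t s * h s)\<bar>"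
      by (intro tendsto_rabs lim)
    then show ?thesis by (rule tendsto_upperbound) (use bound in auto)
  qed
  have prim: "integral {0..t} h = 0" if t: "0 \<le> t" "t < a" for t
  proof -
    \<comment> \<open>The limit of the kernel as k grows. At s = t it has the constant value 1 - exp
      (- 1), and a single point does not affect the integral.\<close>
    define G where "G s = (if s < t then h s else if s = t then (1 - exp (- 1)) * h s else 0)" for s
    have "(\<lambda>n. integral {0..N} (\<lambda>s. E (real n) t s * h s)) \<longlonglongrightarrow> integral {0..N} G"
    proof (rule dominated_convergence(2)[where h = "\<lambda>s. \<bar>h s\<bar>"])
      show "(\<lambda>s. E (real n) t s * h s) integrable_on {0..N}" for n
        by (intro integrable_continuous_interval continuous_on_mult cE ch)
      show "(\<lambda>s. \<bar>h s\<bar>) integrable_on {0..N}"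
        by (intro integrable_continuous_interval continuous_intros ch)
      have "\<bar>E k t s\<bar> \<le> 1" for k s by (simp add: E_def abs_le_iff)
      then show "norm (E (real n) t s * h s) \<le> \<bar>h s\<bar>" for n s
        by (simp add: abs_mult mult_left_le_one_le)
      show "(\<lambda>n. E (real n) t s * h s) \<longlonglongrightarrow> G s" for s
      proof -
        consider "s < t" | "s = t" | "s > t" by linarith
        then show ?thesis
        proof cases
          case 1
          have "filterlim (\<lambda>n. exp (real n * (t - s))) at_top sequentially"
            using 1 by (intro filterlim_compose[OF exp_at_top] filterlim_at_top_mult_tendsto_pos[OF tendsto_const _ filterlim_real_sequentially, of "t - s", simplified mult.commute]) auto
          then have "(\<lambda>n. exp (- exp (real n * (t - s)))) \<longlonglongrightarrow> 0"
            by (intro filterlim_compose[OF exp_at_bot] filterlim_compose[OF filterlim_uminus_at_bot_at_top])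
          then have "(\<lambda>n. E (real n) t s * h s) \<longlonglongrightarrow> (1 - 0) * h s"
            unfolding E_def by (intro tendsto_intros)
          then show ?thesis using 1 by (simp add: G_def)
        next
          case 2
          then show ?thesis by (simp add: G_def E_def)
        next
          case 3
          have "filterlim (\<lambda>n. real n * (s - t)) at_top sequentially"
            using 3 by (intro filterlim_at_top_mult_tendsto_pos[OF tendsto_const _ filterlim_real_sequentially, of "s - t", simplified mult.commute]) auto
          then have "(\<lambda>n. exp (- (real n * (s - t)))) \<longlonglongrightarrow> 0"
            by (intro filterlim_compose[OF exp_at_bot] filterlim_compose[OF filterlim_uminus_at_bot_at_top])
          then have "(\<lambda>n. (1 - exp (- exp (- (real n * (s - t))))) * h s) \<longlonglongrightarrow> (1 - exp (- 0)) * h s"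
            by (intro tendsto_intros)
          moreover have "- (real n * (s - t)) = real n * (t - s)" for n by (simp add: algebra_simps)
          ultimately show ?thesis using 3 by (simp add: G_def E_def)
        qed
      qed
    qed
    moreover have "(\<lambda>n. integral {0..N} (\<lambda>s. E (real n) t s * h s)) \<longlonglongrightarrow> 0"
    proof (rule Lim_null_comparison)
      show "\<forall>\<^sub>F n in sequentially. norm (integral {0..N} (\<lambda>s. E (real n) t s * h s)) \<le> C * (exp (exp (- real n * (a - t))) - 1)"
        using eventually_ge_at_top[of "nat \<lceil>k0\<rceil>"]
        by eventually_elim (use est t in \<open>auto simp: nat_le_iff ceiling_le_iff\<close>)
      have "filterlim (\<lambda>n. real n * (a - t)) at_top sequentially"
        using t by (intro filterlim_at_top_mult_tendsto_pos[OF tendsto_const _ filterlim_real_sequentially, of "a - t", simplified mult.commute]) auto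
      then have "(\<lambda>n. exp (- (real n * (a - t)))) \<longlonglongrightarrow> 0"
        by (intro filterlim_compose[OF exp_at_bot] filterlim_compose[OF filterlim_uminus_at_bot_at_top])
      then have "(\<lambda>n. C * (exp (exp (- (real n * (a - t)))) - 1)) \<longlonglongrightarrow> C * (exp 0 - 1)"
        by (intro tendsto_intros)
      then show "(\<lambda>n. C * (exp (exp (- real n * (a - t))) - 1)) \<longlonglongrightarrow> 0" by simp
    qed
    ultimately have G0: "integral {0..N} G = 0" by (rule LIMSEQ_unique)
    have "(h has_integral integral {0..t} h) {0..t}"
      by (intro integrable_integral integrable_continuous_interval ch)
    then have "((\<lambda>s. if s \<in> {0..t} then h s else 0) has_integral integral {0..t} h) {0..N}"
      using has_integral_restrict_closed_subinterval[of h "integral {0..t} h" 0 t 0 N] t a by simp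
    then have "(G has_integral integral {0..t} h) {0..N}"
      by (rule has_integral_spike[of "{t}", rotated 2]) (auto simp: G_def)
    then show ?thesis using G0 by (simp add: integral_unique)
  qed
  show ?thesis
  proof -
    have "((\<lambda>t. integral {0..t} h) has_real_derivative h t) (at t within {0..a})"
      using t by (intro integral_has_real_derivative ch) auto
    moreover have "((\<lambda>t. integral {0..t} h) has_real_derivative 0) (at t within {0..a})"
    proof (rule has_field_derivative_transform_within[where d = "a - t" and f = "\<lambda>_. 0"])
      show "0 = integral {0..s} h" if "s \<in> {0..a}" "dist s t < a - t" for s
        using prim[of s] that t by (auto simp: dist_real_def)
    qed (use t in auto)
    moreover have "at t within {0..a} \<noteq> bot" using t a by (simp add: trivial_limit_within islimpt_Icc)
    ultimately show ?thesis using has_field_derivative_unique by blast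
  qed
qed


lemma integral_exp_minus_le:
  fixes V :: "real \<Rightarrow> real"
  assumes V: "continuous_on UNIV V" and b: "\<And>s. s \<in> {u..v} \<Longrightarrow> \<bar>V s\<bar> \<le> K * exp (g * s)"
    and uv: "u \<le> v" and k: "k \<ge> g" and K: "K \<ge> 0"
  shows "\<bar>integral {u..v} (\<lambda>s. exp (- k * s) * V s)\<bar> \<le> K * exp (- (k - g) * u) * (v - u)"
proof (rule abs_integral_le_const)
  show "(\<lambda>s. exp (- k * s) * V s) integrable_on {u..v}"
    by (intro integrable_continuous_interval continuous_intros continuous_on_subset[OF V]) auto
  fix s assume s: "s \<in> {u..v}"
  have "\<bar>exp (- k * s) * V s\<bar> \<le> exp (- k * s) * (K * exp (g * s))"
    unfolding abs_mult using b[OF s] by (intro mult_mono) auto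
  also have "\<dots> = K * exp (- (k - g) * s)" by (simp add: exp_add[symmetric] algebra_simps)
  also have "\<dots> \<le> K * exp (- (k - g) * u)"
    using s k K mult_left_mono_neg[of u s "g - k"] by (intro mult_left_mono) auto
  finally show "\<bar>exp (- k * s) * V s\<bar> \<le> K * exp (- (k - g) * u)" .
qed (rule uv)

text \<open>A delay multiplies the transform by exp (- k x). There are two corrections: the past
  from - x to 0 enters, and the last stretch of length x is lost through truncation.\<close>

lemma laplace_shift:
  fixes V :: "real \<Rightarrow> real"
  assumes V: "continuous_on UNIV V" and x: "0 \<le> x" "x \<le> N"
  shows "integral {0..N} (\<lambda>t. exp (- k * t) * V (t - x)) = exp (- k * x) *
    (integral {0..N} (\<lambda>s. exp (- k * s) * V s) + integral {-x..0} (\<lambda>s. exp (- k * s) * V s)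
      - integral {N-x..N} (\<lambda>s. exp (- k * s) * V s))"
proof -
  let ?F = "\<lambda>s. exp (- k * s) * V s"
  have i: "?F integrable_on {u..v}" for u v
    by (intro integrable_continuous_interval continuous_intros continuous_on_subset[OF V]) auto
  have "integral {0..N} (\<lambda>t. exp (- k * t) * V (t - x)) = integral {0..N} (\<lambda>t. exp (- k * x) * (?F \<circ> (+) (- x)) t)"
  proof (rule integral_cong)
    fix t
    have "exp (- k * t) = exp (- k * x) * exp (- k * (t - x))"
      by (simp only: exp_add[symmetric]) (simp add: algebra_simps)
    then show "exp (- k * t) * V (t - x) = exp (- k * x) * (?F \<circ> (+) (- x)) t"
      by simp
  qed
  also have "\<dots> = exp (- k * x) * integral {0 + (- x)..N + (- x)} ?F"
    unfolding integral_mult_right integral_shift_Icc_real ..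
  also have "integral {0 + (- x)..N + (- x)} ?F = integral {-x..0} ?F + integral {0..N - x} ?F"
    using Henstock_Kurzweil_Integration.integral_combine[of "-x" 0 "N - x" ?F] i x by simp
  also have "integral {0..N - x} ?F = integral {0..N} ?F - integral {N-x..N} ?F"
    using Henstock_Kurzweil_Integration.integral_combine[of 0 "N - x" N ?F] i x by simp
  finally show ?thesis by (simp add: algebra_simps)
qed

text \<open>For the full transform, integration in time divides by k and the delay multiplies by exp
  (- k a). Truncation at N leaves terms at times not before N - A, where a function of growth exp (g
  t) has been damped to exp (- (k - g) (N - A)).\<close>

lemma laplace_time_primitive:
  fixes V :: "real \<Rightarrow> real"
  assumes V: "continuous_on UNIV V" and b: "\<And>s. s \<ge> 0 \<Longrightarrow> \<bar>V s\<bar> \<le> K * exp (g * s)"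
    and a: "0 \<le> a" "a \<le> A" "A \<le> N" and k: "k \<ge> g" "k \<ge> 1" and g: "g \<ge> 1" and K: "K \<ge> 0"
  shows "\<bar>integral {0..N} (\<lambda>t. exp (- k * t) * integral {0..max 0 (t - a)} V)
      - exp (- k * a) * integral {0..N} (\<lambda>s. exp (- k * s) * V s) / k\<bar> \<le> K * (A + 1) * exp (- (k - g) * (N - A))"
proof -
  let ?F = "\<lambda>s. exp (- k * s) * V s"
  have iF: "?F integrable_on {u..v}" for u v
    by (intro integrable_continuous_interval continuous_intros continuous_on_subset[OF V]) auto
  have iV: "V integrable_on {u..v}" for u v
    by (intro integrable_continuous_interval continuous_on_subset[OF V]) auto
  define m where "m t = integral {0..max 0 t} V" for t
  have cm: "continuous_on UNIV m"
  proof -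
    have "continuous_on UNIV (\<lambda>(x::real, t). V t)"
      unfolding case_prod_unfold by (intro continuous_on_compose2[OF V] continuous_on_snd continuous_on_id) auto
    from continuous_cone_primitive[OF this continuous_on_id] show ?thesis by (simp add: m_def[abs_def])
  qed
  have m0: "m t = 0" if "t \<le> 0" for t using that by (simp add: m_def)
  have mz: "integral {-a..0} (\<lambda>s. exp (- k * s) * m s) = 0"
    by (rule integral_unique, rule has_integral_is_0) (simp add: m0)
  let ?M = "N - a"
  have M0: "?M \<ge> 0" using a by simp
  have parts: "integral {0..?M} (\<lambda>s. V s * exp (- k * s)) = m ?M * exp (- k * ?M) - m 0 * exp (- k * 0) - integral {0..?M} (\<lambda>s. m s * (- k * exp (- k * s)))"
  proof -
    obtain B where B: "\<And>s. s \<in> {0..?M} \<Longrightarrow> \<bar>V s\<bar> \<le> B"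
      using compact_imp_bounded[OF compact_continuous_image[OF continuous_on_subset[OF V] compact_Icc, of 0 ?M]]
      unfolding bounded_iff by fastforce
    show ?thesis
    proof (rule integral_mult_by_parts[where B = B])
      show "V absolutely_integrable_on {0..?M}"
        by (intro absolutely_integrable_continuous_real continuous_on_subset[OF V]) auto
      show "((\<lambda>s. exp (- k * s)) has_real_derivative - k * exp (- k * s)) (at s)" for s
        by (auto intro!: derivative_eq_intros)
      show "m s = m 0 + integral {0..s} V" if "s \<in> {0..?M}" for s using that by (simp add: m_def)
    qed (use B M0 in \<open>auto intro!: continuous_intros\<close>)
  qed
  have "integral {0..?M} (\<lambda>s. m s * (- k * exp (- k * s))) = - k * integral {0..?M} (\<lambda>s. exp (- k * s) * m s)"
    unfolding integral_mult_right[symmetric] by (rule integral_cong) simp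
  then have "integral {0..?M} ?F = m ?M * exp (- k * ?M) + k * integral {0..?M} (\<lambda>s. exp (- k * s) * m s)"
    using parts m0[of 0] by (simp add: mult.commute)
  then have Lm: "integral {0..?M} (\<lambda>s. exp (- k * s) * m s) = (integral {0..?M} ?F - m ?M * exp (- k * ?M)) / k"
    using k by (simp add: field_simps)
  have X0: "integral {0..N} (\<lambda>t. exp (- k * t) * m (t - a)) = exp (- k * a) * integral {0..?M} (\<lambda>s. exp (- k * s) * m s)"
  proof -
    have im: "(\<lambda>s. exp (- k * s) * m s) integrable_on {u..v}" for u v
      by (intro integrable_continuous_interval continuous_intros continuous_on_subset[OF cm]) auto
    show ?thesis
      using laplace_shift[OF cm, of a N k] mz a im
        Henstock_Kurzweil_Integration.integral_combine[of 0 ?M N "\<lambda>s. exp (- k * s) * m s"] by simp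
  qed
  have F: "integral {0..?M} ?F = integral {0..N} ?F - integral {?M..N} ?F"
    using Henstock_Kurzweil_Integration.integral_combine[of 0 ?M N ?F] iF a by simp
  have X: "integral {0..N} (\<lambda>t. exp (- k * t) * m (t - a))
      = exp (- k * a) * ((integral {0..N} ?F - integral {?M..N} ?F - m ?M * exp (- k * ?M)) / k)"
    unfolding X0 Lm F by (rule refl)
  have alg: "e * ((f - t - w) / k) - e * f / k = - (e / k) * (t + w)" for e f t w :: real
    by (simp add: algebra_simps diff_divide_distrib add_divide_distrib)
  have eq: "integral {0..N} (\<lambda>t. exp (- k * t) * m (t - a)) - exp (- k * a) * integral {0..N} ?F / k
      = - (exp (- k * a) / k) * (integral {?M..N} ?F + m ?M * exp (- k * ?M))"
    unfolding X by (rule alg)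
  have e0: "exp (- (k - g) * ?M) \<le> exp (- (k - g) * (N - A))"
    using a k mult_left_mono_neg[of "N - A" "N - a" "g - k"] by simp
  have "\<bar>integral {?M..N} ?F\<bar> \<le> K * exp (- (k - g) * ?M) * (N - ?M)"
    by (rule integral_exp_minus_le[OF V]) (use b a k K in auto)
  also have "\<dots> \<le> K * exp (- (k - g) * (N - A)) * A"
    using e0 a K by (intro mult_mono) auto
  finally have e1: "\<bar>integral {?M..N} ?F\<bar> \<le> K * exp (- (k - g) * (N - A)) * A" .
  have "\<bar>m ?M\<bar> \<le> K * exp (g * ?M) / g"
    using integral_exp_le[of V ?M K g] iV b g M0 K by (simp add: m_def)
  also have "\<dots> \<le> K * exp (g * ?M) / 1" using g K by (intro divide_left_mono) auto
  finally have "\<bar>m ?M * exp (- k * ?M)\<bar> \<le> (K * exp (g * ?M)) * exp (- k * ?M)"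
    by (simp add: abs_mult)
  also have "\<dots> = K * exp (- (k - g) * ?M)" by (simp add: exp_add[symmetric] algebra_simps)
  also have "\<dots> \<le> K * exp (- (k - g) * (N - A))" using e0 K by (intro mult_left_mono) auto
  finally have e2: "\<bar>m ?M * exp (- k * ?M)\<bar> \<le> K * exp (- (k - g) * (N - A))" .
  have "\<bar>integral {?M..N} ?F + m ?M * exp (- k * ?M)\<bar> \<le> K * (A + 1) * exp (- (k - g) * (N - A))"
    using e1 e2 by (simp add: algebra_simps)
  moreover have "\<bar>- (exp (- k * a) / k)\<bar> \<le> 1"
  proof -
    have "exp (- k * a) \<le> 1" using a k by simp
    then have "exp (- k * a) \<le> k" using k by linarith
    then show ?thesis using k by (simp add: divide_le_eq)
  qed
  ultimately have "\<bar>- (exp (- k * a) / k) * (integral {?M..N} ?F + m ?M * exp (- k * ?M))\<bar> \<le> 1 * (K * (A + 1) * exp (- (k - g) * (N - A)))"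
    unfolding abs_mult[of "- (exp (- k * a) / k)"] by (intro mult_mono) auto
  then have "\<bar>integral {0..N} (\<lambda>t. exp (- k * t) * m (t - a)) - exp (- k * a) * integral {0..N} ?F / k\<bar>
      \<le> K * (A + 1) * exp (- (k - g) * (N - A))"
    unfolding eq by (simp only: mult_1_left)
  then show ?thesis unfolding m_def .
qed

section \<open>The resolvent equation on the network and the transform of the wave\<close>

context network
begin

lemma lmax_pos: "d \<in> H \<Longrightarrow> lmax > 0"
  using len[of d] lmin by linarith

text \<open>The right-hand side of the resolvent equation on an edge, as a function of the outgoing
amplitudes \<open>\<alpha>\<close> and of the solution \<open>\<kappa>\<close> itself.\<close>

definition res :: "('h \<Rightarrow> real \<Rightarrow> real) \<Rightarrow> real \<Rightarrow> ('h \<Rightarrow> real) \<Rightarrow> ('h \<Rightarrow> real \<Rightarrow> real) \<Rightarrow> 'h \<Rightarrow> real \<Rightarrow> real" where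
  "res P k \<alpha> \<kappa> d x = \<alpha> d * exp (- k * x) + \<alpha> (opp d) * exp (- k * (l d - x))
     - 1 / (2 * k) * integral {0..l d} (\<lambda>y. P d y * (\<kappa> d y * exp (- k * \<bar>x - y\<bar>)))"

text \<open>Let S be the largest value of D on the edges and M the largest amplitude. The equation
  gives S \<le> 2 M + S / 200 + E, and the node condition gives M \<le> 3 (M / 12 + S / 200 + E),
  with 3 from scattering and 1/12 from damping across an edge. Eliminating M bounds S by a multiple
  of E.\<close>

lemma resolvent_contraction:
  assumes P: "pot P C" and k: "k > 0" "\<And>d. d \<in> H \<Longrightarrow> C * l d / (2 * k) \<le> 1 / 200" "\<And>d. d \<in> H \<Longrightarrow> exp (- k * l d) \<le> 1 / 12"
    and cD: "\<And>d. d \<in> H \<Longrightarrow> continuous_on {0..l d} (D d)"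
    and D: "\<And>d x. d \<in> H \<Longrightarrow> x \<in> {0..l d} \<Longrightarrow> \<bar>D d x - res P k \<alpha> D d x\<bar> \<le> E"
    and \<alpha>: "\<And>d. d \<in> H \<Longrightarrow> \<alpha> d = scatter (\<lambda>e. D e 0 - \<alpha> e) d"
    and d: "d \<in> H" and x: "x \<in> {0..l d}"
  shows "\<bar>D d x\<bar> \<le> 50 * E"
proof -
  have E0: "E \<ge> 0" using D[OF d x] by linarith
  define M where "M = Max ((\<lambda>d. \<bar>\<alpha> d\<bar>) ` H)"
  have M: "\<bar>\<alpha> e\<bar> \<le> M" if "e \<in> H" for e unfolding M_def using fin that by (intro Max_ge) auto
  have "M \<in> (\<lambda>d. \<bar>\<alpha> d\<bar>) ` H" unfolding M_def using fin d by (intro Max_in) auto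
  then obtain dM where dM: "dM \<in> H" "M = \<bar>\<alpha> dM\<bar>" by blast
  have "\<exists>xm\<in>{0..l e}. \<forall>y\<in>{0..l e}. \<bar>D e y\<bar> \<le> \<bar>D e xm\<bar>" if "e \<in> H" for e
    by (rule continuous_attains_sup) (use l_pos[OF that] cD[OF that] in \<open>auto intro!: continuous_intros\<close>)
  then obtain xm where xm: "\<And>e. e \<in> H \<Longrightarrow> xm e \<in> {0..l e}" "\<And>e y. e \<in> H \<Longrightarrow> y \<in> {0..l e} \<Longrightarrow> \<bar>D e y\<bar> \<le> \<bar>D e (xm e)\<bar>"
    by metis
  define S where "S = Max ((\<lambda>e. \<bar>D e (xm e)\<bar>) ` H)"
  have S: "\<bar>D e y\<bar> \<le> S" if "e \<in> H" "y \<in> {0..l e}" for e y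
  proof -
    have "\<bar>D e (xm e)\<bar> \<le> S" unfolding S_def using fin that by (intro Max_ge) auto
    then show ?thesis using xm(2)[OF that] by linarith
  qed
  have "S \<in> (\<lambda>e. \<bar>D e (xm e)\<bar>) ` H" unfolding S_def using fin d by (intro Max_in) auto
  then obtain dS where dS: "dS \<in> H" "S = \<bar>D dS (xm dS)\<bar>" by blast
  have S0: "S \<ge> 0" using dS by simp
  have I: "\<bar>1 / (2 * k) * integral {0..l e} (\<lambda>y. P e y * (D e y * exp (- k * \<bar>y' - y\<bar>)))\<bar> \<le> S / 200"
    if e: "e \<in> H" for e y'
  proof -
    have "\<bar>integral {0..l e} (\<lambda>y. P e y * (D e y * exp (- k * \<bar>y' - y\<bar>)))\<bar> \<le> C * S * (l e - 0)"
    proof (rule bdm_integral_bound[OF potD(1)[OF P e]])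
      show "continuous_on {0..l e} (\<lambda>y. D e y * exp (- k * \<bar>y' - y\<bar>))" by (intro continuous_intros cD e)
      show "\<bar>D e y * exp (- k * \<bar>y' - y\<bar>)\<bar> \<le> S" if "y \<in> {0..l e}" for y
        using mult_mono[OF S[OF e that], of "exp (- k * \<bar>y' - y\<bar>)" 1] k S0 by (simp add: abs_mult)
    qed (use l_pos[OF e] in auto)
    then have "\<bar>1 / (2 * k) * integral {0..l e} (\<lambda>y. P e y * (D e y * exp (- k * \<bar>y' - y\<bar>)))\<bar> \<le> 1 / (2 * k) * (C * S * (l e - 0))"
      unfolding abs_mult using k by (intro mult_mono) auto
    also have "\<dots> = (C * l e / (2 * k)) * S" by simp
    also have "\<dots> \<le> (1 / 200) * S" using k(2)[OF e] S0 by (intro mult_right_mono) auto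
    finally show ?thesis by simp
  qed
  have small: "\<bar>\<alpha> e * exp (- k * y)\<bar> \<le> M" if "e \<in> H" "y \<ge> 0" for e y
    using mult_mono[OF M[OF that(1)], of "exp (- k * y)" 1] k that dM by (simp add: abs_mult)
  have aux: "\<bar>s\<bar> \<le> m1 + m2 + c + E" "\<bar>s - a\<bar> \<le> m2 + c + E"
    if "\<bar>s - (a + b - i)\<bar> \<le> E" "\<bar>a\<bar> \<le> m1" "\<bar>b\<bar> \<le> m2" "\<bar>i\<bar> \<le> c" for s a b i m1 m2 c :: real
    using that by linarith+
  have 1: "S \<le> 2 * M + S / 200 + E"
    using aux(1)[OF D[OF dS(1) xm(1)[OF dS(1)], unfolded res_def] small[OF dS(1)] small[OF opp(1)[OF dS(1)]] I[OF dS(1)]]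
      xm(1)[OF dS(1)] dS(2) by simp
  have "\<bar>scatter (\<lambda>e. D e 0 - \<alpha> e) dM\<bar> \<le> 3 * (M / 12 + S / 200 + E)"
  proof (rule scatter_bound[OF dM(1)])
    fix e assume e: "e \<in> H"
    have "\<bar>\<alpha> (opp e) * exp (- k * (l e - 0))\<bar> \<le> M * (1 / 12)"
      unfolding abs_mult using M[OF opp(1)[OF e]] k(3)[OF e] dM(2) by (intro mult_mono) auto
    then have "\<bar>\<alpha> (opp e) * exp (- k * (l e - 0))\<bar> \<le> M / 12" by simp
    from aux(2)[OF D[OF e, of 0, unfolded res_def] small[OF e, of 0] this I[OF e]] l_pos[OF e]
    show "\<bar>D e 0 - \<alpha> e\<bar> \<le> M / 12 + S / 200 + E" by simp
  qed
  then have 2: "M \<le> 3 * (M / 12 + S / 200 + E)" using \<alpha>[OF dM(1)] dM(2) by simp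
  have 3: "M \<le> S / 50 + 4 * E" using 2 by (simp add: field_simps)
  have "S \<le> 2 * (S / 50 + 4 * E) + S / 200 + E"
    using 1 mult_left_mono[OF 3, of 2] by linarith
  then have "S \<le> 50 * E" using E0 by (simp add: field_simps)
  then show ?thesis using S[OF d x] by linarith
qed

definition Lap :: "real \<Rightarrow> real \<Rightarrow> (real \<Rightarrow> real) \<Rightarrow> real" where
  "Lap N k V = integral {0..N} (\<lambda>s. exp (- k * s) * V s)"

text \<open>The free kernel exp (- k |x - y|) / (2 k) applied to k u0, the source that an initial
  displacement without velocity produces in the transformed wave equation.\<close>

definition init_part :: "real \<Rightarrow> 'h \<Rightarrow> real \<Rightarrow> real" where
  "init_part k d x = 1/2 * integral {0..l d} (\<lambda>y. u0 d y * exp (- k * \<bar>x - y\<bar>))"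

text \<open>At negative times the outgoing waves carry half of \<open>u0\<close>: the one from this
  end accounts for the points left of x, the one from the far end for those right of x.\<close>

lemma init_part_eq:
  assumes w: "wave P z W g K" and d: "d \<in> H" and x: "x \<in> {0..l d}"
  shows "exp (- k * x) * integral {-x..0} (\<lambda>s. exp (- k * s) * W d s)
    + exp (- k * (l d - x)) * integral {-(l d - x)..0} (\<lambda>s. exp (- k * s) * W (opp d) s) = init_part k d x"
proof -
  have cu: "continuous_on A (u0 d)" for A using continuous_on_subset[OF u0_cont[OF d]] by blast
  have i: "(\<lambda>y. u0 d y * exp (- k * \<bar>x - y\<bar>)) integrable_on {u..v}" for u v
    by (intro integrable_continuous_interval continuous_intros cu)
  have "exp (- k * x) * integral {-x..0} (\<lambda>s. exp (- k * s) * W d s) = integral {-x..-0} (\<lambda>s. exp (- k * x) * (exp (- k * s) * W d s))"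
    by simp
  also have "\<dots> = integral {-x..-0} (\<lambda>s. 1/2 * (u0 d (- s) * exp (- k * \<bar>x - (- s)\<bar>)))"
    by (rule integral_cong) (use waveD(3)[OF w d] in \<open>auto simp: exp_add[symmetric] algebra_simps\<close>)
  also have "\<dots> = integral {0..x} (\<lambda>y. 1/2 * (u0 d y * exp (- k * \<bar>x - y\<bar>)))"
    by (rule Henstock_Kurzweil_Integration.integral_reflect_real[where f = "\<lambda>y. 1/2 * (u0 d y * exp (- k * \<bar>x - y\<bar>))"])
  finally have 1: "exp (- k * x) * integral {-x..0} (\<lambda>s. exp (- k * s) * W d s) = 1/2 * integral {0..x} (\<lambda>y. u0 d y * exp (- k * \<bar>x - y\<bar>))"
    by simp
  let ?x = "l d - x"
  let ?G = "\<lambda>y. 1/2 * (u0 d y * exp (- k * \<bar>x - y\<bar>))"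
  have "exp (- k * ?x) * integral {-?x..0} (\<lambda>s. exp (- k * s) * W (opp d) s) = integral {-?x..0} (\<lambda>s. exp (- k * ?x) * (exp (- k * s) * W (opp d) s))"
    by simp
  also have "\<dots> = integral {-?x..0} (?G \<circ> (+) (l d))"
    by (rule integral_cong) (use waveD(3)[OF w opp(1)[OF d]] u0_opp[OF d] in \<open>auto simp: exp_add[symmetric] algebra_simps\<close>)
  also have "\<dots> = integral {x..l d} ?G"
    unfolding integral_shift_Icc_real by simp
  finally have 2: "exp (- k * ?x) * integral {-?x..0} (\<lambda>s. exp (- k * s) * W (opp d) s) = 1/2 * integral {x..l d} (\<lambda>y. u0 d y * exp (- k * \<bar>x - y\<bar>))"
    by simp
  show ?thesis unfolding 1 2 init_part_def
    using Henstock_Kurzweil_Integration.integral_combine[of 0 x "l d" "\<lambda>y. u0 d y * exp (- k * \<bar>x - y\<bar>)"] i x by auto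
qed

lemma Lap_scatter:
  assumes "\<And>e. e \<in> H \<Longrightarrow> continuous_on UNIV (f e)" "d \<in> H"
  shows "Lap N k (\<lambda>s. scatter (\<lambda>e. f e s) d) = scatter (\<lambda>e. Lap N k (f e)) d"
proof -
  have i: "(\<lambda>s. exp (- k * s) * f e s) integrable_on {0..N}" if "e \<in> H" for e
    by (intro integrable_continuous_interval continuous_intros continuous_on_subset[OF assms(1)[OF that]]) auto
  have "((\<lambda>s. 2 / real (card (at_node (nd d))) * (\<Sum>e\<in>at_node (nd d). exp (- k * s) * f e s) - exp (- k * s) * f d s)
      has_integral 2 / real (card (at_node (nd d))) * (\<Sum>e\<in>at_node (nd d). Lap N k (f e)) - Lap N k (f d)) {0..N}"
    unfolding Lap_def
    by (intro has_integral_diff has_integral_mult_right has_integral_sum integrable_integral i at_node(1)) (auto intro: at_node(3) assms(2))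
  moreover have "exp (- k * s) * scatter (\<lambda>e. f e s) d
      = 2 / real (card (at_node (nd d))) * (\<Sum>e\<in>at_node (nd d). exp (- k * s) * f e s) - exp (- k * s) * f d s" for s
    by (simp add: scatter_def sum_distrib_left sum_divide_distrib algebra_simps)
  ultimately have "((\<lambda>s. exp (- k * s) * scatter (\<lambda>e. f e s) d) has_integral
      2 / real (card (at_node (nd d))) * (\<Sum>e\<in>at_node (nd d). Lap N k (f e)) - Lap N k (f d)) {0..N}"
    by (simp only:)
  from integral_unique[OF this] show ?thesis
    by (simp only: Lap_def[of N k "\<lambda>s. scatter (\<lambda>e. f e s) d"] scatter_def[of "\<lambda>e. Lap N k (f e)"])
qed

lemma Lap_wave_scatter:
  assumes P: "pot P C" and w: "wave P z W g K" and d: "d \<in> H" 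
  shows "Lap N k (W d) = scatter (\<lambda>e. Lap N k (z e 0) - Lap N k (W e)) d"
proof -
  have cz: "continuous_on UNIV (z e 0)" if "e \<in> H" for e
    by (rule continuous_section(1)[OF waveD(1)[OF w that]])
  have i: "(\<lambda>s. exp (- k * s) * z e 0 s) integrable_on {0..N}" "(\<lambda>s. exp (- k * s) * W e s) integrable_on {0..N}" if "e \<in> H" for e
    by (intro integrable_continuous_interval continuous_intros continuous_on_subset[OF cz[OF that]] continuous_on_subset[OF waveD(2)[OF w that]]; simp)+
  have inc: "inc P z W e s = z e 0 s - W e s" if "e \<in> H" "s \<ge> 0" for e s
    using waveD(5)[OF w that(1) _ that(2), of 0] l_pos[OF that(1)] by (simp add: inc_def)
  have "Lap N k (W d) = Lap N k (\<lambda>s. scatter (\<lambda>e. z e 0 s - W e s) d)"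
    unfolding Lap_def
  proof (rule integral_cong)
    fix s assume s: "s \<in> {0..N}"
    have "scatter (\<lambda>e. inc P z W e s) d = scatter (\<lambda>e. z e 0 s - W e s) d"
      unfolding scatter_def using inc s d at_node(3) by (simp cong: sum.cong)
    then show "exp (- k * s) * W d s = exp (- k * s) * scatter (\<lambda>e. z e 0 s - W e s) d"
      using waveD(6)[OF w d] s by simp
  qed
  also have "\<dots> = scatter (\<lambda>e. Lap N k (\<lambda>s. z e 0 s - W e s)) d"
    by (rule Lap_scatter[OF _ d]) (intro continuous_intros cz waveD(2)[OF w])
  also have "\<dots> = scatter (\<lambda>e. Lap N k (z e 0) - Lap N k (W e)) d"
  proof -
    have "Lap N k (\<lambda>s. z e 0 s - W e s) = Lap N k (z e 0) - Lap N k (W e)" if "e \<in> H" for e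
      unfolding Lap_def right_diff_distrib by (rule Henstock_Kurzweil_Integration.integral_diff[OF i[OF that]])
    then show ?thesis unfolding scatter_def using d at_node(3) by (simp cong: sum.cong)
  qed
  finally show ?thesis .
qed

text \<open>d'Alembert's formula is transformed term by term. Every delay is at most
  \<open>lmax\<close>, so the truncation errors live at times not before N - \<open>lmax\<close>,
  against the growth exp (g t) of the wave.\<close>

lemma Lap_wave:
  assumes P: "pot P C" and w: "wave P z W g K" and g: "g \<ge> 1" "K \<ge> 0" and N: "N \<ge> lmax"
    and k: "k \<ge> g" and d: "d \<in> H" and x: "x \<in> {0..l d}"
  shows "\<bar>Lap N k (z d x) - (res P k (\<lambda>d. Lap N k (W d)) (\<lambda>d x. Lap N k (z d x)) d x + init_part k d x)\<bar>
    \<le> (2 * K * lmax + C * K * (lmax + 1) * lmax) * exp (- (k - g) * (N - lmax))"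
proof -
  have lm: "l d \<le> lmax" "0 < l d" "lmax > 0" using len[OF d] l_pos[OF d] lmax_pos[OF d] by auto
  have k1: "k \<ge> 1" "k > 0" using g k by auto
  let ?e = "exp (- (k - g) * (N - lmax))"
  have cW: "continuous_on UNIV (W d)" "continuous_on UNIV (W (opp d))"
    using waveD(2)[OF w] d opp(1)[OF d] by auto
  have cz: "continuous_on UNIV (\<lambda>(x, t). z d x t)" by (rule waveD(1)[OF w d])
  have bP: "bdm (P d) C" by (rule potD(1)[OF P d])
  have C0: "C \<ge> 0" by (rule bdm_nonneg[OF bP])
  let ?A1 = "\<lambda>t. exp (- k * t) * W d (t - x)" and ?A2 = "\<lambda>t. exp (- k * t) * W (opp d) (t - (l d - x))"
    and ?A3 = "\<lambda>t. exp (- k * t) * Nop (P d) (l d) (z d) x t"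
  have i1: "?A1 integrable_on {0..N}" "?A2 integrable_on {0..N}"
    by (intro integrable_continuous_interval continuous_intros continuous_on_compose2[OF cW(1)] continuous_on_compose2[OF cW(2)]; simp)+
  have i3: "?A3 integrable_on {0..N}"
    by (intro integrable_continuous_interval continuous_intros continuous_on_compose_pair[OF continuous_Nop[OF bP cz]])
  have "Lap N k (z d x) = integral {0..N} (\<lambda>t. ?A1 t + ?A2 t + ?A3 t)"
    unfolding Lap_def by (rule integral_cong) (use waveD(5)[OF w d x] in \<open>simp add: algebra_simps\<close>)
  also have "\<dots> = integral {0..N} ?A1 + integral {0..N} ?A2 + integral {0..N} ?A3"
    using i1 i3 by (simp add: Henstock_Kurzweil_Integration.integral_add integrable_add)
  finally have L0: "Lap N k (z d x) = integral {0..N} ?A1 + integral {0..N} ?A2 + integral {0..N} ?A3" .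
  have tail: "\<bar>exp (- k * y) * integral {N-y..N} (\<lambda>s. exp (- k * s) * W f s)\<bar> \<le> K * lmax * ?e"
    if f: "f \<in> H" and y: "0 \<le> y" "y \<le> lmax" for f y
  proof -
    have "\<bar>integral {N-y..N} (\<lambda>s. exp (- k * s) * W f s)\<bar> \<le> K * exp (- (k - g) * (N - y)) * (N - (N - y))"
    proof (rule integral_exp_minus_le[OF waveD(2)[OF w f]])
      show "\<bar>W f s\<bar> \<le> K * exp (g * s)" if "s \<in> {N-y..N}" for s
        using waveD(8)[OF w f, of s] that y N by (simp add: max_def split: if_splits)
    qed (use y k g in auto)
    also have "\<dots> \<le> K * ?e * lmax"
      using y k g mult_left_mono_neg[of "N - lmax" "N - y" "g - k"] by (intro mult_mono) auto
    finally have "\<bar>integral {N-y..N} (\<lambda>s. exp (- k * s) * W f s)\<bar> \<le> K * ?e * lmax" .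
    then have "\<bar>exp (- k * y)\<bar> * \<bar>integral {N-y..N} (\<lambda>s. exp (- k * s) * W f s)\<bar> \<le> 1 * (K * ?e * lmax)"
      using k1 y by (intro mult_mono) auto
    then show ?thesis by (simp add: abs_mult mult_ac)
  qed
  define R1 where "R1 = exp (- k * x) * integral {N-x..N} (\<lambda>s. exp (- k * s) * W d s)"
  define R2 where "R2 = exp (- k * (l d - x)) * integral {N-(l d - x)..N} (\<lambda>s. exp (- k * s) * W (opp d) s)"
  have R12: "\<bar>R1\<bar> \<le> K * lmax * ?e" "\<bar>R2\<bar> \<le> K * lmax * ?e"
    unfolding R1_def R2_def by (rule tail[OF d] tail[OF opp(1)[OF d]]; use x lm in auto)+
  have L1: "integral {0..N} ?A1 = exp (- k * x) * Lap N k (W d) + exp (- k * x) * integral {-x..0} (\<lambda>s. exp (- k * s) * W d s) - R1"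
    using laplace_shift[OF cW(1), of x N k] x lm N by (simp add: Lap_def R1_def algebra_simps)
  have L2: "integral {0..N} ?A2 = exp (- k * (l d - x)) * Lap N k (W (opp d)) + exp (- k * (l d - x)) * integral {-(l d - x)..0} (\<lambda>s. exp (- k * s) * W (opp d) s) - R2"
    using laplace_shift[OF cW(2), of "l d - x" N k] x lm N by (simp add: Lap_def R2_def algebra_simps)
  let ?m = "\<lambda>y t. integral {0..max 0 (t - \<bar>x - y\<bar>)} (z d y)"
  define q where "q y = integral {0..N} (\<lambda>t. exp (- k * t) * ?m y t)" for y
  have cm2: "continuous_on A (\<lambda>v. exp (- k * snd v) * ?m (fst v) (snd v))" for A :: "(real \<times> real) set"
    by (intro continuous_intros continuous_on_compose_pair[OF continuous_time_primitive[OF cz]])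
  have "integral {0..N} ?A3 = - (1/2) * integral {0..N} (\<lambda>t. integral {0..l d} (\<lambda>y. P d y * (exp (- k * t) * ?m y t)))"
    unfolding Nop_def integral_mult_right[symmetric] by (rule integral_cong) (simp add: mult_ac)
  also have "integral {0..N} (\<lambda>t. integral {0..l d} (\<lambda>y. P d y * (exp (- k * t) * ?m y t))) = integral {0..l d} (\<lambda>y. P d y * q y)"
    using integral_swap_weight[OF bP cm2, of 0 "l d" 0 N] lm N by (simp add: q_def)
  finally have L3: "integral {0..N} ?A3 = - (1/2) * integral {0..l d} (\<lambda>y. P d y * q y)" .
  have cq: "continuous_on {0..l d} q"
    using continuous_on_weighted_integral[OF bdm_const[of 1] cm2, of "{0..l d}" 0 N] by (simp add: q_def[abs_def])
  have cLz: "continuous_on {0..l d} (\<lambda>y. Lap N k (z d y))"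
  proof -
    have "continuous_on ({0..l d} \<times> {0..N}) (\<lambda>v. exp (- k * snd v) * z d (fst v) (snd v))"
      by (intro continuous_intros continuous_on_compose_pair[OF cz])
    from continuous_on_weighted_integral[OF bdm_const[of 1] this] show ?thesis by (simp add: Lap_def)
  qed
  let ?L = "\<lambda>y. Lap N k (z d y) * exp (- k * \<bar>x - y\<bar>)"
  have cL: "continuous_on {0..l d} ?L" by (intro continuous_intros cLz)
  have "\<bar>integral {0..l d} (\<lambda>y. P d y * (q y - ?L y / k))\<bar> \<le> C * (K * (lmax + 1) * ?e) * (l d - 0)"
  proof (rule bdm_integral_bound[OF bP])
    show "continuous_on {0..l d} (\<lambda>y. q y - ?L y / k)" using k1 by (intro continuous_intros cq cLz) auto
    fix y assume y: "y \<in> {0..l d}"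
    have "\<bar>integral {0..N} (\<lambda>t. exp (- k * t) * integral {0..max 0 (t - \<bar>x - y\<bar>)} (z d y))
      - exp (- k * \<bar>x - y\<bar>) * integral {0..N} (\<lambda>s. exp (- k * s) * z d y s) / k\<bar> \<le> K * (lmax + 1) * ?e"
      by (rule laplace_time_primitive[OF continuous_section(1)[OF cz]])
        (use waveD(7)[OF w d] x y lm N k k1 g in auto)
    then show "\<bar>q y - ?L y / k\<bar> \<le> K * (lmax + 1) * ?e" by (simp add: q_def Lap_def mult.commute)
  qed (use lm in auto)
  moreover have "integral {0..l d} (\<lambda>y. P d y * (q y - ?L y / k)) = integral {0..l d} (\<lambda>y. P d y * q y) - 1 / k * integral {0..l d} (\<lambda>y. P d y * ?L y)"
  proof -
    have "((\<lambda>y. P d y * q y - 1 / k * (P d y * ?L y)) has_integral integral {0..l d} (\<lambda>y. P d y * q y) - 1 / k * integral {0..l d} (\<lambda>y. P d y * ?L y)) {0..l d}"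
      by (intro has_integral_diff has_integral_mult_right integrable_integral bdm_mult_integrable(2)[OF bP] cq cL)
    moreover have "P d y * q y - 1 / k * (P d y * ?L y) = P d y * (q y - ?L y / k)" for y by (simp add: algebra_simps)
    ultimately show ?thesis by (simp add: integral_unique)
  qed
  moreover have "C * (K * (lmax + 1) * ?e) * (l d - 0) \<le> C * (K * (lmax + 1) * ?e) * lmax"
    using lm C0 g by (intro mult_left_mono) auto
  ultimately have R3: "\<bar>integral {0..l d} (\<lambda>y. P d y * q y) - 1 / k * integral {0..l d} (\<lambda>y. P d y * ?L y)\<bar> \<le> C * (K * (lmax + 1) * ?e) * lmax"
    by linarith
  define J1 where "J1 = integral {0..l d} (\<lambda>y. P d y * q y)"
  define J2 where "J2 = integral {0..l d} (\<lambda>y. P d y * ?L y)"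
  have "Lap N k (z d x) - (res P k (\<lambda>d. Lap N k (W d)) (\<lambda>d x. Lap N k (z d x)) d x + init_part k d x)
      = - R1 - R2 - 1/2 * (J1 - 1 / k * J2)"
    unfolding L0 L1 L2 L3 res_def init_part_eq[OF w d x, symmetric] J1_def[symmetric] J2_def[symmetric]
    by (simp add: algebra_simps diff_divide_distrib)
  also have "\<bar>\<dots>\<bar> \<le> \<bar>R1\<bar> + \<bar>R2\<bar> + \<bar>J1 - 1 / k * J2\<bar>"
  proof -
    have "\<bar>- a - b - 1 / 2 * w\<bar> \<le> \<bar>a\<bar> + \<bar>b\<bar> + \<bar>w\<bar>" for a b w :: real by (simp add: abs_if)
    then show ?thesis .
  qed
  also have "\<dots> \<le> K * lmax * ?e + K * lmax * ?e + C * (K * (lmax + 1) * ?e) * lmax"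
    using R12 R3 unfolding J1_def J2_def by linarith
  also have "\<dots> = (2 * K * lmax + C * K * (lmax + 1) * lmax) * ?e" by (simp add: algebra_simps)
  finally show ?thesis .
qed

end


section \<open>The heat flow in the resolvent equation, and its comparison with the wave\<close>

context network
begin

text \<open>With node value v and outgoing derivative X, the outgoing amplitude is (v - X) / 2 and
  the incoming one (v + X) / 2. Averaging the incoming ones removes X, because the derivatives sum
  to 0. With a single half-edge this is the Neumann condition.\<close>

lemma scatter_node:
  assumes d: "d \<in> H" and v: "\<And>e. e \<in> at_node (nd d) \<Longrightarrow> v e = v d" and X: "(\<Sum>e\<in>at_node (nd d). X e) = 0"
  shows "scatter (\<lambda>e. v e - (v e - X e) / 2) d = (v d - X d) / 2"
proof -
  have "(\<Sum>e\<in>at_node (nd d). v e - (v e - X e) / 2) = (\<Sum>e\<in>at_node (nd d). v d / 2 + X e / 2)"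
    by (rule sum.cong) (use v in \<open>auto simp: field_simps\<close>)
  also have "\<dots> = real (card (at_node (nd d))) * (v d / 2)"
    using X by (simp add: sum.distrib sum_divide_distrib[symmetric])
  finally show ?thesis using card_at_node[OF d] by (simp add: scatter_def field_simps)
qed

lemma res_diff:
  assumes P: "pot P C" and d: "d \<in> H" and c: "continuous_on {0..l d} (\<kappa> d)" "continuous_on {0..l d} (\<kappa>' d)"
  shows "res P k (\<lambda>d. \<alpha> d - \<alpha>' d) (\<lambda>d x. \<kappa> d x - \<kappa>' d x) d x = res P k \<alpha> \<kappa> d x - res P k \<alpha>' \<kappa>' d x"
proof -
  let ?e = "\<lambda>y. exp (- k * \<bar>x - y\<bar>)"
  have i: "(\<lambda>y. P d y * (\<kappa> d y * ?e y)) integrable_on {0..l d}" "(\<lambda>y. P d y * (\<kappa>' d y * ?e y)) integrable_on {0..l d}"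
    by (intro bdm_mult_integrable(2)[OF potD(1)[OF P d]] continuous_intros c)+
  have "integral {0..l d} (\<lambda>y. P d y * ((\<kappa> d y - \<kappa>' d y) * ?e y))
      = integral {0..l d} (\<lambda>y. P d y * (\<kappa> d y * ?e y) - P d y * (\<kappa>' d y * ?e y))"
    by (rule integral_cong) (simp add: algebra_simps)
  also have "\<dots> = integral {0..l d} (\<lambda>y. P d y * (\<kappa> d y * ?e y)) - integral {0..l d} (\<lambda>y. P d y * (\<kappa>' d y * ?e y))"
    by (rule Henstock_Kurzweil_Integration.integral_diff[OF i])
  finally have I: "integral {0..l d} (\<lambda>y. P d y * ((\<kappa> d y - \<kappa>' d y) * ?e y))
      = integral {0..l d} (\<lambda>y. P d y * (\<kappa> d y * ?e y)) - integral {0..l d} (\<lambda>y. P d y * (\<kappa>' d y * ?e y))" .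
  show ?thesis unfolding res_def I by (simp add: algebra_simps diff_divide_distrib)
qed

lemma res_opp:
  assumes P: "pot P C" and d: "d \<in> H" and c: "continuous_on {0..l d} (\<kappa> d)" and s: "\<And>y. \<kappa> (opp d) y = \<kappa> d (l d - y)"
  shows "res P k \<alpha> \<kappa> (opp d) x = res P k \<alpha> \<kappa> d (l d - x)"
proof -
  have "(\<lambda>y. P d y * (\<kappa> d y * exp (- k * \<bar>l d - x - y\<bar>))) integrable_on {0..l d}"
    by (intro bdm_mult_integrable(2)[OF potD(1)[OF P d]] continuous_intros c)
  from has_integral_reflect_interval[OF this]
  have "integral {0..l d} (\<lambda>y. P (opp d) y * (\<kappa> (opp d) y * exp (- k * \<bar>x - y\<bar>)))
      = integral {0..l d} (\<lambda>y. P d y * (\<kappa> d y * exp (- k * \<bar>l d - x - y\<bar>)))"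
    using l_pos[OF d] by (simp add: potD(2)[OF P d] s abs_minus_commute)
  then show ?thesis using opp[OF d] by (simp add: res_def)
qed

lemma init_part_opp:
  assumes d: "d \<in> H"
  shows "init_part k (opp d) x = init_part k d (l d - x)"
proof -
  have "(\<lambda>y. u0 d y * exp (- k * \<bar>l d - x - y\<bar>)) integrable_on {0..l d}"
    by (intro integrable_continuous_interval continuous_intros continuous_on_subset[OF u0_cont[OF d]]) auto
  from has_integral_reflect_interval[OF this]
  have "integral {0..l d} (\<lambda>y. u0 (opp d) y * exp (- k * \<bar>x - y\<bar>)) = integral {0..l d} (\<lambda>y. u0 d y * exp (- k * \<bar>l d - x - y\<bar>))"
    using l_pos[OF d] by (simp add: u0_opp[OF d] abs_minus_commute)
  then show ?thesis using opp[OF d] by (simp add: init_part_def)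
qed

lemma integral_cong_open:
  fixes f g :: "real \<Rightarrow> real"
  assumes "\<And>t. t \<in> {0<..<T} \<Longrightarrow> f t = g t"
  shows "integral {0..T} f = integral {0..T} g"
  by (rule integral_spike[of "{0, T}"]) (use assms in \<open>auto intro!: negligible_finite\<close>)

text \<open>\<open>resolvent\<close> says that \<open>\<kappa> k d x\<close>, which is \<open>k\<close> times a truncated Laplace transform at
\<open>k\<^sup>2\<close> of the heat flow, satisfies the same equation as the Laplace transform of the wave, up to
an error that is Gaussian in \<open>k\<close>.\<close>

definition resolvent :: "('h \<Rightarrow> real \<Rightarrow> real) \<Rightarrow> real \<Rightarrow> real \<Rightarrow> (real \<Rightarrow> 'h \<Rightarrow> real \<Rightarrow> real) \<Rightarrow> (real \<Rightarrow> 'h \<Rightarrow> real) \<Rightarrow> bool" where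
  "resolvent P T E \<kappa> \<alpha> \<longleftrightarrow> (\<forall>k>0. \<forall>d\<in>H. continuous_on {0..l d} (\<kappa> k d) \<and>
     (\<forall>x\<in>{0..l d}. \<bar>\<kappa> k d x - (res P k (\<alpha> k) (\<kappa> k) d x + init_part k d x)\<bar> \<le> E * exp (- (k\<^sup>2) * T)) \<and>
     \<alpha> k d = scatter (\<lambda>e. \<kappa> k e 0 - \<alpha> k e) d)"

text \<open>\<open>H0\<close> picks one half-edge of each edge, on which the heat flow is given; the
  opposite ones see it reflected. After division by 2, \<open>Green_representation\<close> is the
  resolvent equation, and the value at time T is its only error.\<close>

lemma heat_resolvent:
  fixes U UX :: "'h \<Rightarrow> real \<times> real \<Rightarrow> real" and ue xe :: "'h \<Rightarrow> real \<Rightarrow> real"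
  assumes P: "pot P C" and H0: "H0 \<subseteq> H" "\<And>d. d \<in> H0 \<Longrightarrow> opp d \<notin> H0" "\<And>d. d \<in> H \<Longrightarrow> d \<notin> H0 \<Longrightarrow> opp d \<in> H0"
    and heat: "\<And>d. d \<in> H0 \<Longrightarrow> edge_heat (l d) T C (P d) (U d) (UX d)"
    and init: "\<And>d x. d \<in> H0 \<Longrightarrow> x \<in> {0..l d} \<Longrightarrow> U d (x, 0) = u0 d x"
    and ue: "\<And>d t. d \<in> H0 \<Longrightarrow> ue d t = U d (0, t)" "\<And>d t. d \<in> H0 \<Longrightarrow> ue (opp d) t = U d (l d, t)"
    and xe: "\<And>d t. d \<in> H0 \<Longrightarrow> xe d t = UX d (0, t)" "\<And>d t. d \<in> H0 \<Longrightarrow> xe (opp d) t = - UX d (l d, t)"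
    and node: "\<And>d e t. d \<in> H \<Longrightarrow> e \<in> H \<Longrightarrow> nd d = nd e \<Longrightarrow> t \<in> {0<..<T} \<Longrightarrow> ue d t = ue e t"
    and kirchhoff: "\<And>d t. d \<in> H \<Longrightarrow> t \<in> {0<..<T} \<Longrightarrow> (\<Sum>e\<in>at_node (nd d). xe e t) = 0"
  obtains E \<kappa> \<alpha> where "resolvent P T E \<kappa> \<alpha>"
    "\<And>k d. d \<in> H \<Longrightarrow> \<kappa> k d 0 = k * integral {0..T} (\<lambda>t. ue d t * exp (- (k\<^sup>2) * t))"
proof -
  define LU where "LU d k x = integral {0..T} (\<lambda>t. U d (x, t) * exp (- (k\<^sup>2) * t))" for d k x
  define LX where "LX d k x = integral {0..T} (\<lambda>t. UX d (x, t) * exp (- (k\<^sup>2) * t))" for d k x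
  have LUeq: "edge_heat.LU T (U d) k x = LU d k x" "edge_heat.LUX T (UX d) k x = LX d k x" if "d \<in> H0" for d k x
    using edge_heat.LU_def[OF heat[OF that]] edge_heat.LUX_def[OF heat[OF that]] by (simp_all add: LU_def LX_def)
  define \<kappa> where "\<kappa> k d x = (if d \<in> H0 then k * LU d k x else k * LU (opp d) k (l d - x))" for k d x
  define X where "X k d = integral {0..T} (\<lambda>t. xe d t * exp (- (k\<^sup>2) * t))" for k d
  \<comment> \<open>The flux \<open>X\<close> comes without the factor k that
    \<open>\<kappa>\<close> has, because differentiating exp (- k x) in space already produces
    one.\<close>
  define \<alpha> where "\<alpha> k d = (\<kappa> k d 0 - X k d) / 2" for k d
  have \<kappa>0: "\<kappa> k d 0 = k * integral {0..T} (\<lambda>t. ue d t * exp (- (k\<^sup>2) * t))" if d: "d \<in> H" for k d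
  proof (cases "d \<in> H0")
    case True
    then show ?thesis by (simp add: \<kappa>_def LU_def ue(1))
  next
    case False
    then have o: "opp d \<in> H0" using H0 d by auto
    then have "ue d t = U (opp d) (l d, t)" for t using ue(2)[OF o] opp[OF d] by simp
    then show ?thesis using False by (simp add: \<kappa>_def LU_def)
  qed
  have cLU: "continuous_on {0..l d} (LU d k)" if "d \<in> H0" for d k
    using edge_heat.continuous_LU(1)[OF heat[OF that], of k] LUeq[OF that] by (simp cong: continuous_on_cong)
  have sym: "\<kappa> k (opp d) y = \<kappa> k d (l d - y)" if "d \<in> H0" for k d y
    using that H0 opp[of d] by (auto simp: \<kappa>_def)
  have cU: "continuous_on {0..l d} (\<lambda>x. U d (x, T))" "continuous_on {0..l d} (\<lambda>x. U d (x, 0))" if "d \<in> H0" for d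
    using edge_heat.continuous_slice(2)[OF heat[OF that] edge_heat.U[OF heat[OF that]]] edge_heat.T[OF heat[OF that]] by auto
  have "\<exists>b. \<forall>x\<in>{0..l d}. \<bar>U d (x, T)\<bar> \<le> b" if "d \<in> H0" for d
    using compact_imp_bounded[OF compact_continuous_image[OF cU(1)[OF that] compact_Icc]] unfolding bounded_iff by fastforce
  then obtain b where b: "\<And>d x. d \<in> H0 \<Longrightarrow> x \<in> {0..l d} \<Longrightarrow> \<bar>U d (x, T)\<bar> \<le> b d" by metis
  define E where "E = (\<Sum>d\<in>H. \<bar>b d\<bar> * lmax)"
  have E: "b d * l d \<le> E" if "d \<in> H0" for d
  proof -
    have d: "d \<in> H" using that H0 by auto
    have "b d * l d \<le> \<bar>b d\<bar> * lmax" using len(2)[OF d] l_pos[OF d] by (intro mult_mono) auto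
    also have "\<dots> \<le> E" unfolding E_def using fin d lmax_pos[OF d]
      by (intro member_le_sum[of d H "\<lambda>d. \<bar>b d\<bar> * lmax"]) auto
    finally show ?thesis .
  qed
  have main: "\<bar>\<kappa> k d x - (res P k (\<alpha> k) (\<kappa> k) d x + init_part k d x)\<bar> \<le> E * exp (- (k\<^sup>2) * T)"
    if d0: "d \<in> H0" and k: "k > 0" and x: "x \<in> {0..l d}" for d k x
  proof -
    have d: "d \<in> H" using d0 H0 by auto
    let ?e = "\<lambda>y. exp (- k * \<bar>x - y\<bar>)"
    let ?w = "exp (- (k\<^sup>2) * T)"
    have bP: "bdm (P d) C" by (rule potD(1)[OF P d])
    have ce: "continuous_on A ?e" for A by (intro continuous_intros)
    have a1: "2 * \<alpha> k d = k * LU d k 0 - LX d k 0"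
      using d0 by (simp add: \<alpha>_def \<kappa>_def X_def LX_def xe(1))
    have a2: "2 * \<alpha> k (opp d) = k * LU d k (l d) + LX d k (l d)"
      using d0 H0(2)[OF d0] opp[OF d] by (simp add: \<alpha>_def \<kappa>_def X_def LX_def xe(2))
    define I1 where "I1 = integral {0..l d} (\<lambda>y. P d y * (LU d k y * ?e y))"
    define I2 where "I2 = integral {0..l d} (\<lambda>y. u0 d y * ?e y)"
    define I3 where "I3 = integral {0..l d} (\<lambda>y. U d (y, T) * ?e y)"
    have h1: "((\<lambda>y. P d y * (LU d k y * ?e y)) has_integral I1) {0..l d}"
      unfolding I1_def by (intro integrable_integral bdm_mult_integrable(2)[OF bP] continuous_on_mult cLU d0 ce)
    have h2: "((\<lambda>y. u0 d y * ?e y) has_integral I2) {0..l d}"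
      unfolding I2_def by (intro integrable_integral integrable_continuous_interval continuous_on_mult ce continuous_on_subset[OF u0_cont[OF d]]) auto
    have h3: "((\<lambda>y. U d (y, T) * ?e y) has_integral I3) {0..l d}"
      unfolding I3_def by (intro integrable_integral integrable_continuous_interval continuous_on_mult ce cU d0)
    have "((\<lambda>y. P d y * (LU d k y * ?e y) - (u0 d y * ?e y - ?w * (U d (y, T) * ?e y))) has_integral (I1 - (I2 - ?w * I3))) {0..l d}"
      by (intro has_integral_diff has_integral_mult_right h1 h2 h3)
    moreover have "integral {0..l d} (\<lambda>y. P d y * (LU d k y * ?e y) - (u0 d y * ?e y - ?w * (U d (y, T) * ?e y)))
        = integral {0..l d} (\<lambda>y. (P d y * LU d k y - (U d (y, 0) - ?w * U d (y, T))) * ?e y)"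
      by (rule integral_cong) (use init[OF d0] in \<open>simp add: algebra_simps\<close>)
    ultimately have I: "integral {0..l d} (\<lambda>y. (P d y * LU d k y - (U d (y, 0) - ?w * U d (y, T))) * ?e y) = I1 - (I2 - ?w * I3)"
      by (simp add: integral_unique)
    have G: "2 * k * LU d k x = 2 * \<alpha> k d * exp (- k * x) + 2 * \<alpha> k (opp d) * exp (- k * (l d - x)) - (I1 - (I2 - ?w * I3))"
      using edge_heat.Green_representation[OF heat[OF d0] x, of k] unfolding LUeq[OF d0] I a1 a2 .
    have "integral {0..l d} (\<lambda>y. P d y * (\<kappa> k d y * ?e y)) = integral {0..l d} (\<lambda>y. k * (P d y * (LU d k y * ?e y)))"
      by (rule integral_cong) (use d0 in \<open>simp add: \<kappa>_def\<close>)
    also have "\<dots> = k * I1" unfolding I1_def by (rule integral_mult_right)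
    finally have I\<kappa>: "integral {0..l d} (\<lambda>y. P d y * (\<kappa> k d y * ?e y)) = k * I1" .
    have ip: "init_part k d x = I2 / 2" by (simp add: init_part_def I2_def)
    have r: "res P k (\<alpha> k) (\<kappa> k) d x = \<alpha> k d * exp (- k * x) + \<alpha> k (opp d) * exp (- k * (l d - x)) - I1 / 2"
      unfolding res_def I\<kappa> using k by simp
    have "\<kappa> k d x = k * LU d k x" using d0 by (simp add: \<kappa>_def)
    then have "\<kappa> k d x - (res P k (\<alpha> k) (\<kappa> k) d x + init_part k d x) = - (?w * I3) / 2"
      unfolding r ip using G by (simp add: field_simps)
    moreover have "\<bar>I3\<bar> \<le> b d * (l d - 0)"
      unfolding I3_def
    proof (rule abs_integral_le_const)
      show "(\<lambda>y. U d (y, T) * ?e y) integrable_on {0..l d}" using h3 by (rule has_integral_integrable)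
      show "\<bar>U d (y, T) * ?e y\<bar> \<le> b d" if "y \<in> {0..l d}" for y
        using mult_mono[OF b[OF d0 that], of "?e y" 1] k b[OF d0 that] by (simp add: abs_mult)
    qed (use l_pos[OF d] in auto)
    then have "\<bar>I3\<bar> \<le> E" using E[OF d0] by simp
    then have "?w * \<bar>I3\<bar> \<le> ?w * E" by (intro mult_left_mono) auto
    ultimately show ?thesis by (simp add: abs_mult mult.commute)
  qed
  have "resolvent P T E \<kappa> \<alpha>"
    unfolding resolvent_def
  proof (intro allI impI ballI conjI)
    fix k d assume k: "(k::real) > 0" and d: "d \<in> H"
    have refl: "continuous_on {0..l d} (\<lambda>x. LU (opp d) k (l d - x))" if "opp d \<in> H0"
      by (rule continuous_on_compose2[OF cLU[OF that]]) (use opp[OF d] in \<open>auto intro!: continuous_intros\<close>)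
    show "continuous_on {0..l d} (\<kappa> k d)"
      using cLU[of d k] refl H0(3)[OF d] unfolding \<kappa>_def[abs_def] by (cases "d \<in> H0") (auto intro!: continuous_intros)
    show "\<bar>\<kappa> k d x - (res P k (\<alpha> k) (\<kappa> k) d x + init_part k d x)\<bar> \<le> E * exp (- (k\<^sup>2) * T)" if x: "x \<in> {0..l d}" for x
    proof (cases "d \<in> H0")
      case True then show ?thesis using main k x by blast
    next
      case False
      then have o: "opp d \<in> H0" using H0 d by auto
      have cO: "continuous_on {0..l (opp d)} (\<kappa> k (opp d))"
        using cLU[OF o, of k] o unfolding \<kappa>_def[abs_def] by (auto intro!: continuous_intros)
      have "\<kappa> k d x = \<kappa> k (opp d) (l d - x)" using sym[OF o, of k x] opp[OF d] by simp
      moreover have "res P k (\<alpha> k) (\<kappa> k) d x = res P k (\<alpha> k) (\<kappa> k) (opp d) (l d - x)"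
        using res_opp[where \<kappa> = "\<kappa> k", OF P opp(1)[OF d] cO sym[OF o]] opp[OF d] by simp
      moreover have "init_part k d x = init_part k (opp d) (l d - x)"
        using init_part_opp[OF opp(1)[OF d], of k x] opp[OF d] by simp
      ultimately show ?thesis using main[OF o k, of "l d - x"] x opp[OF d] by simp
    qed
    have "\<kappa> k e 0 = \<kappa> k d 0" if "e \<in> at_node (nd d)" for e
    proof -
      have e: "e \<in> H" "nd e = nd d" using that at_node by auto
      have "integral {0..T} (\<lambda>t. ue e t * exp (- (k\<^sup>2) * t)) = integral {0..T} (\<lambda>t. ue d t * exp (- (k\<^sup>2) * t))"
        by (rule integral_cong_open) (use node[OF e(1) d e(2)] in simp)
      then show ?thesis using \<kappa>0 e d by simp
    qed
    moreover have "(\<Sum>e\<in>at_node (nd d). X k e) = 0"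
    proof -
      have i: "(\<lambda>t. xe e t * exp (- (k\<^sup>2) * t)) integrable_on {0..T}" if e: "e \<in> H" for e
      proof (cases "e \<in> H0")
        case True
        have "continuous_on {0..T} (\<lambda>t. UX e (0, t))"
          by (rule edge_heat.continuous_slice(1)[OF heat[OF True] edge_heat.UX[OF heat[OF True]]]) (use l_pos[OF e] in auto)
        then show ?thesis using xe(1)[OF True] by (auto intro!: integrable_continuous_interval continuous_intros)
      next
        case False
        then have o: "opp e \<in> H0" using H0 e by auto
        have "continuous_on {0..T} (\<lambda>t. UX (opp e) (l e, t))"
          by (rule edge_heat.continuous_slice(1)[OF heat[OF o] edge_heat.UX[OF heat[OF o]]]) (use l_pos[OF e] opp[OF e] in auto)
        moreover have "xe e t = - UX (opp e) (l e, t)" for t using xe(2)[OF o] opp[OF e] by simp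
        ultimately show ?thesis by (auto intro!: integrable_continuous_interval continuous_intros)
      qed
      have "(\<Sum>e\<in>at_node (nd d). X k e) = integral {0..T} (\<lambda>t. \<Sum>e\<in>at_node (nd d). xe e t * exp (- (k\<^sup>2) * t))"
        unfolding X_def by (rule integral_sum[symmetric]) (use at_node i in auto)
      also have "\<dots> = integral {0..T} (\<lambda>t. 0)"
        by (rule integral_cong_open) (use kirchhoff[OF d] in \<open>simp flip: sum_distrib_right\<close>)
      finally show ?thesis by simp
    qed
    ultimately show "\<alpha> k d = scatter (\<lambda>e. \<kappa> k e 0 - \<alpha> k e) d"
      using scatter_node[OF d, of "\<lambda>e. \<kappa> k e 0" "X k"] by (simp add: \<alpha>_def)
  qed
  then show ?thesis using that \<kappa>0 by blast
qed

text \<open>Both transforms solve the same resolvent equation up to errors of size exp (- k a). In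
  their difference \<open>init_part\<close> cancels, and \<open>resolvent_contraction\<close>
  applies.\<close>

lemma wave_heat_close:
  assumes P: "pot P C" and w: "wave P z W g K" and g: "g \<ge> 1" "K \<ge> 0"
    and res: "resolvent P T E \<kappa> \<alpha>" and T: "T > 0" and a: "a > 0" and d: "d \<in> H"
  obtains k0 B where "\<And>k. k \<ge> k0 \<Longrightarrow> \<bar>Lap (lmax + 2 * a) k (z d 0) - \<kappa> k d 0\<bar> \<le> B * exp (- k * a)"
proof -
  \<comment> \<open>For k \<ge> 2 g one has (k - g) 2 a \<ge> k a, so this length brings the
    truncation error of the wave down to exp (- k a).\<close>
  define N where "N = lmax + 2 * a"
  define Cw where "Cw = 2 * K * lmax + C * K * (lmax + 1) * lmax"
  have C0: "C \<ge> 0" using bdm_nonneg potD(1)[OF P d] by blast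
  have lm: "lmax > 0" by (rule lmax_pos[OF d])
  have Cw0: "Cw \<ge> 0" using C0 lm g by (simp add: Cw_def)
  \<comment> \<open>From a / T on, the Gaussian exp (- k^2 T) is at most exp (- k a). The last two
    summands provide the factors 1/200 and 1/12 of the contraction.\<close>
  define k0 where "k0 = 2 * g + a / T + 100 * C * lmax + 12 / lmin"
  have close: "\<bar>Lap N k (z d 0) - \<kappa> k d 0\<bar> \<le> (50 * (Cw + \<bar>E\<bar>)) * exp (- k * a)" if k: "k \<ge> k0" for k
  proof -
    have parts: "a / T \<ge> 0" "100 * C * lmax \<ge> 0" "12 / lmin \<ge> 0" using a T C0 lm lmin by auto
    then have k1: "k \<ge> 2 * g" "k \<ge> a / T" "k \<ge> 100 * C * lmax" "k \<ge> 12 / lmin" "k > 0" "k \<ge> g"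
      using k g unfolding k0_def by linarith+
    have cz: "continuous_on {0..l e} (\<lambda>x. Lap N k (z e x))" if e: "e \<in> H" for e
    proof -
      have "continuous_on ({0..l e} \<times> {0..N}) (\<lambda>v. exp (- k * snd v) * z e (fst v) (snd v))"
        by (intro continuous_intros continuous_on_compose_pair[OF waveD(1)[OF w e]])
      from continuous_on_weighted_integral[OF bdm_const[of 1] this] show ?thesis by (simp add: Lap_def)
    qed
    have c\<kappa>: "continuous_on {0..l e} (\<kappa> k e)" if "e \<in> H" for e
      using res k1(5) that unfolding resolvent_def by blast
    have e1: "exp (- (k - g) * (N - lmax)) \<le> exp (- k * a)"
    proof -
      have "k * a \<le> (k - g) * (2 * a)" using k1(1) a mult_right_mono[of g "k / 2" "2 * a"] by (simp add: algebra_simps)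
      moreover have "- (k - g) * (N - lmax) = - ((k - g) * (2 * a))" by (simp add: N_def algebra_simps)
      ultimately show ?thesis by simp
    qed
    have e2: "exp (- (k\<^sup>2) * T) \<le> exp (- k * a)"
    proof -
      have "a \<le> k * T" using k1(2) T by (simp add: field_simps)
      then have "k * a \<le> k * (k * T)" using k1(5) by (intro mult_left_mono) auto
      then show ?thesis by (simp add: power2_eq_square)
    qed
    have D: "\<bar>(Lap N k (z e x) - \<kappa> k e x) - res P k (\<lambda>d. Lap N k (W d) - \<alpha> k d) (\<lambda>d x. Lap N k (z d x) - \<kappa> k d x) e x\<bar> \<le> (Cw + \<bar>E\<bar>) * exp (- k * a)"
      if e: "e \<in> H" and x: "x \<in> {0..l e}" for e x
    proof -
      have "\<bar>Lap N k (z e x) - (res P k (\<lambda>d. Lap N k (W d)) (\<lambda>d x. Lap N k (z d x)) e x + init_part k e x)\<bar> \<le> Cw * exp (- (k - g) * (N - lmax))"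
        unfolding Cw_def by (rule Lap_wave[OF P w g _ k1(6) e x]) (use a in \<open>simp add: N_def\<close>)
      also have "\<dots> \<le> Cw * exp (- k * a)" using e1 Cw0 by (intro mult_left_mono) auto
      finally have 1: "\<bar>Lap N k (z e x) - (res P k (\<lambda>d. Lap N k (W d)) (\<lambda>d x. Lap N k (z d x)) e x + init_part k e x)\<bar> \<le> Cw * exp (- k * a)" .
      have "\<bar>\<kappa> k e x - (res P k (\<alpha> k) (\<kappa> k) e x + init_part k e x)\<bar> \<le> E * exp (- (k\<^sup>2) * T)"
        using res k1(5) e x unfolding resolvent_def by blast
      also have "\<dots> \<le> \<bar>E\<bar> * exp (- k * a)" using e2 by (intro mult_mono) auto
      finally have 2: "\<bar>\<kappa> k e x - (res P k (\<alpha> k) (\<kappa> k) e x + init_part k e x)\<bar> \<le> \<bar>E\<bar> * exp (- k * a)" .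
      show ?thesis
        unfolding res_diff[where \<kappa> = "\<lambda>d x. Lap N k (z d x)" and \<kappa>' = "\<kappa> k", OF P e cz[OF e] c\<kappa>[OF e]] distrib_right using 1 2 by linarith
    qed
    have A: "Lap N k (W e) - \<alpha> k e = scatter (\<lambda>e. (Lap N k (z e 0) - \<kappa> k e 0) - (Lap N k (W e) - \<alpha> k e)) e" if e: "e \<in> H" for e
    proof -
      have "\<alpha> k e = scatter (\<lambda>e. \<kappa> k e 0 - \<alpha> k e) e" using res k1(5) e unfolding resolvent_def by blast
      with Lap_wave_scatter[OF P w e, of N k]
      have "Lap N k (W e) - \<alpha> k e = scatter (\<lambda>e. Lap N k (z e 0) - Lap N k (W e)) e - scatter (\<lambda>e. \<kappa> k e 0 - \<alpha> k e) e" by simp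
      also have "\<dots> = scatter (\<lambda>e. (Lap N k (z e 0) - \<kappa> k e 0) - (Lap N k (W e) - \<alpha> k e)) e"
        unfolding scatter_diff by (rule arg_cong[where f = "\<lambda>f. scatter f e"]) (simp add: fun_eq_iff)
      finally show ?thesis .
    qed
    have c1: "C * l e / (2 * k) \<le> 1 / 200" if e: "e \<in> H" for e
    proof -
      have "C * l e \<le> C * lmax" using len(2)[OF e] C0 by (intro mult_left_mono) auto
      then have "C * l e * 100 \<le> k" using k1(3) by simp
      then show ?thesis using k1(5) by (simp add: field_simps)
    qed
    have c2: "exp (- k * l e) \<le> 1 / 12" if e: "e \<in> H" for e
    proof -
      have "12 / lmin * lmin \<le> k * l e" using k1(4,5) len(1)[OF e] lmin by (intro mult_mono) auto
      then have "12 \<le> k * l e" using lmin by simp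
      then have "12 \<le> exp (k * l e)" using exp_ge_add_one_self[of "k * l e"] by linarith
      then show ?thesis by (simp add: exp_minus field_simps)
    qed
    have cD: "continuous_on {0..l e} (\<lambda>x. Lap N k (z e x) - \<kappa> k e x)" if "e \<in> H" for e
      by (intro continuous_on_diff cz c\<kappa> that)
    have "\<bar>Lap N k (z d 0) - \<kappa> k d 0\<bar> \<le> 50 * ((Cw + \<bar>E\<bar>) * exp (- k * a))"
      by (rule resolvent_contraction[where D = "\<lambda>d x. Lap N k (z d x) - \<kappa> k d x" and \<alpha> = "\<lambda>d. Lap N k (W d) - \<alpha> k d",
          OF P k1(5) c1 c2 cD D A d]) (use l_pos[OF d] in auto)
    then show ?thesis by (simp only: mult.assoc)
  qed
  show ?thesis by (rule that[of k0 "50 * (Cw + \<bar>E\<bar>)"]) (use close in \<open>simp add: N_def\<close>)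
qed

text \<open>The error exp (- k a) is available for every a while T stays fixed, so choosing a > t
  reaches every time t.\<close>

lemma observed_waves_equal:
  assumes P: "pot P C" and Q: "pot Q C" and w: "wave P z W g K" and w': "wave Q z' W' g' K'"
    and g: "g \<ge> 1" "K \<ge> 0" "g' \<ge> 1" "K' \<ge> 0"
    and r: "resolvent P T E \<kappa> \<alpha>" and r': "resolvent Q T E' \<kappa>' \<alpha>'" and T: "T > 0" and d: "d \<in> H"
    and eq: "\<And>k. \<kappa> k d 0 = \<kappa>' k d 0" and t: "t \<ge> 0"
  shows "z d 0 t = z' d 0 t"
proof -
  define a where "a = t + 1"
  have a: "a > 0" using t by (simp add: a_def)
  let ?N = "lmax + 2 * a"
  obtain k1 B1 where 1: "\<And>k. k \<ge> k1 \<Longrightarrow> \<bar>Lap ?N k (z d 0) - \<kappa> k d 0\<bar> \<le> B1 * exp (- k * a)"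
    using wave_heat_close[OF P w g(1,2) r T a d] by blast
  obtain k2 B2 where 2: "\<And>k. k \<ge> k2 \<Longrightarrow> \<bar>Lap ?N k (z' d 0) - \<kappa>' k d 0\<bar> \<le> B2 * exp (- k * a)"
    using wave_heat_close[OF Q w' g(3,4) r' T a d] by blast
  have c: "continuous_on A (z d 0)" "continuous_on A (z' d 0)" for A
    using continuous_section(1)[OF waveD(1)[OF w d]] continuous_section(1)[OF waveD(1)[OF w' d]] .
  have "z d 0 t - z' d 0 t = 0"
  proof (rule laplace_small_imp_zero[where a = a and N = ?N and h = "\<lambda>t. z d 0 t - z' d 0 t" and ?k0.0 = "max k1 k2" and C = "B1 + B2"])
    show "continuous_on UNIV (\<lambda>t. z d 0 t - z' d 0 t)" by (intro continuous_intros c)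
    fix k assume "k \<ge> max k1 k2"
    then have "k \<ge> k1" "k \<ge> k2" by auto
    moreover have "integral {0..?N} (\<lambda>s. exp (- k * s) * (z d 0 s - z' d 0 s)) = Lap ?N k (z d 0) - Lap ?N k (z' d 0)"
      unfolding Lap_def right_diff_distrib
      by (intro Henstock_Kurzweil_Integration.integral_diff integrable_continuous_interval continuous_intros c)
    ultimately show "\<bar>integral {0..?N} (\<lambda>s. exp (- k * s) * (z d 0 s - z' d 0 s))\<bar> \<le> (B1 + B2) * exp (- k * a)"
      using 1[of k] 2[of k] eq[of k] unfolding distrib_right by linarith
  qed (use a t lmax_pos[OF d] in \<open>auto simp: a_def\<close>)
  then show ?thesis by simp
qed

text \<open>Peeling: a half-edge at which everything is known makes its edge known, and a node with
only one unknown half-edge makes it known, once the value at the node is known.\<close>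

lemma potentials_equal:
  assumes P: "pot P C" and Q: "pot Q C"
    and u0L: "\<And>d x y. d \<in> H \<Longrightarrow> \<bar>u0 d x - u0 d y\<bar> \<le> L0 * \<bar>x - y\<bar>" and L0: "L0 \<ge> 0"
    and rpos: "r > 0" "\<And>d x. d \<in> H \<Longrightarrow> x \<in> {0..l d} \<Longrightarrow> \<bar>u0 d x\<bar> \<ge> r"
    and R: "resolvent P T E \<kappa> \<alpha>" and R': "resolvent Q T E' \<kappa>' \<alpha>'" and T: "T > 0"
    and obs: "\<And>d k. d \<in> H \<Longrightarrow> at_node (nd d) = {d} \<Longrightarrow> nd d \<noteq> v0 \<Longrightarrow> \<kappa> k d 0 = \<kappa>' k d 0"
    and leaf: "\<And>B. B \<subseteq> H \<Longrightarrow> B \<noteq> {} \<Longrightarrow> (\<And>d. d \<in> B \<Longrightarrow> opp d \<in> B) \<Longrightarrow> \<exists>d\<in>B. nd d \<noteq> v0 \<and> at_node (nd d) \<inter> B = {d}"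
    and d: "d \<in> H"
  shows "AE x in lborel. x \<in> {0..l d} \<longrightarrow> P d x = Q d x"
proof -
  obtain z W g K where w: "g \<ge> 1" "K \<ge> 0" "wave P z W g K" by (rule wave_exists[OF P])
  obtain z' W' g' K' where w': "g' \<ge> 1" "K' \<ge> 0" "wave Q z' W' g' K'" by (rule wave_exists[OF Q])
  define good where "good d \<longleftrightarrow> (\<forall>s\<ge>0. W d s = W' d s \<and> inc P z W d s = inc Q z' W' d s)" for d
  have edge: "good (opp d) \<and> (AE x in lborel. x \<in> {0..l d} \<longrightarrow> P d x = Q d x)" if "d \<in> H" "good d" for d
  proof -
    have g0: "g > 0" "g' > 0" using w(1) w'(1) by auto
    note eu = edge_uniqueness[OF P Q w(3) w'(3) that(1) g0(1) w(2) g0(2) w'(2) _ _ u0L L0 rpos]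
    have a: "W d s = W' d s" "inc P z W d s = inc Q z' W' d s" if "s \<ge> 0" for s
      using \<open>good d\<close> that by (auto simp: good_def)
    show ?thesis using eu(1)[OF a] eu(2)[OF a] eu(3)[OF a] by (auto simp: good_def)
  qed
  \<comment> \<open>The unknown half-edges. If there were any, \<open>leaf\<close> would provide a
    node other than \<open>v0\<close> with exactly one of them.\<close>
  define B where "B = {d \<in> H. \<not> good d}"
  have "B = {}"
  proof (rule ccontr)
    assume "B \<noteq> {}"
    moreover have "opp d \<in> B" if "d \<in> B" for d
      using that edge[of "opp d"] opp[of d] by (auto simp: B_def)
    ultimately obtain d where d: "d \<in> B" "nd d \<noteq> v0" "at_node (nd d) \<inter> B = {d}"
      using leaf[of B] by (auto simp: B_def)
    have dH: "d \<in> H" and bad: "\<not> good d" using d(1) by (auto simp: B_def)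
    have others: "good e" if "e \<in> at_node (nd d)" "e \<noteq> d" for e
      using that d(3) at_node(3) by (auto simp: B_def)
    let ?n = "real (card (at_node (nd d)))"
    define S where "S s = (\<Sum>e\<in>at_node (nd d). inc P z W e s)" for s
    define S' where "S' s = (\<Sum>e\<in>at_node (nd d). inc Q z' W' e s)" for s
    have n: "?n > 0" by (rule card_at_node[OF dH])
    \<comment> \<open>These are the values of the two waves at the node, the same on all its
      half-edges.\<close>
    have sc: "W e s + inc P z W e s = 2 / ?n * S s" "W' e s + inc Q z' W' e s = 2 / ?n * S' s"
      if e: "e \<in> at_node (nd d)" and s: "s \<ge> 0" for e s
    proof -
      have eH: "e \<in> H" "nd e = nd d" using e at_node by auto
      show "W e s + inc P z W e s = 2 / ?n * S s" "W' e s + inc Q z' W' e s = 2 / ?n * S' s"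
        using waveD(6)[OF w(3) eH(1) s] waveD(6)[OF w'(3) eH(1) s] eH(2) by (simp_all add: scatter_def S_def S'_def)
    qed
    \<comment> \<open>The node value is known either from the observation, when \<open>d\<close> is
      alone at its node, or from another half-edge there, which is good already.\<close>
    have SS: "S s = S' s" if s: "s \<ge> 0" for s
    proof (cases "at_node (nd d) = {d}")
      case True
      have "z d 0 s = z' d 0 s"
        by (rule observed_waves_equal[OF P Q w(3) w'(3) w(1,2) w'(1,2) R R' T dH obs[OF dH True d(2)] s])
      moreover have "z d 0 s = W d s + inc P z W d s" "z' d 0 s = W' d s + inc Q z' W' d s"
        using waveD(5)[OF w(3) dH _ s, of 0] waveD(5)[OF w'(3) dH _ s, of 0] l_pos[OF dH] by (simp_all add: inc_def)
      ultimately show ?thesis using sc[OF at_node(2)[OF dH] s] n by simp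
    next
      case False
      then obtain e where e: "e \<in> at_node (nd d)" "e \<noteq> d" using at_node(2)[OF dH] by auto
      then have "good e" by (rule others)
      then have "W e s + inc P z W e s = W' e s + inc Q z' W' e s" using s by (simp add: good_def)
      then show ?thesis using sc[OF e(1) s] n by simp
    qed
    have "good d"
      unfolding good_def
    proof (intro allI impI)
      fix s :: real assume s: "s \<ge> 0"
      have "S s - S' s = (\<Sum>e\<in>at_node (nd d). inc P z W e s - inc Q z' W' e s)"
        by (simp add: S_def S'_def sum_subtractf)
      also have "\<dots> = (\<Sum>e\<in>{d}. inc P z W e s - inc Q z' W' e s)"
        by (rule sum.mono_neutral_right) (use at_node(1) at_node(2)[OF dH] others s in \<open>auto simp: good_def\<close>)
      finally have I: "inc P z W d s = inc Q z' W' d s" using SS[OF s] by simp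
      then show "W d s = W' d s \<and> inc P z W d s = inc Q z' W' d s"
        using sc[OF at_node(2)[OF dH] s] SS[OF s] by simp
    qed
    then show False using bad by simp
  qed
  then have "good d" using d by (auto simp: B_def)
  then show ?thesis using edge[OF d] by simp
qed

end


subsection \<open>Trees\<close>

definition half_node :: "(nat \<Rightarrow> 'v) \<Rightarrow> (nat \<Rightarrow> 'v) \<Rightarrow> nat \<times> bool \<Rightarrow> 'v" where
  "half_node ini ter d = (if snd d then ini (fst d) else ter (fst d))"

text \<open>The last node of a longest trail in \<open>B\<close> meets no further edge of
  \<open>B\<close>, which would either extend the trail or close a loop with it. Starting at
  \<open>v0\<close> whenever \<open>v0\<close> meets \<open>B\<close> keeps the last node away from
  \<open>v0\<close>.\<close>

lemma acyclic_leaf: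
  assumes acyc: "\<not> has_closed_loop N ini ter" and B: "B \<subseteq> {..N}" "B \<noteq> {}"
  shows "\<exists>j\<in>B. \<exists>b. half_node ini ter (j, b) \<noteq> v0 \<and>
    (\<forall>i\<in>B. \<forall>c. half_node ini ter (i, c) = half_node ini ter (j, b) \<longrightarrow> i = j \<and> c = b)"
proof -
  define joins where "joins j v w \<longleftrightarrow> (ini j = v \<and> ter j = w) \<or> (ter j = v \<and> ini j = w)" for j v w
  define e where "e = half_node ini ter"
  have joinsI: "joins j (e (j, b)) (e (j, \<not> b))" for j b by (auto simp: joins_def e_def half_node_def)
  obtain s where s: "\<exists>j\<in>B. \<exists>b. e (j, b) = s" "s = v0 \<or> (\<forall>j\<in>B. \<forall>b. e (j, b) \<noteq> v0)"
    using B(2) by (metis ex_in_conv)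
  define trail where "trail es vs \<longleftrightarrow> distinct es \<and> set es \<subseteq> B \<and> length vs = Suc (length es) \<and> vs ! 0 = s \<and>
     distinct vs \<and> (\<forall>i<length es. joins (es ! i) (vs ! i) (vs ! Suc i))" for es vs
  have fin: "finite B" using B(1) finite_subset by blast
  define P where "P k \<longleftrightarrow> (\<exists>es vs. trail es vs \<and> length es = k)" for k
  have "trail [] [s]" by (simp add: trail_def)
  then have "P 0" unfolding P_def by force
  moreover have "k \<le> card B" if k: "P k" for k
  proof -
    obtain es vs where "trail es vs" "length es = k" using k unfolding P_def by (elim exE conjE)
    then have "distinct es" "set es \<subseteq> B" "length es = k" by (simp_all add: trail_def)
    then show ?thesis using card_mono[OF fin, of "set es"] distinct_card[of es] by simp
  qed
  ultimately have "\<exists>k. P k \<and> (\<forall>k'. P k' \<longrightarrow> k' \<le> k)"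
    by (intro ex_has_greatest_nat[where P = P and k = 0 and f = "\<lambda>k. k" and b = "Suc (card B)"])
      (auto simp: le_imp_less_Suc)
  then obtain k where k: "P k" "\<And>k'. P k' \<Longrightarrow> k' \<le> k" by blast
  from k(1) obtain es vs where tr: "trail es vs" and esk: "length es = k" unfolding P_def by (elim exE conjE)
  have max: "length es' \<le> length es" if "trail es' vs'" for es' vs'
  proof -
    have "P (length es')" unfolding P_def by (intro exI conjI, rule that, rule refl)
    then show ?thesis using k(2) esk by simp
  qed
  define n where "n = length es"
  define v where "v = vs ! n"
  have t: "distinct es" "set es \<subseteq> B" "length vs = Suc n" "vs ! 0 = s" "distinct vs"
    "\<And>i. i < n \<Longrightarrow> joins (es ! i) (vs ! i) (vs ! Suc i)"
    using tr by (auto simp: trail_def n_def)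
  have key: False if j: "j \<in> B" "j \<notin> set es" and jv: "e (j, b) = v" for j b
  proof -
    define w where "w = e (j, \<not> b)"
    have jo: "joins j v w" using joinsI[of j b] jv by (simp add: w_def)
    show False
    proof (cases "w \<in> set vs")
      case True
      then obtain i where i: "i < Suc n" "vs ! i = w" using t(3) by (metis in_set_conv_nth)
      \<comment> \<open>The loop is the trail from its visit to \<open>w\<close> onwards, closed by
        the new edge; for w = v it is a single edge that joins a node to itself.\<close>
      let ?es = "drop i es @ [j]" and ?vs = "drop i vs @ [w]"
      have "has_closed_loop N ini ter"
        unfolding has_closed_loop_def
      proof (intro exI[of _ ?es] exI[of _ ?vs] conjI allI impI)
        show "distinct ?es" using t(1) j(2) by (auto dest: in_set_dropD)
        show "set ?es \<subseteq> {..N}" using t(2) j(1) B(1) by (auto dest: in_set_dropD)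
        show "length ?vs = Suc (length ?es)" using t(3) i by (simp add: n_def Suc_diff_le)
        show "hd ?vs = last ?vs" using i t(3) by (simp add: hd_append hd_drop_conv_nth)
        show "distinct (butlast ?vs)" using t(5) by simp
        fix k assume k: "k < length ?es"
        have len: "length ?es = Suc (n - i)" by (simp add: n_def)
        have "joins (?es ! k) (?vs ! k) (?vs ! Suc k)"
        proof (cases "k < n - i")
          case True
          then have "?es ! k = es ! (i + k)" "?vs ! k = vs ! (i + k)" "?vs ! Suc k = vs ! Suc (i + k)"
            using t(3) i by (auto simp: nth_append n_def)
          then show ?thesis using t(6)[of "i + k"] True by simp
        next
          case False
          then have "k = n - i" using k len by simp
          then have "?es ! k = j" "?vs ! k = v" "?vs ! Suc k = w"
            using t(3) i by (auto simp: nth_append n_def v_def Suc_diff_le)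
          then show ?thesis using jo by simp
        qed
        then show "ini (?es ! k) = ?vs ! k \<and> ter (?es ! k) = ?vs ! Suc k \<or> ter (?es ! k) = ?vs ! k \<and> ini (?es ! k) = ?vs ! Suc k"
          by (simp add: joins_def)
      qed simp
      then show False using acyc by simp
    next
      case False
      have "trail (es @ [j]) (vs @ [w])"
        unfolding trail_def
      proof (intro conjI allI impI)
        fix i assume "i < length (es @ [j])"
        then consider "i < n" | "i = n" by (auto simp: n_def less_Suc_eq)
        then show "joins ((es @ [j]) ! i) ((vs @ [w]) ! i) ((vs @ [w]) ! Suc i)"
        proof cases
          case 1
          then show ?thesis using t(6)[OF 1] t(3) by (simp add: nth_append n_def)
        next
          case 2
          then show ?thesis using jo t(3) by (simp add: nth_append n_def v_def)
        qed
      qed (use t j False in \<open>auto simp: n_def nth_append\<close>)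
      from max[OF this] show False by simp
    qed
  qed
  have "n > 0"
  proof (rule ccontr)
    assume "\<not> n > 0"
    then have "es = []" "v = s" using t(4) by (auto simp: n_def v_def)
    then show False using s(1) key by auto
  qed
  define j where "j = es ! (n - 1)"
  have j: "j \<in> B" using t(2) \<open>n > 0\<close> by (auto simp: j_def n_def)
  have jj: "joins j (vs ! (n - 1)) v" using t(6)[of "n - 1"] \<open>n > 0\<close> by (simp add: j_def v_def)
  have ne: "vs ! k \<noteq> v" if "k < n" for k
    using t(3,5) that by (auto simp: v_def nth_eq_iff_index_eq)
  have "\<exists>b. e (j, b) = v \<and> e (j, \<not> b) = vs ! (n - 1)"
    using jj by (auto simp: joins_def e_def half_node_def intro: exI[of _ True] exI[of _ False])
  then obtain b where b: "e (j, b) = v" "e (j, \<not> b) = vs ! (n - 1)" by blast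
  have uniq: "i = j \<and> c = b" if i: "i \<in> B" "e (i, c) = v" for i c
  proof -
    have "i \<in> set es" using key[OF i(1) _ i(2)] by blast
    then obtain k where k: "k < n" "es ! k = i" by (auto simp: in_set_conv_nth n_def)
    have "v = vs ! k \<or> v = vs ! Suc k"
      using t(6)[OF k(1)] k(2) i(2) by (cases c) (auto simp: joins_def e_def half_node_def)
    then have "\<not> Suc k < n" using ne[of k] ne[of "Suc k"] k(1) by auto
    then have "k = n - 1" using k(1) by simp
    then have "i = j" using k(2) by (simp add: j_def)
    moreover have "c = b" using b ne[of "n - 1"] \<open>n > 0\<close> i(2) \<open>i = j\<close> by (cases "c = b") auto
    ultimately show ?thesis by simp
  qed
  have "v \<noteq> v0"
    using s(2) ne[of 0] t(4) \<open>n > 0\<close> b(1) j by auto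
  then show ?thesis using uniq b(1) j unfolding e_def by blast
qed


section \<open>Representatives and half-edges of the heat network\<close>

text \<open>The points of the open interval with values outside \<open>S\<close> form an open null
  set, which is empty; continuity then reaches the end-points.\<close>

lemma continuous_AE_closed:
  fixes f :: "real \<Rightarrow> real"
  assumes l: "l > 0" and f: "continuous_on {0..l} f" and S: "closed S"
    and ae: "AE x in lborel. x \<in> {0<..<l} \<longrightarrow> f x \<in> S" and x: "x \<in> {0..l}"
  shows "f x \<in> S"
proof -
  define O' where "O' = {0<..<l} \<inter> f -` (- S)"
  have op: "open O'"
    unfolding O'_def
    by (rule continuous_open_preimage[OF continuous_on_subset[OF f]]) (use S in auto)
  have "AE x in lborel. x \<notin> O'" using ae by eventually_elim (auto simp: O'_def)
  then have "AE x in lebesgue. x \<notin> O'" by (rule AE_completion)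
  then have "negligible O'"
    using op by (simp add: negligible_iff_null_sets AE_iff_null_sets lborelD)
  then have "O' = {}" using op open_not_negligible by blast
  then have "f ` {0<..<l} \<subseteq> S" unfolding O'_def by auto
  then have "f ` closure {0<..<l} \<subseteq> S"
    by (intro image_closure_subset) (use l f S in auto)
  then show ?thesis using x l by auto
qed

lemma AE_fst:
  fixes Q :: "real \<Rightarrow> bool"
  assumes "AE x in lborel. Q x"
  shows "AE z in (lborel :: (real \<times> real) measure). Q (fst z)"
proof -
  obtain A where A: "{x. \<not> Q x} \<subseteq> A" "A \<in> sets lborel" "emeasure lborel A = 0"
    using AE_E[OF assms] by (auto simp: space_lborel)
  have "emeasure (lborel \<Otimes>\<^sub>M lborel) (A \<times> (UNIV :: real set)) = 0"
    using A by (subst lborel.emeasure_pair_measure_Times) auto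
  then have "A \<times> (UNIV :: real set) \<in> null_sets (lborel \<Otimes>\<^sub>M lborel)"
    using A(2) by (intro null_setsI) auto
  then have "A \<times> (UNIV :: real set) \<in> null_sets lborel" by (simp add: lborel_prod)
  then show ?thesis using A(1) by (intro AE_I') (auto simp: space_lborel)
qed

text \<open>Extension by 0 and truncation at the essential bound change f on the interval only in a
  null set.\<close>

lemma Linf_on_bdm:
  assumes "Linf_on l f"
  obtains C f' where "bdm f' C" "AE x in lborel. x \<in> {0<..<l} \<longrightarrow> f' x = f x"
proof -
  from assms obtain C where C: "AE x in lborel. x \<in> {0<..<l} \<longrightarrow> \<bar>f x\<bar> \<le> C"
    and m: "(\<lambda>x. indicator {0<..<l} x * f x) \<in> borel_measurable borel"
    by (auto simp: Linf_on_def set_borel_measurable_def)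
  define f' where "f' x = max (- \<bar>C\<bar>) (min \<bar>C\<bar> (indicator {0<..<l} x * f x))" for x
  have "bdm f' \<bar>C\<bar>"
    unfolding bdm_def f'_def using m by (auto intro!: borel_measurable_max borel_measurable_min)
  moreover have "AE x in lborel. x \<in> {0<..<l} \<longrightarrow> f' x = f x"
    using C by eventually_elim (auto simp: f'_def indicator_def)
  ultimately show ?thesis by (rule that)
qed

lemma bdm_mono: "bdm p C \<Longrightarrow> C \<le> C' \<Longrightarrow> bdm p C'"
  unfolding bdm_def by (meson order_trans)

lemma bdm_reflect:
  assumes "bdm p C"
  shows "bdm (\<lambda>x. p (a - x)) C"
proof -
  have "(\<lambda>x. p (a - x)) \<in> borel_measurable borel"
    using assms by (intro measurable_compose[of "\<lambda>x. a - x" borel borel p]) (auto simp: bdm_def)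
  then show ?thesis using assms by (auto simp: bdm_def)
qed


lemma sum_half_node:
  "(\<Sum>e\<in>{e \<in> {..N} \<times> UNIV. half_node ini ter e = v}. f e) =
   (\<Sum>j\<in>{j. j \<le> N \<and> ini j = v}. f (j, True)) + (\<Sum>j\<in>{j. j \<le> N \<and> ter j = v}. f (j, False))"
proof -
  have eq: "{e \<in> {..N} \<times> UNIV. half_node ini ter e = v} =
      (\<lambda>j. (j, True)) ` {j. j \<le> N \<and> ini j = v} \<union> (\<lambda>j. (j, False)) ` {j. j \<le> N \<and> ter j = v}"
    by (auto simp: half_node_def image_iff)
  show ?thesis
    unfolding eq by (subst sum.union_disjoint) (auto simp: sum.reindex inj_on_def)
qed

lemma card_half_node: "card {e \<in> {..N} \<times> UNIV. half_node ini ter e = v} = Defs.degree N ini ter v"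
  using sum_half_node[of "\<lambda>_. 1 :: nat"] by (simp add: Defs.degree_def)

definition end_value :: "(nat \<Rightarrow> real) \<Rightarrow> (nat \<Rightarrow> real \<Rightarrow> real \<Rightarrow> real) \<Rightarrow> nat \<times> bool \<Rightarrow> real \<Rightarrow> real" where
  "end_value len u d t = u (fst d) (if snd d then 0 else len (fst d)) t"

text \<open>The sign turns the derivative along the orientation into the one that points away from
  the node.\<close>

definition end_flux :: "(nat \<Rightarrow> real) \<Rightarrow> (nat \<Rightarrow> real \<Rightarrow> real \<Rightarrow> real) \<Rightarrow> nat \<times> bool \<Rightarrow> real \<Rightarrow> real" where
  "end_flux len ux d t = (if snd d then ux (fst d) 0 t else - ux (fst d) (len (fst d)) t)"

text \<open>At an exterior node only one half-edge ends, so continuity is trivial and the Neumann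
  condition is a Kirchhoff sum with one term. Both kinds of nodes thus obey the same
  conditions.\<close>

lemma heat_network_solution_half_edges:
  assumes tree: "tree_network V N ini ter len" and sol: "heat_network_solution V N ini ter len T p u0 u"
    and T: "T > 0" and p': "\<And>j. j \<le> N \<Longrightarrow> bdm (p' j) C"
      "\<And>j. j \<le> N \<Longrightarrow> AE x in lborel. x \<in> {0<..<len j} \<longrightarrow> p' j x = p j x"
  obtains ux where "\<And>j. j \<le> N \<Longrightarrow> edge_heat (len j) T C (p' j) (uncurry2 (u j)) (uncurry2 (ux j))"
    "\<And>j. j \<le> N \<Longrightarrow> AE x in lborel. x \<in> {0<..<len j} \<longrightarrow> u j x 0 = u0 j x"
    "\<And>d e t. d \<in> {..N} \<times> UNIV \<Longrightarrow> e \<in> {..N} \<times> UNIV \<Longrightarrow> half_node ini ter d = half_node ini ter e \<Longrightarrow>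
       t \<in> {0<..<T} \<Longrightarrow> end_value len u d t = end_value len u e t"
    "\<And>d t. d \<in> {..N} \<times> UNIV \<Longrightarrow> t \<in> {0<..<T} \<Longrightarrow>
       (\<Sum>e\<in>{e \<in> {..N} \<times> UNIV. half_node ini ter e = half_node ini ter d}. end_flux len ux e t) = 0"
proof -
  let ?H = "{..N} \<times> (UNIV :: bool set)" and ?nd = "half_node ini ter"
  obtain ux where all_edges: "(\<forall>j\<le>N.
         continuous_on ({0..len j} \<times> {0..T}) (uncurry2 (u j)) \<and>
         continuous_on ({0..len j} \<times> {0..T}) (uncurry2 (ux j)) \<and>
         (\<forall>x\<in>{0..len j}. \<forall>t\<in>{0..T}.
            ((\<lambda>y. u j y t) has_real_derivative ux j x t) (at x within {0..len j})) \<and>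
         (\<exists>ut uxx. weak_deriv (rect (len j) T) (0,1) (uncurry2 (u j)) ut \<and>
            weak_deriv (rect (len j) T) (1,0) (uncurry2 (ux j)) uxx \<and>
            (AE z in lborel. z \<in> rect (len j) T \<longrightarrow>
               ut z - uxx z + p j (fst z) * u j (fst z) (snd z) = 0)) \<and>
         (AE x in lborel. x \<in> {0<..<len j} \<longrightarrow> u j x 0 = u0 j x))"
    and ext: "(\<forall>Q\<in>exterior_nodes V N ini ter. \<forall>t\<in>{0<..<T}. \<forall>j\<le>N.
         (ini j = Q \<longrightarrow> ux j 0 t = 0) \<and> (ter j = Q \<longrightarrow> ux j (len j) t = 0))"
    and int: "(\<forall>P\<in>interior_nodes V N ini ter. \<forall>t\<in>{0<..<T}.
         (\<forall>i\<le>N. \<forall>j\<le>N.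
            (ini i = P \<and> ini j = P \<longrightarrow> u i 0 t = u j 0 t) \<and>
            (ini i = P \<and> ter j = P \<longrightarrow> u i 0 t = u j (len j) t) \<and>
            (ter i = P \<and> ter j = P \<longrightarrow> u i (len i) t = u j (len j) t)) \<and>
         (\<Sum>j\<in>{j. j \<le> N \<and> ini j = P}. ux j 0 t)
           - (\<Sum>j\<in>{j. j \<le> N \<and> ter j = P}. ux j (len j) t) = 0)"
    using sol unfolding heat_network_solution_def by (elim exE conjE) (rule that; assumption)
  have edge: "continuous_on ({0..len j} \<times> {0..T}) (uncurry2 (u j))"
      "continuous_on ({0..len j} \<times> {0..T}) (uncurry2 (ux j))"
      "\<And>x t. x \<in> {0..len j} \<Longrightarrow> t \<in> {0..T} \<Longrightarrow>
            ((\<lambda>y. u j y t) has_real_derivative ux j x t) (at x within {0..len j})"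
      "\<exists>ut uxx. weak_deriv (rect (len j) T) (0,1) (uncurry2 (u j)) ut \<and>
            weak_deriv (rect (len j) T) (1,0) (uncurry2 (ux j)) uxx \<and>
            (AE z in lborel. z \<in> rect (len j) T \<longrightarrow>
               ut z - uxx z + p j (fst z) * u j (fst z) (snd z) = 0)"
      "AE x in lborel. x \<in> {0<..<len j} \<longrightarrow> u j x 0 = u0 j x" if "j \<le> N" for j
    using all_edges[THEN spec, THEN mp, OF that] by (elim conjE; blast)+
  have cont: "(ini i = P \<and> ini j = P \<longrightarrow> u i 0 t = u j 0 t) \<and>
            (ini i = P \<and> ter j = P \<longrightarrow> u i 0 t = u j (len j) t) \<and>
            (ter i = P \<and> ter j = P \<longrightarrow> u i (len i) t = u j (len j) t)"
    if "P \<in> interior_nodes V N ini ter" "t \<in> {0<..<T}" "i \<le> N" "j \<le> N" for P t i j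
    using int[THEN bspec, OF that(1), THEN bspec, OF that(2), THEN conjunct1, THEN spec, THEN mp, OF that(3),
        THEN spec, THEN mp, OF that(4)] .
  have kir: "(\<Sum>j\<in>{j. j \<le> N \<and> ini j = P}. ux j 0 t) - (\<Sum>j\<in>{j. j \<le> N \<and> ter j = P}. ux j (len j) t) = 0"
    if "P \<in> interior_nodes V N ini ter" "t \<in> {0<..<T}" for P t
    using int[THEN bspec, OF that(1), THEN bspec, OF that(2), THEN conjunct2] .
  have nodes: "?nd d \<in> exterior_nodes V N ini ter \<or> ?nd d \<in> interior_nodes V N ini ter" if "d \<in> ?H" for d
  proof -
    have "?nd d \<in> V" using tree that by (auto simp: tree_network_def half_node_def)
    then show ?thesis using tree by (auto simp: tree_network_def exterior_nodes_def interior_nodes_def)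
  qed
  show ?thesis
  proof (rule that)
    fix j assume j: "j \<le> N"
    from edge(4)[OF j] obtain ut uxx where w: "weak_deriv (rect (len j) T) (0,1) (uncurry2 (u j)) ut"
      "weak_deriv (rect (len j) T) (1,0) (uncurry2 (ux j)) uxx"
      "AE z in lborel. z \<in> rect (len j) T \<longrightarrow> ut z - uxx z + p j (fst z) * u j (fst z) (snd z) = 0" by blast
    have "AE z in lborel. z \<in> rect (len j) T \<longrightarrow> ut z - uxx z + p' j (fst z) * uncurry2 (u j) z = 0"
      using w(3) AE_fst[OF p'(2)[OF j]]
      by eventually_elim (auto simp: rect_def uncurry2_def)
    then have weak: "\<exists>ut uxx. weak_deriv (rect (len j) T) (0,1) (uncurry2 (u j)) ut \<and>
        weak_deriv (rect (len j) T) (1,0) (uncurry2 (ux j)) uxx \<and>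
        (AE z in lborel. z \<in> rect (len j) T \<longrightarrow> ut z - uxx z + p' j (fst z) * uncurry2 (u j) z = 0)"
      using w by blast
    show "edge_heat (len j) T C (p' j) (uncurry2 (u j)) (uncurry2 (ux j))"
    proof
      show "0 < len j" using tree j by (simp add: tree_network_def)
      fix x t assume "x \<in> {0..len j}" "t \<in> {0..T}"
      then show "((\<lambda>y. uncurry2 (u j) (y, t)) has_real_derivative uncurry2 (ux j) (x, t)) (at x within {0..len j})"
        using edge(3)[OF j] by (simp add: uncurry2_def)
    qed (use T p'(1)[OF j] edge(1,2)[OF j] weak in auto)
  next
    fix j assume "j \<le> N"
    then show "AE x in lborel. x \<in> {0<..<len j} \<longrightarrow> u j x 0 = u0 j x" by (rule edge(5))
  next
    fix d e t assume d: "d \<in> ?H" and e: "e \<in> ?H" and de: "?nd d = ?nd e" and t: "t \<in> {0<..<T}"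
    from nodes[OF d] show "end_value len u d t = end_value len u e t"
    proof
      assume "?nd d \<in> exterior_nodes V N ini ter"
      then have "card {e \<in> ?H. ?nd e = ?nd d} = 1" by (simp add: card_half_node exterior_nodes_def)
      then have "d = e" using d e de by (metis (mono_tags, lifting) card_1_singletonE mem_Collect_eq singletonD)
      then show ?thesis by simp
    next
      assume i: "?nd d \<in> interior_nodes V N ini ter"
      obtain j b i' c where je: "d = (j, b)" "e = (i', c)" by (cases d, cases e) auto
      have le: "j \<le> N" "i' \<le> N" using d e je by auto
      define v where "v = ?nd d"
      have v: "v \<in> interior_nodes V N ini ter" "half_node ini ter (j, b) = v" "half_node ini ter (i', c) = v"
        using i de je by (simp_all add: v_def)
      note c1 = cont[OF v(1) t le] and c2 = cont[OF v(1) t le(2,1)]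
      show ?thesis
        unfolding je
        by ((cases b; cases c),
          use c1 v(2,3) in \<open>simp add: half_node_def end_value_def\<close>,
          use c1 v(2,3) in \<open>simp add: half_node_def end_value_def\<close>,
          use c2 v(2,3) in \<open>simp add: half_node_def end_value_def\<close>,
          use c1 v(2,3) in \<open>simp add: half_node_def end_value_def\<close>)
    qed
  next
    fix d t assume d: "d \<in> ?H" and t: "t \<in> {0<..<T}"
    have fl: "(\<Sum>e\<in>{e \<in> ?H. ?nd e = ?nd d}. end_flux len ux e t) =
        (\<Sum>j\<in>{j. j \<le> N \<and> ini j = ?nd d}. ux j 0 t) + (\<Sum>j\<in>{j. j \<le> N \<and> ter j = ?nd d}. - ux j (len j) t)"
      unfolding sum_half_node by (simp add: end_flux_def)
    from nodes[OF d] show "(\<Sum>e\<in>{e \<in> ?H. ?nd e = ?nd d}. end_flux len ux e t) = 0"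
    proof
      assume "?nd d \<in> exterior_nodes V N ini ter"
      then have "ini j = ?nd d \<longrightarrow> ux j 0 t = 0" "ter j = ?nd d \<longrightarrow> ux j (len j) t = 0" if "j \<le> N" for j
        using ext t that by blast+
      then show ?thesis unfolding fl by simp
    next
      assume "?nd d \<in> interior_nodes V N ini ter"
      from kir[OF this t] show ?thesis unfolding fl by (simp add: sum_negf)
    qed
  qed
qed

text \<open>The space derivative is continuous up to time 0, hence bounded there. This is the source
  of the Lipschitz constant of the initial displacement in the sideways argument.\<close>

lemma (in edge_heat) lipschitz_initial:
  "\<exists>L\<ge>0. \<forall>x\<in>{0..l}. \<forall>y\<in>{0..l}. \<bar>U (x, 0) - U (y, 0)\<bar> \<le> L * \<bar>x - y\<bar>"
proof -
  have "continuous_on {0..l} (\<lambda>x. UX (x, 0))"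
    by (rule continuous_on_compose2[OF UX]) (use T in \<open>auto intro!: continuous_intros\<close>)
  then have "bounded ((\<lambda>x. UX (x, 0)) ` {0..l})"
    by (intro compact_imp_bounded compact_continuous_image) auto
  then obtain L where L: "\<And>x. x \<in> {0..l} \<Longrightarrow> \<bar>UX (x, 0)\<bar> \<le> L"
    unfolding bounded_iff by (metis image_eqI real_norm_def)
  have "L \<ge> 0" using L[of 0] l by auto
  moreover have "\<bar>U (x, 0) - U (y, 0)\<bar> \<le> L * \<bar>x - y\<bar>" if "x \<in> {0..l}" "y \<in> {0..l}" for x y
    using field_differentiable_bound[of "{0..l}" "\<lambda>y. U (y, 0)" "\<lambda>x. UX (x, 0)" L x y] deriv[of _ 0] L T that
    by auto
  ultimately show ?thesis by blast
qed


definition clamp0 :: "real \<Rightarrow> real \<Rightarrow> real" where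
  "clamp0 l x = max 0 (min l x)"

lemma clamp0: "l > 0 \<Longrightarrow> clamp0 l x \<in> {0..l}" "x \<in> {0..l} \<Longrightarrow> clamp0 l x = x"
    "\<bar>clamp0 l x - clamp0 l y\<bar> \<le> \<bar>x - y\<bar>" "clamp0 l (l - (l - x)) = clamp0 l x"
  by (auto simp: clamp0_def)

definition along :: "(nat \<Rightarrow> real) \<Rightarrow> (nat \<Rightarrow> real \<Rightarrow> real) \<Rightarrow> nat \<times> bool \<Rightarrow> real \<Rightarrow> real" where
  "along len f d x = f (fst d) (if snd d then x else len (fst d) - x)"

definition flip :: "nat \<times> bool \<Rightarrow> nat \<times> bool" where
  "flip d = (fst d, \<not> snd d)"

lemma Linf_net_bdm:
  assumes "Linf_net N len p"
  shows "\<exists>C p'. (\<forall>j\<le>N. bdm (p' j) C \<and> (AE x in lborel. x \<in> {0<..<len j} \<longrightarrow> p' j x = p j x))"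
proof -
  have "\<forall>j\<in>{..N}. \<exists>Cf. bdm (snd Cf) (fst Cf) \<and> (AE x in lborel. x \<in> {0<..<len j} \<longrightarrow> snd Cf x = p j x)"
  proof
    fix j assume "j \<in> {..N}"
    then have "Linf_on (len j) (p j)" using assms by (simp add: Linf_net_def)
    then obtain C f' where "bdm f' C" "AE x in lborel. x \<in> {0<..<len j} \<longrightarrow> f' x = p j x"
      by (rule Linf_on_bdm)
    then show "\<exists>Cf. bdm (snd Cf) (fst Cf) \<and> (AE x in lborel. x \<in> {0<..<len j} \<longrightarrow> snd Cf x = p j x)"
      by (intro exI[of _ "(C, f')"]) simp
  qed
  from bchoice[OF this] obtain Cf where
    Cf: "\<forall>j\<in>{..N}. bdm (snd (Cf j)) (fst (Cf j)) \<and> (AE x in lborel. x \<in> {0<..<len j} \<longrightarrow> snd (Cf j) x = p j x)"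
    by (elim exE)
  define C where "C = (\<Sum>j\<le>N. \<bar>fst (Cf j)\<bar>)"
  have C: "fst (Cf j) \<le> C" if "j \<le> N" for j
  proof -
    have "fst (Cf j) \<le> \<bar>fst (Cf j)\<bar>" by simp
    also have "\<dots> \<le> C" unfolding C_def by (rule member_le_sum[of j "{..N}" "\<lambda>j. \<bar>fst (Cf j)\<bar>"]) (use that in auto)
    finally show ?thesis .
  qed
  have "bdm (snd (Cf j)) C" if "j \<le> N" for j using Cf that bdm_mono[OF _ C[OF that]] by simp
  then show ?thesis
    using Cf by (intro exI[of _ C] exI[of _ "\<lambda>j. snd (Cf j)"]) simp
qed

section \<open>Assembly on the tree\<close>

theorem theorem2:
  fixes V :: "'v set" and N :: nat and ini ter :: "nat \<Rightarrow> 'v" and len :: "nat \<Rightarrow> real"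
    and p q u0 :: "nat \<Rightarrow> real \<Rightarrow> real"
    and up uq :: "nat \<Rightarrow> real \<Rightarrow> real \<Rightarrow> real"
    and T0 r :: real and Qx :: 'v
  assumes tree: "tree_network V N ini ter len"
    and p_Linf: "Linf_net N len p" and q_Linf: "Linf_net N len q"
    and r_pos: "r > 0"
    and u0_bound: "\<forall>j\<le>N. AE x in lborel. x \<in> {0<..<len j} \<longrightarrow> \<bar>u0 j x\<bar> \<ge> r"
    and T0_pos: "T0 > 0"
    and up_sol: "heat_network_solution V N ini ter len T0 p u0 up"
    and uq_sol: "heat_network_solution V N ini ter len T0 q u0 uq"
    and up_reg: "\<forall>j\<le>N. H2_Linf (len j) T0 (up j) \<and> H1_H2 (len j) T0 (up j)"
    and uq_reg: "\<forall>j\<le>N. H2_Linf (len j) T0 (uq j) \<and> H1_H2 (len j) T0 (uq j)"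
    and Qx: "Qx \<in> exterior_nodes V N ini ter"
  shows "\<exists>T>0. T \<le> T0 \<and>
    ((\<forall>t\<in>{0<..<T}. \<forall>Q\<in>exterior_nodes V N ini ter - {Qx}. \<forall>j\<le>N.
        (ini j = Q \<longrightarrow> up j 0 t = uq j 0 t) \<and>
        (ter j = Q \<longrightarrow> up j (len j) t = uq j (len j) t))
     \<longrightarrow> (\<forall>j\<le>N. AE x in lborel. x \<in> {0<..<len j} \<longrightarrow> p j x = q j x))"
proof -
  let ?H = "{..N} \<times> (UNIV :: bool set)" and ?nd = "half_node ini ter" and ?l = "\<lambda>d :: nat \<times> bool. len (fst d)"
  have lenp: "len j > 0" if "j \<le> N" for j using tree that by (simp add: tree_network_def)
  obtain Cp p' where p': "\<And>j. j \<le> N \<Longrightarrow> bdm (p' j) Cp"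
      "\<And>j. j \<le> N \<Longrightarrow> AE x in lborel. x \<in> {0<..<len j} \<longrightarrow> p' j x = p j x"
    using Linf_net_bdm[OF p_Linf] by blast
  obtain Cq q' where q': "\<And>j. j \<le> N \<Longrightarrow> bdm (q' j) Cq"
      "\<And>j. j \<le> N \<Longrightarrow> AE x in lborel. x \<in> {0<..<len j} \<longrightarrow> q' j x = q j x"
    using Linf_net_bdm[OF q_Linf] by blast
  define C where "C = max Cp Cq"
  have p'C: "bdm (p' j) C" and q'C: "bdm (q' j) C" if "j \<le> N" for j
    using bdm_mono[OF p'(1)[OF that], of C] bdm_mono[OF q'(1)[OF that], of C] by (simp_all add: C_def)
  obtain upx where up: "\<And>j. j \<le> N \<Longrightarrow> edge_heat (len j) T0 C (p' j) (uncurry2 (up j)) (uncurry2 (upx j))"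
    "\<And>j. j \<le> N \<Longrightarrow> AE x in lborel. x \<in> {0<..<len j} \<longrightarrow> up j x 0 = u0 j x"
    "\<And>d e t. d \<in> ?H \<Longrightarrow> e \<in> ?H \<Longrightarrow> ?nd d = ?nd e \<Longrightarrow> t \<in> {0<..<T0} \<Longrightarrow> end_value len up d t = end_value len up e t"
    "\<And>d t. d \<in> ?H \<Longrightarrow> t \<in> {0<..<T0} \<Longrightarrow> (\<Sum>e\<in>{e \<in> ?H. ?nd e = ?nd d}. end_flux len upx e t) = 0"
    apply (rule heat_network_solution_half_edges[where p' = p' and C = C, OF tree up_sol T0_pos])
      apply (erule p'C)
     apply (erule p'(2))
    subgoal premises prems for ux by (rule prems(1); fact prems)
    done
  obtain uqx where uq: "\<And>j. j \<le> N \<Longrightarrow> edge_heat (len j) T0 C (q' j) (uncurry2 (uq j)) (uncurry2 (uqx j))"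
    "\<And>j. j \<le> N \<Longrightarrow> AE x in lborel. x \<in> {0<..<len j} \<longrightarrow> uq j x 0 = u0 j x"
    "\<And>d e t. d \<in> ?H \<Longrightarrow> e \<in> ?H \<Longrightarrow> ?nd d = ?nd e \<Longrightarrow> t \<in> {0<..<T0} \<Longrightarrow> end_value len uq d t = end_value len uq e t"
    "\<And>d t. d \<in> ?H \<Longrightarrow> t \<in> {0<..<T0} \<Longrightarrow> (\<Sum>e\<in>{e \<in> ?H. ?nd e = ?nd d}. end_flux len uqx e t) = 0"
    apply (rule heat_network_solution_half_edges[where p' = q' and C = C, OF tree uq_sol T0_pos])
      apply (erule q'C)
     apply (erule q'(2))
    subgoal premises prems for ux by (rule prems(1); fact prems)
    done
  have initial: "continuous_on {0..l} (\<lambda>x. u x 0)" if "edge_heat l T0 C P (uncurry2 u) W" for l u P W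
  proof -
    have "continuous_on {0..l} (\<lambda>x. uncurry2 u (x, 0))"
      by (rule continuous_on_compose2[OF edge_heat.U[OF that]]) (use T0_pos in \<open>auto intro!: continuous_intros\<close>)
    then show ?thesis by (simp add: uncurry2_def)
  qed
  have up_ge: "\<bar>up j x 0\<bar> \<ge> r" if j: "j \<le> N" and x: "x \<in> {0..len j}" for j x
  proof -
    have "\<bar>up j x 0\<bar> \<in> {r..}"
    proof (rule continuous_AE_closed[OF lenp[OF j] _ _ _ x])
      show "continuous_on {0..len j} (\<lambda>x. \<bar>up j x 0\<bar>)" by (intro continuous_intros initial[OF up(1)[OF j]])
      have "AE x in lborel. x \<in> {0<..<len j} \<longrightarrow> \<bar>u0 j x\<bar> \<ge> r" using u0_bound j by blast
      with up(2)[OF j] show "AE x in lborel. x \<in> {0<..<len j} \<longrightarrow> \<bar>up j x 0\<bar> \<in> {r..}"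
        by eventually_elim auto
    qed simp
    then show ?thesis by simp
  qed
  have uq_up: "uq j x 0 = up j x 0" if j: "j \<le> N" and x: "x \<in> {0..len j}" for j x
  proof -
    have "uq j x 0 - up j x 0 \<in> {0}"
    proof (rule continuous_AE_closed[OF lenp[OF j] _ _ _ x])
      show "continuous_on {0..len j} (\<lambda>x. uq j x 0 - up j x 0)"
        by (intro continuous_intros initial[OF up(1)[OF j]] initial[OF uq(1)[OF j]])
      from up(2)[OF j] uq(2)[OF j] show "AE x in lborel. x \<in> {0<..<len j} \<longrightarrow> uq j x 0 - up j x 0 \<in> {0}"
        by eventually_elim auto
    qed simp
    then show ?thesis by simp
  qed
  have "\<forall>j\<in>{..N}. \<exists>L\<ge>0. \<forall>x\<in>{0..len j}. \<forall>y\<in>{0..len j}. \<bar>up j x 0 - up j y 0\<bar> \<le> L * \<bar>x - y\<bar>"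
    using edge_heat.lipschitz_initial[OF up(1)] by (auto simp: uncurry2_def)
  then obtain L where L: "\<And>j. j \<in> {..N} \<Longrightarrow> L j \<ge> 0"
      "\<And>j x y. j \<in> {..N} \<Longrightarrow> x \<in> {0..len j} \<Longrightarrow> y \<in> {0..len j} \<Longrightarrow> \<bar>up j x 0 - up j y 0\<bar> \<le> L j * \<bar>x - y\<bar>"
    by metis
  define L0 where "L0 = sum L {..N}"
  have L0: "L j \<le> L0" if "j \<in> {..N}" for j
    unfolding L0_def by (rule member_le_sum) (use that L in auto)
  have L0_nonneg: "L0 \<ge> 0" unfolding L0_def by (rule sum_nonneg) (rule L(1))
  define lmax where "lmax = Max (len ` {..N})"
  define K0 where "K0 = (\<Sum>j\<le>N. \<bar>up j 0 0\<bar>) + L0 * lmax"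
  \<comment> \<open>The initial displacement is read off the continuous function \<open>up\<close>
    at time 0, as \<open>u0\<close> is tied to it only almost everywhere, and is continued
    constantly beyond the ends of the edge.\<close>
  define w where "w d x = up (fst d) (clamp0 (?l d) (if snd d then x else ?l d - x)) 0" for d x
  have lip: "\<bar>w d x - w d y\<bar> \<le> L0 * \<bar>x - y\<bar>" if d: "d \<in> ?H" for d x y
  proof -
    have j: "fst d \<in> {..N}" "fst d \<le> N" using d by auto
    let ?x = "clamp0 (?l d) (if snd d then x else ?l d - x)" and ?y = "clamp0 (?l d) (if snd d then y else ?l d - y)"
    have "\<bar>w d x - w d y\<bar> \<le> L (fst d) * \<bar>?x - ?y\<bar>"
      unfolding w_def using L(2)[OF j(1)] clamp0(1)[OF lenp[OF j(2)]] by blast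
    also have "\<dots> \<le> L0 * \<bar>x - y\<bar>"
    proof (intro mult_mono L0 j)
      show "\<bar>?x - ?y\<bar> \<le> \<bar>x - y\<bar>"
        by (rule order_trans[OF clamp0(3)]) (cases "snd d"; simp)
    qed (use L0_nonneg in auto)
    finally show ?thesis .
  qed
  have w0: "w d 0 = end_value len up d 0" if "d \<in> ?H" for d
  proof -
    have "fst d \<le> N" using that by auto
    then show ?thesis using lenp[of "fst d"] by (simp add: w_def end_value_def clamp0_def)
  qed
  \<comment> \<open>The half-edge (j, True) starts at \<open>ini j\<close>, and (j, False) starts at
    \<open>ter j\<close>.\<close>
  interpret network ?H flip ?nd ?l w "Min (len ` {..N})" lmax K0
  proof
    show "finite ?H" by simp
    show "0 < Min (len ` {..N})" using lenp by (subst Min_gr_iff) auto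
  next
    fix d assume d: "d \<in> ?H"
    then have j: "fst d \<in> {..N}" "fst d \<le> N" by auto
    show "flip d \<in> ?H" "flip (flip d) = d" "?l (flip d) = ?l d" using d by (auto simp: flip_def)
    show "Min (len ` {..N}) \<le> ?l d" using j by (intro Min_le) auto
    show lmax: "?l d \<le> lmax" unfolding lmax_def using j by (intro Max_ge) auto
    show "continuous_on UNIV (w d)"
      by (rule lipschitz_on_continuous_on[of L0]) (use lip[OF d] L0_nonneg in \<open>auto simp: lipschitz_on_def dist_real_def\<close>)
    fix x
    show "\<bar>w d x\<bar> \<le> K0"
    proof -
      let ?x = "clamp0 (?l d) (if snd d then x else ?l d - x)"
      have x: "?x \<in> {0..?l d}" by (rule clamp0(1)[OF lenp[OF j(2)]])
      have "\<bar>w d x - up (fst d) 0 0\<bar> \<le> L (fst d) * \<bar>?x - 0\<bar>"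
        unfolding w_def by (rule L(2)[OF j(1) x]) (use lenp[OF j(2)] in auto)
      also have "\<dots> \<le> L0 * lmax" by (intro mult_mono L0 j) (use x lmax L0_nonneg in auto)
      finally have "\<bar>w d x - up (fst d) 0 0\<bar> \<le> L0 * lmax" .
      moreover have "\<bar>up (fst d) 0 0\<bar> \<le> (\<Sum>j\<le>N. \<bar>up j 0 0\<bar>)"
        by (rule member_le_sum[of "fst d" "{..N}" "\<lambda>j. \<bar>up j 0 0\<bar>"]) (use j in auto)
      ultimately show ?thesis unfolding K0_def by linarith
    qed
    show "w (flip d) x = w d (?l d - x)" by (simp add: w_def flip_def)
  next
    fix d e assume de: "d \<in> ?H" "e \<in> ?H" "?nd d = ?nd e"
    \<comment> \<open>Continuity at the nodes is given for t > 0 only; letting t tend to 0 carries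
      it to the initial displacement.\<close>
    have lim: "((\<lambda>t. end_value len up d t) \<longlongrightarrow> end_value len up d 0) (at_right 0)" if d: "d \<in> ?H" for d
    proof -
      have j: "fst d \<le> N" using d by auto
      have "continuous_on {0..T0} (\<lambda>t. uncurry2 (up (fst d)) (if snd d then 0 else ?l d, t))"
        by (rule continuous_on_compose2[OF edge_heat.U[OF up(1)[OF j]]])
          (use lenp[OF j] in \<open>auto intro!: continuous_intros\<close>)
      then have "continuous_on {0..T0} (end_value len up d)"
        by (simp add: uncurry2_def end_value_def[abs_def])
      then show ?thesis
        using T0_pos by (auto simp: continuous_on_Icc_at_rightD)
    qed
    have "\<forall>\<^sub>F t in at_right 0. end_value len up d t = end_value len up e t"
      unfolding eventually_at_right_field using up(3)[OF de] T0_pos by auto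
    then have "((\<lambda>t. end_value len up d t) \<longlongrightarrow> end_value len up e 0) (at_right 0)"
      using lim[OF de(2)] by (simp add: tendsto_cong)
    then have "end_value len up d 0 = end_value len up e 0"
      using lim[OF de(1)] tendsto_unique[OF trivial_limit_at_right_real] by blast
    then show "w d 0 = w e 0" using w0 de by simp
  qed
  have at_node_eq: "at_node v = {e \<in> ?H. ?nd e = v}" for v by (simp add: at_node_def)
  have pot: "pot (along len P) C" if "\<And>j. j \<le> N \<Longrightarrow> bdm (P j) C" for P
    unfolding pot_def
  proof (intro ballI conjI allI)
    fix d assume "d \<in> ?H"
    then have b: "bdm (P (fst d)) C" using that by auto
    show "bdm (along len P d) C"
      unfolding along_def[abs_def] using b bdm_reflect[OF b, of "?l d"] by (cases "snd d") auto
    show "along len P (flip d) x = along len P d (?l d - x)" for x by (simp add: along_def flip_def)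
  qed
  have res: "\<exists>E \<kappa> \<alpha>. resolvent (along len P) T0 E \<kappa> \<alpha> \<and>
      (\<forall>k. \<forall>d\<in>?H. \<kappa> k d 0 = k * integral {0..T0} (\<lambda>t. end_value len u d t * exp (- (k\<^sup>2) * t)))"
    if bdm: "\<And>j. j \<le> N \<Longrightarrow> bdm (P j) C"
      and heat: "\<And>j. j \<le> N \<Longrightarrow> edge_heat (len j) T0 C (P j) (uncurry2 (u j)) (uncurry2 (ux j))"
      and init: "\<And>j x. j \<le> N \<Longrightarrow> x \<in> {0..len j} \<Longrightarrow> u j x 0 = up j x 0"
      and node: "\<And>d e t. d \<in> ?H \<Longrightarrow> e \<in> ?H \<Longrightarrow> ?nd d = ?nd e \<Longrightarrow> t \<in> {0<..<T0} \<Longrightarrow> end_value len u d t = end_value len u e t"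
      and kir: "\<And>d t. d \<in> ?H \<Longrightarrow> t \<in> {0<..<T0} \<Longrightarrow> (\<Sum>e\<in>{e \<in> ?H. ?nd e = ?nd d}. end_flux len ux e t) = 0"
    for P u ux
  proof -
    define H0 where "H0 = {..N} \<times> {True}"
    show ?thesis
    proof (rule heat_resolvent[where ?H0.0 = H0 and U = "\<lambda>d. uncurry2 (u (fst d))" and UX = "\<lambda>d. uncurry2 (ux (fst d))"
          and ue = "end_value len u" and xe = "end_flux len ux", OF pot[of P, OF bdm]])
      show "H0 \<subseteq> ?H" "\<And>d. d \<in> H0 \<Longrightarrow> flip d \<notin> H0" "\<And>d. d \<in> ?H \<Longrightarrow> d \<notin> H0 \<Longrightarrow> flip d \<in> H0"
        by (auto simp: H0_def flip_def)
      fix d assume d: "d \<in> H0"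
      then have j: "fst d \<le> N" "snd d" by (auto simp: H0_def)
      have "along len P d = P (fst d)" using j by (simp add: along_def[abs_def])
      then show "edge_heat (?l d) T0 C (along len P d) (uncurry2 (u (fst d))) (uncurry2 (ux (fst d)))"
        using heat[OF j(1)] by simp
      show "uncurry2 (u (fst d)) (x, 0) = w d x" if "x \<in> {0..?l d}" for x
        using init[OF j(1) that] clamp0(2)[OF that] j by (simp add: w_def uncurry2_def)
      fix t
      show "end_value len u d t = uncurry2 (u (fst d)) (0, t)"
        "end_value len u (flip d) t = uncurry2 (u (fst d)) (?l d, t)"
        "end_flux len ux d t = uncurry2 (ux (fst d)) (0, t)"
        "end_flux len ux (flip d) t = - uncurry2 (ux (fst d)) (?l d, t)"
        using j by (simp_all add: end_value_def end_flux_def flip_def uncurry2_def)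
    next
      show "end_value len u d t = end_value len u e t"
        if "d \<in> ?H" "e \<in> ?H" "?nd d = ?nd e" "t \<in> {0<..<T0}" for d e t using node[OF that] .
      show "(\<Sum>e\<in>at_node (?nd d). end_flux len ux e t) = 0" if "d \<in> ?H" "t \<in> {0<..<T0}" for d t
        using kir[OF that] by (simp add: at_node_eq)
    next
      fix E \<kappa> \<alpha> assume "resolvent (along len P) T0 E \<kappa> \<alpha>"
        "\<And>k d. d \<in> ?H \<Longrightarrow> \<kappa> k d 0 = k * integral {0..T0} (\<lambda>t. end_value len u d t * exp (- (k\<^sup>2) * t))"
      then show ?thesis by blast
    qed
  qed
  obtain E \<kappa> \<alpha> where rp: "resolvent (along len p') T0 E \<kappa> \<alpha>"
      "\<And>k d. d \<in> ?H \<Longrightarrow> \<kappa> k d 0 = k * integral {0..T0} (\<lambda>t. end_value len up d t * exp (- (k\<^sup>2) * t))"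
    using res[OF p'C up(1) _ up(3,4)] by blast
  obtain E' \<kappa>' \<alpha>' where rq: "resolvent (along len q') T0 E' \<kappa>' \<alpha>'"
      "\<And>k d. d \<in> ?H \<Longrightarrow> \<kappa>' k d 0 = k * integral {0..T0} (\<lambda>t. end_value len uq d t * exp (- (k\<^sup>2) * t))"
    using res[OF q'C uq(1) uq_up uq(3,4)] by blast
  show ?thesis
  \<comment> \<open>The Gaussian error beats every exponential for any positive time, so
    \<open>T0\<close> itself is the witness.\<close>
  proof (intro exI[of _ T0] conjI impI allI)
    assume obs: "\<forall>t\<in>{0<..<T0}. \<forall>Q\<in>exterior_nodes V N ini ter - {Qx}. \<forall>j\<le>N.
        (ini j = Q \<longrightarrow> up j 0 t = uq j 0 t) \<and> (ter j = Q \<longrightarrow> up j (len j) t = uq j (len j) t)"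
    have obs': "\<kappa> k d 0 = \<kappa>' k d 0" if d: "d \<in> ?H" "at_node (?nd d) = {d}" "?nd d \<noteq> Qx" for k d
    proof -
      have "?nd d \<in> V" using d(1) tree by (auto simp: tree_network_def half_node_def)
      moreover have "Defs.degree N ini ter (?nd d) = 1"
        using d(2) card_half_node[of N ini ter "?nd d"] by (simp add: at_node_eq)
      ultimately have Q: "?nd d \<in> exterior_nodes V N ini ter - {Qx}" using d(3) by (simp add: exterior_nodes_def)
      have j: "fst d \<le> N" using d(1) by auto
      have "end_value len up d t = end_value len uq d t" if "t \<in> {0<..<T0}" for t
        using obs[THEN bspec, OF that, THEN bspec, OF Q, THEN spec, THEN mp, OF j]
        by (cases "snd d") (simp_all add: end_value_def half_node_def)
      then have "integral {0..T0} (\<lambda>t. end_value len up d t * exp (- (k\<^sup>2) * t)) =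
          integral {0..T0} (\<lambda>t. end_value len uq d t * exp (- (k\<^sup>2) * t))"
        by (intro integral_cong_open) simp
      then show ?thesis using rp(2)[OF d(1)] rq(2)[OF d(1)] by simp
    qed
    have leaf: "\<exists>d\<in>B. ?nd d \<noteq> Qx \<and> at_node (?nd d) \<inter> B = {d}"
      if B: "B \<subseteq> ?H" "B \<noteq> {}" "\<And>d. d \<in> B \<Longrightarrow> flip d \<in> B" for B
    proof -
      \<comment> \<open>A set of half-edges closed under \<open>flip\<close> is determined by its
        edges, so \<open>acyclic_leaf\<close> can be applied to these.\<close>
      have full: "(j, b) \<in> B" if "j \<in> fst ` B" for j b
      proof -
        obtain c where c: "(j, c) \<in> B" using \<open>j \<in> fst ` B\<close> by auto
        show ?thesis using c B(3)[OF c] by (cases "b = c") (auto simp: flip_def)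
      qed
      have "fst ` B \<subseteq> {..N}" "fst ` B \<noteq> {}" using B(1,2) by auto
      with tree obtain j b where jb: "j \<in> fst ` B" "?nd (j, b) \<noteq> Qx"
        "\<And>i c. i \<in> fst ` B \<Longrightarrow> ?nd (i, c) = ?nd (j, b) \<Longrightarrow> i = j \<and> c = b"
        using acyclic_leaf[of N ini ter "fst ` B" Qx] unfolding tree_network_def by blast
      have "at_node (?nd (j, b)) \<inter> B = {(j, b)}"
      proof (intro equalityI subsetI)
        fix e assume e: "e \<in> at_node (?nd (j, b)) \<inter> B"
        then have "fst e \<in> fst ` B" "?nd (fst e, snd e) = ?nd (j, b)" by (auto simp: at_node_eq)
        from jb(3)[OF this] show "e \<in> {(j, b)}" by (simp add: prod_eq_iff)
      qed (use full[OF jb(1)] B(1) in \<open>auto simp: at_node_eq\<close>)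
      then show ?thesis using full[OF jb(1)] jb(2) by blast
    qed
    have w_ge: "r \<le> \<bar>w d x\<bar>" if "d \<in> ?H" "x \<in> {0..?l d}" for d x
    proof -
      have j: "fst d \<le> N" using that(1) by auto
      show ?thesis unfolding w_def by (rule up_ge[OF j clamp0(1)[OF lenp[OF j]]])
    qed
    fix j assume j: "j \<le> N"
    then have "AE x in lborel. x \<in> {0..?l (j, True)} \<longrightarrow> along len p' (j, True) x = along len q' (j, True) x"
      by (intro potentials_equal[OF pot[of p', OF p'C] pot[of q', OF q'C] lip L0_nonneg r_pos w_ge rp(1) rq(1) T0_pos obs' leaf])
        auto
    with p'(2)[OF j] q'(2)[OF j] show "AE x in lborel. x \<in> {0<..<len j} \<longrightarrow> p j x = q j x"
      by eventually_elim (auto simp: along_def)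
  qed (use T0_pos in auto)
qed

end
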